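(* Let $p\ge1$, let $D,f,g,r,B,\xi,i_0$ be as in the context, and let $X$ be the exact solution of the neutral stochastic differential delay equation with Markov switching $$d[X(t)-D(X(t-\tau),r(t))]=f(X(t),X(t-\tau),t,r(t))\,dt+g(X(t),X(t-\tau),t,r(t))\,dB_t,\quad t\ge 0,$$ with initial data $X(s)=\xi(s)$ for $s\in[-\tau,0]$, $r(0)=i_0$. Let $\lambda>0$ and assume that $X$ is $p$-th moment exponentially stable with Lyapunov exponent no greater than $-\lambda$, i.e. $\limsup_{t\to\infty}\frac1t\log\mathbb{E}|X(t)|^p\le-\lambda$. Suppose there exist functions $V\in C^{2,1}(\mathbb{R}^d\times\mathbb{R}_+\times S;\mathbb{R}_+)$, $\varphi\in L^1(\mathbb{R}_+;\mathbb{R}_+)$, $h:\mathbb{R}_+\to\mathbb{R}_+$ and positive constants $c_1,c_2,C_0,\alpha$ such that $\int_0^\infty e^{\lambda t}h(t)\,dt<\infty$ and, for all $x,y\in\mathbb{R}^d$, $t\ge0$, $i\in S$, $$c_1|x|^p\le V(x,t,i)\le c_2|x|^p,$$ $$LV(x,y,t,i)\le h(t)+(C_0+\varphi(t))V(x-D(y,i),t,i),$$ $$|g^T(x,y,t,i)V_x(x-D(y,i),t,i)^T|^2+\int_{\mathbb{R}}|V(x-D(y,i),t,i+\bar h(i,l))-V(x-D(y,i),t,i)|^2\,dl\le\alpha V^2(x-D(y,i),t,i).$$ If $\beta<e^{-\lambda\tau}$, then $X$ is almost surely exponentially stable with Lyapunov exponent no greater than $-\frac{\lambda}{p}$, that is,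 $$\limsup_{t\to\infty}\frac1t\log|X(t)|\le-\frac{\lambda}{p}\quad\text{almost surely}.$$
   Context: Setting. $(\Omega,\mathscr{F},P)$ is a probability space with a complete filtration $(\mathscr{F}_t)_{t\ge0}$; $d,m\in\mathbb{N}$ and $\tau>0$ are fixed. $|\cdot|$ is the Euclidean norm, $\langle\cdot,\cdot\rangle$ the inner product, and $\|\cdot\|$ the Hilbert-Schmidt norm of matrices (also written $|\cdot|$). $r(t)$, $t\ge0$, is a right-continuous $(\mathscr{F}_t)$-adapted Markov chain with values in the finite set $S=\{1,\dots,N\}$ and generator $\Gamma=(\gamma_{ij})_{N\times N}$: $P(r(t+\delta)=j\mid r(t)=i)=\gamma_{ij}\delta+o(\delta)$ for $i\ne j$, where $\gamma_{ij}\ge0$ for $i\neq j$ and $\gamma_{ii}=-\sum_{j\ne i}\gamma_{ij}$. $(B_t)_{t\ge0}$ is an $m$-dimensional standard $(\mathscr{F}_t)$-Brownian motion independent of $r$. The initial datum $\xi=\{\xi(s):s\in[-\tau,0]\}$ is a bounded, $\mathscr{F}_0$-measurable, $C([-\tau,0];\mathbb{R}^d)$-valued random variable, and $r(0)=i_0\in S$. Representation of the chain. $r$ is represented as $dr(t)=\int_{\mathbb{R}}\bar h(r(t-),l)\,\nu(dt,dl)$, where $\nu$ is a Poisson random measure with intensity $dt\times dl$ ($dl$ Lebesgue measure on $\mathbb{R}$), and $\bar h:S\times\mathbb{R}\to\mathbb{R}$ is the standard jump function: choose consecutive, pairwise disjoint, left-closed right-open intervals $\Delta_{ij}\subset\mathbb{R}$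 ($i\ne j$ in $S$) with $\Delta_{ij}$ of length $\gamma_{ij}$, and set $\bar h(i,l)=j-i$ if $l\in\Delta_{ij}$ for some $j\neq i$, and $\bar h(i,l)=0$ otherwise. Coefficients and standing assumptions. $D:\mathbb{R}^d\times S\to\mathbb{R}^d$, $f:\mathbb{R}^d\times\mathbb{R}^d\times\mathbb{R}_+\times S\to\mathbb{R}^d$, $g:\mathbb{R}^d\times\mathbb{R}^d\times\mathbb{R}_+\times S\to\mathbb{R}^{d\times m}$ are Borel measurable and satisfy: - local Lipschitz condition: for each $R>0$ there is $L_R>0$ with $|f(x,y,t,i)-f(\bar x,\bar y,t,i)|\vee|g(x,y,t,i)-g(\bar x,\bar y,t,i)|\le L_R(|x-\bar x|+|y-\bar y|)$ for all $(t,i)\in\mathbb{R}_+\times S$ and $|x|\vee|y|\vee|\bar x|\vee|\bar y|\le R$; - there is $0<\beta<1$ with $|D(x,i)-D(y,i)|\le\beta|x-y|$ for all $x,y\in\mathbb{R}^d$, $i\in S$ (this fixes $\beta$); - $D(0,i)=0$, $f(0,0,t,i)=0$, $g(0,0,t,i)=0$ for all $(t,i)\in\mathbb{R}_+\times S$. The exact solution $X(t)$, $t\ge-\tau$, is the unique global solution of the equation with the given initial data. Operator $L$. For $V\in C^{2,1}(\mathbb{R}^d\times\mathbb{R}_+\times S;\mathbb{R}_+)$ (twice continuously differentiable in $x$, once in $t$), $LV:\mathbb{R}^d\times\mathbb{R}^d\times\mathbb{R}_+\times S\to\mathbb{R}$ is $$LV(x,y,t,i)=V_t(x-D(y,i),t,i)+V_x(x-D(y,i),t,i)f(x,y,t,i)+\tfrac12\mathrm{trace}\big[g^T(x,y,t,i)V_{xx}(x-D(y,i),t,i)g(x,y,t,i)\big]+\sum_{j=1}^N\gamma_{ij}V(x-D(y,i),t,j),$$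 where $V_t=\partial V/\partial t$, $V_x=(\partial V/\partial x_1,\dots,\partial V/\partial x_d)$ (row vector), $V_{xx}=(\partial^2V/\partial x_l\partial x_j)_{d\times d}$. *)

theory Defs
  imports "HOL-Probability.Probability"
begin

subsection \<open>Filtration, Brownian motion, Poisson random measure\<close>

text \<open>Time runs through \<open>[0, \<infinity>)\<close>; the values \<open>F t\<close> for \<open>t < 0\<close> are never used. Completeness means that
  every subset of a null set of \<open>M\<close> already belongs to \<open>F 0\<close> (so \<open>M\<close> itself is complete).\<close>

definition complete_filtration :: "'w measure \<Rightarrow> (real \<Rightarrow> 'w measure) \<Rightarrow> bool" where
  "complete_filtration M F \<longleftrightarrow>
     (\<forall>t\<ge>0. subalgebra M (F t)) \<and>
     (\<forall>s t. 0 \<le> s \<and> s \<le> t \<longrightarrow> sets (F s) \<subseteq> sets (F t)) \<and>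
     (\<forall>A\<in>null_sets M. \<forall>A'\<subseteq>A. A' \<in> sets (F 0))"

definition brownian_motion ::
    "'w measure \<Rightarrow> (real \<Rightarrow> 'w measure) \<Rightarrow> (real \<Rightarrow> 'w \<Rightarrow> real ^ 'm) \<Rightarrow> bool" where
  "brownian_motion M F B \<longleftrightarrow>
     (\<forall>t\<ge>0. B t \<in> borel_measurable (F t)) \<and>
     (AE \<omega> in M. B 0 \<omega> = 0) \<and>
     (\<forall>\<omega>\<in>space M. continuous_on {0..} (\<lambda>t. B t \<omega>)) \<and>
     (\<forall>s t. 0 \<le> s \<and> s < t \<longrightarrow>
        prob_space.indep_set M (sets (F s))
          (sets (vimage_algebra (space M) (\<lambda>\<omega>. B t \<omega> - B s \<omega>) borel)) \<and>
        prob_space.indep_vars M (\<lambda>_. borel) (\<lambda>k \<omega>. B t \<omega> $ k - B s \<omega> $ k) UNIV \<and>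
        (\<forall>k. distributed M lborel (\<lambda>\<omega>. B t \<omega> $ k - B s \<omega> $ k)
               (normal_density 0 (sqrt (t - s)))))"

definition poisson_random_measure :: "'w measure \<Rightarrow> 'e measure \<Rightarrow> ('w \<Rightarrow> 'e measure) \<Rightarrow> bool" where
  "poisson_random_measure M \<mu> \<nu> \<longleftrightarrow>
     (\<forall>\<omega>\<in>space M. sets (\<nu> \<omega>) = sets \<mu>) \<and>
     (\<forall>A\<in>sets \<mu>. (\<lambda>\<omega>. emeasure (\<nu> \<omega>) A) \<in> borel_measurable M) \<and>
     (\<forall>A\<in>sets \<mu>. emeasure \<mu> A < \<infinity> \<longrightarrow>
        (\<forall>k::nat. \<P>(\<omega> in M. emeasure (\<nu> \<omega>) A = of_nat k)
                  = measure \<mu> A ^ k / fact k * exp (- measure \<mu> A))) \<and>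
     (\<forall>A::nat \<Rightarrow> 'e set. range A \<subseteq> sets \<mu> \<and> disjoint_family A \<longrightarrow>
        prob_space.indep_vars M (\<lambda>_. borel) (\<lambda>n \<omega>. emeasure (\<nu> \<omega>) (A n)) UNIV)"

definition path_sigma :: "'w measure \<Rightarrow> 'a measure \<Rightarrow> (real \<Rightarrow> 'w \<Rightarrow> 'a) \<Rightarrow> 'w measure" where
  "path_sigma M E Y =
     vimage_algebra (space M) (\<lambda>\<omega>. \<lambda>t\<in>{0..}. Y t \<omega>) (\<Pi>\<^sub>M t\<in>{0..}. E)"

definition independent_processes ::
    "'w measure \<Rightarrow> 'a measure \<Rightarrow> (real \<Rightarrow> 'w \<Rightarrow> 'a) \<Rightarrow> 'b measure \<Rightarrow> (real \<Rightarrow> 'w \<Rightarrow> 'b) \<Rightarrow> bool" where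
  "independent_processes M E Y E' Z \<longleftrightarrow>
     prob_space.indep_set M (sets (path_sigma M E Y)) (sets (path_sigma M E' Z))"


subsection \<open>The Markov chain\<close>

text \<open>States are integers, so that \<open>i + hbar i l\<close> is again a state.\<close>

definition state_space :: "nat \<Rightarrow> int set" where
  "state_space N = {1..int N}"

definition generator_matrix :: "int set \<Rightarrow> (int \<Rightarrow> int \<Rightarrow> real) \<Rightarrow> bool" where
  "generator_matrix S \<Gamma> \<longleftrightarrow>
     (\<forall>i\<in>S. \<forall>j\<in>S. i \<noteq> j \<longrightarrow> 0 \<le> \<Gamma> i j) \<and>
     (\<forall>i\<in>S. \<Gamma> i i = - (\<Sum>j\<in>S - {i}. \<Gamma> i j))"

text \<open>The Markov property is taken relative to \<open>F\<close>. The chain is time-homogeneous: \<open>p \<delta> i j\<close> is its transition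
  probability. Conditioning on \<open>r t = i\<close> is only meaningful when that event has positive probability;
  at other states \<open>p\<close> is unconstrained by the law of \<open>r\<close>.\<close>

definition markov_chain ::
    "'w measure \<Rightarrow> (real \<Rightarrow> 'w measure) \<Rightarrow> int set \<Rightarrow> (int \<Rightarrow> int \<Rightarrow> real) \<Rightarrow> (real \<Rightarrow> 'w \<Rightarrow> int) \<Rightarrow> bool" where
  "markov_chain M F S \<Gamma> r \<longleftrightarrow>
     (\<forall>t\<ge>0. r t \<in> measurable (F t) (count_space S)) \<and>
     (\<forall>\<omega>\<in>space M. \<forall>t\<ge>0. continuous (at_right t) (\<lambda>s. r s \<omega>)) \<and>
     (\<forall>s t. 0 \<le> s \<and> s \<le> t \<longrightarrow> (\<forall>j\<in>S. AE \<omega> in M.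
        real_cond_exp M (F s) (indicator {\<omega>\<in>space M. r t \<omega> = j}) \<omega> =
        real_cond_exp M (vimage_algebra (space M) (r s) (count_space S))
          (indicator {\<omega>\<in>space M. r t \<omega> = j}) \<omega>)) \<and>
     (\<exists>p :: real \<Rightarrow> int \<Rightarrow> int \<Rightarrow> real.
        (\<forall>t\<ge>0. \<forall>\<delta>\<ge>0. \<forall>i\<in>S. \<forall>j\<in>S. \<P>(\<omega> in M. r t \<omega> = i) > 0 \<longrightarrow>
           \<P>(\<omega> in M. r (t + \<delta>) \<omega> = j \<bar> r t \<omega> = i) = p \<delta> i j) \<and>
        (\<forall>i\<in>S. \<forall>j\<in>S. i \<noteq> j \<longrightarrow>
           (\<lambda>\<delta>. p \<delta> i j - \<Gamma> i j * \<delta>) \<in> o[at_right 0](\<lambda>\<delta>. \<delta>)))"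

text \<open>``Consecutive'' is expressed by requiring the union of the disjoint half-open intervals to be an
  interval; the order in which they are laid end to end and the starting point are arbitrary.\<close>

definition jump_intervals ::
    "int set \<Rightarrow> (int \<Rightarrow> int \<Rightarrow> real) \<Rightarrow> (int \<Rightarrow> int \<Rightarrow> real set) \<Rightarrow> bool" where
  "jump_intervals S \<Gamma> \<Delta> \<longleftrightarrow>
     (\<forall>i\<in>S. \<forall>j\<in>S. i \<noteq> j \<longrightarrow> (\<exists>a. \<Delta> i j = {a..<a + \<Gamma> i j})) \<and>
     disjoint_family_on (\<lambda>(i, j). \<Delta> i j) {(i, j). i \<in> S \<and> j \<in> S \<and> i \<noteq> j} \<and>
     is_interval (\<Union>(i, j)\<in>{(i, j). i \<in> S \<and> j \<in> S \<and> i \<noteq> j}. \<Delta> i j)"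

definition jump_function :: "int set \<Rightarrow> (int \<Rightarrow> int \<Rightarrow> real set) \<Rightarrow> int \<Rightarrow> real \<Rightarrow> int" where
  "jump_function S \<Delta> i l =
     (if \<exists>j\<in>S - {i}. l \<in> \<Delta> i j then (THE j. j \<in> S - {i} \<and> l \<in> \<Delta> i j) - i else 0)"

text \<open>\<open>dr(t) = \<integral> hbar(r(t-), l) \<nu>(dt, dl)\<close>, integrated over \<open>(0, t]\<close>. Only finitely many atoms of \<open>\<nu>\<close>
  contribute, so this is a pathwise integral against the measure \<open>\<nu> \<omega>\<close>.\<close>

definition chain_representation ::
    "'w measure \<Rightarrow> (int \<Rightarrow> real \<Rightarrow> int) \<Rightarrow> (real \<Rightarrow> 'w \<Rightarrow> int) \<Rightarrow> ('w \<Rightarrow> (real \<times> real) measure) \<Rightarrow> bool" where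
  "chain_representation M hbar r \<nu> \<longleftrightarrow>
     poisson_random_measure M (restrict_space lborel {0..} \<Otimes>\<^sub>M lborel) \<nu> \<and>
     (AE \<omega> in M. \<forall>t\<ge>0. has_bochner_integral (\<nu> \<omega>)
        (\<lambda>(s, l). indicator {0<..t} s * real_of_int (hbar (Lim (at_left s) (\<lambda>u. r u \<omega>)) l))
        (real_of_int (r t \<omega> - r 0 \<omega>)))"


subsection \<open>The Ito integral\<close>

text \<open>A simple process is \<open>\<Sum>k<n. Z k * indicator (t k, t (k + 1)]\<close> with \<open>Z k\<close> bounded and
  \<open>F (t k)\<close>-measurable.\<close>

definition simple_process ::
    "'w measure \<Rightarrow> (real \<Rightarrow> 'w measure) \<Rightarrow> nat \<Rightarrow> (nat \<Rightarrow> real) \<Rightarrow>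
     (nat \<Rightarrow> 'w \<Rightarrow> real ^ 'm ^ 'd) \<Rightarrow> bool" where
  "simple_process M F n t Z \<longleftrightarrow>
     0 \<le> t 0 \<and> (\<forall>k<n. t k \<le> t (Suc k)) \<and>
     (\<forall>k<n. Z k \<in> borel_measurable (F (t k)) \<and> (\<exists>C. \<forall>\<omega>\<in>space M. norm (Z k \<omega>) \<le> C))"

definition simple_value ::
    "nat \<Rightarrow> (nat \<Rightarrow> real) \<Rightarrow> (nat \<Rightarrow> 'w \<Rightarrow> real ^ 'm ^ 'd) \<Rightarrow> real \<Rightarrow> 'w \<Rightarrow> real ^ 'm ^ 'd" where
  "simple_value n t Z s \<omega> = (\<Sum>k<n. indicator {t k<..t (Suc k)} s *\<^sub>R Z k \<omega>)"

definition simple_integral ::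
    "(real \<Rightarrow> 'w \<Rightarrow> real ^ 'm) \<Rightarrow> nat \<Rightarrow> (nat \<Rightarrow> real) \<Rightarrow> (nat \<Rightarrow> 'w \<Rightarrow> real ^ 'm ^ 'd) \<Rightarrow>
     real \<Rightarrow> 'w \<Rightarrow> real ^ 'd" where
  "simple_integral B n t Z s \<omega> =
     (\<Sum>k<n. Z k \<omega> *v (B (min s (t (Suc k))) \<omega> - B (min s (t k)) \<omega>))"

definition progressive :: "(real \<Rightarrow> 'w measure) \<Rightarrow> (real \<Rightarrow> 'w \<Rightarrow> 'b::topological_space) \<Rightarrow> bool" where
  "progressive F G \<longleftrightarrow>
     (\<forall>T\<ge>0. (\<lambda>(s, \<omega>). G s \<omega>) \<in> borel_measurable (restrict_space borel {0..T} \<Otimes>\<^sub>M F T))"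

text \<open>\<open>J\<close> is (a continuous version of) the integral process of \<open>G\<close>, for progressive \<open>G\<close> that is a.s. locally
  square integrable: the limit, locally uniformly in time in probability, of the integrals of simple
  processes that converge to \<open>G\<close> in \<open>L^2[0, T]\<close> in probability. This determines \<open>J\<close> up to
  indistinguishability.\<close>

definition ito_integral ::
    "'w measure \<Rightarrow> (real \<Rightarrow> 'w measure) \<Rightarrow> (real \<Rightarrow> 'w \<Rightarrow> real ^ 'm) \<Rightarrow>
     (real \<Rightarrow> 'w \<Rightarrow> real ^ 'm ^ 'd) \<Rightarrow> (real \<Rightarrow> 'w \<Rightarrow> real ^ 'd) \<Rightarrow> bool" where
  "ito_integral M F B G J \<longleftrightarrow>
     progressive F G \<and>
     (AE \<omega> in M. \<forall>T\<ge>0. (\<integral>\<^sup>+s\<in>{0..T}. ennreal ((norm (G s \<omega>))\<^sup>2) \<partial>lborel) < \<infinity>) \<and>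
     (\<forall>t\<ge>0. J t \<in> borel_measurable (F t)) \<and>
     (\<forall>\<omega>\<in>space M. continuous_on {0..} (\<lambda>t. J t \<omega>)) \<and>
     (\<exists>n t Z. (\<forall>k::nat. simple_process M F (n k) (t k) (Z k)) \<and>
        (\<forall>T\<ge>0. \<forall>\<epsilon>>0.
           (\<lambda>k. \<P>(\<omega> in M. (\<integral>\<^sup>+s\<in>{0..T}.
                    ennreal ((norm (simple_value (n k) (t k) (Z k) s \<omega> - G s \<omega>))\<^sup>2) \<partial>lborel)
                  > ennreal \<epsilon>)) \<longlonglongrightarrow> 0 \<and>
           (\<lambda>k. \<P>(\<omega> in M. \<exists>s\<in>{0..T}.
                    norm (simple_integral B (n k) (t k) (Z k) s \<omega> - J s \<omega>) > \<epsilon>)) \<longlonglongrightarrow> 0))"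


subsection \<open>The equation\<close>

definition initial_segment ::
    "'w measure \<Rightarrow> (real \<Rightarrow> 'w measure) \<Rightarrow> real \<Rightarrow> (real \<Rightarrow> 'w \<Rightarrow> real ^ 'd) \<Rightarrow> bool" where
  "initial_segment M F \<tau> \<xi> \<longleftrightarrow>
     (\<forall>\<omega>\<in>space M. continuous_on {-\<tau>..0} (\<lambda>s. \<xi> s \<omega>)) \<and>
     (\<forall>s\<in>{-\<tau>..0}. \<xi> s \<in> borel_measurable (F 0)) \<and>
     (\<exists>C. \<forall>\<omega>\<in>space M. \<forall>s\<in>{-\<tau>..0}. norm (\<xi> s \<omega>) \<le> C)"

text \<open>The process \<open>X - D(X(\<cdot> - \<tau>), r)\<close> is continuous, but \<open>X\<close> itself may jump with \<open>r\<close>; hence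
  right-continuity of \<open>X\<close>.\<close>

definition nsdde_solution ::
    "'w measure \<Rightarrow> (real \<Rightarrow> 'w measure) \<Rightarrow>
     (real ^ 'd \<Rightarrow> int \<Rightarrow> real ^ 'd) \<Rightarrow>
     (real ^ 'd \<Rightarrow> real ^ 'd \<Rightarrow> real \<Rightarrow> int \<Rightarrow> real ^ 'd) \<Rightarrow>
     (real ^ 'd \<Rightarrow> real ^ 'd \<Rightarrow> real \<Rightarrow> int \<Rightarrow> real ^ 'm ^ 'd) \<Rightarrow>
     (real \<Rightarrow> 'w \<Rightarrow> real ^ 'm) \<Rightarrow> (real \<Rightarrow> 'w \<Rightarrow> int) \<Rightarrow> real \<Rightarrow>
     (real \<Rightarrow> 'w \<Rightarrow> real ^ 'd) \<Rightarrow> int \<Rightarrow> (real \<Rightarrow> 'w \<Rightarrow> real ^ 'd) \<Rightarrow> bool" where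
  "nsdde_solution M F D f g B r \<tau> \<xi> i\<^sub>0 X \<longleftrightarrow>
     (\<forall>t\<ge>-\<tau>. X t \<in> borel_measurable (F (max t 0))) \<and>
     (\<forall>\<omega>\<in>space M. \<forall>t\<ge>-\<tau>. continuous (at_right t) (\<lambda>s. X s \<omega>)) \<and>
     (AE \<omega> in M. r 0 \<omega> = i\<^sub>0) \<and>
     (AE \<omega> in M. \<forall>s\<in>{-\<tau>..0}. X s \<omega> = \<xi> s \<omega>) \<and>
     (AE \<omega> in M. \<forall>t\<ge>0.
        set_integrable lborel {0..t} (\<lambda>s. f (X s \<omega>) (X (s - \<tau>) \<omega>) s (r s \<omega>))) \<and>
     (\<exists>J. ito_integral M F B (\<lambda>s \<omega>. g (X s \<omega>) (X (s - \<tau>) \<omega>) s (r s \<omega>)) J \<and>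
        (AE \<omega> in M. \<forall>t\<ge>0.
           X t \<omega> - D (X (t - \<tau>) \<omega>) (r t \<omega>) =
             X 0 \<omega> - D (X (- \<tau>) \<omega>) (r 0 \<omega>)
             + (LINT s:{0..t}|lborel. f (X s \<omega>) (X (s - \<tau>) \<omega>) s (r s \<omega>))
             + J t \<omega>))"


subsection \<open>The operator L\<close>

definition partial_deriv :: "'d \<Rightarrow> (real ^ 'd \<Rightarrow> real) \<Rightarrow> real ^ 'd \<Rightarrow> real" where
  "partial_deriv k u x = deriv (\<lambda>s. u (x + s *\<^sub>R axis k 1)) 0"

definition has_partial :: "'d \<Rightarrow> (real ^ 'd \<Rightarrow> real) \<Rightarrow> real ^ 'd \<Rightarrow> bool" where
  "has_partial k u x \<longleftrightarrow> (\<lambda>s. u (x + s *\<^sub>R axis k 1)) field_differentiable (at 0)"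

text \<open>The time derivative at \<open>t = 0\<close> is one-sided.\<close>

definition Vt :: "(real ^ 'd \<Rightarrow> real \<Rightarrow> int \<Rightarrow> real) \<Rightarrow> real ^ 'd \<Rightarrow> real \<Rightarrow> int \<Rightarrow> real" where
  "Vt V x t i = vector_derivative (\<lambda>s. V x s i) (at t within {0..})"

definition Vx :: "(real ^ 'd \<Rightarrow> real \<Rightarrow> int \<Rightarrow> real) \<Rightarrow> real ^ 'd \<Rightarrow> real \<Rightarrow> int \<Rightarrow> real ^ 'd" where
  "Vx V x t i = (\<chi> k. partial_deriv k (\<lambda>y. V y t i) x)"

definition Vxx :: "(real ^ 'd \<Rightarrow> real \<Rightarrow> int \<Rightarrow> real) \<Rightarrow> real ^ 'd \<Rightarrow> real \<Rightarrow> int \<Rightarrow> real ^ 'd ^ 'd" where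
  "Vxx V x t i = (\<chi> l j. partial_deriv l (partial_deriv j (\<lambda>y. V y t i)) x)"

definition C21 :: "int set \<Rightarrow> (real ^ 'd \<Rightarrow> real \<Rightarrow> int \<Rightarrow> real) \<Rightarrow> bool" where
  "C21 S V \<longleftrightarrow> (\<forall>i\<in>S.
     (\<forall>x. \<forall>t\<ge>0. (\<lambda>s. V x s i) differentiable (at t within {0..}) \<and>
        (\<forall>j. has_partial j (\<lambda>y. V y t i) x \<and>
           (\<forall>l. has_partial l (partial_deriv j (\<lambda>y. V y t i)) x))) \<and>
     continuous_on (UNIV \<times> {0..}) (\<lambda>(x, t). V x t i) \<and>
     continuous_on (UNIV \<times> {0..}) (\<lambda>(x, t). Vt V x t i) \<and>
     continuous_on (UNIV \<times> {0..}) (\<lambda>(x, t). Vx V x t i) \<and>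
     continuous_on (UNIV \<times> {0..}) (\<lambda>(x, t). Vxx V x t i))"

definition LV ::
    "int set \<Rightarrow> (int \<Rightarrow> int \<Rightarrow> real) \<Rightarrow>
     (real ^ 'd \<Rightarrow> int \<Rightarrow> real ^ 'd) \<Rightarrow>
     (real ^ 'd \<Rightarrow> real ^ 'd \<Rightarrow> real \<Rightarrow> int \<Rightarrow> real ^ 'd) \<Rightarrow>
     (real ^ 'd \<Rightarrow> real ^ 'd \<Rightarrow> real \<Rightarrow> int \<Rightarrow> real ^ 'm ^ 'd) \<Rightarrow>
     (real ^ 'd \<Rightarrow> real \<Rightarrow> int \<Rightarrow> real) \<Rightarrow>
     real ^ 'd \<Rightarrow> real ^ 'd \<Rightarrow> real \<Rightarrow> int \<Rightarrow> real" where
  "LV S \<Gamma> D f g V x y t i =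
     Vt V (x - D y i) t i
     + Vx V (x - D y i) t i \<bullet> f x y t i
     + 1 / 2 * trace (transpose (g x y t i) ** Vxx V (x - D y i) t i ** g x y t i)
     + (\<Sum>j\<in>S. \<Gamma> i j * V (x - D y i) t j)"


subsection \<open>Lyapunov exponents\<close>

text \<open>Logarithm with \<open>log 0 = -\<infinity>\<close> and \<open>log \<infinity> = \<infinity>\<close>; needed because the real \<open>ln\<close> has \<open>ln 0 = 0\<close>, which
  would misrepresent the exponent of a solution that vanishes.\<close>

definition ext_ln :: "ennreal \<Rightarrow> ereal" where
  "ext_ln a = (if a = 0 then - \<infinity> else if a = \<infinity> then \<infinity> else ereal (ln (enn2real a)))"

text \<open>\<open>limsup 1/t log (u t)\<close> as \<open>t\<close> tends to infinity.\<close>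

definition lyapunov_exponent :: "(real \<Rightarrow> ennreal) \<Rightarrow> ereal" where
  "lyapunov_exponent u = Limsup at_top (\<lambda>t. ereal (1 / t) * ext_ln (u t))"

end

theory Submission
  imports Defs
begin

text \<open>
  The process \<open>Z(t) = X(t) - D(X(t - \<tau>), r(t))\<close> has Ito differential \<open>f dt + g dB\<close>. By the bound on \<open>LV\<close>, the process
  \<open>exp(-\<integral> C\<^sub>0 + \<phi>) V(Z(t), t, r(t))\<close> has drift at most \<open>h\<close>. Stopping it when \<open>|Z|\<close> first reaches \<open>\<rho>\<close> after time \<open>n\<close> yields
  the maximal inequality \<open>c\<^sub>1 \<rho>\<^sup>p \<delta> P(sup |Z| \<ge> \<rho> on [n, n + 1]) \<le> c\<^sub>2 E|Z(n)|\<^sup>p + \<integral> h\<close>, where the integral is over \<open>[n, n + 1]\<close> and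
  \<open>\<delta> = exp(- C\<^sub>0 - \<integral> \<phi>)\<close>. For \<open>\<rho> = exp(-\<mu> n)\<close> with \<open>\<mu> < lam / p\<close> the right-hand side decays faster than \<open>\<rho>\<^sup>p\<close>, so the
  Borel-Cantelli lemma bounds \<open>|Z(t)|\<close> by a multiple of \<open>exp(-\<mu> t)\<close>. This passes to \<open>X\<close> by
  \<open>|X(t)| \<le> |Z(t)| + \<beta> |X(t - \<tau>)|\<close> and \<open>\<beta> exp(\<mu> \<tau>) < 1\<close>.

  Ito's formula is replaced by a second-order Taylor expansion of \<open>V\<close> over the cells of the partition \<open>n + k / N\<close>. It uses
  the first, second and fourth moments of the increments of the stopped stochastic integral, conditionally on the left end
  of the cell for the first two, and the one-step law of the chain. The linear terms have mean at most the integral of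
  \<open>LV - (C\<^sub>0 + \<phi>) V\<close> with coefficients frozen at the left end, and the remainders vanish as \<open>N \<rightarrow> \<infinity>\<close>.
\<close>

subsection \<open>Brownian increments along a grid\<close>

text \<open>Little is known of the noise: the stochastic integral is only a limit in probability of
  integrals of simple processes, and the chain is given by its first-order transition probabilities.
  So stochastic facts are stated as means against bounded weights known at the left end of a cell,
  which play the part of conditioning. The chain and the integral may move within the same cell. The
  expansion therefore keeps the new state in \<open>V y t i'\<close>, whose change is a pure Markov
  increment, and restores the old state in the derivatives at a cost \<open>\<eta>\<close> per jump.
  Jumps have probability of order \<open>1 / N\<close> and fourth powers of increments have mean of
  order \<open>1 / N^2\<close>, so the errors of the \<open>N\<close> cells add up to
  \<open>\<eta> + C / N\<close>. Stopping confines \<open>Z\<close> to a ball, the contraction of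
  \<open>D\<close> then confines \<open>X\<close>, and the Lipschitz condition bounds the
  coefficients there. The radius \<open>R\<close> imposed before time \<open>n\<close> does not
  occur in the final bound and is sent to infinity. As \<open>f\<close>, \<open>g\<close> and
  \<open>\<phi>\<close> are merely measurable in time, only the state is frozen in a cell.\<close>

lemma measurable_vec_nth [measurable (raw)]:
  fixes f :: "'a \<Rightarrow> 'b::topological_space ^ 'n"
  assumes "f \<in> borel_measurable M"
  shows "(\<lambda>x. f x $ i) \<in> borel_measurable M"
  using assms by (rule measurable_compose)
    (auto intro!: borel_measurable_continuous_onI continuous_intros)

locale filtered_bm = prob_space M for M :: "'w measure" +
  fixes F :: "real \<Rightarrow> 'w measure" and B :: "real \<Rightarrow> 'w \<Rightarrow> real ^ 'm"
  assumes filtration: "complete_filtration M F"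
    and bm: "brownian_motion M F B"
begin

lemma subalg: "0 \<le> t \<Longrightarrow> subalgebra M (F t)"
  using filtration by (auto simp: complete_filtration_def)

lemma space_F [simp]: "0 \<le> t \<Longrightarrow> space (F t) = space M"
  using subalg by (auto simp: subalgebra_def)

lemma sets_F_mono: "0 \<le> s \<Longrightarrow> s \<le> t \<Longrightarrow> sets (F s) \<subseteq> sets (F t)"
  using filtration by (auto simp: complete_filtration_def)

lemma subalg_F: "0 \<le> s \<Longrightarrow> s \<le> t \<Longrightarrow> subalgebra (F t) (F s)"
  using sets_F_mono by (auto simp: subalgebra_def)

lemma measurable_F_M: "f \<in> measurable (F t) N \<Longrightarrow> 0 \<le> t \<Longrightarrow> f \<in> measurable M N"
  using measurable_from_subalg subalg by blast

lemma measurable_F_mono: "f \<in> measurable (F s) N \<Longrightarrow> 0 \<le> s \<Longrightarrow> s \<le> t \<Longrightarrow> f \<in> measurable (F t) N"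
  using measurable_from_subalg subalg_F by blast

lemma sets_F_M: "A \<in> sets (F t) \<Longrightarrow> 0 \<le> t \<Longrightarrow> A \<in> sets M"
  using subalg by (auto simp: subalgebra_def)

lemma B_measurable_F: "0 \<le> s \<Longrightarrow> s \<le> t \<Longrightarrow> B s \<in> borel_measurable (F t)"
  using bm measurable_F_mono[of "B s" s borel t] by (simp add: brownian_motion_def)

lemma B_measurable: "0 \<le> s \<Longrightarrow> B s \<in> borel_measurable M"
  using B_measurable_F[of s s] measurable_F_M by blast

lemma B_continuous: "w \<in> space M \<Longrightarrow> continuous_on {0..} (\<lambda>t. B t w)"
  using bm by (auto simp: brownian_motion_def)

text \<open>The sigma-algebras generated by \<open>\<xi>\<close> and by \<open>\<psi>\<close> of the
  increment lie inside \<open>F s\<close> and inside the sigma-algebra of the increment, which are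
  independent by definition.\<close>

lemma increment_indep_var:
  fixes \<xi> :: "'w \<Rightarrow> real" and \<psi> :: "real ^ 'm \<Rightarrow> real"
  assumes "0 \<le> s" "s < t" and \<xi>: "\<xi> \<in> borel_measurable (F s)" and \<psi>: "\<psi> \<in> borel_measurable borel"
  shows "indep_var borel \<xi> borel (\<lambda>w. \<psi> (B t w - B s w))"
proof -
  let ?\<G> = "vimage_algebra (space M) (\<lambda>w. B t w - B s w) borel"
  have ind: "indep_set (sets (F s)) (sets ?\<G>)"
    using bm assms(1,2) by (auto simp: brownian_motion_def)
  have Bm [measurable]: "B t \<in> borel_measurable M" "B s \<in> borel_measurable M"
    using assms B_measurable by auto
  have \<xi>M: "\<xi> \<in> borel_measurable M" using \<xi> assms(1) measurable_F_M by blast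
  have \<psi>M: "(\<lambda>w. \<psi> (B t w - B s w)) \<in> borel_measurable M" using \<psi> by measurable
  have \<psi>G: "(\<lambda>w. \<psi> (B t w - B s w)) \<in> borel_measurable ?\<G>"
    by (rule measurable_compose[OF measurable_vimage_algebra1 \<psi>]) auto
  have 1: "sigma_sets (space M) {\<xi> -` A \<inter> space M |A. A \<in> sets borel} \<subseteq> sets (F s)"
    using sets.sigma_sets_subset[of "{\<xi> -` A \<inter> space M |A. A \<in> sets borel}" "F s"]
      measurable_sets[OF \<xi>] assms(1) by fastforce
  have 2: "sigma_sets (space M) {(\<lambda>w. \<psi> (B t w - B s w)) -` A \<inter> space M |A. A \<in> sets borel} \<subseteq> sets ?\<G>"
    using sets.sigma_sets_subset[of "{(\<lambda>w. \<psi> (B t w - B s w)) -` A \<inter> space M |A. A \<in> sets borel}" ?\<G>]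
      measurable_sets[OF \<psi>G] by fastforce
  show ?thesis
    unfolding indep_var_eq using \<xi>M \<psi>M ind 1 2 unfolding indep_sets2_eq by blast
qed

lemma increment_expectation:
  fixes \<xi> :: "'w \<Rightarrow> real" and \<psi> :: "real ^ 'm \<Rightarrow> real"
  assumes "0 \<le> s" "s < t" and \<xi>: "\<xi> \<in> borel_measurable (F s)" and \<psi>: "\<psi> \<in> borel_measurable borel"
    and "integrable M \<xi>" "integrable M (\<lambda>w. \<psi> (B t w - B s w))"
  shows "integrable M (\<lambda>w. \<xi> w * \<psi> (B t w - B s w))"
    and "expectation (\<lambda>w. \<xi> w * \<psi> (B t w - B s w)) = expectation \<xi> * expectation (\<lambda>w. \<psi> (B t w - B s w))"
  using indep_var_integrable[OF increment_indep_var[OF assms(1-4)] assms(5,6)]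
    indep_var_lebesgue_integral[OF increment_indep_var[OF assms(1-4)] assms(5,6)] by auto

context
  fixes s t :: real assumes st: "0 \<le> s" "s < t"
begin

lemma increment_distributed:
  "distributed M lborel (\<lambda>w. B t w $ k - B s w $ k) (normal_density 0 (sqrt (t - s)))"
  using bm st by (auto simp: brownian_motion_def)

lemma increment_power_integrable: "integrable M (\<lambda>w. (B t w $ k - B s w $ k) ^ n)"
  using distributed_integrable[OF increment_distributed, of "\<lambda>x. x ^ n" k]
    integrable_normal_moment[of "sqrt (t - s)" 0 n] st by simp

lemma increment_power_expectation:
  "expectation (\<lambda>w. (B t w $ k - B s w $ k) ^ n) = (\<integral>x. normal_density 0 (sqrt (t - s)) x * x ^ n \<partial>lborel)"
  using distributed_integral[OF increment_distributed, of "\<lambda>x. x ^ n" k] by simp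

lemma increment_moments:
  "expectation (\<lambda>w. B t w $ k - B s w $ k) = 0"
  "expectation (\<lambda>w. (B t w $ k - B s w $ k) ^ 2) = t - s"
  "expectation (\<lambda>w. (B t w $ k - B s w $ k) ^ 3) = 0"
  "expectation (\<lambda>w. (B t w $ k - B s w $ k) ^ 4) = 3 * (t - s) ^ 2"
proof -
  have p: "sqrt (t - s) > 0" "(sqrt (t - s))\<^sup>2 = t - s" using st by auto
  show "expectation (\<lambda>w. B t w $ k - B s w $ k) = 0"
    using increment_power_expectation[of k 1] integral_normal_moment_odd[OF p(1), of 0 0] by simp
  show "expectation (\<lambda>w. (B t w $ k - B s w $ k) ^ 2) = t - s"
    using increment_power_expectation[of k 2] integral_normal_moment_even[OF p(1), of 0 1] p(2)
    by (simp add: fact_numeral)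
  show "expectation (\<lambda>w. (B t w $ k - B s w $ k) ^ 3) = 0"
    using increment_power_expectation[of k 3] integral_normal_moment_odd[OF p(1), of 0 1] by simp
  have "fact 4 / ((2 / (t - s))\<^sup>2 * fact 2) = 3 * (t - s) ^ 2"
    using st by (simp add: fact_numeral power2_eq_square)
  then show "expectation (\<lambda>w. (B t w $ k - B s w $ k) ^ 4) = 3 * (t - s) ^ 2"
    using increment_power_expectation[of k 4] integral_normal_moment_even[OF p(1), of 0 2] p(2) by simp
qed

text \<open>Off the diagonal the mean factorises into two zero means, because the coordinates of an
  increment are independent; the diagonal is the variance.\<close>

lemma increment_product:
  "integrable M (\<lambda>w. (B t w $ k - B s w $ k) * (B t w $ l - B s w $ l))"
  "expectation (\<lambda>w. (B t w $ k - B s w $ k) * (B t w $ l - B s w $ l)) = (if k = l then t - s else 0)"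
proof -
  let ?X = "\<lambda>k w. B t w $ k - B s w $ k"
  have iv: "indep_vars (\<lambda>_. borel) ?X UNIV"
    using bm st by (auto simp: brownian_motion_def)
  have int: "integrable M (?X i)" for i
    using increment_power_integrable[of i 1] by simp
  have *: "integrable M (\<lambda>w. ?X k w * ?X l w) \<and> expectation (\<lambda>w. ?X k w * ?X l w) = 0" if "k \<noteq> l"
  proof -
    have iv2: "indep_vars (\<lambda>_. borel) ?X {k, l}"
      by (rule indep_vars_subset[OF iv]) auto
    show ?thesis
      using indep_vars_integrable[OF _ iv2 int] indep_vars_lebesgue_integral[OF _ iv2 int] that
        increment_moments(1) by simp
  qed
  show "integrable M (\<lambda>w. ?X k w * ?X l w)"
    using * increment_power_integrable[of k 2] by (cases "k = l") (auto simp: power2_eq_square)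
  show "expectation (\<lambda>w. ?X k w * ?X l w) = (if k = l then t - s else 0)"
    using * increment_moments(2)[of k] by (auto simp: power2_eq_square)
qed

end

lemma integrable_mult_bounded:
  fixes f g :: "'w \<Rightarrow> real"
  assumes f: "integrable M f" and g: "g \<in> borel_measurable M" and b: "\<And>w. w \<in> space M \<Longrightarrow> \<bar>g w\<bar> \<le> C"
  shows "integrable M (\<lambda>w. f w * g w)"
proof (rule Bochner_Integration.integrable_bound)
  show "integrable M (\<lambda>w. \<bar>f w\<bar> * C)" using f by auto
  show "(\<lambda>w. f w * g w) \<in> borel_measurable M" using f g by auto
  show "AE w in M. norm (f w * g w) \<le> norm (\<bar>f w\<bar> * C)"
    using b by (intro AE_I2) (force simp: abs_mult intro: mult_left_mono)
qed

lemma integrable_bounded: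
  fixes g :: "'w \<Rightarrow> real"
  assumes g: "g \<in> borel_measurable M" and b: "\<And>w. w \<in> space M \<Longrightarrow> \<bar>g w\<bar> \<le> C"
  shows "integrable M g"
  by (rule integrable_const_bound[of _ C]) (use g b in auto)

text \<open>Every lower power is dominated by \<open>1 + x ^ 4\<close>, so the fourth moment is the
  only integrability that has to be carried along.\<close>

lemma integrable_power_le:
  fixes f :: "'w \<Rightarrow> real"
  assumes f: "integrable M (\<lambda>w. f w ^ 4)" "f \<in> borel_measurable M" and "k \<le> 4"
  shows "integrable M (\<lambda>w. f w ^ k)"
proof (rule Bochner_Integration.integrable_bound)
  show "integrable M (\<lambda>w. 1 + f w ^ 4)" using f by auto
  show "(\<lambda>w. f w ^ k) \<in> borel_measurable M" using f by auto
  have "\<bar>x\<bar> ^ k \<le> 1 + x ^ 4" for x :: real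
  proof (cases "\<bar>x\<bar> \<le> 1")
    case True then have "\<bar>x\<bar> ^ k \<le> 1" by (simp add: power_le_one)
    then show ?thesis by (smt (verit) zero_le_even_power even_numeral)
  next
    case False then have "\<bar>x\<bar> ^ k \<le> \<bar>x\<bar> ^ 4" using \<open>k \<le> 4\<close> by (intro power_increasing) auto
    then show ?thesis by (simp add: power_even_abs)
  qed
  then show "AE w in M. norm (f w ^ k) \<le> norm (1 + f w ^ 4)"
    by (intro AE_I2) (smt (verit, best) norm_power real_norm_def)
qed

section \<open>Moments of discrete martingale transforms\<close>

context
  fixes d :: real and m\<^sub>0 :: nat
  assumes d: "d > 0"
begin

definition dB :: "'m \<Rightarrow> nat \<Rightarrow> 'w \<Rightarrow> real" where
  "dB b j w = B (real (Suc j) * d) w $ b - B (real j * d) w $ b"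

lemma dB_measurable_F: "real (Suc j) * d \<le> t \<Longrightarrow> dB b j \<in> borel_measurable (F t)"
proof -
  assume t: "real (Suc j) * d \<le> t"
  have "real j * d \<le> t" using t d by (simp add: distrib_right)
  then have "B (real (Suc j) * d) \<in> borel_measurable (F t)" "B (real j * d) \<in> borel_measurable (F t)"
    using t d by (auto intro!: B_measurable_F)
  then show ?thesis unfolding dB_def by measurable
qed

text \<open>A weight known at the left end of a cell is independent of the increment over it, so the
  mean factorises.\<close>

lemma weighted_dB_power:
  assumes \<xi>: "\<xi> \<in> borel_measurable (F (real j * d))" "integrable M \<xi>"
  shows "integrable M (\<lambda>w. \<xi> w * dB b j w ^ k)"
    and "expectation (\<lambda>w. \<xi> w * dB b j w ^ k) = expectation \<xi> * expectation (\<lambda>w. dB b j w ^ k)"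
  using increment_expectation[of "real j * d" "real (Suc j) * d" \<xi> "\<lambda>v. (v $ b) ^ k"] \<xi>
    increment_power_integrable[of "real j * d" "real (Suc j) * d" b k] d
  by (auto simp: dB_def)

lemma weighted_dB_product:
  assumes \<xi>: "\<xi> \<in> borel_measurable (F (real j * d))" "integrable M \<xi>"
  shows "integrable M (\<lambda>w. \<xi> w * (dB b j w * dB c j w))"
    and "expectation (\<lambda>w. \<xi> w * (dB b j w * dB c j w)) = expectation \<xi> * (if b = c then d else 0)"
  using increment_expectation[of "real j * d" "real (Suc j) * d" \<xi> "\<lambda>v. v $ b * v $ c"] \<xi>
    increment_product[of "real j * d" "real (Suc j) * d" b c] d
  by (auto simp: dB_def distrib_right)

lemma dB_moments:
  "expectation (dB b j) = 0" "expectation (\<lambda>w. dB b j w ^ 2) = d"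
  "expectation (\<lambda>w. dB b j w ^ 3) = 0" "expectation (\<lambda>w. dB b j w ^ 4) = 3 * d ^ 2"
  using increment_moments[of "real j * d" "real (Suc j) * d" b] d
  unfolding dB_def[abs_def] by (auto simp: distrib_right)

text \<open>With \<open>x\<close> the new increment and \<open>w\<close> its weight, only even
  powers of \<open>x\<close> survive in the mean of \<open>(S + w x)^4\<close>. What is left is at
  most \<open>E S^4 + 6 K^2 d E S^2 + 3 K^4 d^2\<close>, so the second moment has to be bounded in
  the same induction. After \<open>k\<close> cells this is at most
  \<open>3 K^4 d^2 (k^2 + 2 k + 1)\<close>: the constant 3 of the Gaussian fourth moment closes the
  induction exactly.\<close>

lemma martingale_transform_fourth_moment:
  fixes b :: 'm and W :: "nat \<Rightarrow> 'w \<Rightarrow> real"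
  assumes W: "\<And>j. m\<^sub>0 \<le> j \<Longrightarrow> j < m \<Longrightarrow> W j \<in> borel_measurable (F (real j * d))"
    and K: "\<And>j w. m\<^sub>0 \<le> j \<Longrightarrow> j < m \<Longrightarrow> w \<in> space M \<Longrightarrow> \<bar>W j w\<bar> \<le> K" and "m\<^sub>0 \<le> m"
  defines "S \<equiv> \<lambda>m w. \<Sum>j=m\<^sub>0..<m. W j w * dB b j w"
  shows "S m \<in> borel_measurable (F (real m * d))"
    and "integrable M (\<lambda>w. S m w ^ 4)"
    and "expectation (\<lambda>w. S m w ^ 2) \<le> K\<^sup>2 * (d * real (m - m\<^sub>0))"
    and "expectation (\<lambda>w. S m w ^ 4) \<le> 3 * K ^ 4 * (d * real (m - m\<^sub>0))\<^sup>2"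
proof -
  have "S m \<in> borel_measurable (F (real m * d)) \<and> integrable M (\<lambda>w. S m w ^ 4) \<and>
    expectation (\<lambda>w. S m w ^ 2) \<le> K\<^sup>2 * (d * real (m - m\<^sub>0)) \<and>
    expectation (\<lambda>w. S m w ^ 4) \<le> 3 * K ^ 4 * (d * real (m - m\<^sub>0))\<^sup>2"
    using \<open>m\<^sub>0 \<le> m\<close> W K
  proof (induction m rule: dec_induct)
    case base then show ?case by (simp add: S_def)
  next
    case (step n)
    define x where "x = dB b n"
    have Wn: "W n \<in> borel_measurable (F (real n * d))" and Kn: "\<And>w. w \<in> space M \<Longrightarrow> \<bar>W n w\<bar> \<le> K"
      using step.prems step.hyps by auto
    from step have IH: "S n \<in> borel_measurable (F (real n * d))" "integrable M (\<lambda>w. S n w ^ 4)"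
      "expectation (\<lambda>w. S n w ^ 2) \<le> K\<^sup>2 * (d * real (n - m\<^sub>0))"
      "expectation (\<lambda>w. S n w ^ 4) \<le> 3 * K ^ 4 * (d * real (n - m\<^sub>0))\<^sup>2"
      by auto
    have SM: "S n \<in> borel_measurable M" using measurable_F_M[OF IH(1)] d by simp
    have WM: "W n \<in> borel_measurable M" using measurable_F_M[OF Wn] d by simp
    have Ssuc: "S (Suc n) w = S n w + W n w * x w" for w
      using step.hyps by (simp add: S_def x_def)
    have mono: "real n * d \<le> real (Suc n) * d" using d by simp
    have m1: "S (Suc n) \<in> borel_measurable (F (real (Suc n) * d))"
    proof -
      have "S n \<in> borel_measurable (F (real (Suc n) * d))" "W n \<in> borel_measurable (F (real (Suc n) * d))"
        using measurable_F_mono[OF IH(1) _ mono] measurable_F_mono[OF Wn _ mono] d by auto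
      moreover have "x \<in> borel_measurable (F (real (Suc n) * d))"
        unfolding x_def by (rule dB_measurable_F) simp
      ultimately have "(\<lambda>w. S n w + W n w * x w) \<in> borel_measurable (F (real (Suc n) * d))" by measurable
      then show ?thesis unfolding Ssuc[abs_def, symmetric] .
    qed
    have SWm: "(\<lambda>w. S n w ^ i * W n w ^ k) \<in> borel_measurable (F (real n * d))" for i k
      using IH(1) Wn by measurable
    have Wk: "\<bar>W n w ^ k\<bar> \<le> K ^ k" if "w \<in> space M" for w k
      unfolding power_abs using Kn[OF that] by (intro power_mono) auto
    have SWi: "integrable M (\<lambda>w. S n w ^ i * W n w ^ k)" if "i \<le> 4" for i k
      by (rule integrable_mult_bounded[OF integrable_power_le[OF IH(2) SM that], where C="K^k"])
        (use WM Wk in auto)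
    note A = weighted_dB_power[OF SWm SWi, of _ _ b, folded x_def]
    have mom: "expectation x = 0" "expectation (\<lambda>w. x w ^ 2) = d"
      "expectation (\<lambda>w. x w ^ 3) = 0" "expectation (\<lambda>w. x w ^ 4) = 3 * d ^ 2"
      unfolding x_def by (rule dB_moments)+
    have bd: "expectation (\<lambda>w. S n w ^ i * W n w ^ k) \<le> K ^ k * expectation (\<lambda>w. S n w ^ i)"
      if "i \<le> 4" "even i" for i k
    proof -
      have "expectation (\<lambda>w. S n w ^ i * W n w ^ k) \<le> expectation (\<lambda>w. S n w ^ i * K ^ k)"
      proof (rule integral_mono[OF SWi[OF that(1)]])
        show "integrable M (\<lambda>w. S n w ^ i * K ^ k)"
          using integrable_power_le[OF IH(2) SM that(1)] by simp
        fix w assume "w \<in> space M"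
        then show "S n w ^ i * W n w ^ k \<le> S n w ^ i * K ^ k"
          using Wk[of w k] that(2) by (intro mult_left_mono) (auto simp: zero_le_even_power)
      qed
      then show ?thesis by (simp add: mult.commute)
    qed
    \<comment> \<open>Exponents 0 and 1 are spelled out so that every term has the form
      \<open>S^i W^k x^k\<close> to which \<open>A\<close> applies.\<close>
    have e4: "S (Suc n) w ^ 4 = S n w ^ 4 * W n w ^ 0 * x w ^ 0 + 4 * (S n w ^ 3 * W n w ^ 1 * x w ^ 1)
        + 6 * (S n w ^ 2 * W n w ^ 2 * x w ^ 2) + 4 * (S n w ^ 1 * W n w ^ 3 * x w ^ 3)
        + S n w ^ 0 * W n w ^ 4 * x w ^ 4" for w
      unfolding Ssuc by (simp add: power4_eq_xxxx power2_eq_square power3_eq_cube algebra_simps)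
    have e2: "S (Suc n) w ^ 2 = S n w ^ 2 * W n w ^ 0 * x w ^ 0 + 2 * (S n w ^ 1 * W n w ^ 1 * x w ^ 1)
        + S n w ^ 0 * W n w ^ 2 * x w ^ 2" for w
      unfolding Ssuc by (simp add: power2_eq_square algebra_simps)
    have i4: "integrable M (\<lambda>w. S (Suc n) w ^ 4)"
      unfolding e4 by (intro Bochner_Integration.integrable_add integrable_mult_right A(1)) auto
    have "expectation (\<lambda>w. S (Suc n) w ^ 4) = expectation (\<lambda>w. S n w ^ 4)
        + 6 * (expectation (\<lambda>w. S n w ^ 2 * W n w ^ 2) * d) + expectation (\<lambda>w. S n w ^ 0 * W n w ^ 4) * (3 * d ^ 2)"
      unfolding e4
      apply (subst Bochner_Integration.integral_add, (intro Bochner_Integration.integrable_add integrable_mult_right A(1); simp), (intro Bochner_Integration.integrable_add integrable_mult_right A(1); simp))+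
      apply (simp only: integral_mult_right_zero A(2) numeral_le_iff order_refl one_le_numeral zero_le semiring_norm mom power_one_right)
      apply (simp add: prob_space mom)
      done
    also have "\<dots> \<le> 3 * K ^ 4 * (d * real (n - m\<^sub>0))\<^sup>2 + 6 * (K\<^sup>2 * (K\<^sup>2 * (d * real (n - m\<^sub>0))) * d) + K ^ 4 * (3 * d ^ 2)"
    proof -
      have "expectation (\<lambda>w. S n w ^ 2 * W n w ^ 2) \<le> K\<^sup>2 * (K\<^sup>2 * (d * real (n - m\<^sub>0)))"
        using bd[of 2 2] mult_left_mono[OF IH(3), of "K\<^sup>2"] by simp
      moreover have "expectation (\<lambda>w. S n w ^ 0 * W n w ^ 4) \<le> K ^ 4"
        using bd[of 0 4] by (simp add: prob_space)
      ultimately show ?thesis using IH(4) d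
        by (intro add_mono mult_left_mono mult_right_mono) auto
    qed
    also have "\<dots> \<le> 3 * K ^ 4 * (d * real (Suc n - m\<^sub>0))\<^sup>2"
      using step.hyps by (simp add: Suc_diff_le power2_eq_square power4_eq_xxxx algebra_simps)
    finally have b4: "expectation (\<lambda>w. S (Suc n) w ^ 4) \<le> 3 * K ^ 4 * (d * real (Suc n - m\<^sub>0))\<^sup>2" .
    have "expectation (\<lambda>w. S (Suc n) w ^ 2) = expectation (\<lambda>w. S n w ^ 2) + expectation (\<lambda>w. S n w ^ 0 * W n w ^ 2) * d"
      unfolding e2
      apply (subst Bochner_Integration.integral_add, (intro Bochner_Integration.integrable_add integrable_mult_right A(1); simp), (intro Bochner_Integration.integrable_add integrable_mult_right A(1); simp))+
      apply (simp only: integral_mult_right_zero A(2) numeral_le_iff order_refl one_le_numeral zero_le semiring_norm mom power_one_right)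
      apply (simp add: prob_space mom)
      done
    also have "\<dots> \<le> K\<^sup>2 * (d * real (n - m\<^sub>0)) + K\<^sup>2 * d"
    proof -
      have "expectation (\<lambda>w. S n w ^ 0 * W n w ^ 2) \<le> K\<^sup>2"
        using bd[of 0 2] by (simp add: prob_space)
      then show ?thesis using IH(3) d by (intro add_mono mult_right_mono) auto
    qed
    also have "\<dots> = K\<^sup>2 * (d * real (Suc n - m\<^sub>0))"
      using step.hyps by (simp add: Suc_diff_le algebra_simps)
    finally show ?case using m1 i4 b4 by blast
  qed
  then show "S m \<in> borel_measurable (F (real m * d))" "integrable M (\<lambda>w. S m w ^ 4)"
    "expectation (\<lambda>w. S m w ^ 2) \<le> K\<^sup>2 * (d * real (m - m\<^sub>0))"
    "expectation (\<lambda>w. S m w ^ 4) \<le> 3 * K ^ 4 * (d * real (m - m\<^sub>0))\<^sup>2" by auto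
qed

text \<open>The weight \<open>\<xi>\<close> is known at the start \<open>m\<^sub>0 * d\<close>;
  testing against all such bounded weights amounts to conditioning on that sigma-algebra. A new
  increment is uncorrelated with everything known before it, so mixed terms drop out. Only products
  of two increments over the same cell remain, and they give \<open>d\<close> when the columns
  agree.\<close>

lemma martingale_transform_covariance:
  fixes W :: "nat \<Rightarrow> 'w \<Rightarrow> real ^ 'm ^ 'd" and \<xi> :: "'w \<Rightarrow> real"
  assumes W: "\<And>j. m\<^sub>0 \<le> j \<Longrightarrow> j < m \<Longrightarrow> W j \<in> borel_measurable (F (real j * d))"
    and K: "\<And>j w a b. m\<^sub>0 \<le> j \<Longrightarrow> j < m \<Longrightarrow> w \<in> space M \<Longrightarrow> \<bar>W j w $ a $ b\<bar> \<le> K" and "m\<^sub>0 \<le> m"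
    and \<xi>: "\<xi> \<in> borel_measurable (F (real m\<^sub>0 * d))" "\<And>w. w \<in> space M \<Longrightarrow> \<bar>\<xi> w\<bar> \<le> C"
  defines "S \<equiv> \<lambda>a m w. \<Sum>j=m\<^sub>0..<m. \<Sum>b\<in>UNIV. W j w $ a $ b * dB b j w"
  shows "S a m \<in> borel_measurable (F (real m * d))"
    and "integrable M (\<lambda>w. S a m w ^ 4)"
    and "expectation (\<lambda>w. S a m w ^ 4) \<le> 3 * real CARD('m) ^ 4 * K ^ 4 * (d * real (m - m\<^sub>0))\<^sup>2"
    and "expectation (\<lambda>w. \<xi> w * S a m w) = 0"
    and "expectation (\<lambda>w. \<xi> w * (S a m w * S c m w)) =
      (\<Sum>j=m\<^sub>0..<m. \<Sum>b\<in>UNIV. d * expectation (\<lambda>w. \<xi> w * (W j w $ a $ b * W j w $ c $ b)))"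
proof -
  define s where "s = (\<lambda>a b m w. \<Sum>j=m\<^sub>0..<m. W j w $ a $ b * dB b j w)"
  have Ss: "S a n w = (\<Sum>b\<in>UNIV. s a b n w)" for a n w
    unfolding S_def s_def by (rule sum.swap)
  have s: "s a b n \<in> borel_measurable (F (real n * d))" "integrable M (\<lambda>w. s a b n w ^ 4)"
    "expectation (\<lambda>w. s a b n w ^ 4) \<le> 3 * K ^ 4 * (d * real (n - m\<^sub>0))\<^sup>2"
    if "m\<^sub>0 \<le> n" "n \<le> m" for a b n
  proof -
    have 1: "(\<lambda>w. W j w $ a $ b) \<in> borel_measurable (F (real j * d))" if "m\<^sub>0 \<le> j" "j < n" for j
      using W[of j] that \<open>n \<le> m\<close> by (intro measurable_vec_nth) auto
    have 2: "\<bar>W j w $ a $ b\<bar> \<le> K" if "m\<^sub>0 \<le> j" "j < n" "w \<in> space M" for j w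
      using K[of j] that \<open>n \<le> m\<close> by auto
    show "s a b n \<in> borel_measurable (F (real n * d))" "integrable M (\<lambda>w. s a b n w ^ 4)"
      "expectation (\<lambda>w. s a b n w ^ 4) \<le> 3 * K ^ 4 * (d * real (n - m\<^sub>0))\<^sup>2"
      using martingale_transform_fourth_moment[where W="\<lambda>j w. W j w $ a $ b" and K=K and m=n, OF 1 2 that(1)]
      unfolding s_def by auto
  qed
  have Sm: "S a n \<in> borel_measurable (F (real n * d))" if "m\<^sub>0 \<le> n" "n \<le> m" for a n
    unfolding Ss using s(1)[OF that] by measurable
  have SM: "S a n \<in> borel_measurable M" if "m\<^sub>0 \<le> n" "n \<le> m" for a n
    using measurable_F_M[OF Sm[OF that]] d by simp
  \<comment> \<open>Cauchy-Schwarz over the columns, used twice.\<close>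
  have pw: "(\<Sum>b\<in>UNIV. y b) ^ 4 \<le> real CARD('m) ^ 3 * (\<Sum>b\<in>UNIV. y b ^ 4)" for y :: "'m \<Rightarrow> real"
  proof -
    have "(\<Sum>b\<in>UNIV. y b) ^ 4 = ((\<Sum>b\<in>UNIV. y b)\<^sup>2)\<^sup>2" by (simp flip: power_mult)
    also have "\<dots> \<le> (real CARD('m) * (\<Sum>b\<in>UNIV. (y b)\<^sup>2))\<^sup>2"
      using sum_squared_le_sum_of_squares[of y UNIV] by (intro power_mono) (auto simp: mult.commute)
    also have "\<dots> \<le> (real CARD('m))\<^sup>2 * (real CARD('m) * (\<Sum>b\<in>UNIV. ((y b)\<^sup>2)\<^sup>2))"
      using sum_squared_le_sum_of_squares[of "\<lambda>b. (y b)\<^sup>2" UNIV]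
      by (auto simp: power_mult_distrib mult.commute intro!: mult_left_mono)
    finally show ?thesis by (simp add: power3_eq_cube power2_eq_square power4_eq_xxxx mult.assoc)
  qed
  have S4: "integrable M (\<lambda>w. S a n w ^ 4) \<and>
     expectation (\<lambda>w. S a n w ^ 4) \<le> 3 * real CARD('m) ^ 4 * K ^ 4 * (d * real (n - m\<^sub>0))\<^sup>2"
    if "m\<^sub>0 \<le> n" "n \<le> m" for a n
  proof
    have i: "integrable M (\<lambda>w. real CARD('m) ^ 3 * (\<Sum>b\<in>UNIV. s a b n w ^ 4))"
      using s(2)[OF that] by auto
    show 1: "integrable M (\<lambda>w. S a n w ^ 4)"
    proof (rule Bochner_Integration.integrable_bound[OF i])
      show "(\<lambda>w. S a n w ^ 4) \<in> borel_measurable M" using SM[OF that] by measurable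
      have "norm (S a n w ^ 4) \<le> norm (real CARD('m) ^ 3 * (\<Sum>b\<in>UNIV. s a b n w ^ 4))" for w
        using pw[of "\<lambda>b. s a b n w"] zero_le_even_power[of 4 "S a n w", OF even_numeral] unfolding Ss real_norm_def by linarith
      then show "AE w in M. norm (S a n w ^ 4) \<le> norm (real CARD('m) ^ 3 * (\<Sum>b\<in>UNIV. s a b n w ^ 4))" by simp
    qed
    have "expectation (\<lambda>w. S a n w ^ 4) \<le> expectation (\<lambda>w. real CARD('m) ^ 3 * (\<Sum>b\<in>UNIV. s a b n w ^ 4))"
      by (rule integral_mono[OF 1 i]) (simp add: Ss pw)
    also have "\<dots> = real CARD('m) ^ 3 * (\<Sum>b\<in>UNIV. expectation (\<lambda>w. s a b n w ^ 4))"
      using s(2)[OF that] by (simp add: Bochner_Integration.integral_sum)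
    also have "\<dots> \<le> real CARD('m) ^ 3 * (\<Sum>b\<in>(UNIV::'m set). 3 * K ^ 4 * (d * real (n - m\<^sub>0))\<^sup>2)"
      using s(3)[OF that] by (intro mult_left_mono sum_mono) auto
    also have "\<dots> = 3 * real CARD('m) ^ 4 * K ^ 4 * (d * real (n - m\<^sub>0))\<^sup>2"
      by (simp add: eval_nat_numeral)
    finally show "expectation (\<lambda>w. S a n w ^ 4) \<le> \<dots>" .
  qed
  have I: "integrable M (\<lambda>w. S a n w ^ k)" if "m\<^sub>0 \<le> n" "n \<le> m" "k \<le> 4" for a n k
    using integrable_power_le S4 SM that by auto
  have main: "expectation (\<lambda>w. \<xi> w * S a n w) = 0 \<and> expectation (\<lambda>w. \<xi> w * (S a n w * S c n w)) =
      (\<Sum>j=m\<^sub>0..<n. \<Sum>b\<in>UNIV. d * expectation (\<lambda>w. \<xi> w * (W j w $ a $ b * W j w $ c $ b)))"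
    if "m\<^sub>0 \<le> n" "n \<le> m" for n
    using that
  proof (induction n rule: dec_induct)
    case base then show ?case by (simp add: S_def)
  next
    case (step n)
    have n: "m\<^sub>0 \<le> n" "n \<le> m" "n < m" using step by auto
    define y where "y = (\<lambda>a w. \<Sum>b\<in>UNIV. W n w $ a $ b * dB b n w)"
    have Suc: "S a (Suc n) w = S a n w + y a w" for a w using step.hyps by (simp add: S_def y_def)
    have \<xi>n: "\<xi> \<in> borel_measurable (F (real n * d))"
      using measurable_F_mono[OF \<xi>(1)] d n by (simp add: mult_right_mono)
    have Wn: "(\<lambda>w. W n w $ a $ b) \<in> borel_measurable (F (real n * d))" for a b
      using W[OF n(1,3)] by measurable
    have \<xi>M: "\<xi> \<in> borel_measurable M" using measurable_F_M[OF \<xi>n] d by simp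
    have WM: "(\<lambda>w. W n w $ a $ b) \<in> borel_measurable M" for a b using measurable_F_M[OF Wn] d by simp
    have \<xi>W: "\<bar>\<xi> w * W n w $ a $ b\<bar> \<le> C * K" if "w \<in> space M" for w a b
      unfolding abs_mult using \<xi>(2)[OF that] K[OF n(1,3) that] abs_ge_zero order_trans by (intro mult_mono) blast+
    have i0: "integrable M (\<lambda>w. \<xi> w * W n w $ a $ b)" for a b
      by (rule integrable_bounded[OF _ \<xi>W]) (use \<xi>M WM in auto)
    have i1: "integrable M (\<lambda>w. S a n w * (\<xi> w * W n w $ c $ b))" for a c b
      by (rule integrable_mult_bounded[OF _ _ \<xi>W]) (use I[OF n(1,2), of 1] \<xi>M WM in auto)
    have i2: "integrable M (\<lambda>w. \<xi> w * W n w $ a $ b * W n w $ c $ b')" for a c b b'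
      by (rule integrable_mult_bounded[OF i0 _ K]) (use WM n in auto)
    have m0: "(\<lambda>w. \<xi> w * W n w $ a $ b) \<in> borel_measurable (F (real n * d))" for a b
      using Wn \<xi>n by measurable
    have m1: "(\<lambda>w. S a n w * (\<xi> w * W n w $ c $ b)) \<in> borel_measurable (F (real n * d))" for a c b
      using m0 Sm[OF n(1,2)] by measurable
    have m2: "(\<lambda>w. \<xi> w * W n w $ a $ b * W n w $ c $ b') \<in> borel_measurable (F (real n * d))" for a c b b'
      using m0 Wn by measurable
    note A0 = weighted_dB_power[OF m0 i0, of _ _ _ 1, simplified dB_moments(1) power_one_right mult_zero_right]
    note A1 = weighted_dB_power[OF m1 i1, of _ _ _ _ 1, simplified dB_moments(1) power_one_right mult_zero_right]
    note A2 = weighted_dB_product[OF m2 i2]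
    have e1: "\<xi> w * y a w = (\<Sum>b\<in>UNIV. \<xi> w * W n w $ a $ b * dB b n w)" for a w
      unfolding y_def by (simp add: sum_distrib_left mult.assoc)
    have e2: "\<xi> w * (S a n w * y c w) = (\<Sum>b\<in>UNIV. S a n w * (\<xi> w * W n w $ c $ b) * dB b n w)" for a c w
      unfolding y_def by (simp add: sum_distrib_left mult_ac)
    have e3: "\<xi> w * (y a w * y c w) =
        (\<Sum>b\<in>UNIV. \<Sum>b'\<in>UNIV. \<xi> w * W n w $ a $ b * W n w $ c $ b' * (dB b n w * dB b' n w))" for w
      unfolding y_def sum_product unfolding sum_distrib_left by (intro sum.cong refl) (simp add: mult_ac)
    have E1: "integrable M (\<lambda>w. \<xi> w * y a w)" "expectation (\<lambda>w. \<xi> w * y a w) = 0"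
      unfolding e1 using A0 by (auto simp: Bochner_Integration.integral_sum)
    have E2: "integrable M (\<lambda>w. \<xi> w * (S a n w * y c w))" "expectation (\<lambda>w. \<xi> w * (S a n w * y c w)) = 0" for a c
      unfolding e2 using A1 by (auto simp: Bochner_Integration.integral_sum)
    have E3i: "integrable M (\<lambda>w. \<xi> w * (y a w * y c w))"
      unfolding e3 by (intro Bochner_Integration.integrable_sum A2(1))
    have "expectation (\<lambda>w. \<xi> w * (y a w * y c w)) =
        (\<Sum>b\<in>UNIV. \<Sum>b'\<in>UNIV. expectation (\<lambda>w. \<xi> w * W n w $ a $ b * W n w $ c $ b') * (if b = b' then d else 0))"
      unfolding e3
      by (subst Bochner_Integration.integral_sum, intro Bochner_Integration.integrable_sum A2(1),
        subst Bochner_Integration.integral_sum, intro A2(1), simp only: A2(2))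
    also have "\<dots> = (\<Sum>b\<in>UNIV. d * expectation (\<lambda>w. \<xi> w * (W n w $ a $ b * W n w $ c $ b)))"
      by (simp add: if_distrib sum.delta mult.assoc mult.commute[of _ d] cong: if_cong)
    finally have E3: "expectation (\<lambda>w. \<xi> w * (y a w * y c w)) = \<dots>" .
    have \<xi>S: "integrable M (\<lambda>w. \<xi> w * S a n w)"
      using integrable_mult_bounded[OF _ \<xi>M \<xi>(2), of "S a n"] I[OF n(1,2), of 1] by (simp add: mult.commute)
    have SS: "integrable M (\<lambda>w. S a n w * S c n w)"
    proof (rule Bochner_Integration.integrable_bound)
      show "integrable M (\<lambda>w. S a n w ^ 2 + S c n w ^ 2)" using I[OF n(1,2), of 2] by auto
      show "(\<lambda>w. S a n w * S c n w) \<in> borel_measurable M" using SM[OF n(1,2)] by auto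
      have "\<bar>x * z\<bar> \<le> \<bar>x ^ 2 + z ^ 2\<bar>" for x z :: real
        using sum_squares_bound[of x z] sum_squares_bound[of x "-z"] by (auto simp: abs_if)
      then show "AE w in M. norm (S a n w * S c n w) \<le> norm (S a n w ^ 2 + S c n w ^ 2)" by simp
    qed
    have \<xi>SS: "integrable M (\<lambda>w. \<xi> w * (S a n w * S c n w))"
      using integrable_mult_bounded[OF SS \<xi>M \<xi>(2)] by (simp add: mult.commute)
    have "(\<lambda>w. \<xi> w * S a (Suc n) w) = (\<lambda>w. \<xi> w * S a n w + \<xi> w * y a w)"
      unfolding Suc by (simp add: algebra_simps)
    moreover have "(\<lambda>w. \<xi> w * (S a (Suc n) w * S c (Suc n) w)) = (\<lambda>w. (\<xi> w * (S a n w * S c n w) +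
        \<xi> w * (S a n w * y c w)) + (\<xi> w * (S c n w * y a w) + \<xi> w * (y a w * y c w)))"
      unfolding Suc by (simp add: algebra_simps)
    ultimately show ?case
      using step E1 E2 E3i E3 \<xi>S \<xi>SS by simp
  qed
  show "S a m \<in> borel_measurable (F (real m * d))" "integrable M (\<lambda>w. S a m w ^ 4)"
    "expectation (\<lambda>w. S a m w ^ 4) \<le> 3 * real CARD('m) ^ 4 * K ^ 4 * (d * real (m - m\<^sub>0))\<^sup>2"
    using Sm S4 \<open>m\<^sub>0 \<le> m\<close> by auto
  show "expectation (\<lambda>w. \<xi> w * S a m w) = 0" "expectation (\<lambda>w. \<xi> w * (S a m w * S c m w)) =
      (\<Sum>j=m\<^sub>0..<m. \<Sum>b\<in>UNIV. d * expectation (\<lambda>w. \<xi> w * (W j w $ a $ b * W j w $ c $ b)))"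
    using main \<open>m\<^sub>0 \<le> m\<close> by auto
qed

end

end

subsection \<open>Rounding to a grid\<close>

text \<open>By continuity the rational times in the interior decide, and there are countably many of
  them. An interval without interior is treated apart.\<close>

lemma sets_all_le_interval:
  fixes u :: "real \<Rightarrow> 'w \<Rightarrow> real"
  assumes c: "\<And>w. w \<in> space M \<Longrightarrow> continuous_on {a..b} (\<lambda>s. u s w)"
    and m: "\<And>s. s \<in> {a..b} \<Longrightarrow> u s \<in> borel_measurable M"
  shows "{w\<in>space M. \<forall>s\<in>{a..b}. u s w \<le> c} \<in> sets M"
proof (cases "a < b")
  case False
  then consider "{a..b} = {}" | "{a..b} = {a}" by fastforce
  then show ?thesis
  proof cases
    case 2
    have "u a \<in> borel_measurable M" using m[of a] unfolding 2 by simp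
    then have "{w\<in>space M. u a w \<le> c} \<in> sets M" by measurable
    then show ?thesis unfolding 2 by simp
  qed simp
next
  case True
  define Q where "Q = \<rat> \<inter> {a<..<b}"
  have Q: "countable Q" "Q \<subseteq> {a..b}" unfolding Q_def by (auto simp: countable_rat)
  have cl: "closure Q = {a..b}"
    unfolding Q_def using closure_open_Int_superset[of "{a<..<b}" \<rat>] Rats_closure_real True
    by (simp add: Int_commute)
  have "{w\<in>space M. \<forall>s\<in>{a..b}. u s w \<le> c} = {w\<in>space M. \<forall>s\<in>Q. u s w \<le> c}"
  proof (intro Collect_cong conj_cong refl iffI)
    fix w assume w: "w \<in> space M" and *: "\<forall>s\<in>Q. u s w \<le> c"
    show "\<forall>s\<in>{a..b}. u s w \<le> c"
      using continuous_le_on_closure[of Q "\<lambda>s. u s w"] c[OF w] * unfolding cl by blast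
  qed (use Q in auto)
  also have "\<dots> \<in> sets M"
  proof (rule sets.sets_Collect_countable_All'[OF _ Q(1)])
    fix s assume "s \<in> Q"
    then have "u s \<in> borel_measurable M" using Q m by blast
    then show "{w\<in>space M. u s w \<le> c} \<in> sets M" by measurable
  qed
  finally show ?thesis .
qed

text \<open>A continuous path attains its maximum on the compact interval, so a strict bound holds
  with a margin \<open>1 / (n + 1)\<close>, and the event is a countable union of events with a weak
  bound.\<close>

lemma sets_all_less_interval:
  fixes u :: "real \<Rightarrow> 'w \<Rightarrow> real"
  assumes c: "\<And>w. w \<in> space M \<Longrightarrow> continuous_on {a..b} (\<lambda>s. u s w)"
    and m: "\<And>s. s \<in> {a..b} \<Longrightarrow> u s \<in> borel_measurable M"
  shows "{w\<in>space M. \<forall>s\<in>{a..b}. u s w < c} \<in> sets M"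
proof -
  have "{w\<in>space M. \<forall>s\<in>{a..b}. u s w < c} =
      (\<Union>n::nat. {w\<in>space M. \<forall>s\<in>{a..b}. u s w \<le> c - inverse (real (Suc n))})" (is "?L = ?R")
  proof (intro equalityI subsetI)
    fix w assume "w \<in> ?L"
    then have w: "w \<in> space M" and *: "\<forall>s\<in>{a..b}. u s w < c" by auto
    show "w \<in> ?R"
    proof (cases "a \<le> b")
      case True
      obtain s0 where s0: "s0 \<in> {a..b}" "\<forall>s\<in>{a..b}. u s w \<le> u s0 w"
        using continuous_attains_sup[OF compact_Icc _ c[OF w]] True by force
      obtain n where "inverse (real (Suc n)) < c - u s0 w"
        using reals_Archimedean[of "c - u s0 w"] * s0 by auto
      then have "\<forall>s\<in>{a..b}. u s w \<le> c - inverse (real (Suc n))" using s0(2) by fastforce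
      then show ?thesis using w by blast
    qed (use w in auto)
  next
    fix w assume "w \<in> ?R"
    then obtain n where "w \<in> space M" "\<forall>s\<in>{a..b}. u s w \<le> c - inverse (real (Suc n))" by auto
    moreover have "inverse (real (Suc n)) > 0" by simp
    ultimately have "\<forall>s\<in>{a..b}. u s w < c" by (meson add_less_cancel_left diff_add_cancel diff_less_eq less_add_same_cancel1 order_le_less_trans)
    then show "w \<in> ?L" using \<open>w \<in> space M\<close> by blast
  qed
  also have "\<dots> \<in> sets M"
    using sets_all_le_interval[OF c m] by (intro sets.countable_nat_UN) blast
  finally show ?thesis .
qed

text \<open>\<open>\<sigma>\<close> is replaced by the grid time just below it, which takes
  countably many values; as the mesh \<open>1 / (n + 1)\<close> tends to zero, continuity of the
  paths gives the limit.\<close>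

lemma measurable_at_random_time:
  fixes u :: "real \<Rightarrow> 'w \<Rightarrow> 'b::metric_space"
  assumes c: "\<And>w. w \<in> space M \<Longrightarrow> continuous_on {0..} (\<lambda>s. u s w)"
    and m: "\<And>s. 0 \<le> s \<Longrightarrow> u s \<in> borel_measurable M"
    and \<sigma>: "\<sigma> \<in> borel_measurable M" "\<And>w. w \<in> space M \<Longrightarrow> 0 \<le> \<sigma> w"
  shows "(\<lambda>w. u (\<sigma> w) w) \<in> borel_measurable M"
proof (rule borel_measurable_LIMSEQ_metric)
  fix n :: nat
  have g: "(\<lambda>w. nat \<lfloor>real (Suc n) * \<sigma> w\<rfloor>) \<in> measurable M (count_space UNIV)"
    using \<sigma>(1) by measurable
  have "(\<lambda>w. u (real (nat \<lfloor>real (Suc n) * \<sigma> w\<rfloor>) / real (Suc n)) w) \<in> borel_measurable M"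
    by (rule measurable_compose_countable[where f="\<lambda>i. u (real i / real (Suc n))", OF m g]) auto
  then show "(\<lambda>w. u (real (nat \<lfloor>real (Suc n) * \<sigma> w\<rfloor>) / real (Suc n)) w) \<in> borel_measurable M" .
next
  fix w assume w: "w \<in> space M"
  let ?t = "\<lambda>n. real (nat \<lfloor>real (Suc n) * \<sigma> w\<rfloor>) / real (Suc n)"
  have "(\<lambda>n. ?t n - \<sigma> w) \<longlonglongrightarrow> 0"
  proof (rule Lim_null_comparison)
    show "\<forall>\<^sub>F n in sequentially. norm (?t n - \<sigma> w) \<le> inverse (real (Suc n))"
    proof (intro always_eventually allI)
      fix n
      have f: "real (nat \<lfloor>real (Suc n) * \<sigma> w\<rfloor>) = of_int \<lfloor>real (Suc n) * \<sigma> w\<rfloor>"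
        using \<sigma>(2)[OF w] by simp
      have "\<bar>of_int \<lfloor>real (Suc n) * \<sigma> w\<rfloor> - real (Suc n) * \<sigma> w\<bar> \<le> 1" by linarith
      moreover have "?t n - \<sigma> w = (of_int \<lfloor>real (Suc n) * \<sigma> w\<rfloor> - real (Suc n) * \<sigma> w) / real (Suc n)"
        unfolding f by (simp add: field_simps)
      ultimately show "norm (?t n - \<sigma> w) \<le> inverse (real (Suc n))"
        by (simp add: abs_divide divide_inverse abs_mult mult_left_le_one_le del: of_nat_Suc)
    qed
  qed (rule LIMSEQ_inverse_real_of_nat)
  then have t: "?t \<longlonglongrightarrow> \<sigma> w" by (rule LIM_zero_cancel)
  show "(\<lambda>n. u (?t n) w) \<longlonglongrightarrow> u (\<sigma> w) w"
    by (rule continuous_on_tendsto_compose[OF c[OF w] t]) (use \<sigma>(2)[OF w] in auto)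
qed

text \<open>Borel sets of the interval are the measurable sets of restricted Lebesgue measure, so
  after swapping the factors this is Tonelli's theorem.\<close>

lemma progressive_nn_integral_measurable:
  fixes H :: "real \<Rightarrow> 'w \<Rightarrow> ennreal"
  assumes "(\<lambda>(s, w). H s w) \<in> borel_measurable (restrict_space borel {a..b} \<Otimes>\<^sub>M M)"
  shows "(\<lambda>w. \<integral>\<^sup>+s\<in>{a..b}. H s w \<partial>lborel) \<in> borel_measurable M"
proof -
  interpret S: sigma_finite_measure "restrict_space lborel {a..b::real}"
    by (rule sigma_finite_measure_restrict_space) (auto intro: lborel.sigma_finite_measure_axioms)
  have "(\<lambda>(s, w). H s w) \<in> borel_measurable (restrict_space lborel {a..b} \<Otimes>\<^sub>M M)"
    using assms measurable_cong_sets[OF sets_pair_measure_cong[OF sets_restrict_space_cong[OF sets_lborel] refl] refl]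
    by blast
  then have "(\<lambda>(w, s). H s w) \<in> borel_measurable (M \<Otimes>\<^sub>M restrict_space lborel {a..b})"
    by (subst measurable_pair_swap_iff) (simp add: case_prod_beta')
  then have "(\<lambda>w. \<integral>\<^sup>+s. H s w \<partial>restrict_space lborel {a..b}) \<in> borel_measurable M"
    by (rule S.borel_measurable_nn_integral)
  then show ?thesis by (simp add: nn_integral_restrict_space)
qed

text \<open>For \<open>d > 0\<close> the value is \<open>W j\<close> on the cell from
  \<open>j * d\<close> (excluded) to \<open>(j + 1) * d\<close> (included), so a value fixed at the
  left end is used only afterwards. For \<open>s \<le> 0\<close> truncation to \<open>nat\<close>
  yields \<open>W 0\<close>.\<close>

definition step_process :: "real \<Rightarrow> (nat \<Rightarrow> 'w \<Rightarrow> 'b) \<Rightarrow> real \<Rightarrow> 'w \<Rightarrow> 'b" where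
  "step_process d W s w = W (nat (\<lceil>s / d\<rceil> - 1)) w"

lemma step_process_measurable:
  fixes W :: "nat \<Rightarrow> 'w \<Rightarrow> 'b::topological_space"
  assumes "\<And>j. W j \<in> borel_measurable M"
  shows "(\<lambda>(s, w). step_process d W s w) \<in> borel_measurable (restrict_space borel A \<Otimes>\<^sub>M M)"
proof -
  have "(\<lambda>x. W (nat (\<lceil>fst x / d\<rceil> - 1)) (snd x)) \<in> borel_measurable (restrict_space borel A \<Otimes>\<^sub>M M)"
  proof (rule measurable_compose_countable)
    show "(\<lambda>x. W i (snd x)) \<in> borel_measurable (restrict_space borel A \<Otimes>\<^sub>M M)" for i
      using assms by measurable
    have "(\<lambda>s::real. nat (\<lceil>s / d\<rceil> - 1)) \<in> measurable (restrict_space borel A) (count_space UNIV)"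
      by (intro measurable_restrict_space1) measurable
    then show "(\<lambda>x. nat (\<lceil>fst x / d\<rceil> - 1)) \<in> measurable (restrict_space borel A \<Otimes>\<^sub>M M) (count_space UNIV)"
      by (rule measurable_compose[OF measurable_fst])
  qed
  then show ?thesis by (simp add: step_process_def case_prod_beta')
qed

lemma step_process_cell:
  assumes "d > 0" "real j * d < s" "s \<le> real (Suc j) * d"
  shows "step_process d W s w = W j w"
proof -
  have "\<lceil>s / d\<rceil> = int j + 1"
    using assms by (intro ceiling_unique) (auto simp: field_simps)
  then show ?thesis by (simp add: step_process_def)
qed

text \<open>Dominated convergence for the indicators of the events.\<close>

lemma (in prob_space) prob_tendsto_0:
  assumes E: "\<And>n. E n \<in> events" and ev: "\<And>w. w \<in> space M \<Longrightarrow> \<forall>\<^sub>F n in sequentially. w \<notin> E n"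
  shows "(\<lambda>n. prob (E n)) \<longlonglongrightarrow> 0"
proof -
  have "(\<lambda>n. \<integral>w. indicator (E n) w \<partial>M) \<longlonglongrightarrow> (\<integral>w. (0::real) \<partial>M)"
  proof (rule integral_dominated_convergence[where w="\<lambda>_. 1"])
    show "AE w in M. (\<lambda>n. indicator (E n) w) \<longlonglongrightarrow> (0::real)"
    proof (rule AE_I2)
      fix w assume "w \<in> space M"
      from ev[OF this] show "(\<lambda>n. indicator (E n) w) \<longlonglongrightarrow> (0::real)"
        by (intro tendsto_eventually) (auto elim: eventually_mono)
    qed
  qed (use E in auto)
  then show ?thesis using E by simp
qed

lemma measurable_matrix_vector_mult [measurable (raw)]:
  fixes A :: "'a \<Rightarrow> real ^ 'm ^ 'd" and x :: "'a \<Rightarrow> real ^ 'm"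
  assumes [measurable]: "A \<in> borel_measurable M" "x \<in> borel_measurable M"
  shows "(\<lambda>w. A w *v x w) \<in> borel_measurable M"
proof (subst borel_measurable_euclidean_space, rule ballI)
  fix e :: "real ^ 'd" assume "e \<in> Basis"
  then obtain k where "e = axis k 1" by (auto simp: Basis_vec_def)
  then have "(\<lambda>w. (A w *v x w) \<bullet> e) = (\<lambda>w. \<Sum>b\<in>UNIV. A w $ k $ b * x w $ b)"
    by (simp add: inner_axis matrix_vector_mult_def)
  then show "(\<lambda>w. (A w *v x w) \<bullet> e) \<in> borel_measurable M" by simp
qed

lemma sum_matrix_vector_mult: "(\<Sum>i\<in>I. A i) *v (x :: 'a::real_normed_field ^ 'n) = (\<Sum>i\<in>I. A i *v x)"
  by (induction I rule: infinite_finite_induct) (simp_all add: matrix_vector_mult_add_rdistrib)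

text \<open>The partition points of a simple process are rounded up to multiples of
  \<open>d\<close>. Rounding up, not down, keeps the rounded integrand adapted: \<open>Z i\<close>
  is known at \<open>t i\<close>, hence at \<open>m i * d\<close>.\<close>

locale rounded_grid =
  fixes n :: nat and t :: "nat \<Rightarrow> real" and d :: real and m :: "nat \<Rightarrow> nat"
  assumes t0: "0 \<le> t 0" and tmono: "\<And>k. k < n \<Longrightarrow> t k \<le> t (Suc k)" and d: "0 < d"
    and m_def: "m = (\<lambda>i. nat \<lceil>t i / d\<rceil>)"
begin

lemma t_nonneg: "i \<le> n \<Longrightarrow> 0 \<le> t i"
proof (induction i)
  case (Suc i) then show ?case using tmono[of i] by auto
qed (rule t0)

lemma m_mono: "i < n \<Longrightarrow> m i \<le> m (Suc i)"
  using tmono[of i] d unfolding m_def by (intro nat_mono ceiling_mono divide_right_mono) auto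

lemma m_bounds: "i \<le> n \<Longrightarrow> t i \<le> real (m i) * d \<and> real (m i) * d < t i + d"
proof -
  assume "i \<le> n"
  then have r: "real (m i) = of_int \<lceil>t i / d\<rceil>" using t_nonneg d unfolding m_def by simp
  have "t i / d \<le> real (m i)" "real (m i) < t i / d + 1" unfolding r by linarith+
  then show ?thesis using d by (simp add: field_simps)
qed

definition rounded :: "(nat \<Rightarrow> 'w \<Rightarrow> 'b::real_vector) \<Rightarrow> nat \<Rightarrow> 'w \<Rightarrow> 'b" where
  "rounded Z j w = (\<Sum>i<n. if m i \<le> j \<and> j < m (Suc i) then Z i w else 0)"

text \<open>For \<open>s > 0\<close> the cell index of \<open>s\<close> is at least \<open>k\<close>
  exactly when \<open>k * d < s\<close>; this one equivalence translates both ends of every rounded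
  interval.\<close>

lemma step_process_rounded:
  assumes "0 < s"
  shows "step_process d (rounded Z) s w =
    (\<Sum>i<n. indicator {real (m i) * d<..real (m (Suc i)) * d} s *\<^sub>R Z i w)"
proof -
  have c: "\<lceil>s / d\<rceil> \<ge> 1" using assms d by simp
  have le: "k \<le> nat (\<lceil>s / d\<rceil> - 1) \<longleftrightarrow> real k * d < s" for k
  proof -
    have "k \<le> nat (\<lceil>s / d\<rceil> - 1) \<longleftrightarrow> int k < \<lceil>s / d\<rceil>" using c by linarith
    also have "\<dots> \<longleftrightarrow> real k < s / d" by (simp add: less_ceiling_iff)
    finally show ?thesis using d by (simp add: field_simps)
  qed
  show ?thesis unfolding step_process_def rounded_def
    by (intro sum.cong refl) (auto simp: le indicator_def not_le[symmetric])
qed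

text \<open>One more grid cell lengthens exactly the increments over those rounded partition
  intervals that contain it and leaves the others alone. The sum over cells therefore telescopes to
  one increment per partition interval, cut off at \<open>j\<close>.\<close>

lemma sum_rounded:
  fixes Z :: "nat \<Rightarrow> 'w \<Rightarrow> real ^ 'm ^ 'd" and b :: "nat \<Rightarrow> real ^ 'm"
  shows "(\<Sum>l<j. rounded Z l w *v (b (Suc l) - b l)) =
    (\<Sum>i<n. Z i w *v (b (min j (m (Suc i))) - b (min j (m i))))"
proof (induction j)
  case (Suc j)
  have "rounded Z j w *v (b (Suc j) - b j) =
    (\<Sum>i<n. (if m i \<le> j \<and> j < m (Suc i) then Z i w else 0) *v (b (Suc j) - b j))"
    unfolding rounded_def by (rule sum_matrix_vector_mult)
  then have "(\<Sum>l<Suc j. rounded Z l w *v (b (Suc l) - b l)) =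
    (\<Sum>i<n. Z i w *v (b (min j (m (Suc i))) - b (min j (m i))) +
       (if m i \<le> j \<and> j < m (Suc i) then Z i w else 0) *v (b (Suc j) - b j))"
    using Suc by (simp add: sum.distrib)
  also have "\<dots> = (\<Sum>i<n. Z i w *v (b (min (Suc j) (m (Suc i))) - b (min (Suc j) (m i))))"
  proof (rule sum.cong[OF refl])
    fix i assume "i \<in> {..<n}"
    then have "m i \<le> m (Suc i)" using m_mono by auto
    then consider "m i \<le> j" "j < m (Suc i)" | "m (Suc i) \<le> j" | "j < m i" by linarith
    then show "Z i w *v (b (min j (m (Suc i))) - b (min j (m i))) +
       (if m i \<le> j \<and> j < m (Suc i) then Z i w else 0) *v (b (Suc j) - b j) =
       Z i w *v (b (min (Suc j) (m (Suc i))) - b (min (Suc j) (m i)))"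
    proof cases
      case 1
      then have "min j (m (Suc i)) = j" "min j (m i) = m i" "min (Suc j) (m (Suc i)) = Suc j" "min (Suc j) (m i) = m i"
        by auto
      then show ?thesis using 1 by (simp flip: matrix_vector_right_distrib)
    next
      case 2
      then show ?thesis using \<open>m i \<le> m (Suc i)\<close> by (simp add: min_def)
    next
      case 3
      then show ?thesis using \<open>m i \<le> m (Suc i)\<close> by (simp add: min_def)
    qed
  qed
  finally show ?case .
qed simp

end

section \<open>Grid approximation of the Ito integral\<close>

context filtered_bm
begin

abbreviation grid_integral :: "real \<Rightarrow> (nat \<Rightarrow> 'w \<Rightarrow> real ^ 'm ^ 'd) \<Rightarrow> nat \<Rightarrow> 'w \<Rightarrow> real ^ 'd" where
  "grid_integral d W j w \<equiv> (\<Sum>l<j. W l w *v (B (real (Suc l) * d) w - B (real l * d) w))"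

lemma grid_integral_measurable:
  assumes "0 < d" "\<And>l. W l \<in> borel_measurable M"
  shows "grid_integral d W j \<in> borel_measurable M"
proof -
  have [measurable]: "B (real l * d) \<in> borel_measurable M" for l by (rule B_measurable) (use assms in auto)
  note assms(2)[measurable]
  show ?thesis by measurable
qed

end

lemma norm_diff_power2_le:
  fixes a b c :: "'b::real_normed_vector"
  shows "(norm (a - c))\<^sup>2 \<le> 2 * (norm (a - b))\<^sup>2 + 2 * (norm (b - c))\<^sup>2"
proof -
  have "(norm (a - c))\<^sup>2 \<le> (norm (a - b) + norm (b - c))\<^sup>2"
    using norm_triangle_ineq[of "a - b" "b - c"] by (intro power_mono) auto
  also have "\<dots> \<le> 2 * (norm (a - b))\<^sup>2 + 2 * (norm (b - c))\<^sup>2"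
    using zero_le_power2[of "norm (a - b) - norm (b - c)"] by (simp add: power2_eq_square algebra_simps)
  finally show ?thesis .
qed

lemma ennreal_two_mult_add:
  "0 \<le> x \<Longrightarrow> 0 \<le> y \<Longrightarrow> ennreal 2 * ennreal x + ennreal 2 * ennreal y = ennreal (2 * x + 2 * y)"
  by (simp only: ennreal_plus ennreal_mult mult_nonneg_nonneg zero_le_numeral)

context filtered_bm
begin

lemma simple_process_nonneg:
  assumes "simple_process M F n t Z" "k \<le> n"
  shows "0 \<le> t k"
  using assms(2)
proof (induction k)
  case (Suc k)
  then have "t k \<le> t (Suc k)" using assms(1) unfolding simple_process_def by auto
  then show ?case using Suc by simp
qed (use assms(1) in \<open>simp add: simple_process_def\<close>)

text \<open>The identity is measurable from \<open>M\<close> to the coarser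
  \<open>F T\<close>.\<close>

lemma progressive_measurable_M:
  fixes G :: "real \<Rightarrow> 'w \<Rightarrow> 'b::topological_space"
  assumes "progressive F G" "0 \<le> T"
  shows "(\<lambda>(s, w). G s w) \<in> borel_measurable (restrict_space borel {0..T} \<Otimes>\<^sub>M M)"
proof -
  have 1: "(\<lambda>(s, w). G s w) \<in> borel_measurable (restrict_space borel {0..T} \<Otimes>\<^sub>M F T)"
    using assms by (auto simp: progressive_def)
  have i: "(\<lambda>x. x) \<in> measurable M (F T)"
    using subalg[OF assms(2)] by (auto simp: subalgebra_def intro!: measurableI)
  have "(\<lambda>x. (fst x, snd x)) \<in> measurable (restrict_space borel {0..T} \<Otimes>\<^sub>M M) (restrict_space borel {0..T} \<Otimes>\<^sub>M F T)"
    by (intro measurable_Pair measurable_fst measurable_compose[OF measurable_snd i])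
  from measurable_compose[OF this 1] show ?thesis by (simp add: case_prod_beta')
qed

lemma progressive_section:
  fixes G :: "real \<Rightarrow> 'w \<Rightarrow> 'b::topological_space"
  assumes "progressive F G" "0 \<le> T" "w \<in> space M"
  shows "(\<lambda>s. G s w) \<in> borel_measurable (restrict_space borel {0..T})"
  using measurable_compose[OF measurable_Pair2'[OF assms(3)] progressive_measurable_M[OF assms(1,2)]] by simp

lemma simple_integral_continuous:
  assumes "simple_process M F n t Z" "w \<in> space M"
  shows "continuous_on {0..} (\<lambda>s. simple_integral B n t Z s w)"
proof -
  have t: "0 \<le> t 0" "\<And>k. k < n \<Longrightarrow> t k \<le> t (Suc k)"
    using assms(1) unfolding simple_process_def by auto
  note nn = simple_process_nonneg[OF assms(1)]
  have c: "continuous_on {0..} (\<lambda>s. B (min s (t k)) w)" if "k \<le> n" for k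
    by (rule continuous_on_compose2[OF B_continuous[OF assms(2)]])
      (use nn[OF that] in \<open>auto intro!: continuous_intros\<close>)
  show ?thesis unfolding simple_integral_def
    by (intro continuous_on_sum bounded_linear.continuous_on[OF matrix_vector_mul_bounded_linear] continuous_on_diff c) auto
qed

lemma simple_integral_measurable:
  assumes "simple_process M F n t Z" "0 \<le> s"
  shows "simple_integral B n t Z s \<in> borel_measurable M"
proof -
  have t: "0 \<le> t 0" "\<And>k. k < n \<Longrightarrow> t k \<le> t (Suc k)" "\<And>k. k < n \<Longrightarrow> Z k \<in> borel_measurable (F (t k))"
    using assms(1) unfolding simple_process_def by auto
  note nn = simple_process_nonneg[OF assms(1)]
  have "(\<lambda>w. Z k w *v (B (min s (t (Suc k))) w - B (min s (t k)) w)) \<in> borel_measurable M" if "k < n" for k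
  proof -
    have "B (min s (t k)) \<in> borel_measurable M" "B (min s (t (Suc k))) \<in> borel_measurable M" "Z k \<in> borel_measurable M"
      using nn[of k] nn[of "Suc k"] that \<open>0 \<le> s\<close> measurable_F_M[OF t(3)[OF that]] by (auto intro!: B_measurable)
    then show ?thesis by measurable
  qed
  then show ?thesis unfolding simple_integral_def[abs_def] by (intro borel_measurable_sum) auto
qed

lemma simple_value_measurable:
  fixes Z :: "nat \<Rightarrow> 'w \<Rightarrow> real ^ 'm ^ 'd"
  assumes "simple_process M F n t Z"
  shows "(\<lambda>(s, w). simple_value n t Z s w) \<in> borel_measurable (restrict_space borel A \<Otimes>\<^sub>M M)"
proof -
  have t: "0 \<le> t 0" "\<And>k. k < n \<Longrightarrow> t k \<le> t (Suc k)" "\<And>k. k < n \<Longrightarrow> Z k \<in> borel_measurable (F (t k))"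
    using assms(1) unfolding simple_process_def by auto
  note nn = simple_process_nonneg[OF assms(1)]
  have "(\<lambda>x. indicator {t i<..t (Suc i)} (fst x) *\<^sub>R Z i (snd x)) \<in> borel_measurable (restrict_space borel A \<Otimes>\<^sub>M M)"
    if "i < n" for i
  proof -
    have "fst \<in> restrict_space borel A \<Otimes>\<^sub>M M \<rightarrow>\<^sub>M borel"
      by (rule measurable_compose[OF measurable_fst]) (rule measurable_restrict_space1, simp)
    moreover have "Z i \<in> borel_measurable M" using measurable_F_M[OF t(3)[OF that]] nn[of i] that by simp
    ultimately show ?thesis by measurable
  qed
  then show ?thesis
    unfolding simple_value_def case_prod_beta' by (intro borel_measurable_sum) auto
qed

lemma grid_width_tendsto_0:
  fixes q :: "nat \<Rightarrow> nat"
  assumes N: "0 < N" and q: "\<And>k. k < q k"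
  shows "(\<lambda>k. 1 / real (N * q k)) \<longlonglongrightarrow> 0"
proof (rule Lim_null_comparison[OF _ LIMSEQ_inverse_real_of_nat])
  have "norm (1 / real (N * q k)) \<le> inverse (real (Suc k))" for k
  proof -
    have "Suc k \<le> 1 * q k" using q[of k] by simp
    also have "\<dots> \<le> N * q k" using N by (intro mult_right_mono) auto
    finally have "real (Suc k) \<le> real (N * q k)" by (rule of_nat_mono)
    then show ?thesis by (simp add: divide_inverse le_imp_inverse_le del: of_nat_Suc of_nat_mult)
  qed
  then show "\<forall>\<^sub>F k in sequentially. norm (1 / real (N * q k)) \<le> inverse (real (Suc k))" by simp
qed

text \<open>As \<open>q\<close> grows, the rounded integrand converges to the simple one at every
  positive time and stays bounded. The two integrals get close because only the times at which the
  Brownian path is read have moved, by less than the mesh. So both bad events have probability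
  tending to zero. The factor \<open>N\<close> in the mesh keeps multiples of \<open>1 / N\<close>
  on the grid, and \<open>q > k\<close> makes the mesh shrink when the lemma is used for every
  \<open>k\<close>.\<close>

lemma round_simple_process:
  fixes Z :: "nat \<Rightarrow> 'w \<Rightarrow> real ^ 'm ^ 'd"
  assumes sp: "simple_process M F n t Z" and N: "0 < (N::nat)" and \<epsilon>: "0 < \<epsilon>" and T: "0 \<le> T"
  obtains q W where "q > k" "\<And>j. W j \<in> borel_measurable (F (real j * (1 / real (N * q))))"
    "{w\<in>space M. (\<integral>\<^sup>+s\<in>{0..T}. ennreal ((norm (step_process (1 / real (N * q)) W s w - simple_value n t Z s w))\<^sup>2) \<partial>lborel) > ennreal \<epsilon>} \<in> events"
    "prob {w\<in>space M. (\<integral>\<^sup>+s\<in>{0..T}. ennreal ((norm (step_process (1 / real (N * q)) W s w - simple_value n t Z s w))\<^sup>2) \<partial>lborel) > ennreal \<epsilon>} < \<epsilon>"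
    "{w\<in>space M. \<exists>j. real j * (1 / real (N * q)) \<le> T \<and>
      norm (grid_integral (1 / real (N * q)) W j w - simple_integral B n t Z (real j * (1 / real (N * q))) w) > \<epsilon>} \<in> events"
    "prob {w\<in>space M. \<exists>j. real j * (1 / real (N * q)) \<le> T \<and>
      norm (grid_integral (1 / real (N * q)) W j w - simple_integral B n t Z (real j * (1 / real (N * q))) w) > \<epsilon>} < \<epsilon>"
proof -
  define d where "d q = 1 / real (N * Suc q)" for q
  define m where "m q i = nat \<lceil>t i / d q\<rceil>" for q i
  have d0: "0 < d q" for q using N by (simp add: d_def del: of_nat_Suc of_nat_mult)
  have dlim: "d \<longlonglongrightarrow> 0" unfolding d_def by (rule grid_width_tendsto_0[OF N]) simp
  have t: "0 \<le> t 0" "\<And>k. k < n \<Longrightarrow> t k \<le> t (Suc k)"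
    and Zm: "\<And>k. k < n \<Longrightarrow> Z k \<in> borel_measurable (F (t k))"
    and Zb: "\<And>k. k < n \<Longrightarrow> \<exists>C. \<forall>w\<in>space M. norm (Z k w) \<le> C"
    using sp unfolding simple_process_def by auto
  interpret r: rounded_grid n t "d q" "m q" for q
    by unfold_locales (use t d0 in \<open>auto simp: m_def\<close>)
  define W where "W q = r.rounded q Z" for q
  have W_meas: "W q j \<in> borel_measurable (F (real j * d q))" for q j
  proof -
    have "(\<lambda>w. if m q i \<le> j \<and> j < m q (Suc i) then Z i w else 0) \<in> borel_measurable (F (real j * d q))"
      if "i < n" for i
    proof (cases "m q i \<le> j")
      case True
      have "t i \<le> real (m q i) * d q" using r.m_bounds[of i q] that by auto
      also have "\<dots> \<le> real j * d q" using True d0[of q] by (intro mult_right_mono) auto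
      finally have "Z i \<in> borel_measurable (F (real j * d q))"
        using measurable_F_mono[OF Zm[OF that]] r.t_nonneg[of i] that by simp
      then show ?thesis by (cases "j < m q (Suc i)") auto
    qed simp
    then show ?thesis unfolding W_def r.rounded_def[abs_def] by (intro borel_measurable_sum) auto
  qed
  have WM: "W q j \<in> borel_measurable M" for q j
    using measurable_F_M[OF W_meas] d0[of q] by simp
  obtain C where C: "\<And>i w. i < n \<Longrightarrow> w \<in> space M \<Longrightarrow> norm (Z i w) \<le> C i" using Zb by metis
  \<comment> \<open>One bound for the simple integrand and for all its roundings; it provides the
    dominating constant.\<close>
  define K where "K = (\<Sum>i<n. C i)"
  have K: "norm (\<Sum>i<n. f i *\<^sub>R Z i w) \<le> K" if "w \<in> space M" "\<And>i. \<bar>f i\<bar> \<le> 1" for w f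
    unfolding K_def
  proof (rule order_trans[OF norm_sum sum_mono])
    fix i assume "i \<in> {..<n}"
    then show "norm (f i *\<^sub>R Z i w) \<le> C i"
      using C[of i w] that mult_mono[of "\<bar>f i\<bar>" 1 "norm (Z i w)" "C i"] by auto
  qed
  have Wb: "norm (W q j w) \<le> K" if "w \<in> space M" for q j w
  proof -
    have "W q j w = (\<Sum>i<n. (if m q i \<le> j \<and> j < m q (Suc i) then 1 else 0) *\<^sub>R Z i w)"
      unfolding W_def r.rounded_def by (intro sum.cong) auto
    then show ?thesis using K[OF that] by auto
  qed
  let ?sv = "simple_value n t Z"
  have svb: "norm (?sv s w) \<le> K" if "w \<in> space M" for s w
    unfolding simple_value_def by (rule K[OF that]) (auto simp: indicator_def)
  let ?E = "\<lambda>q. {w\<in>space M. (\<integral>\<^sup>+s\<in>{0..T}. ennreal ((norm (step_process (d q) (W q) s w - ?sv s w))\<^sup>2) \<partial>lborel) > ennreal \<epsilon>}"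
  let ?E' = "\<lambda>q. {w\<in>space M. \<exists>j. real j * d q \<le> T \<and>
      norm (grid_integral (d q) (W q) j w - simple_integral B n t Z (real j * d q) w) > \<epsilon>}"
  have spm: "(\<lambda>(s, w). step_process (d q) (W q) s w) \<in> borel_measurable (restrict_space borel {0..T} \<Otimes>\<^sub>M M)" for q
    by (rule step_process_measurable[OF WM])
  have svm: "(\<lambda>(s, w). ?sv s w) \<in> borel_measurable (restrict_space borel {0..T} \<Otimes>\<^sub>M M)"
    by (rule simple_value_measurable[OF sp])
  have Iv: "(\<lambda>w. \<integral>\<^sup>+s\<in>{0..T}. ennreal ((norm (step_process (d q) (W q) s w - ?sv s w))\<^sup>2) \<partial>lborel) \<in> borel_measurable M" for q
    by (rule progressive_nn_integral_measurable) (use spm[of q] svm in measurable)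
  have E_ev: "?E q \<in> events" for q using Iv[of q] by measurable
  have gm: "grid_integral (d q) (W q) j \<in> borel_measurable M" for q j
    by (rule grid_integral_measurable[OF d0 WM])
  have "{w\<in>space M. real j * d q \<le> T \<and>
      norm (grid_integral (d q) (W q) j w - simple_integral B n t Z (real j * d q) w) > \<epsilon>} \<in> events" for q j
  proof -
    have [measurable]: "simple_integral B n t Z (real j * d q) \<in> borel_measurable M"
      using d0[of q] by (intro simple_integral_measurable[OF sp]) auto
    note gm[measurable]
    show ?thesis by measurable
  qed
  then have E'_ev: "?E' q \<in> events" for q by (intro sets.sets_Collect_countable_Ex)
  have "\<forall>\<^sub>F q in sequentially. w \<notin> ?E q" if w: "w \<in> space M" for w
  proof -
    have "(\<lambda>q. \<integral>\<^sup>+s\<in>{0..T}. ennreal ((norm (step_process (d q) (W q) s w - ?sv s w))\<^sup>2) \<partial>lborel) \<longlonglongrightarrow> (\<integral>\<^sup>+(s::real). 0 \<partial>lborel)"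
    proof (rule nn_integral_dominated_convergence[where w="\<lambda>s. ennreal ((2 * K)\<^sup>2) * indicator {0..T} s"])
      have 1: "(\<lambda>s. step_process (d q) (W q) s w) \<in> borel_measurable borel" for q
        unfolding step_process_def by measurable
      have 2: "(\<lambda>s. ?sv s w) \<in> borel_measurable borel"
        unfolding simple_value_def by measurable
      show "(\<lambda>s. ennreal ((norm (step_process (d q) (W q) s w - ?sv s w))\<^sup>2) * indicator {0..T} s) \<in> borel_measurable lborel" for q
        using 1 2 by measurable
      show "(\<integral>\<^sup>+s. ennreal ((2 * K)\<^sup>2) * indicator {0..T} s \<partial>lborel) < \<infinity>"
        using T by (simp add: nn_integral_cmult_indicator ennreal_mult_less_top)
      show "AE s in lborel. ennreal ((norm (step_process (d q) (W q) s w - ?sv s w))\<^sup>2) * indicator {0..T} s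
          \<le> ennreal ((2 * K)\<^sup>2) * indicator {0..T} s" for q
      proof (intro AE_I2 mult_right_mono ennreal_leI power_mono)
        fix s
        have "norm (step_process (d q) (W q) s w) \<le> K" unfolding step_process_def by (rule Wb[OF w])
        then show "norm (step_process (d q) (W q) s w - ?sv s w) \<le> 2 * K"
          using svb[OF w, of s] norm_triangle_ineq4[of "step_process (d q) (W q) s w" "?sv s w"] by linarith
      qed auto
      \<comment> \<open>Time 0 is excepted: there \<open>step_process\<close> takes the value
        \<open>W 0\<close>, while the simple integrand is zero.\<close>
      show "AE s in lborel. (\<lambda>q. ennreal ((norm (step_process (d q) (W q) s w - ?sv s w))\<^sup>2) * indicator {0..T} s) \<longlonglongrightarrow> 0"
        using AE_lborel_singleton[of 0]
      proof eventually_elim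
        case (elim s)
        show ?case
        proof (cases "0 < s")
          case True
          \<comment> \<open>A rounded point never lies to the left of \<open>t i\<close> and comes
            arbitrarily close to it, so each half-line indicator at \<open>s\<close> eventually
            equals its limit.\<close>
          have ev: "\<forall>\<^sub>F q in sequentially. indicator {real (m q i) * d q<..} s = (indicator {t i<..} s :: real)" if "i \<le> n" for i
          proof (cases "t i < s")
            case True
            then have "\<forall>\<^sub>F q in sequentially. d q < s - t i" using order_tendstoD(2)[OF dlim, of "s - t i"] by simp
            then show ?thesis
            proof eventually_elim
              case (elim q)
              then have "real (m q i) * d q < s" using r.m_bounds[OF that, of q] by linarith
              then show ?case using True by (simp add: indicator_def)
            qed
          next
            case False
            then have "\<not> real (m q i) * d q < s" for q using r.m_bounds[OF that, of q] by auto
            then show ?thesis using False by (auto simp: indicator_def)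
          qed
          have ind: "indicator {a<..b} s = indicator {a<..} s * (1 - indicator {b<..} s :: real)" for a b
            by (auto simp: indicator_def)
          have "\<forall>\<^sub>F q in sequentially. \<forall>i\<in>{..n}. indicator {real (m q i) * d q<..} s = (indicator {t i<..} s :: real)"
            by (rule eventually_ball_finite) (use ev in auto)
          then have "\<forall>\<^sub>F q in sequentially. ennreal ((norm (step_process (d q) (W q) s w - ?sv s w))\<^sup>2) * indicator {0..T} s = 0"
            by eventually_elim (simp add: W_def r.step_process_rounded[OF True] simple_value_def ind)
          then show ?thesis by (rule tendsto_eventually)
        next
          case False
          then show ?thesis using elim by (simp add: indicator_def)
        qed
      qed
    qed auto
    then have "\<forall>\<^sub>F q in sequentially. (\<integral>\<^sup>+s\<in>{0..T}. ennreal ((norm (step_process (d q) (W q) s w - ?sv s w))\<^sup>2) \<partial>lborel) < ennreal \<epsilon>"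
      using \<epsilon> by (intro order_tendstoD(2)) auto
    then show ?thesis by eventually_elim auto
  qed
  then have P: "(\<lambda>q. prob (?E q)) \<longlonglongrightarrow> 0" by (intro prob_tendsto_0 E_ev)
  have "\<forall>\<^sub>F q in sequentially. w \<notin> ?E' q" if w: "w \<in> space M" for w
  proof -
    \<comment> \<open>Each partition interval contributes an error at either end, hence the factor
      2; dividing by \<open>Q + 1\<close> avoids a zero denominator.\<close>
    define Q where "Q = (\<Sum>i<n. onorm ((*v) (Z i w)) * 2)"
    have Q0: "0 \<le> Q" unfolding Q_def by (intro sum_nonneg mult_nonneg_nonneg onorm_pos_le matrix_vector_mul_bounded_linear) auto
    have "uniformly_continuous_on {0..T} (\<lambda>s. B s w)"
      by (intro compact_uniformly_continuous continuous_on_subset[OF B_continuous[OF w]]) auto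
    then obtain \<delta> where \<delta>: "\<delta> > 0" "\<And>u v. u \<in> {0..T} \<Longrightarrow> v \<in> {0..T} \<Longrightarrow> dist v u < \<delta> \<Longrightarrow> dist (B v w) (B u w) < \<epsilon> / (Q + 1)"
      using \<epsilon> Q0 unfolding uniformly_continuous_on_def by (metis add_nonneg_pos divide_pos_pos zero_less_one)
    have "\<forall>\<^sub>F q in sequentially. d q < \<delta>" using order_tendstoD(2)[OF dlim \<delta>(1)] .
    then show ?thesis
    proof eventually_elim
      case (elim q)
      have "norm (grid_integral (d q) (W q) j w - simple_integral B n t Z (real j * d q) w) \<le> \<epsilon>"
        if j: "real j * d q \<le> T" for j
      proof -
        have dB: "norm (B (real (min j (m q i)) * d q) w - B (min (real j * d q) (t i)) w) \<le> \<epsilon> / (Q + 1)" if "i \<le> n" for i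
        proof -
          have e: "real (min j (m q i)) * d q = min (real j * d q) (real (m q i) * d q)"
            using d0[of q] by (auto simp: min_def)
          have "dist (B (real (min j (m q i)) * d q) w) (B (min (real j * d q) (t i)) w) < \<epsilon> / (Q + 1)"
            unfolding e
          proof (rule \<delta>(2))
            have b: "t i \<le> real (m q i) * d q" "real (m q i) * d q < t i + d q" "0 \<le> t i" "0 \<le> real j * d q"
              using r.m_bounds[OF that, of q] r.t_nonneg[OF that] d0[of q] by auto
            then show "dist (min (real j * d q) (real (m q i) * d q)) (min (real j * d q) (t i)) < \<delta>"
              using elim unfolding dist_real_def by linarith
            show "min (real j * d q) (t i) \<in> {0..T}" "min (real j * d q) (real (m q i) * d q) \<in> {0..T}"
              using b j by auto
          qed
          then show ?thesis by (simp add: dist_norm)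
        qed
        have g: "grid_integral (d q) (W q) j w = (\<Sum>i<n. Z i w *v (B (real (min j (m q (Suc i))) * d q) w - B (real (min j (m q i)) * d q) w))"
          unfolding W_def by (rule r.sum_rounded)
        have "norm (grid_integral (d q) (W q) j w - simple_integral B n t Z (real j * d q) w) =
          norm (\<Sum>i<n. Z i w *v ((B (real (min j (m q (Suc i))) * d q) w - B (min (real j * d q) (t (Suc i))) w) -
            (B (real (min j (m q i)) * d q) w - B (min (real j * d q) (t i)) w)))" (is "_ = norm (\<Sum>i<n. Z i w *v (?u i - ?v i))")
          unfolding g simple_integral_def sum_subtractf[symmetric] matrix_vector_mult_diff_distrib[symmetric]
          by (simp add: algebra_simps)
        also have "\<dots> \<le> (\<Sum>i<n. onorm ((*v) (Z i w)) * (2 * (\<epsilon> / (Q + 1))))"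
        proof (rule order_trans[OF norm_sum sum_mono])
          fix i assume "i \<in> {..<n}"
          then have "norm (?u i - ?v i) \<le> 2 * (\<epsilon> / (Q + 1))"
            using dB[of i] dB[of "Suc i"] norm_triangle_ineq4[of "?u i" "?v i"] by auto
          then show "norm (Z i w *v (?u i - ?v i)) \<le> onorm ((*v) (Z i w)) * (2 * (\<epsilon> / (Q + 1)))"
            by (intro order_trans[OF onorm[OF matrix_vector_mul_bounded_linear]] mult_left_mono onorm_pos_le matrix_vector_mul_bounded_linear)
        qed
        also have "\<dots> = (\<Sum>i<n. onorm ((*v) (Z i w)) * 2) * (\<epsilon> / (Q + 1))"
          unfolding sum_distrib_right by (simp only: mult.assoc)
        also have "\<dots> = Q * (\<epsilon> / (Q + 1))" unfolding Q_def ..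
        also have "\<dots> \<le> \<epsilon>" using Q0 \<epsilon> by (simp add: field_simps)
        finally show ?thesis .
      qed
      then show ?case by fastforce
    qed
  qed
  then have P': "(\<lambda>q. prob (?E' q)) \<longlonglongrightarrow> 0" by (intro prob_tendsto_0 E'_ev)
  have "\<forall>\<^sub>F q in sequentially. prob (?E q) < \<epsilon> \<and> prob (?E' q) < \<epsilon> \<and> q > k"
    using order_tendstoD(2)[OF P \<epsilon>] order_tendstoD(2)[OF P' \<epsilon>] eventually_gt_at_top[of k] by eventually_elim auto
  then obtain q where q: "prob (?E q) < \<epsilon>" "prob (?E' q) < \<epsilon>" "q > k"
    by (auto dest: eventually_happens)
  show thesis
    by (rule that[of "Suc q" "W q", folded d_def, OF _ W_meas E_ev q(1) E'_ev q(2)]) (use q(3) in simp)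
qed

text \<open>Convergence in probability becomes almost sure: the \<open>k\<close>-th approximant is
  chosen so that its bad set is covered by an event of probability at most
  \<open>4 * (1 / 2)^k\<close>, and Borel-Cantelli leaves only finitely many failures. Uniform
  closeness to \<open>J\<close> at grid points is enough, since \<open>J\<close> is
  continuous.\<close>

lemma ito_grid_approximation:
  fixes G :: "real \<Rightarrow> 'w \<Rightarrow> real ^ 'm ^ 'd"
  assumes ito: "ito_integral M F B G J" and N: "0 < (N::nat)" and T: "0 \<le> T"
  obtains q W where "\<And>k. q k > k" "\<And>k j. W k j \<in> borel_measurable (F (real j * (1 / real (N * q k))))"
    "AE w in M. (\<lambda>k. \<integral>\<^sup>+s\<in>{0..T}. ennreal ((norm (step_process (1 / real (N * q k)) (W k) s w - G s w))\<^sup>2) \<partial>lborel) \<longlonglongrightarrow> 0"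
    "AE w in M. \<forall>\<epsilon>>0. \<forall>\<^sub>F k in sequentially. \<forall>j. real j * (1 / real (N * q k)) \<le> T \<longrightarrow>
       norm (grid_integral (1 / real (N * q k)) (W k) j w - J (real j * (1 / real (N * q k))) w) \<le> \<epsilon>"
proof -
  have prog: "progressive F G" and Jm: "\<And>t. 0 \<le> t \<Longrightarrow> J t \<in> borel_measurable (F t)"
    and Jc: "\<And>w. w \<in> space M \<Longrightarrow> continuous_on {0..} (\<lambda>t. J t w)"
    using ito unfolding ito_integral_def by auto
  obtain n t Z where sp: "\<And>k. simple_process M F (n k) (t k) (Z k :: nat \<Rightarrow> 'w \<Rightarrow> real ^ 'm ^ 'd)"
    and c: "\<And>T \<epsilon>. T \<ge> 0 \<Longrightarrow> \<epsilon> > 0 \<Longrightarrow>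
           (\<lambda>k. \<P>(w in M. (\<integral>\<^sup>+s\<in>{0..T}.
                    ennreal ((norm (simple_value (n k) (t k) (Z k) s w - G s w))\<^sup>2) \<partial>lborel)
                  > ennreal \<epsilon>)) \<longlonglongrightarrow> 0 \<and>
           (\<lambda>k. \<P>(w in M. \<exists>s\<in>{0..T}.
                    norm (simple_integral B (n k) (t k) (Z k) s w - J s w) > \<epsilon>)) \<longlonglongrightarrow> 0"
    using ito unfolding ito_integral_def by blast
  define e where "e k = (1 / 2 :: real) ^ k" for k
  have e: "0 < e k" for k by (simp add: e_def)
  have elim0: "e \<longlonglongrightarrow> 0" unfolding e_def by (rule LIMSEQ_power_zero) simp
  \<comment> \<open>The errors of size \<open>e k\<close> of the simple process and of its rounding
    are combined: for squared norms this gives \<open>2 * e k + 2 * e k\<close>, for the integrals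
    \<open>e k + e k\<close>.\<close>
  define bad where "bad k d W = {w\<in>space M.
      (\<integral>\<^sup>+s\<in>{0..T}. ennreal ((norm (step_process d W s w - G s w))\<^sup>2) \<partial>lborel) > ennreal (4 * e k) \<or>
      (\<exists>j. real j * d \<le> T \<and> norm (grid_integral d W j w - J (real j * d) w) > 2 * e k)}"
    for k d and W :: "nat \<Rightarrow> 'w \<Rightarrow> real ^ 'm ^ 'd"
  have step: "\<exists>q W. q > k \<and> (\<forall>j. W j \<in> borel_measurable (F (real j * (1 / real (N * q))))) \<and>
      (\<exists>A\<in>events. bad k (1 / real (N * q)) W \<subseteq> A \<and> prob A \<le> 4 * e k)" for k
  proof -
    define A1 where "A1 i = {w\<in>space M. (\<integral>\<^sup>+s\<in>{0..T}.
        ennreal ((norm (simple_value (n i) (t i) (Z i) s w - G s w))\<^sup>2) \<partial>lborel) > ennreal (e k)}" for i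
    define A2 where "A2 i = {w\<in>space M. \<exists>s\<in>{0..T}.
        norm (simple_integral B (n i) (t i) (Z i) s w - J s w) > e k}" for i
    have "\<forall>\<^sub>F i in sequentially. prob (A1 i) < e k \<and> prob (A2 i) < e k"
      using c[OF T e[of k]] e[of k] unfolding A1_def A2_def by (auto intro!: eventually_conj elim: order_tendstoD(2))
    then obtain i where i: "prob (A1 i) < e k" "prob (A2 i) < e k" by (auto dest: eventually_happens)
    have svm: "(\<lambda>(s, w). simple_value (n i) (t i) (Z i) s w) \<in> borel_measurable (restrict_space borel {0..T} \<Otimes>\<^sub>M M)"
      by (rule simple_value_measurable[OF sp])
    have gm: "(\<lambda>(s, w). G s w) \<in> borel_measurable (restrict_space borel {0..T} \<Otimes>\<^sub>M M)"
      by (rule progressive_measurable_M[OF prog T])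
    have "(\<lambda>w. \<integral>\<^sup>+s\<in>{0..T}. ennreal ((norm (simple_value (n i) (t i) (Z i) s w - G s w))\<^sup>2) \<partial>lborel) \<in> borel_measurable M"
      by (rule progressive_nn_integral_measurable) (use svm gm in measurable)
    then have A1: "A1 i \<in> events" unfolding A1_def by measurable
    have "{w\<in>space M. \<forall>s\<in>{0..T}. norm (simple_integral B (n i) (t i) (Z i) s w - J s w) \<le> e k} \<in> events"
    proof (rule sets_all_le_interval)
      fix w assume w: "w \<in> space M"
      show "continuous_on {0..T} (\<lambda>s. norm (simple_integral B (n i) (t i) (Z i) s w - J s w))"
        by (intro continuous_on_norm continuous_on_diff
            continuous_on_subset[OF simple_integral_continuous[OF sp w]] continuous_on_subset[OF Jc[OF w]]) auto
    next
      fix s assume "s \<in> {0..T}"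
      then have "simple_integral B (n i) (t i) (Z i) s \<in> borel_measurable M" "J s \<in> borel_measurable M"
        using simple_integral_measurable[OF sp] measurable_F_M[OF Jm] by auto
      then show "(\<lambda>w. norm (simple_integral B (n i) (t i) (Z i) s w - J s w)) \<in> borel_measurable M" by measurable
    qed
    moreover have "A2 i = space M - {w\<in>space M. \<forall>s\<in>{0..T}. norm (simple_integral B (n i) (t i) (Z i) s w - J s w) \<le> e k}"
      unfolding A2_def by (auto simp: not_le)
    ultimately have A2: "A2 i \<in> events" by auto
    define E1 where "E1 d W = {w\<in>space M. (\<integral>\<^sup>+s\<in>{0..T}.
        ennreal ((norm (step_process d W s w - simple_value (n i) (t i) (Z i) s w))\<^sup>2) \<partial>lborel) > ennreal (e k)}" for d W
    define E2 where "E2 d W = {w\<in>space M. \<exists>j. real j * d \<le> T \<and>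
        norm (grid_integral d W j w - simple_integral B (n i) (t i) (Z i) (real j * d) w) > e k}" for d W
    obtain q W where q: "q > k" "\<And>j. W j \<in> borel_measurable (F (real j * (1 / real (N * q))))"
        and EE: "E1 (1 / real (N * q)) W \<in> events" "prob (E1 (1 / real (N * q)) W) < e k"
        "E2 (1 / real (N * q)) W \<in> events" "prob (E2 (1 / real (N * q)) W) < e k"
    proof (rule round_simple_process[OF sp[of i] N e[of k] T, of k])
    qed (rule that; unfold E1_def E2_def; assumption)
    define d where "d = 1 / real (N * q)"
    note E = EE[folded d_def]
    \<comment> \<open>It suffices to cover \<open>bad\<close> by an event. \<open>A1\<close> and
      \<open>A2\<close> hold the error of the simple process, \<open>E1\<close> and
      \<open>E2\<close> that of rounding it.\<close>
    have "bad k d W \<subseteq> (A1 i \<union> A2 i) \<union> (E1 d W \<union> E2 d W)"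
    proof
      fix w assume b: "w \<in> bad k d W"
      then have w: "w \<in> space M" by (auto simp: bad_def)
      show "w \<in> (A1 i \<union> A2 i) \<union> (E1 d W \<union> E2 d W)"
      proof (rule ccontr)
        assume "w \<notin> (A1 i \<union> A2 i) \<union> (E1 d W \<union> E2 d W)"
        then have n1: "(\<integral>\<^sup>+s\<in>{0..T}. ennreal ((norm (simple_value (n i) (t i) (Z i) s w - G s w))\<^sup>2) \<partial>lborel) \<le> ennreal (e k)"
          and n2: "\<And>s. s \<in> {0..T} \<Longrightarrow> norm (simple_integral B (n i) (t i) (Z i) s w - J s w) \<le> e k"
          and n3: "(\<integral>\<^sup>+s\<in>{0..T}. ennreal ((norm (step_process d W s w - simple_value (n i) (t i) (Z i) s w))\<^sup>2) \<partial>lborel) \<le> ennreal (e k)"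
          and n4: "\<And>j. real j * d \<le> T \<Longrightarrow> norm (grid_integral d W j w - simple_integral B (n i) (t i) (Z i) (real j * d) w) \<le> e k"
          using w unfolding A1_def A2_def E1_def E2_def by (auto simp: not_less)
        have "(\<integral>\<^sup>+s\<in>{0..T}. ennreal ((norm (step_process d W s w - G s w))\<^sup>2) \<partial>lborel) \<le>
          (\<integral>\<^sup>+s\<in>{0..T}. (ennreal 2 * ennreal ((norm (step_process d W s w - simple_value (n i) (t i) (Z i) s w))\<^sup>2) +
             ennreal 2 * ennreal ((norm (simple_value (n i) (t i) (Z i) s w - G s w))\<^sup>2)) \<partial>lborel)"
        proof (intro nn_integral_mono mult_right_mono)
          fix s
          show "ennreal ((norm (step_process d W s w - G s w))\<^sup>2) \<le>
            ennreal 2 * ennreal ((norm (step_process d W s w - simple_value (n i) (t i) (Z i) s w))\<^sup>2) +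
             ennreal 2 * ennreal ((norm (simple_value (n i) (t i) (Z i) s w - G s w))\<^sup>2)"
            by (subst ennreal_two_mult_add; (rule ennreal_leI norm_diff_power2_le zero_le_power2)+)
        qed auto
        also have "\<dots> = ennreal 2 * (\<integral>\<^sup>+s\<in>{0..T}. ennreal ((norm (step_process d W s w - simple_value (n i) (t i) (Z i) s w))\<^sup>2) \<partial>lborel) +
            ennreal 2 * (\<integral>\<^sup>+s\<in>{0..T}. ennreal ((norm (simple_value (n i) (t i) (Z i) s w - G s w))\<^sup>2) \<partial>lborel)"
        proof -
          have [measurable]: "(\<lambda>s. step_process d W s w) \<in> borel_measurable borel"
            unfolding step_process_def by measurable
          have [measurable]: "(\<lambda>s. simple_value (n i) (t i) (Z i) s w) \<in> borel_measurable borel"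
            unfolding simple_value_def by measurable
          have "(\<lambda>s. G s w) \<in> borel_measurable (restrict_space lborel {0..T})"
            using progressive_section[OF prog T w] measurable_cong_sets[OF sets_restrict_space_cong[OF sets_lborel] refl] by blast
          moreover have "(\<lambda>s. simple_value (n i) (t i) (Z i) s w) \<in> borel_measurable (restrict_space lborel {0..T})"
            by (rule measurable_restrict_space1) simp
          ultimately have "(\<lambda>s. ennreal ((norm (simple_value (n i) (t i) (Z i) s w - G s w))\<^sup>2)) \<in> borel_measurable (restrict_space lborel {0..T})"
            by measurable
          then have [measurable]: "(\<lambda>s. ennreal ((norm (simple_value (n i) (t i) (Z i) s w - G s w))\<^sup>2) * indicator {0..T} s) \<in> borel_measurable lborel"
            by (subst (asm) borel_measurable_restrict_space_iff_ennreal) auto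
          show ?thesis
            by (simp only: distrib_right mult.assoc) (subst nn_integral_add nn_integral_cmult, measurable)+
        qed
        also have "\<dots> \<le> ennreal 2 * ennreal (e k) + ennreal 2 * ennreal (e k)"
          using n1 n3 by (intro add_mono mult_left_mono) auto
        also have "\<dots> = ennreal (4 * e k)" using e[of k] by (subst ennreal_two_mult_add) (auto intro: arg_cong[where f=ennreal])
        finally have c1: "(\<integral>\<^sup>+s\<in>{0..T}. ennreal ((norm (step_process d W s w - G s w))\<^sup>2) \<partial>lborel) \<le> ennreal (4 * e k)" .
        have c2: "norm (grid_integral d W j w - J (real j * d) w) \<le> 2 * e k" if "real j * d \<le> T" for j
        proof -
          have "0 \<le> real j * d" by (simp add: d_def)
          then show ?thesis
            using n4[OF that] n2[of "real j * d"] that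
              norm_triangle_ineq[of "grid_integral d W j w - simple_integral B (n i) (t i) (Z i) (real j * d) w"
                "simple_integral B (n i) (t i) (Z i) (real j * d) w - J (real j * d) w"] by simp
        qed
        from b c1 c2 show False unfolding bad_def by fastforce
      qed
    qed
    moreover have "prob ((A1 i \<union> A2 i) \<union> (E1 d W \<union> E2 d W)) \<le> 4 * e k"
    proof -
      have "prob ((A1 i \<union> A2 i) \<union> (E1 d W \<union> E2 d W)) \<le> prob (A1 i \<union> A2 i) + prob (E1 d W \<union> E2 d W)"
        using A1 A2 E(1,3) by (intro measure_Un_le) auto
      also have "\<dots> \<le> (prob (A1 i) + prob (A2 i)) + (prob (E1 d W) + prob (E2 d W))"
        using A1 A2 E(1,3) by (intro add_mono measure_Un_le) auto
      finally show ?thesis using i E(2,4) by linarith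
    qed
    ultimately show ?thesis using q A1 A2 E(1,3) unfolding d_def by blast
  qed
  obtain q where "\<forall>k. \<exists>W. q k > k \<and> (\<forall>j. W j \<in> borel_measurable (F (real j * (1 / real (N * q k))))) \<and>
      (\<exists>A\<in>events. bad k (1 / real (N * q k)) W \<subseteq> A \<and> prob A \<le> 4 * e k)"
    using step by metis
  then obtain W where W: "\<And>k. q k > k" "\<And>k j. W k j \<in> borel_measurable (F (real j * (1 / real (N * q k))))"
      "\<forall>k. \<exists>A\<in>events. bad k (1 / real (N * q k)) (W k) \<subseteq> A \<and> prob A \<le> 4 * e k"
    by metis
  then obtain A where A: "\<And>k. A k \<in> events" "\<And>k. bad k (1 / real (N * q k)) (W k) \<subseteq> A k" "\<And>k. prob (A k) \<le> 4 * e k"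
    by metis
  have "summable (\<lambda>k. 4 * e k)" unfolding e_def by (intro summable_mult summable_geometric) simp
  then have "summable (\<lambda>k. prob (A k))" by (rule summable_comparison_test') (use A(3) in auto)
  then have ae: "AE w in M. \<forall>\<^sub>F k in sequentially. w \<in> space M - A k"
    using A(1) by (intro borel_cantelli_AE1) (auto simp: emeasure_eq_measure)
  show thesis
  proof (rule that[of q W])
    show "AE w in M. (\<lambda>k. \<integral>\<^sup>+s\<in>{0..T}. ennreal ((norm (step_process (1 / real (N * q k)) (W k) s w - G s w))\<^sup>2) \<partial>lborel) \<longlonglongrightarrow> 0"
      using ae
    proof eventually_elim
      case (elim w)
      have lim: "(\<lambda>k. ennreal (4 * e k)) \<longlonglongrightarrow> 0"
        using tendsto_ennrealI[OF tendsto_mult_right_zero[OF elim0, of 4]] by simp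
      have le: "\<forall>\<^sub>F k in sequentially. (\<integral>\<^sup>+s\<in>{0..T}. ennreal ((norm (step_process (1 / real (N * q k)) (W k) s w - G s w))\<^sup>2) \<partial>lborel) \<le> ennreal (4 * e k)"
        using elim
      proof eventually_elim
        case (elim k)
        then have "w \<notin> bad k (1 / real (N * q k)) (W k)" "w \<in> space M" using A(2)[of k] by blast+
        then show ?case unfolding bad_def by (simp only: mem_Collect_eq not_less de_Morgan_disj de_Morgan_conj simp_thms)
      qed
      show ?case by (rule tendsto_sandwich[OF _ le tendsto_const lim]) simp
    qed
    show "AE w in M. \<forall>\<epsilon>>0. \<forall>\<^sub>F k in sequentially. \<forall>j. real j * (1 / real (N * q k)) \<le> T \<longrightarrow>
       norm (grid_integral (1 / real (N * q k)) (W k) j w - J (real j * (1 / real (N * q k))) w) \<le> \<epsilon>"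
      using ae
    proof (eventually_elim, intro allI impI)
      fix w and \<epsilon> :: real assume ev: "\<forall>\<^sub>F k in sequentially. w \<in> space M - A k" and \<epsilon>: "0 < \<epsilon>"
      have "\<forall>\<^sub>F k in sequentially. e k < \<epsilon> / 2" using order_tendstoD(2)[OF elim0, of "\<epsilon> / 2"] \<epsilon> by simp
      with ev show "\<forall>\<^sub>F k in sequentially. \<forall>j. real j * (1 / real (N * q k)) \<le> T \<longrightarrow>
       norm (grid_integral (1 / real (N * q k)) (W k) j w - J (real j * (1 / real (N * q k))) w) \<le> \<epsilon>"
      proof (eventually_elim, intro allI impI)
        fix k j assume k: "w \<in> space M - A k" "e k < \<epsilon> / 2" and j: "real j * (1 / real (N * q k)) \<le> T"
        then have "w \<notin> bad k (1 / real (N * q k)) (W k)" "w \<in> space M" using A(2)[of k] by blast+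
        then have "norm (grid_integral (1 / real (N * q k)) (W k) j w - J (real j * (1 / real (N * q k))) w) \<le> 2 * e k"
          using j unfolding bad_def by (auto simp: not_less)
        then show "norm (grid_integral (1 / real (N * q k)) (W k) j w - J (real j * (1 / real (N * q k))) w) \<le> \<epsilon>"
          using k(2) by linarith
      qed
    qed
  qed (use W in auto)
qed

end

subsection \<open>The stopped Ito integral\<close>

context prob_space
begin

text \<open>Fatou's lemma passes the second moment to the limit. Bounded second moments make the
  sequence uniformly integrable, so almost sure convergence becomes convergence in mean, which a
  bounded weight preserves.\<close>

lemma expectation_tendsto_of_L2_bounded:
  fixes X :: "nat \<Rightarrow> 'a \<Rightarrow> real"
  assumes Xm: "\<And>k. X k \<in> borel_measurable M" and Ym: "Y \<in> borel_measurable M"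
    and lim: "AE w in M. (\<lambda>k. X k w) \<longlonglongrightarrow> Y w"
    and X2: "\<And>k. integrable M (\<lambda>w. (X k w)\<^sup>2)" "\<And>k. expectation (\<lambda>w. (X k w)\<^sup>2) \<le> C"
    and \<xi>m: "\<xi> \<in> borel_measurable M" and \<xi>b: "\<And>w. w \<in> space M \<Longrightarrow> \<bar>\<xi> w\<bar> \<le> A"
  shows "integrable M (\<lambda>w. (Y w)\<^sup>2)" "expectation (\<lambda>w. (Y w)\<^sup>2) \<le> C"
    "(\<lambda>k. expectation (\<lambda>w. \<xi> w * X k w)) \<longlonglongrightarrow> expectation (\<lambda>w. \<xi> w * Y w)"
proof -
  note [measurable] = Xm Ym \<xi>m
  have C0: "0 \<le> C" using X2(2)[of 0] by (meson Bochner_Integration.integral_nonneg order_trans zero_le_power2)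
  have A0: "0 \<le> A" using \<xi>b not_empty by (meson abs_ge_zero ex_in_conv order_trans)
  have "(\<integral>\<^sup>+w. ennreal ((Y w)\<^sup>2) \<partial>M) = (\<integral>\<^sup>+w. liminf (\<lambda>k. ennreal ((X k w)\<^sup>2)) \<partial>M)"
  proof (rule nn_integral_cong_AE)
    show "AE w in M. ennreal ((Y w)\<^sup>2) = liminf (\<lambda>k. ennreal ((X k w)\<^sup>2))"
      using lim
    proof eventually_elim
      case (elim w)
      then have "(\<lambda>k. ennreal ((X k w)\<^sup>2)) \<longlonglongrightarrow> ennreal ((Y w)\<^sup>2)" by (intro tendsto_ennrealI tendsto_power)
      then show ?case by (metis lim_imp_Liminf trivial_limit_sequentially)
    qed
  qed
  also have "\<dots> \<le> liminf (\<lambda>k. \<integral>\<^sup>+w. ennreal ((X k w)\<^sup>2) \<partial>M)"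
    by (rule nn_integral_liminf) measurable
  also have "\<dots> \<le> ennreal C"
  proof (rule Liminf_le)
    show "\<forall>\<^sub>F k in sequentially. (\<integral>\<^sup>+w. ennreal ((X k w)\<^sup>2) \<partial>M) \<le> ennreal C"
      using X2 by (intro always_eventually allI) (simp add: nn_integral_eq_integral ennreal_leI)
  qed simp
  finally have Y2: "(\<integral>\<^sup>+w. ennreal ((Y w)\<^sup>2) \<partial>M) \<le> ennreal C" .
  show iY: "integrable M (\<lambda>w. (Y w)\<^sup>2)"
    by (rule integrableI_bounded) (use Y2 in \<open>auto simp: le_less_trans\<close>)
  show EY: "expectation (\<lambda>w. (Y w)\<^sup>2) \<le> C"
    using Y2 iY C0 by (simp add: nn_integral_eq_integral)
  define D where "D k w = \<bar>X k w - Y w\<bar>" for k w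
  have D2: "(D k w)\<^sup>2 \<le> 2 * (X k w)\<^sup>2 + 2 * (Y w)\<^sup>2" for k w
    unfolding D_def using zero_le_power2[of "X k w + Y w"] by (simp add: power2_eq_square algebra_simps)
  have iD2: "integrable M (\<lambda>w. (D k w)\<^sup>2)" for k
    by (rule Bochner_Integration.integrable_bound[of _ "\<lambda>w. 2 * (X k w)\<^sup>2 + 2 * (Y w)\<^sup>2"])
      (use X2 iY D2 in \<open>auto simp: D_def[abs_def] intro!: order_trans[OF _ abs_ge_self]\<close>)
  have ED2: "expectation (\<lambda>w. (D k w)\<^sup>2) \<le> 4 * C" for k
  proof -
    have "expectation (\<lambda>w. (D k w)\<^sup>2) \<le> expectation (\<lambda>w. 2 * (X k w)\<^sup>2 + 2 * (Y w)\<^sup>2)"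
      by (intro integral_mono iD2 D2 Bochner_Integration.integrable_add integrable_mult_right X2 iY)
    also have "\<dots> = 2 * expectation (\<lambda>w. (X k w)\<^sup>2) + 2 * expectation (\<lambda>w. (Y w)\<^sup>2)" using X2 iY by simp
    finally show ?thesis using X2(2)[of k] EY by linarith
  qed
  have sq: "integrable M f" if "integrable M (\<lambda>w. (f w)\<^sup>2)" "f \<in> borel_measurable M" for f :: "'a \<Rightarrow> real"
    using square_integrable_imp_integrable[OF that(2,1)] .
  have Dmeas: "D k \<in> borel_measurable M" for k unfolding D_def[abs_def] by measurable
  have iD: "integrable M (D k)" for k by (rule sq[OF iD2 Dmeas])
  have ED: "(\<lambda>k. expectation (D k)) \<longlonglongrightarrow> 0"
  proof (rule LIMSEQ_I)
    fix \<epsilon> :: real assume \<epsilon>: "0 < \<epsilon>"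
    \<comment> \<open>\<open>4 * C\<close> bounds the second moment of \<open>D k\<close>, so
      cutting \<open>D k\<close> at \<open>R\<close> costs at most \<open>4 * C / R\<close>, which
      is at most \<open>\<epsilon> / 2\<close>.\<close>
    define R where "R = (8 * C + 1) / \<epsilon>"
    have R: "R > 0" using C0 \<epsilon> by (simp add: R_def)
    have RC: "4 * C / R \<le> \<epsilon> / 2" using C0 \<epsilon> by (simp add: R_def field_simps)
    have mr: "integrable M (\<lambda>w. min (D k w) R)" for k
      by (rule integrable_const_bound[of _ R]) (use R Dmeas in \<open>auto simp: D_def\<close>)
    have "(\<lambda>k. expectation (\<lambda>w. min (D k w) R)) \<longlonglongrightarrow> expectation (\<lambda>w. 0)"
    proof (rule integral_dominated_convergence[where w="\<lambda>_. R"])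
      show "AE w in M. (\<lambda>k. min (D k w) R) \<longlonglongrightarrow> 0"
        using lim
      proof eventually_elim
        case (elim w)
        then have "(\<lambda>k. D k w) \<longlonglongrightarrow> 0"
          unfolding D_def using LIM_zero tendsto_rabs_zero by blast
        then show ?case using tendsto_min[of "\<lambda>k. D k w" 0 sequentially "\<lambda>_. R" R] R by (simp add: min_def)
      qed
    qed (use R Dmeas in \<open>auto simp: D_def\<close>)
    then have "\<forall>\<^sub>F k in sequentially. expectation (\<lambda>w. min (D k w) R) < \<epsilon> / 2"
      using order_tendstoD(2)[of _ 0 sequentially "\<epsilon> / 2"] \<epsilon> by simp
    then obtain K where K: "\<And>k. k \<ge> K \<Longrightarrow> expectation (\<lambda>w. min (D k w) R) < \<epsilon> / 2"
      by (auto simp: eventually_sequentially)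
    have "norm (expectation (D k) - 0) < \<epsilon>" if "k \<ge> K" for k
    proof -
      have "D k w \<le> min (D k w) R + (D k w)\<^sup>2 / R" for w
      proof (cases "D k w \<le> R")
        case True then show ?thesis using R by simp
      next
        case False
        then have "D k w * R \<le> D k w * D k w" using R by (intro mult_left_mono) auto
        then have "D k w \<le> (D k w)\<^sup>2 / R" using R by (simp add: power2_eq_square field_simps)
        then show ?thesis using R False by simp
      qed
      then have "expectation (D k) \<le> expectation (\<lambda>w. min (D k w) R + (D k w)\<^sup>2 / R)"
        using mr iD2 by (intro integral_mono iD) auto
      also have "\<dots> = expectation (\<lambda>w. min (D k w) R) + expectation (\<lambda>w. (D k w)\<^sup>2) / R"
        using mr iD2 by simp
      also have "\<dots> \<le> expectation (\<lambda>w. min (D k w) R) + 4 * C / R"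
        using ED2 R by (simp add: divide_right_mono)
      also have "\<dots> < \<epsilon>" using K[OF that] RC by linarith
      finally show ?thesis using Bochner_Integration.integral_nonneg[of M "D k"] by (auto simp: D_def)
    qed
    then show "\<exists>no. \<forall>n\<ge>no. norm (expectation (D n) - 0) < \<epsilon>" by blast
  qed
  have iX: "integrable M (X k)" for k using sq X2(1) Xm by blast
  have iYY: "integrable M Y" using sq iY Ym by blast
  have i\<xi>: "integrable M (\<lambda>w. \<xi> w * f w)" if "integrable M f" for f
    by (rule Bochner_Integration.integrable_bound[OF integrable_mult_right[OF integrable_abs[OF that], of A]])
      (use \<xi>b A0 \<xi>m borel_measurable_integrable[OF that] in \<open>auto intro!: AE_I2 mult_right_mono simp: abs_mult\<close>)
  show "(\<lambda>k. expectation (\<lambda>w. \<xi> w * X k w)) \<longlonglongrightarrow> expectation (\<lambda>w. \<xi> w * Y w)"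
  proof (rule LIM_zero_cancel, rule Lim_null_comparison)
    have "\<bar>expectation (\<lambda>w. \<xi> w * X k w) - expectation (\<lambda>w. \<xi> w * Y w)\<bar> \<le> A * expectation (D k)" for k
    proof -
      have "\<bar>expectation (\<lambda>w. \<xi> w * X k w) - expectation (\<lambda>w. \<xi> w * Y w)\<bar> = \<bar>expectation (\<lambda>w. \<xi> w * (X k w - Y w))\<bar>"
        using i\<xi>[OF iX[of k]] i\<xi>[OF iYY] by (simp add: right_diff_distrib)
      also have "\<dots> \<le> expectation (\<lambda>w. \<bar>\<xi> w * (X k w - Y w)\<bar>)" by (rule integral_abs_bound)
      also have "\<dots> \<le> expectation (\<lambda>w. A * D k w)"
        by (intro integral_mono integrable_abs i\<xi> Bochner_Integration.integrable_diff iX iYY integrable_mult_right iD)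
          (auto simp: abs_mult D_def intro!: mult_right_mono \<xi>b)
      finally show ?thesis by simp
    qed
    then show "\<forall>\<^sub>F k in sequentially. norm (expectation (\<lambda>w. \<xi> w * X k w) - expectation (\<lambda>w. \<xi> w * Y w)) \<le> A * expectation (D k)"
      by simp
    show "(\<lambda>k. A * expectation (D k)) \<longlonglongrightarrow> 0" using tendsto_mult_right_zero[OF ED] .
  qed
qed

end

lemma nn_integral_step_process:
  assumes d: "0 < d" and "m\<^sub>0 \<le> m"
  shows "(\<integral>\<^sup>+s\<in>{real m\<^sub>0 * d<..real m * d}. step_process d (\<lambda>j _. x j) s w \<partial>lborel) = (\<Sum>j=m\<^sub>0..<m. ennreal d * x j)"
  using \<open>m\<^sub>0 \<le> m\<close>
proof (induction m rule: dec_induct)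
  case (step m)
  have meas: "(\<lambda>s. step_process d (\<lambda>j _. x j) s w) \<in> borel_measurable lborel"
    unfolding step_process_def by measurable
  have "{x<..z} = {x<..y} \<union> {y<..z}" if "x \<le> y" "y \<le> z" for x y z :: real
    using that by auto
  then have u: "{real m\<^sub>0 * d<..real (Suc m) * d} = {real m\<^sub>0 * d<..real m * d} \<union> {real m * d<..real (Suc m) * d}"
    using d step.hyps by (simp add: mult_right_mono)
  have "(\<integral>\<^sup>+s\<in>{real m * d<..real (Suc m) * d}. step_process d (\<lambda>j _. x j) s w \<partial>lborel) =
    (\<integral>\<^sup>+s. x m * indicator {real m * d<..real (Suc m) * d} s \<partial>lborel)"
    by (intro nn_integral_cong) (auto simp: indicator_def step_process_cell[OF d])
  also have "\<dots> = ennreal d * x m"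
    using d by (simp add: nn_integral_cmult_indicator algebra_simps)
  finally show ?case
    using step unfolding u by (subst nn_integral_disjoint_pair[OF meas]) auto
qed simp

definition clamp_matrix :: "real \<Rightarrow> real ^ 'm ^ 'd \<Rightarrow> real ^ 'm ^ 'd" where
  "clamp_matrix K A = (\<chi> a b. max (- K) (min K (A $ a $ b)))"

lemma norm_matrix_le_componentwise:
  fixes A C :: "real ^ 'm ^ 'd"
  assumes "\<And>a b. \<bar>A $ a $ b\<bar> \<le> \<bar>C $ a $ b\<bar>"
  shows "norm A \<le> norm C"
  by (rule norm_le_componentwise_cart, rule norm_le_componentwise_cart) (use assms in auto)

lemma abs_entry_le_norm: "\<bar>(A :: real ^ 'm ^ 'd) $ a $ b\<bar> \<le> norm A"
  using component_le_norm_cart[of "A $ a" b] Finite_Cartesian_Product.norm_nth_le[of A a] by linarith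

lemma clamp_matrix_measurable [measurable (raw)]:
  fixes A :: "'w \<Rightarrow> real ^ 'm ^ 'd"
  assumes [measurable]: "A \<in> borel_measurable M"
  shows "(\<lambda>w. clamp_matrix K (A w)) \<in> borel_measurable M"
proof (subst borel_measurable_euclidean_space, rule ballI)
  fix e :: "real ^ 'm ^ 'd" assume "e \<in> Basis"
  then obtain a b where "e = axis a (axis b 1)" by (auto simp: Basis_vec_def)
  then have "(\<lambda>w. clamp_matrix K (A w) \<bullet> e) = (\<lambda>w. max (- K) (min K (A w $ a $ b)))"
    by (simp add: inner_axis clamp_matrix_def)
  then show "(\<lambda>w. clamp_matrix K (A w) \<bullet> e) \<in> borel_measurable M" by simp
qed

lemma clamp_matrix_entry: "0 \<le> K \<Longrightarrow> \<bar>clamp_matrix K A $ a $ b\<bar> \<le> K"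
  by (auto simp: clamp_matrix_def)

text \<open>Clamping is the projection onto \<open>[-K, K]\<close>: its value is the point of the
  interval nearest to the entry of \<open>A\<close>, and it does not increase the distance to any
  point of the interval.\<close>

lemma clamp_matrix_entry_diff:
  assumes "\<bar>G $ a $ b\<bar> \<le> K"
  shows "\<bar>A $ a $ b - clamp_matrix K A $ a $ b\<bar> \<le> \<bar>A $ a $ b - G $ a $ b\<bar>"
    and "\<bar>clamp_matrix K A $ a $ b - G $ a $ b\<bar> \<le> \<bar>A $ a $ b - G $ a $ b\<bar>"
  using assms by (simp_all add: clamp_matrix_def)

lemma norm_diff_clamp_matrix_le: "0 \<le> K \<Longrightarrow> norm (A - clamp_matrix K A) \<le> norm A"
  by (rule norm_matrix_le_componentwise) (auto simp: clamp_matrix_def max_def min_def abs_if)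

lemma norm_diff_clamp_matrix_le_diff: "norm G \<le> K \<Longrightarrow> norm (A - clamp_matrix K A) \<le> norm (A - G)"
  by (rule norm_matrix_le_componentwise)
    (simp, rule clamp_matrix_entry_diff(1), rule order_trans[OF abs_entry_le_norm])

text \<open>\<open>\<kappa>\<close> is the first grid index not before \<open>\<sigma>\<close>,
  confined to the range of summation. The cell in which \<open>\<sigma>\<close> falls is kept whole,
  because the decision is taken at its left end, so \<open>\<sigma>\<close> is overshot by at most
  one mesh width.\<close>

lemma stopped_sum:
  fixes x :: "nat \<Rightarrow> 'b::ab_group_add"
  assumes d: "0 < d" and "m\<^sub>0 \<le> m"
  shows "\<exists>\<kappa>. m\<^sub>0 \<le> \<kappa> \<and> \<kappa> \<le> m \<and>
    (\<Sum>j=m\<^sub>0..<m. if real j * d < \<sigma> then x j else 0) = (\<Sum>j<\<kappa>. x j) - (\<Sum>j<m\<^sub>0. x j) \<and>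
    \<bar>real \<kappa> * d - max (real m\<^sub>0 * d) (min \<sigma> (real m * d))\<bar> \<le> d"
proof -
  have "\<exists>\<kappa>. m\<^sub>0 \<le> \<kappa> \<and> \<kappa> \<le> m \<and> (m\<^sub>0 < \<kappa> \<longrightarrow> real (\<kappa> - 1) * d < \<sigma>) \<and> (\<kappa> < m \<longrightarrow> \<sigma> \<le> real \<kappa> * d) \<and>
    (\<Sum>j=m\<^sub>0..<m. if real j * d < \<sigma> then x j else 0) = (\<Sum>j<\<kappa>. x j) - (\<Sum>j<m\<^sub>0. x j)"
    using \<open>m\<^sub>0 \<le> m\<close>
  proof (induction m rule: dec_induct)
    case (step m)
    then obtain \<kappa> where \<kappa>: "m\<^sub>0 \<le> \<kappa>" "\<kappa> \<le> m" "m\<^sub>0 < \<kappa> \<longrightarrow> real (\<kappa> - 1) * d < \<sigma>" "\<kappa> < m \<longrightarrow> \<sigma> \<le> real \<kappa> * d"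
      "(\<Sum>j=m\<^sub>0..<m. if real j * d < \<sigma> then x j else 0) = (\<Sum>j<\<kappa>. x j) - (\<Sum>j<m\<^sub>0. x j)" by blast
    show ?case
    proof (cases "real m * d < \<sigma>")
      case True
      have "\<kappa> = m"
      proof (rule ccontr)
        assume "\<kappa> \<noteq> m"
        then have "\<kappa> < m" "\<sigma> \<le> real \<kappa> * d" using \<kappa> by auto
        moreover have "real \<kappa> * d \<le> real m * d" using \<open>\<kappa> < m\<close> d by simp
        ultimately show False using True by linarith
      qed
      then show ?thesis using True \<kappa> step.hyps by (intro exI[of _ "Suc m"]) auto
    next
      case False
      then show ?thesis using \<kappa> step.hyps by (intro exI[of _ \<kappa>]) (auto simp: le_less)
    qed
  qed auto
  then obtain \<kappa> where \<kappa>: "m\<^sub>0 \<le> \<kappa>" "\<kappa> \<le> m" "m\<^sub>0 < \<kappa> \<longrightarrow> real (\<kappa> - 1) * d < \<sigma>" "\<kappa> < m \<longrightarrow> \<sigma> \<le> real \<kappa> * d"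
      "(\<Sum>j=m\<^sub>0..<m. if real j * d < \<sigma> then x j else 0) = (\<Sum>j<\<kappa>. x j) - (\<Sum>j<m\<^sub>0. x j)" by blast
  have m: "real m\<^sub>0 * d \<le> real \<kappa> * d" "real \<kappa> * d \<le> real m * d" using \<kappa> d by simp_all
  have "real (\<kappa> - 1) * d = real \<kappa> * d - d" if "m\<^sub>0 < \<kappa>"
    using that by (simp add: of_nat_diff left_diff_distrib)
  note e = this
  have "\<bar>real \<kappa> * d - max (real m\<^sub>0 * d) (min \<sigma> (real m * d))\<bar> \<le> d"
  proof (cases "m\<^sub>0 < \<kappa>")
    case True
    then have "real \<kappa> * d - d < \<sigma>" using \<kappa>(3) e by simp
    then show ?thesis using m \<kappa>(2,4) d True by (cases "\<kappa> = m"; simp; linarith)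
  next
    case False
    then have "\<kappa> = m\<^sub>0" using \<kappa>(1) by simp
    then show ?thesis using m \<kappa>(2,4) d by (cases "\<kappa> = m") auto
  qed
  then show ?thesis using \<kappa> by blast
qed

lemma cell_index:
  fixes d s :: real
  assumes "0 < d" "0 < s"
  defines "j \<equiv> nat (\<lceil>s / d\<rceil> - 1)"
  shows "real j * d < s" "s \<le> real (Suc j) * d"
proof -
  have c: "\<lceil>s / d\<rceil> \<ge> 1" using assms by simp
  then have r: "real j = of_int \<lceil>s / d\<rceil> - 1" unfolding j_def by simp
  have "real j < s / d" "s / d \<le> real (Suc j)" unfolding r of_nat_Suc by linarith+
  then show "real j * d < s" "s \<le> real (Suc j) * d" using assms(1) by (simp_all add: field_simps)
qed

lemma norm_matrix_le_entries:
  fixes A :: "real ^ 'm ^ 'd"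
  assumes "\<And>a b. \<bar>A $ a $ b\<bar> \<le> K"
  shows "norm A \<le> real CARD('d) * (real CARD('m) * K)"
proof -
  have "norm (A $ a) \<le> real CARD('m) * K" for a
    using norm_le_l1_cart[of "A $ a"] sum_bounded_above[of UNIV "\<lambda>b. \<bar>A $ a $ b\<bar>" K] assms by simp
  then have "(\<Sum>a\<in>UNIV. norm (A $ a)) \<le> real CARD('d) * (real CARD('m) * K)"
    using sum_bounded_above[of UNIV "\<lambda>a. norm (A $ a)"] by simp
  moreover have "norm A \<le> (\<Sum>a\<in>UNIV. norm (A $ a))" unfolding norm_vec_def by (rule L2_set_le_sum) simp
  ultimately show ?thesis by linarith
qed

text \<open>\<open>u\<close> is the left end of the cell of \<open>s\<close>. The grid continues
  while \<open>u < \<sigma>\<close>, the true integrand while \<open>s \<le> \<sigma>\<close>; they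
  disagree only if \<open>\<sigma>\<close> lies between, which puts \<open>s\<close> within
  \<open>d\<close> after \<open>\<sigma>\<close>. Up to \<open>\<sigma>\<close> the value
  \<open>g\<close> obeys the bound \<open>K\<close>, so clamping does not increase the distance to
  it.\<close>

lemma stopped_clamp_estimates:
  fixes wt :: "real ^ 'm ^ 'd" and g :: "real ^ 'm ^ 'd" and s u d \<sigma> :: real
  assumes K: "0 \<le> K" and g: "s \<le> \<sigma> \<Longrightarrow> norm g \<le> K" and s: "u < s" "s \<le> u + d"
  shows "(norm (if u < \<sigma> then wt - clamp_matrix K wt else 0))\<^sup>2 \<le>
      2 * (norm (wt - g))\<^sup>2 + 2 * ((norm g)\<^sup>2 * indicator {\<sigma><..<\<sigma> + d} s)"
    and "norm ((if u < \<sigma> then clamp_matrix K wt else 0) - (if s \<le> \<sigma> then g else 0)) \<le>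
      norm (wt - g) + real CARD('d) * (real CARD('m) * K) * indicator {\<sigma><..<\<sigma> + d} s"
proof -
  show "(norm (if u < \<sigma> then wt - clamp_matrix K wt else 0))\<^sup>2 \<le>
      2 * (norm (wt - g))\<^sup>2 + 2 * ((norm g)\<^sup>2 * indicator {\<sigma><..<\<sigma> + d} s)"
  proof (cases "u < \<sigma>")
    case u: True
    show ?thesis
    proof (cases "s \<le> \<sigma>")
      case True
      have "(norm (wt - clamp_matrix K wt))\<^sup>2 \<le> (norm (wt - g))\<^sup>2"
        by (rule power_mono[OF norm_diff_clamp_matrix_le_diff[OF g[OF True]]]) simp
      moreover have "0 \<le> (norm (wt - g))\<^sup>2" "0 \<le> (norm g)\<^sup>2 * indicator {\<sigma><..<\<sigma> + d} s" by auto
      ultimately show ?thesis unfolding if_P[OF u] by linarith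
    next
      case False
      have "(norm (wt - clamp_matrix K wt))\<^sup>2 \<le> (norm (wt - 0))\<^sup>2"
        using norm_diff_clamp_matrix_le[OF K, of wt] by (simp add: power_mono)
      also have "\<dots> \<le> 2 * (norm (wt - g))\<^sup>2 + 2 * (norm (g - 0))\<^sup>2" by (rule norm_diff_power2_le)
      finally have "(norm (wt - clamp_matrix K wt))\<^sup>2 \<le> 2 * (norm (wt - g))\<^sup>2 + 2 * (norm g)\<^sup>2" by simp
      moreover have "s \<in> {\<sigma><..<\<sigma> + d}" using False u s by auto
      ultimately show ?thesis using u by simp
    qed
  qed (simp add: indicator_def)
  show "norm ((if u < \<sigma> then clamp_matrix K wt else 0) - (if s \<le> \<sigma> then g else 0)) \<le>
      norm (wt - g) + real CARD('d) * (real CARD('m) * K) * indicator {\<sigma><..<\<sigma> + d} s"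
  proof (cases "s \<le> \<sigma>")
    case True
    have "norm (clamp_matrix K wt - g) \<le> norm (wt - g)"
      by (rule norm_matrix_le_componentwise)
        (simp, rule clamp_matrix_entry_diff(2), rule order_trans[OF abs_entry_le_norm g[OF True]])
    then show ?thesis using True s by simp
  next
    case False
    have "norm (clamp_matrix K wt) \<le> real CARD('d) * (real CARD('m) * K)"
      by (rule norm_matrix_le_entries[OF clamp_matrix_entry[OF K]])
    moreover have "0 \<le> real CARD('d) * (real CARD('m) * K)" using K by simp
    ultimately show ?thesis using False s norm_ge_zero[of "wt - g"]
      by (auto simp: indicator_def intro: order_trans add_increasing)
  qed
qed

text \<open>Partial sums increase, so the terms kept form an initial segment with total at most 1,
  and nothing is cut if the full total is at most 1. The criterion at \<open>j\<close> uses terms up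
  to \<open>j\<close> only, which keeps a truncated integrand adapted.\<close>

lemma truncated_sum:
  fixes x :: "nat \<Rightarrow> real"
  assumes "\<And>j. 0 \<le> x j"
  shows "(\<Sum>j=m\<^sub>0..<m. if (\<Sum>i=m\<^sub>0..j. x i) \<le> 1 then x j else 0) \<le> 1"
    and "(\<Sum>j=m\<^sub>0..<m. x j) \<le> 1 \<Longrightarrow> m\<^sub>0 \<le> j \<Longrightarrow> j < m \<Longrightarrow> (\<Sum>i=m\<^sub>0..j. x i) \<le> 1"
proof -
  show "(\<Sum>j=m\<^sub>0..<m. if (\<Sum>i=m\<^sub>0..j. x i) \<le> 1 then x j else 0) \<le> 1"
  proof (induction m)
    case (Suc m)
    show ?case
    proof (cases "m\<^sub>0 \<le> m \<and> (\<Sum>i=m\<^sub>0..m. x i) \<le> 1")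
      case True
      have "(\<Sum>j=m\<^sub>0..<Suc m. if (\<Sum>i=m\<^sub>0..j. x i) \<le> 1 then x j else 0) \<le> (\<Sum>j=m\<^sub>0..<Suc m. x j)"
        using assms by (intro sum_mono) auto
      also have "\<dots> = (\<Sum>i=m\<^sub>0..m. x i)" by (simp add: atLeastLessThanSuc_atLeastAtMost)
      finally show ?thesis using True by linarith
    next
      case False
      then show ?thesis using Suc by (cases "m\<^sub>0 \<le> m") auto
    qed
  qed simp
  assume *: "(\<Sum>j=m\<^sub>0..<m. x j) \<le> 1" "m\<^sub>0 \<le> j" "j < m"
  have "(\<Sum>i=m\<^sub>0..j. x i) \<le> (\<Sum>j=m\<^sub>0..<m. x j)"
    using assms * by (intro sum_mono2) auto
  then show "(\<Sum>i=m\<^sub>0..j. x i) \<le> 1" using * by linarith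
qed

lemma sum_row_square_le: "(\<Sum>b\<in>UNIV. (A $ c $ b)\<^sup>2) \<le> (norm (A :: real ^ 'm ^ 'd))\<^sup>2"
proof -
  have "(\<Sum>b\<in>UNIV. (A $ c $ b)\<^sup>2) = (norm (A $ c))\<^sup>2"
    unfolding norm_vec_def L2_set_def by (simp add: sum_nonneg)
  also have "\<dots> \<le> (norm A)\<^sup>2" using Finite_Cartesian_Product.norm_nth_le[of A c] by (intro power_mono) auto
  finally show ?thesis .
qed

lemma ennreal_tendsto_0_of_power2:
  fixes y z :: "nat \<Rightarrow> ennreal"
  assumes le: "\<And>k. (y k)\<^sup>2 \<le> z k" and z: "z \<longlonglongrightarrow> 0"
  shows "y \<longlonglongrightarrow> 0"
proof (rule order_tendstoI)
  fix a :: ennreal assume a: "0 < a"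
  then have "0 < a * a" by (simp add: ennreal_zero_less_mult_iff)
  then have "\<forall>\<^sub>F k in sequentially. z k < a * a" by (rule order_tendstoD(2)[OF z])
  then show "\<forall>\<^sub>F k in sequentially. y k < a"
  proof eventually_elim
    case (elim k)
    show ?case
    proof (rule ccontr)
      assume "\<not> y k < a"
      then have "a * a \<le> (y k)\<^sup>2" unfolding power2_eq_square by (intro mult_mono) auto
      then show False using le[of k] elim by simp
    qed
  qed
qed simp

text \<open>\<open>\<sigma>\<close> is a stopping time only as far as times in the cell \<open>[i/N, i'/N]\<close> can tell.\<close>

locale stopped_ito = filtered_bm M F B for M :: "'w measure" and F and B :: "real \<Rightarrow> 'w \<Rightarrow> real ^ 'm" +
  fixes G :: "real \<Rightarrow> 'w \<Rightarrow> real ^ 'm ^ 'd" and J :: "real \<Rightarrow> 'w \<Rightarrow> real ^ 'd" and K :: real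
    and \<sigma> :: "'w \<Rightarrow> real" and N i i' :: nat
  assumes ito: "ito_integral M F B G J" and N: "0 < N" and ii': "i \<le> i'" and K: "0 \<le> K"
    and bound: "AE w in M. \<forall>s. real i / real N < s \<and> s \<le> real i' / real N \<and> s \<le> \<sigma> w \<longrightarrow> norm (G s w) \<le> K"
    and \<sigma>_meas: "\<sigma> \<in> borel_measurable M" and \<sigma>_nonneg: "\<And>w. w \<in> space M \<Longrightarrow> 0 \<le> \<sigma> w"
    and \<sigma>_stop: "\<And>u. real i / real N \<le> u \<Longrightarrow> u \<le> real i' / real N \<Longrightarrow> {w\<in>space M. u < \<sigma> w} \<in> sets (F u)"
begin

definition t\<^sub>0 where "t\<^sub>0 = real i / real N"
definition t\<^sub>1 where "t\<^sub>1 = real i' / real N"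
definition \<Delta>J where "\<Delta>J w = J (min t\<^sub>1 (\<sigma> w)) w - J (min t\<^sub>0 (\<sigma> w)) w"
definition Gs where "Gs s w = (if s \<le> \<sigma> w then G s w else 0)"

lemma t01: "0 \<le> t\<^sub>0" "t\<^sub>0 \<le> t\<^sub>1"
  using ii' by (auto simp: t\<^sub>0_def t\<^sub>1_def divide_right_mono)

lemma J_continuous: "w \<in> space M \<Longrightarrow> continuous_on {0..} (\<lambda>t. J t w)"
  and J_measurable: "0 \<le> t \<Longrightarrow> J t \<in> borel_measurable M"
  and G_progressive: "progressive F G"
  using ito measurable_F_M unfolding ito_integral_def by auto

lemma \<Delta>J_measurable: "\<Delta>J \<in> borel_measurable M"
proof -
  have "(\<lambda>w. J (min t (\<sigma> w)) w) \<in> borel_measurable M" if "0 \<le> t" for t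
    by (rule measurable_at_random_time[OF J_continuous J_measurable]) (use \<sigma>_meas \<sigma>_nonneg that in auto)
  then show ?thesis unfolding \<Delta>J_def using t01 by auto
qed

lemma Gs_measurable: "(\<lambda>(s, w). Gs s w) \<in> borel_measurable (restrict_space borel {0..t\<^sub>1} \<Otimes>\<^sub>M M)"
proof -
  have g: "(\<lambda>x. G (fst x) (snd x)) \<in> borel_measurable (restrict_space borel {0..t\<^sub>1} \<Otimes>\<^sub>M M)"
    using progressive_measurable_M[OF G_progressive] t01 by (simp add: case_prod_beta')
  have f: "fst \<in> restrict_space borel {0..t\<^sub>1} \<Otimes>\<^sub>M M \<rightarrow>\<^sub>M borel"
    by (rule measurable_compose[OF measurable_fst]) (rule measurable_restrict_space1, simp)
  have s: "(\<lambda>x. \<sigma> (snd x)) \<in> borel_measurable (restrict_space borel {0..t\<^sub>1} \<Otimes>\<^sub>M M)"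
    using \<sigma>_meas by measurable
  show ?thesis unfolding Gs_def case_prod_beta' using g f s by measurable
qed

text \<open>The approximating integrands are stopped at \<open>\<sigma>\<close> and clamped to the bound \<open>K\<close>. The discarded part tends to \<open>0\<close>
  in \<open>L\<^sup>2[t\<^sub>0, t\<^sub>1]\<close> almost surely only; truncating it where this norm exceeds \<open>1\<close> gives convergence in the mean, so
  that its stochastic integral disappears along a subsequence. The factor \<open>q k\<close> keeps \<open>t\<^sub>0\<close> and \<open>t\<^sub>1\<close> on the grid.\<close>

lemma approximation:
  obtains H q where "\<And>k. 0 < q k"
    "\<And>k j. i * q k \<le> j \<Longrightarrow> j < i' * q k \<Longrightarrow> H k j \<in> borel_measurable (F (real j * (1 / real (N * q k))))"
    "\<And>k j w a b. \<bar>H k j w $ a $ b\<bar> \<le> K"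
    "AE w in M. \<forall>c. (\<lambda>k. (\<Sum>j=i * q k..<i' * q k. H k j w *v
       (B (real (Suc j) * (1 / real (N * q k))) w - B (real j * (1 / real (N * q k))) w)) $ c) \<longlonglongrightarrow> \<Delta>J w $ c"
    "AE w in M. (\<lambda>k. \<integral>\<^sup>+s\<in>{t\<^sub>0<..t\<^sub>1}. ennreal (norm (step_process (1 / real (N * q k)) (H k) s w - Gs s w)) \<partial>lborel) \<longlonglongrightarrow> 0"
proof (rule ito_grid_approximation[OF ito N order_trans[OF t01]])
  fix q W
  assume qk: "\<And>k. q k > k" and Wm: "\<And>k j. W k j \<in> borel_measurable (F (real j * (1 / real (N * q k))))"
    and e1: "AE w in M. (\<lambda>k. \<integral>\<^sup>+s\<in>{0..t\<^sub>1}. ennreal ((norm (step_process (1 / real (N * q k)) (W k) s w - G s w))\<^sup>2) \<partial>lborel) \<longlonglongrightarrow> 0"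
    and gr: "AE w in M. \<forall>\<epsilon>>0. \<forall>\<^sub>F k in sequentially. \<forall>j. real j * (1 / real (N * q k)) \<le> t\<^sub>1 \<longrightarrow>
       norm (grid_integral (1 / real (N * q k)) (W k) j w - J (real j * (1 / real (N * q k))) w) \<le> \<epsilon>"
  define d where "d k = 1 / real (N * q k)" for k
  define m\<^sub>0 where "m\<^sub>0 k = i * q k" for k
  define m\<^sub>1 where "m\<^sub>1 k = i' * q k" for k
  have q0: "0 < q k" for k using qk[of k] by simp
  have d0: "0 < d k" for k using N q0 by (simp add: d_def)
  have md: "real (m\<^sub>0 k) * d k = t\<^sub>0" "real (m\<^sub>1 k) * d k = t\<^sub>1" for k
    using q0[of k] N by (simp_all add: m\<^sub>0_def m\<^sub>1_def d_def t\<^sub>0_def t\<^sub>1_def)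
  have m01: "m\<^sub>0 k \<le> m\<^sub>1 k" for k unfolding m\<^sub>0_def m\<^sub>1_def using ii' by simp
  have dlim: "d \<longlonglongrightarrow> 0" unfolding d_def by (rule grid_width_tendsto_0[OF N qk])
  note Wm = Wm[folded d_def] and e1 = e1[folded d_def] and gr = gr[folded d_def]
  let ?G = "\<lambda>s w. indicator {0..t\<^sub>1} s *\<^sub>R G s w" and ?\<sigma> = "\<lambda>k w. {\<sigma> w<..<\<sigma> w + d k}"
    and ?W = "\<lambda>k s w. step_process (d k) (W k) s w" and ?I = "\<lambda>k. {m\<^sub>0 k..<m\<^sub>1 k}"
  \<comment> \<open>\<open>H\<close> is the stopped and clamped integrand, \<open>D\<close> the
    discarded part; they add up to \<open>W\<close> stopped at \<open>\<sigma>\<close>. The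
    integrals of the latter tend to \<open>\<Delta>J\<close>, so those of \<open>D\<close> have to
    disappear.\<close>
  define H where "H k j w = (if real j * d k < \<sigma> w then clamp_matrix K (W k j w) else 0)" for k j w
  define D where "D k j w = (if real j * d k < \<sigma> w then W k j w - clamp_matrix K (W k j w) else 0)" for k j w
  define v where "v k j w = B (real (Suc j) * d k) w - B (real j * d k) w" for k j w
  have jd: "t\<^sub>0 \<le> real j * d k" "real j * d k \<le> t\<^sub>1" if "m\<^sub>0 k \<le> j" "j < m\<^sub>1 k" for j k
    using that d0[of k] by (auto simp flip: md[of k] intro!: mult_right_mono)
  have stop: "Measurable.pred (F (real j * d k)) (\<lambda>w. real j * d k < \<sigma> w)" if "m\<^sub>0 k \<le> j" "j < m\<^sub>1 k" for j k
    using \<sigma>_stop[of "real j * d k"] jd[OF that] d0[of k] unfolding t\<^sub>0_def t\<^sub>1_def pred_def by simp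
  have Hm: "H k j \<in> borel_measurable (F (real j * d k))" if "m\<^sub>0 k \<le> j" "j < m\<^sub>1 k" for j k
    unfolding H_def using Wm[of k j] stop[OF that] by measurable
  have Dm: "D k j \<in> borel_measurable (F (real j * d k))" if "m\<^sub>0 k \<le> j" "j < m\<^sub>1 k" for j k
    unfolding D_def using Wm[of k j] stop[OF that] by measurable
  have HK: "\<bar>H k j w $ a $ b\<bar> \<le> K" for k j w a b
    using clamp_matrix_entry[OF K, of "W k j w"] K by (simp add: H_def)
  let ?K' = "real CARD('d) * (real CARD('m) * K)"
  \<comment> \<open>The energy of \<open>G\<close> in the window of length \<open>d k\<close> after
    \<open>\<sigma>\<close>, where the grid may not have stopped yet; it vanishes as the window
    shrinks.\<close>
  define e2 where "e2 k w = (\<integral>\<^sup>+s\<in>{0..t\<^sub>1}. ennreal ((norm (G s w))\<^sup>2 * indicator (?\<sigma> k w) s) \<partial>lborel)" for k w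
  have sec: "(\<lambda>s. ?G s w) \<in> borel_measurable borel" if "w \<in> space M" for w
    using progressive_section[OF G_progressive order_trans[OF t01] that]
    by (subst borel_measurable_restrict_space_iff[symmetric]) auto
  have stepm: "(\<lambda>s. step_process (d k) X s w) \<in> borel_measurable borel" for k w and X :: "nat \<Rightarrow> 'w \<Rightarrow> real ^ 'm ^ 'd"
    unfolding step_process_def by measurable
  have e2_lim: "AE w in M. (\<lambda>k. e2 k w) \<longlonglongrightarrow> 0"
  proof -
    have "AE w in M. \<forall>T\<ge>0. (\<integral>\<^sup>+s\<in>{0..T}. ennreal ((norm (G s w))\<^sup>2) \<partial>lborel) < \<infinity>"
      using ito unfolding ito_integral_def by auto
    then show ?thesis using AE_space
    proof eventually_elim
      case (elim w)
      note [measurable] = sec[OF elim(2)]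
      have eq: "ennreal ((norm (G s w))\<^sup>2 * indicator (?\<sigma> k w) s) * indicator {0..t\<^sub>1} s =
        ennreal ((norm (?G s w))\<^sup>2) * indicator (?\<sigma> k w) s" for s k
        by (auto simp: indicator_def)
      have "(\<lambda>k. e2 k w) \<longlonglongrightarrow> (\<integral>\<^sup>+s. (0::ennreal) \<partial>(lborel :: real measure))"
        unfolding e2_def eq
      proof (rule nn_integral_dominated_convergence[where w="\<lambda>s. ennreal ((norm (?G s w))\<^sup>2)"])
        have "(\<integral>\<^sup>+s. ennreal ((norm (?G s w))\<^sup>2) \<partial>lborel) = (\<integral>\<^sup>+s\<in>{0..t\<^sub>1}. ennreal ((norm (G s w))\<^sup>2) \<partial>lborel)"
          by (intro nn_integral_cong) (auto simp: indicator_def)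
        then show "(\<integral>\<^sup>+s. ennreal ((norm (?G s w))\<^sup>2) \<partial>lborel) < \<infinity>"
          using elim(1) t01 by simp
        show "AE s in lborel. (\<lambda>k. ennreal ((norm (?G s w))\<^sup>2) * indicator (?\<sigma> k w) s) \<longlonglongrightarrow> 0"
        proof (rule AE_I2)
          fix s :: real
          have "\<forall>\<^sub>F k in sequentially. s \<notin> ?\<sigma> k w"
          proof (cases "\<sigma> w < s")
            case True
            then have "\<forall>\<^sub>F k in sequentially. d k < s - \<sigma> w" using order_tendstoD(2)[OF dlim, of "s - \<sigma> w"] by simp
            then show ?thesis by eventually_elim auto
          qed simp
          then show "(\<lambda>k. ennreal ((norm (?G s w))\<^sup>2) * indicator (?\<sigma> k w) s) \<longlonglongrightarrow> 0"
            by (intro tendsto_eventually, eventually_elim) simp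
        qed
        show "AE s in lborel. ennreal ((norm (?G s w))\<^sup>2) * indicator (?\<sigma> k w) s
            \<le> ennreal ((norm (?G s w))\<^sup>2)" for k
          by (rule AE_I2) (simp add: indicator_def)
      qed measurable
      then show ?case by simp
    qed
  qed
  define SD where "SD k w = (\<Sum>j\<in>?I k. d k * (norm (D k j w))\<^sup>2)" for k w
  have pt: "\<exists>j. step_process (d k) X s w = X j w \<and> real j * d k < s \<and> s \<le> real j * d k + d k \<and> nat (\<lceil>s / d k\<rceil> - 1) = j"
    if "0 < s" for s k w and X :: "nat \<Rightarrow> 'w \<Rightarrow> real ^ 'm ^ 'd"
    using cell_index[OF d0 that, of k] by (auto simp: step_process_def distrib_right)
  \<comment> \<open>The discarded part is charged to the approximation error up to
    \<open>\<sigma>\<close>, where \<open>G\<close> is bounded by \<open>K\<close>, and additionally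
    to the energy of \<open>G\<close> in the window after it.\<close>
  have SD_le: "ennreal (SD k w) \<le> ennreal 2 * (\<integral>\<^sup>+s\<in>{0..t\<^sub>1}. ennreal ((norm (?W k s w - G s w))\<^sup>2) \<partial>lborel) + ennreal 2 * e2 k w"
    if w: "w \<in> space M" and b: "\<forall>s. t\<^sub>0 < s \<and> s \<le> t\<^sub>1 \<and> s \<le> \<sigma> w \<longrightarrow> norm (G s w) \<le> K" for k w
  proof -
    note [measurable] = sec[OF w] stepm
    have "ennreal (SD k w) = (\<Sum>j\<in>?I k. ennreal (d k) * ennreal ((norm (D k j w))\<^sup>2))"
      unfolding SD_def using d0[of k] by (simp flip: ennreal_mult add: sum_ennreal)
    also have "\<dots> = (\<integral>\<^sup>+s\<in>{t\<^sub>0<..t\<^sub>1}. step_process (d k) (\<lambda>j _. ennreal ((norm (D k j w))\<^sup>2)) s w \<partial>lborel)"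
      using nn_integral_step_process[OF d0[of k] m01[of k], of "\<lambda>j. ennreal ((norm (D k j w))\<^sup>2)" w] unfolding md by simp
    also have "\<dots> \<le> (\<integral>\<^sup>+s. ennreal 2 * (ennreal ((norm (?W k s w - ?G s w))\<^sup>2) * indicator {0..t\<^sub>1} s) +
        ennreal 2 * (ennreal ((norm (?G s w))\<^sup>2 * indicator (?\<sigma> k w) s) * indicator {0..t\<^sub>1} s) \<partial>lborel)"
    proof (rule nn_integral_mono)
      fix s
      show "step_process (d k) (\<lambda>j _. ennreal ((norm (D k j w))\<^sup>2)) s w * indicator {t\<^sub>0<..t\<^sub>1} s \<le>
        ennreal 2 * (ennreal ((norm (?W k s w - ?G s w))\<^sup>2) * indicator {0..t\<^sub>1} s) +
        ennreal 2 * (ennreal ((norm (?G s w))\<^sup>2 * indicator (?\<sigma> k w) s) * indicator {0..t\<^sub>1} s)"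
      proof (cases "t\<^sub>0 < s \<and> s \<le> t\<^sub>1")
        case True
        then have "0 < s" using t01 by simp
        then obtain j where j: "?W k s w = W k j w" "real j * d k < s" "s \<le> real j * d k + d k"
          "nat (\<lceil>s / d k\<rceil> - 1) = j" using pt by blast
        have "(norm (D k j w))\<^sup>2 \<le> 2 * (norm (W k j w - G s w))\<^sup>2 + 2 * ((norm (G s w))\<^sup>2 * indicator (?\<sigma> k w) s)"
          unfolding D_def by (rule stopped_clamp_estimates(1)[OF K _ j(2,3)]) (use b True in auto)
        then have "ennreal ((norm (D k j w))\<^sup>2) \<le> ennreal 2 * ennreal ((norm (W k j w - G s w))\<^sup>2) + ennreal 2 * ennreal ((norm (G s w))\<^sup>2 * indicator (?\<sigma> k w) s)"
          by (subst ennreal_two_mult_add) (rule zero_le_power2 mult_nonneg_nonneg indicator_pos_le | erule ennreal_leI)+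
        then show ?thesis using True \<open>0 < s\<close> j by (simp add: step_process_def)
      qed simp
    qed
    also have "\<dots> = ennreal 2 * (\<integral>\<^sup>+s\<in>{0..t\<^sub>1}. ennreal ((norm (?W k s w - ?G s w))\<^sup>2) \<partial>lborel) +
        ennreal 2 * (\<integral>\<^sup>+s\<in>{0..t\<^sub>1}. ennreal ((norm (?G s w))\<^sup>2 * indicator (?\<sigma> k w) s) \<partial>lborel)"
      by (subst nn_integral_add nn_integral_cmult, measurable)+
    also have "(\<integral>\<^sup>+s\<in>{0..t\<^sub>1}. ennreal ((norm (?W k s w - ?G s w))\<^sup>2) \<partial>lborel) =
      (\<integral>\<^sup>+s\<in>{0..t\<^sub>1}. ennreal ((norm (?W k s w - G s w))\<^sup>2) \<partial>lborel)"
      by (intro nn_integral_cong) (auto simp: indicator_def)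
    also have "(\<integral>\<^sup>+s\<in>{0..t\<^sub>1}. ennreal ((norm (?G s w))\<^sup>2 * indicator (?\<sigma> k w) s) \<partial>lborel) = e2 k w"
      unfolding e2_def by (intro nn_integral_cong) (auto simp: indicator_def)
    finally show ?thesis .
  qed
  have SD_lim: "AE w in M. (\<lambda>k. SD k w) \<longlonglongrightarrow> 0"
    using e1 e2_lim bound AE_space
  proof eventually_elim
    case (elim w)
    have "(\<lambda>k. ennreal 2 * (\<integral>\<^sup>+s\<in>{0..t\<^sub>1}. ennreal ((norm (?W k s w - G s w))\<^sup>2) \<partial>lborel) + ennreal 2 * e2 k w)
        \<longlonglongrightarrow> ennreal 2 * 0 + ennreal 2 * 0"
      by (intro tendsto_add ennreal_tendsto_cmult elim) auto
    then have lim: "(\<lambda>k. ennreal 2 * (\<integral>\<^sup>+s\<in>{0..t\<^sub>1}. ennreal ((norm (?W k s w - G s w))\<^sup>2) \<partial>lborel) + ennreal 2 * e2 k w) \<longlonglongrightarrow> 0"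
      by simp
    have "(\<lambda>k. ennreal (SD k w)) \<longlonglongrightarrow> 0"
      by (rule tendsto_sandwich[OF _ _ tendsto_const lim])
        (use SD_le[OF elim(4)] elim(3) in \<open>auto simp: t\<^sub>0_def t\<^sub>1_def\<close>)
    then show ?case
      by (subst (asm) ennreal_tendsto_0_iff) (use d0 in \<open>auto simp: SD_def less_imp_le intro!: sum_nonneg\<close>)
  qed
  \<comment> \<open>The criterion looks at the norm accumulated up to and including cell
    \<open>j\<close>. As \<open>D k j\<close> is known at the left end of that cell,
    \<open>Dt k j\<close> is again adapted.\<close>
  define Dt where "Dt k j w = (if (\<Sum>l=m\<^sub>0 k..j. d k * (norm (D k l w))\<^sup>2) \<le> 1 then D k j w else 0)" for k j w
  have Dtm: "Dt k j \<in> borel_measurable (F (real j * d k))" if "m\<^sub>0 k \<le> j" "j < m\<^sub>1 k" for j k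
  proof -
    have "(\<lambda>w. d k * (norm (D k l w))\<^sup>2) \<in> borel_measurable (F (real j * d k))" if l: "l \<in> {m\<^sub>0 k..j}" for l
    proof -
      have "D k l \<in> borel_measurable (F (real j * d k))"
        by (rule measurable_F_mono[OF Dm]) (use l \<open>j < m\<^sub>1 k\<close> d0[of k] in auto)
      then show ?thesis by measurable
    qed
    then have "(\<lambda>w. \<Sum>l=m\<^sub>0 k..j. d k * (norm (D k l w))\<^sup>2) \<in> borel_measurable (F (real j * d k))"
      by (intro borel_measurable_sum) auto
    then show ?thesis unfolding Dt_def using Dm[OF that] by measurable
  qed
  have nn: "0 \<le> d k * (norm (D k l w))\<^sup>2" for k l w using d0[of k] by simp
  \<comment> \<open>A crude bound depending on \<open>k\<close>; it only makes the moment formulas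
    applicable for each fixed \<open>k\<close>.\<close>
  have Dtb: "norm (Dt k j w) \<le> 1 / d k + 1" if "m\<^sub>0 k \<le> j" for k j w
  proof (cases "(\<Sum>l=m\<^sub>0 k..j. d k * (norm (D k l w))\<^sup>2) \<le> 1")
    case True
    have "d k * (norm (D k j w))\<^sup>2 \<le> (\<Sum>l=m\<^sub>0 k..j. d k * (norm (D k l w))\<^sup>2)"
      using nn that by (intro member_le_sum) auto
    then have "(norm (D k j w))\<^sup>2 \<le> 1 / d k" using True d0[of k] by (simp add: field_simps)
    moreover have "norm (D k j w) \<le> (norm (D k j w))\<^sup>2 + 1"
      using zero_le_power2[of "norm (D k j w) - 1 / 2"] by (simp add: power2_eq_square algebra_simps)
    ultimately show ?thesis using True by (simp add: Dt_def)
  qed (use d0[of k] in \<open>simp add: Dt_def\<close>)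
  have Dte: "\<bar>Dt k j w $ a $ b\<bar> \<le> 1 / d k + 1" if "m\<^sub>0 k \<le> j" for k j w a b
    using Dtb[OF that] abs_entry_le_norm order_trans by blast
  define S where "S k c w = (\<Sum>j\<in>?I k. \<Sum>b\<in>UNIV. Dt k j w $ c $ b * dB (d k) b j w)" for k c w
  define SDt where "SDt k w = (\<Sum>j\<in>?I k. d k * (norm (Dt k j w))\<^sup>2)" for k w
  have cov: "S k c \<in> borel_measurable (F (real (m\<^sub>1 k) * d k))" "integrable M (\<lambda>w. S k c w ^ 4)"
    "expectation (\<lambda>w. S k c w * S k c w) =
       (\<Sum>j\<in>?I k. \<Sum>b\<in>UNIV. d k * expectation (\<lambda>w. Dt k j w $ c $ b * Dt k j w $ c $ b))" for k c
    using martingale_transform_covariance(1,2)[OF d0[of k], where W="Dt k" and \<xi>="\<lambda>_. 1" and C=1 and m\<^sub>0="m\<^sub>0 k"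
        and m="m\<^sub>1 k" and K="1 / d k + 1" and a=c, OF Dtm Dte m01]
      martingale_transform_covariance(5)[OF d0[of k], where W="Dt k" and \<xi>="\<lambda>_. 1" and C=1 and m\<^sub>0="m\<^sub>0 k"
        and m="m\<^sub>1 k" and K="1 / d k + 1" and a=c and c=c, OF Dtm Dte m01]
    unfolding S_def by simp_all
  have DtM: "Dt k j \<in> borel_measurable M" if "m\<^sub>0 k \<le> j" "j < m\<^sub>1 k" for k j
    using measurable_F_M[OF Dtm[OF that]] d0[of k] by simp
  have SM: "S k c \<in> borel_measurable M" for k c using measurable_F_M[OF cov(1)] d0[of k] by (simp add: less_imp_le)
  have S2: "integrable M (\<lambda>w. (S k c w)\<^sup>2)" for k c by (rule integrable_power_le[OF cov(2) SM]) simp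
  have SDt_alt: "SDt k w = (\<Sum>j\<in>?I k. if (\<Sum>l=m\<^sub>0 k..j. d k * (norm (D k l w))\<^sup>2) \<le> 1 then d k * (norm (D k j w))\<^sup>2 else 0)" for k w
    unfolding SDt_def Dt_def by (intro sum.cong) auto
  have SDt1: "SDt k w \<le> 1" for k w
    unfolding SDt_alt by (rule truncated_sum(1)[OF nn])
  have SDt_le: "SDt k w \<le> SD k w" for k w
    unfolding SDt_alt SD_def using nn by (intro sum_mono) auto
  have SDt0: "0 \<le> SDt k w" for k w unfolding SDt_def using d0[of k] by (intro sum_nonneg) auto
  have SDtM: "SDt k \<in> borel_measurable M" for k
  proof -
    have "(\<lambda>w. d k * (norm (Dt k j w))\<^sup>2) \<in> borel_measurable M" if "j \<in> ?I k" for j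
      using DtM[of k j] that by simp
    then show ?thesis unfolding SDt_def[abs_def] by (intro borel_measurable_sum) auto
  qed
  \<comment> \<open>Truncation makes \<open>SDt\<close> at most 1, so its almost sure limit zero is
    also the limit of its mean.\<close>
  have ESDt: "(\<lambda>k. expectation (SDt k)) \<longlonglongrightarrow> 0"
  proof -
    have "(\<lambda>k. expectation (SDt k)) \<longlonglongrightarrow> expectation (\<lambda>_. 0)"
    proof (rule integral_dominated_convergence[where w="\<lambda>_. 1"])
      show "AE w in M. (\<lambda>k. SDt k w) \<longlonglongrightarrow> 0"
        using SD_lim
      proof eventually_elim
        case (elim w)
        show ?case by (rule tendsto_sandwich[OF _ _ tendsto_const elim]) (use SDt0 SDt_le in auto)
      qed
    qed (use SDt0 SDt1 SDtM in auto)
    then show ?thesis by simp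
  qed
  have ES: "expectation (\<lambda>w. (S k c w)\<^sup>2) \<le> expectation (SDt k)" for k c
  proof -
    have DtM': "Dt k j \<in> borel_measurable M" if "j \<in> ?I k" for j using DtM that by simp
    have ie: "integrable M (\<lambda>w. Dt k j w $ c $ b * Dt k j w $ c $ b)" if j: "j \<in> ?I k" for j b
    proof (rule integrable_bounded)
      show "(\<lambda>w. Dt k j w $ c $ b * Dt k j w $ c $ b) \<in> borel_measurable M" using DtM'[OF j] by measurable
      show "\<bar>Dt k j w $ c $ b * Dt k j w $ c $ b\<bar> \<le> (1 / d k + 1) * (1 / d k + 1)" for w
        unfolding abs_mult using Dte[of k j] j d0[of k] by (intro mult_mono) auto
    qed
    have in2: "integrable M (\<lambda>w. (norm (Dt k j w))\<^sup>2)" if j: "j \<in> ?I k" for j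
    proof (rule integrable_bounded)
      show "(\<lambda>w. (norm (Dt k j w))\<^sup>2) \<in> borel_measurable M" using DtM'[OF j] by measurable
      show "\<bar>(norm (Dt k j w))\<^sup>2\<bar> \<le> (1 / d k + 1)\<^sup>2" for w
        using Dtb[of k j] j by (simp add: power_mono)
    qed
    have "expectation (\<lambda>w. (S k c w)\<^sup>2) = (\<Sum>j\<in>?I k. \<Sum>b\<in>UNIV. d k * expectation (\<lambda>w. Dt k j w $ c $ b * Dt k j w $ c $ b))"
      using cov(3)[of k c] by (simp add: power2_eq_square)
    also have "\<dots> = (\<Sum>j\<in>?I k. d k * expectation (\<lambda>w. \<Sum>b\<in>UNIV. Dt k j w $ c $ b * Dt k j w $ c $ b))"
      using ie by (intro sum.cong refl) (simp add: Bochner_Integration.integral_sum sum_distrib_left)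
    also have "\<dots> \<le> (\<Sum>j\<in>?I k. d k * expectation (\<lambda>w. (norm (Dt k j w))\<^sup>2))"
    proof (intro sum_mono mult_left_mono integral_mono)
      fix j w assume j: "j \<in> ?I k"
      show "integrable M (\<lambda>w. \<Sum>b\<in>UNIV. Dt k j w $ c $ b * Dt k j w $ c $ b)"
        using ie[OF j] by (intro Bochner_Integration.integrable_sum)
      show "integrable M (\<lambda>w. (norm (Dt k j w))\<^sup>2)" by (rule in2[OF j])
      show "(\<Sum>b\<in>UNIV. Dt k j w $ c $ b * Dt k j w $ c $ b) \<le> (norm (Dt k j w))\<^sup>2"
        using sum_row_square_le[of "Dt k j w" c] by (simp add: power2_eq_square)
    qed (use d0[of k] in simp)
    also have "\<dots> = expectation (SDt k)"
      unfolding SDt_def[abs_def] using in2 by (simp add: Bochner_Integration.integral_sum)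
    finally show ?thesis .
  qed
  \<comment> \<open>Convergence in mean gives almost sure convergence along a subsequence only; the
    final approximants are therefore indexed by \<open>r k\<close>.\<close>
  obtain r where r: "strict_mono r" and rlim: "AE w in M. (\<lambda>k. \<Sum>c\<in>UNIV. (S (r k) c w)\<^sup>2) \<longlonglongrightarrow> 0"
  proof -
    have i: "integrable M (\<lambda>w. \<Sum>c\<in>UNIV. (S k c w)\<^sup>2)" for k using S2 by auto
    have "(\<lambda>k. LINT w|M. norm (\<Sum>c\<in>UNIV. (S k c w)\<^sup>2)) \<longlonglongrightarrow> 0"
    proof (rule tendsto_sandwich[OF _ _ tendsto_const])
      have "(LINT w|M. norm (\<Sum>c\<in>UNIV. (S k c w)\<^sup>2)) \<le> real CARD('d) * expectation (SDt k)" for k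
      proof -
        have "(LINT w|M. norm (\<Sum>c\<in>UNIV. (S k c w)\<^sup>2)) = (\<Sum>c\<in>UNIV. expectation (\<lambda>w. (S k c w)\<^sup>2))"
          using S2 by (simp add: sum_nonneg abs_of_nonneg Bochner_Integration.integral_sum)
        then show ?thesis using sum_bounded_above[of UNIV "\<lambda>c. expectation (\<lambda>w. (S k c w)\<^sup>2)"] ES by simp
      qed
      then show "\<forall>\<^sub>F k in sequentially. (LINT w|M. norm (\<Sum>c\<in>UNIV. (S k c w)\<^sup>2)) \<le> real CARD('d) * expectation (SDt k)"
        by simp
      show "(\<lambda>k. real CARD('d) * expectation (SDt k)) \<longlonglongrightarrow> 0" by (rule tendsto_mult_right_zero[OF ESDt])
    qed simp
    from tendsto_L1_AE_subseq[OF i this] that show ?thesis by blast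
  qed
  have tr: "(\<Sum>j\<in>I. A j *v v k j w) $ c = (\<Sum>j\<in>I. \<Sum>b\<in>UNIV. A j $ c $ b * dB (d k) b j w)"
    for I A k w and c :: 'd
    unfolding v_def by (simp add: matrix_vector_mult_def dB_def[OF d0])
  have D_lim: "AE w in M. \<forall>c. (\<lambda>k. (\<Sum>j\<in>?I (r k). D (r k) j w *v v (r k) j w) $ c) \<longlonglongrightarrow> 0"
    using rlim SD_lim
  proof (eventually_elim, intro allI)
    fix w c assume l1: "(\<lambda>k. \<Sum>c\<in>UNIV. (S (r k) c w)\<^sup>2) \<longlonglongrightarrow> 0" and l2: "(\<lambda>k. SD k w) \<longlonglongrightarrow> 0"
    have "(\<lambda>k. (S (r k) c w)\<^sup>2) \<longlonglongrightarrow> 0"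
      by (rule tendsto_sandwich[OF _ _ tendsto_const l1]) (auto intro!: always_eventually member_le_sum[of c UNIV "\<lambda>c. (S _ c w)\<^sup>2"])
    then have S0: "(\<lambda>k. S (r k) c w) \<longlonglongrightarrow> 0" by simp
    \<comment> \<open>On such a path the accumulated norm is eventually below 1, so the truncation
      is inactive and \<open>Dt\<close> is \<open>D\<close>.\<close>
    have "\<forall>\<^sub>F k in sequentially. SD (r k) w < 1"
      using order_tendstoD(2)[OF LIMSEQ_subseq_LIMSEQ[OF l2 r], of 1] by (simp add: comp_def)
    then have "\<forall>\<^sub>F k in sequentially. S (r k) c w = (\<Sum>j\<in>?I (r k). D (r k) j w *v v (r k) j w) $ c"
    proof eventually_elim
      case (elim k)
      have "Dt (r k) j w = D (r k) j w" if "j \<in> ?I (r k)" for j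
        using truncated_sum(2)[where x="\<lambda>l. d (r k) * (norm (D (r k) l w))\<^sup>2", OF nn, of "m\<^sub>0 (r k)" "m\<^sub>1 (r k)" j] elim that
        by (simp add: SD_def Dt_def)
      then show ?case unfolding tr S_def by (intro sum.cong) auto
    qed
    then show "(\<lambda>k. (\<Sum>j\<in>?I (r k). D (r k) j w *v v (r k) j w) $ c) \<longlonglongrightarrow> 0"
      by (rule Lim_transform_eventually[OF S0])
  qed
  \<comment> \<open>The stopped sum is a difference of two grid integrals, up to
    \<open>\<kappa> k\<close> and up to the start of the cell. Both are uniformly close to
    \<open>J\<close>, and \<open>\<kappa> k * d k\<close> tends to \<open>\<sigma>\<close> confined
    to the cell.\<close>
  have W_lim: "AE w in M. (\<lambda>k. \<Sum>j\<in>?I k. if real j * d k < \<sigma> w then W k j w *v v k j w else 0) \<longlonglongrightarrow> \<Delta>J w"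
    using gr AE_space
  proof eventually_elim
    case (elim w)
    have "\<forall>k. \<exists>\<kappa>. m\<^sub>0 k \<le> \<kappa> \<and> \<kappa> \<le> m\<^sub>1 k \<and>
      (\<Sum>j\<in>?I k. if real j * d k < \<sigma> w then W k j w *v v k j w else 0) =
        (\<Sum>j<\<kappa>. W k j w *v v k j w) - (\<Sum>j<m\<^sub>0 k. W k j w *v v k j w) \<and>
      \<bar>real \<kappa> * d k - max t\<^sub>0 (min (\<sigma> w) t\<^sub>1)\<bar> \<le> d k"
    proof
      fix k
      show "\<exists>\<kappa>. m\<^sub>0 k \<le> \<kappa> \<and> \<kappa> \<le> m\<^sub>1 k \<and>
        (\<Sum>j\<in>?I k. if real j * d k < \<sigma> w then W k j w *v v k j w else 0) =
          (\<Sum>j<\<kappa>. W k j w *v v k j w) - (\<Sum>j<m\<^sub>0 k. W k j w *v v k j w) \<and>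
        \<bar>real \<kappa> * d k - max t\<^sub>0 (min (\<sigma> w) t\<^sub>1)\<bar> \<le> d k"
        using stopped_sum[OF d0[of k] m01[of k], where \<sigma>="\<sigma> w" and x="\<lambda>j. W k j w *v v k j w"] unfolding md .
    qed
    from choice[OF this] obtain \<kappa> where \<kappa>': "\<forall>k. m\<^sub>0 k \<le> \<kappa> k \<and> \<kappa> k \<le> m\<^sub>1 k \<and>
      (\<Sum>j\<in>?I k. if real j * d k < \<sigma> w then W k j w *v v k j w else 0) =
        (\<Sum>j<\<kappa> k. W k j w *v v k j w) - (\<Sum>j<m\<^sub>0 k. W k j w *v v k j w) \<and>
      \<bar>real (\<kappa> k) * d k - max t\<^sub>0 (min (\<sigma> w) t\<^sub>1)\<bar> \<le> d k" ..
    note \<kappa> = spec[OF \<kappa>', THEN conjunct2, THEN conjunct1] spec[OF \<kappa>', THEN conjunct2, THEN conjunct2, THEN conjunct1]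
      spec[OF \<kappa>', THEN conjunct2, THEN conjunct2, THEN conjunct2]
    have gl: "(\<lambda>k. (\<Sum>j<l k. W k j w *v v k j w) - J (real (l k) * d k) w) \<longlonglongrightarrow> 0" if l: "\<And>k. l k \<le> m\<^sub>1 k" for l
    proof (rule LIMSEQ_I)
      fix e :: real assume e: "0 < e"
      have "\<forall>\<^sub>F k in sequentially. \<forall>j. real j * d k \<le> t\<^sub>1 \<longrightarrow> norm (grid_integral (d k) (W k) j w - J (real j * d k) w) \<le> e / 2"
        using elim(1) e half_gt_zero by blast
      then have "\<forall>\<^sub>F k in sequentially. norm ((\<Sum>j<l k. W k j w *v v k j w) - J (real (l k) * d k) w - 0) < e"
      proof eventually_elim
        case (elim k)
        have "real (l k) * d k \<le> t\<^sub>1" using l[of k] d0[of k] unfolding md(2)[of k, symmetric] by (intro mult_right_mono) auto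
        then have "norm ((\<Sum>j<l k. W k j w *v v k j w) - J (real (l k) * d k) w) \<le> e / 2"
          using elim unfolding v_def by blast
        then show ?case using e by simp
      qed
      then show "\<exists>no. \<forall>n\<ge>no. norm ((\<Sum>j<l n. W n j w *v v n j w) - J (real (l n) * d n) w - 0) < e"
        by (simp add: eventually_sequentially)
    qed
    have "(\<lambda>k. real (\<kappa> k) * d k - max t\<^sub>0 (min (\<sigma> w) t\<^sub>1)) \<longlonglongrightarrow> 0"
      by (rule Lim_null_comparison[OF _ dlim]) (use \<kappa>(3) in auto)
    then have kt: "(\<lambda>k. real (\<kappa> k) * d k) \<longlonglongrightarrow> max t\<^sub>0 (min (\<sigma> w) t\<^sub>1)" by (rule LIM_zero_cancel)
    have Jk: "(\<lambda>k. J (real (\<kappa> k) * d k) w) \<longlonglongrightarrow> J (max t\<^sub>0 (min (\<sigma> w) t\<^sub>1)) w"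
      by (rule continuous_on_tendsto_compose[OF J_continuous[OF elim(2)] kt])
        (use t01 d0 in \<open>auto simp: less_imp_le\<close>)
    have "(\<lambda>k. (((\<Sum>j<\<kappa> k. W k j w *v v k j w) - J (real (\<kappa> k) * d k) w) + J (real (\<kappa> k) * d k) w) -
        (((\<Sum>j<m\<^sub>0 k. W k j w *v v k j w) - J (real (m\<^sub>0 k) * d k) w) + J t\<^sub>0 w))
      \<longlonglongrightarrow> (0 + J (max t\<^sub>0 (min (\<sigma> w) t\<^sub>1)) w) - (0 + J t\<^sub>0 w)"
      by (intro tendsto_diff tendsto_add tendsto_const gl Jk \<kappa> m01)
    moreover have "J (max t\<^sub>0 (min (\<sigma> w) t\<^sub>1)) w - J t\<^sub>0 w = \<Delta>J w"
      unfolding \<Delta>J_def using t01 by (auto simp: max_def min_def)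
    ultimately show ?case unfolding \<kappa>(2) by (simp add: md)
  qed
  have H_lim: "AE w in M. \<forall>c. (\<lambda>k. (\<Sum>j\<in>?I (r k). H (r k) j w *v v (r k) j w) $ c) \<longlonglongrightarrow> \<Delta>J w $ c"
    using D_lim W_lim
  proof (eventually_elim, intro allI)
    fix w c
    assume l1: "\<forall>c. (\<lambda>k. (\<Sum>j\<in>?I (r k). D (r k) j w *v v (r k) j w) $ c) \<longlonglongrightarrow> 0"
      and l2: "(\<lambda>k. \<Sum>j\<in>?I k. if real j * d k < \<sigma> w then W k j w *v v k j w else 0) \<longlonglongrightarrow> \<Delta>J w"
    have "(\<Sum>j\<in>?I k. H k j w *v v k j w) = (\<Sum>j\<in>?I k. if real j * d k < \<sigma> w then W k j w *v v k j w else 0) -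
      (\<Sum>j\<in>?I k. D k j w *v v k j w)" for k
      unfolding sum_subtractf[symmetric] H_def D_def by (intro sum.cong) (auto simp: matrix_vector_mult_diff_rdistrib)
    moreover have "(\<lambda>k. (\<Sum>j\<in>?I (r k). if real j * d (r k) < \<sigma> w then W (r k) j w *v v (r k) j w else 0) $ c -
      (\<Sum>j\<in>?I (r k). D (r k) j w *v v (r k) j w) $ c) \<longlonglongrightarrow> \<Delta>J w $ c - 0"
      by (intro tendsto_diff tendsto_vec_nth l1[rule_format]) (use LIMSEQ_subseq_LIMSEQ[OF l2 r] in \<open>simp add: comp_def\<close>)
    ultimately show "(\<lambda>k. (\<Sum>j\<in>?I (r k). H (r k) j w *v v (r k) j w) $ c) \<longlonglongrightarrow> \<Delta>J w $ c" by simp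
  qed
  have Gs_lim: "AE w in M. (\<lambda>k. \<integral>\<^sup>+s\<in>{t\<^sub>0<..t\<^sub>1}. ennreal (norm (step_process (d k) (H k) s w - Gs s w)) \<partial>lborel) \<longlonglongrightarrow> 0"
    using e1 bound AE_space
  proof eventually_elim
    case (elim w)
    note [measurable] = sec[OF elim(3)] stepm
    \<comment> \<open>The second copy of the indicator is the constant factor in the Cauchy-Schwarz
      inequality that turns convergence in mean square over time into convergence in mean.\<close>
    define y where "y k = (\<integral>\<^sup>+s. ennreal (norm (?W k s w - ?G s w)) * indicator {0..t\<^sub>1} s * indicator {0..t\<^sub>1} s \<partial>lborel)" for k
    have ysq: "(y k)\<^sup>2 \<le> (\<integral>\<^sup>+s\<in>{0..t\<^sub>1}. ennreal ((norm (?W k s w - G s w))\<^sup>2) \<partial>lborel) * ennreal t\<^sub>1" for k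
    proof -
      have "(y k)\<^sup>2 \<le> (\<integral>\<^sup>+s. (ennreal (norm (?W k s w - ?G s w)) * indicator {0..t\<^sub>1} s)\<^sup>2 \<partial>lborel)
          * (\<integral>\<^sup>+s. (indicator {0..t\<^sub>1} s)\<^sup>2 \<partial>lborel)"
        unfolding y_def by (rule Cauchy_Schwarz_nn_integral) measurable
      also have "(\<integral>\<^sup>+s. (indicator {0..t\<^sub>1} s)\<^sup>2 \<partial>lborel) = ennreal t\<^sub>1"
        using t01 by (simp add: power2_eq_square flip: indicator_inter_arith)
      also have "(\<integral>\<^sup>+s. (ennreal (norm (?W k s w - ?G s w)) * indicator {0..t\<^sub>1} s)\<^sup>2 \<partial>lborel) =
        (\<integral>\<^sup>+s\<in>{0..t\<^sub>1}. ennreal ((norm (?W k s w - G s w))\<^sup>2) \<partial>lborel)"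
        by (intro nn_integral_cong) (auto simp: indicator_def power2_eq_square ennreal_mult)
      finally show ?thesis .
    qed
    have y0: "y \<longlonglongrightarrow> 0"
    proof (rule ennreal_tendsto_0_of_power2[OF ysq])
      show "(\<lambda>k. (\<integral>\<^sup>+s\<in>{0..t\<^sub>1}. ennreal ((norm (?W k s w - G s w))\<^sup>2) \<partial>lborel) * ennreal t\<^sub>1) \<longlonglongrightarrow> 0"
        using ennreal_tendsto_cmult[OF _ elim(1), of "ennreal t\<^sub>1"] by (simp add: mult.commute)
    qed
    have le: "(\<integral>\<^sup>+s\<in>{t\<^sub>0<..t\<^sub>1}. ennreal (norm (step_process (d k) (H k) s w - Gs s w)) \<partial>lborel) \<le> y k + ennreal ?K' * ennreal (d k)" for k
    proof -
      have "(\<integral>\<^sup>+s\<in>{t\<^sub>0<..t\<^sub>1}. ennreal (norm (step_process (d k) (H k) s w - Gs s w)) \<partial>lborel) \<le>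
        (\<integral>\<^sup>+s. ennreal (norm (?W k s w - ?G s w)) * indicator {0..t\<^sub>1} s * indicator {0..t\<^sub>1} s +
          ennreal ?K' * indicator (?\<sigma> k w) s \<partial>lborel)"
      proof (rule nn_integral_mono)
        fix s
        show "ennreal (norm (step_process (d k) (H k) s w - Gs s w)) * indicator {t\<^sub>0<..t\<^sub>1} s \<le>
          ennreal (norm (?W k s w - ?G s w)) * indicator {0..t\<^sub>1} s * indicator {0..t\<^sub>1} s +
          ennreal ?K' * indicator (?\<sigma> k w) s"
        proof (cases "t\<^sub>0 < s \<and> s \<le> t\<^sub>1")
          case True
          then have "0 < s" using t01 by simp
          then obtain j where j: "?W k s w = W k j w" "real j * d k < s" "s \<le> real j * d k + d k"
            "nat (\<lceil>s / d k\<rceil> - 1) = j" using pt by blast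
          have "norm (H k j w - Gs s w) \<le> norm (W k j w - G s w) + ?K' * indicator (?\<sigma> k w) s"
            unfolding H_def Gs_def
            by (rule stopped_clamp_estimates(2)[OF K _ j(2,3)]) (use elim(2) True in \<open>auto simp: t\<^sub>0_def t\<^sub>1_def\<close>)
          then have "ennreal (norm (H k j w - Gs s w)) \<le> ennreal (norm (W k j w - G s w) + ?K' * indicator (?\<sigma> k w) s)"
            by (rule ennreal_leI)
          also have "\<dots> = ennreal (norm (W k j w - G s w)) + ennreal ?K' * indicator (?\<sigma> k w) s"
            using K by (subst ennreal_plus) (auto simp: indicator_def)
          finally show ?thesis using True \<open>0 < s\<close> j by (simp add: step_process_def)
        qed simp
      qed
      also have "\<dots> = y k + ennreal ?K' * ennreal (d k)"
        unfolding y_def using d0[of k] by (subst nn_integral_add) (auto simp: nn_integral_cmult_indicator)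
      finally show ?thesis .
    qed
    have "(\<lambda>k. y k + ennreal ?K' * ennreal (d k)) \<longlonglongrightarrow> 0 + ennreal ?K' * ennreal 0"
      by (intro tendsto_add y0 ennreal_tendsto_cmult tendsto_ennrealI dlim) simp
    then have lim: "(\<lambda>k. y k + ennreal ?K' * ennreal (d k)) \<longlonglongrightarrow> 0" by simp
    show ?case by (rule tendsto_sandwich[OF _ _ tendsto_const lim]) (use le in auto)
  qed
  show thesis
  proof (rule that[of "\<lambda>k. q (r k)" "\<lambda>k. H (r k)"])
    show "0 < q (r k)" for k by (rule q0)
    show "H (r k) j \<in> borel_measurable (F (real j * (1 / real (N * q (r k)))))" if "i * q (r k) \<le> j" "j < i' * q (r k)" for k j
      using Hm[of "r k" j] that unfolding m\<^sub>0_def m\<^sub>1_def d_def by simp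
    show "\<bar>H (r k) j w $ a $ b\<bar> \<le> K" for k j w a b by (rule HK)
    show "AE w in M. \<forall>c. (\<lambda>k. (\<Sum>j=i * q (r k)..<i' * q (r k). H (r k) j w *v
       (B (real (Suc j) * (1 / real (N * q (r k)))) w - B (real j * (1 / real (N * q (r k)))) w)) $ c) \<longlonglongrightarrow> \<Delta>J w $ c"
      using H_lim unfolding m\<^sub>0_def m\<^sub>1_def d_def v_def .
    show "AE w in M. (\<lambda>k. \<integral>\<^sup>+s\<in>{t\<^sub>0<..t\<^sub>1}. ennreal (norm (step_process (1 / real (N * q (r k))) (H (r k)) s w - Gs s w)) \<partial>lborel) \<longlonglongrightarrow> 0"
      using Gs_lim
    proof eventually_elim
      case (elim w)
      show ?case using LIMSEQ_subseq_LIMSEQ[OF elim r] unfolding comp_def d_def .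
    qed
  qed
qed

end

lemma lebesgue_integral_step_process:
  fixes x :: "nat \<Rightarrow> real"
  assumes d: "0 < d" and "m\<^sub>0 \<le> m"
  shows "set_integrable lborel {real m\<^sub>0 * d<..real m * d} (\<lambda>s. step_process d (\<lambda>j _. x j) s w) \<and>
    (LINT s:{real m\<^sub>0 * d<..real m * d}|lborel. step_process d (\<lambda>j _. x j) s w) = (\<Sum>j=m\<^sub>0..<m. d * x j)"
  using \<open>m\<^sub>0 \<le> m\<close>
proof (induction m rule: dec_induct)
  case (step m)
  have "{x<..z} = {x<..y} \<union> {y<..z}" if "x \<le> y" "y \<le> z" for x y z :: real
    using that by auto
  then have u: "{real m\<^sub>0 * d<..real (Suc m) * d} = {real m\<^sub>0 * d<..real m * d} \<union> {real m * d<..real (Suc m) * d}"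
    using d step.hyps by (simp add: mult_right_mono)
  have eq: "indicator {real m * d<..real (Suc m) * d} s *\<^sub>R step_process d (\<lambda>j _. x j) s w =
      indicator {real m * d<..real (Suc m) * d} s *\<^sub>R x m" for s
    by (cases "s \<in> {real m * d<..real (Suc m) * d}") (auto simp: step_process_cell[OF d])
  have i: "set_integrable lborel {real m * d<..real (Suc m) * d} (\<lambda>s. step_process d (\<lambda>j _. x j) s w)"
    unfolding set_integrable_def eq using d by simp
  have v: "(LINT s:{real m * d<..real (Suc m) * d}|lborel. step_process d (\<lambda>j _. x j) s w) = d * x m"
    unfolding set_lebesgue_integral_def eq using d by (simp add: algebra_simps)
  show ?case
    using step i v unfolding u by (auto simp: set_integral_Un intro!: set_integrable_Un)
qed (simp add: set_integrable_def set_lebesgue_integral_def)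

lemma set_integrable_bounded:
  fixes f :: "real \<Rightarrow> real"
  assumes "(\<lambda>s. indicator {a<..b} s *\<^sub>R f s) \<in> borel_measurable borel" "\<And>s. s \<in> {a<..b} \<Longrightarrow> \<bar>f s\<bar> \<le> C" "a \<le> b"
  shows "set_integrable lborel {a<..b} f"
  unfolding set_integrable_def
  by (rule integrableI_bounded_set[where A="{a<..b}" and B=C])
    (use assms in \<open>auto simp: indicator_def\<close>)

lemma progressive_lebesgue_integral_measurable:
  fixes H :: "real \<Rightarrow> 'w \<Rightarrow> real"
  assumes "(\<lambda>(s, w). H s w) \<in> borel_measurable (restrict_space borel {a..b} \<Otimes>\<^sub>M M)"
  shows "(\<lambda>w. LINT s:{a..b}|lborel. H s w) \<in> borel_measurable M"
proof -
  interpret S: sigma_finite_measure "restrict_space lborel {a..b::real}"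
    by (rule sigma_finite_measure_restrict_space) (auto intro: lborel.sigma_finite_measure_axioms)
  have "(\<lambda>(s, w). H s w) \<in> borel_measurable (restrict_space lborel {a..b} \<Otimes>\<^sub>M M)"
    using assms measurable_cong_sets[OF sets_pair_measure_cong[OF sets_restrict_space_cong[OF sets_lborel] refl] refl]
    by blast
  then have "(\<lambda>(w, s). H s w) \<in> borel_measurable (M \<Otimes>\<^sub>M restrict_space lborel {a..b})"
    by (subst measurable_pair_swap_iff) (simp add: case_prod_beta')
  then have "(\<lambda>w. \<integral>s. H s w \<partial>restrict_space lborel {a..b}) \<in> borel_measurable M"
    by (rule S.borel_measurable_lebesgue_integral)
  then show ?thesis by (simp add: integral_restrict_space set_lebesgue_integral_def)
qed

lemma abs_sum_product_le:
  fixes f g :: "'b::finite \<Rightarrow> real"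
  assumes "\<And>b. \<bar>f b\<bar> \<le> K" "\<And>b. \<bar>g b\<bar> \<le> K"
  shows "\<bar>\<Sum>b\<in>UNIV. f b * g b\<bar> \<le> real CARD('b) * (K * K)"
proof -
  have "\<bar>\<Sum>b\<in>UNIV. f b * g b\<bar> \<le> (\<Sum>b\<in>UNIV. \<bar>f b * g b\<bar>)" by (rule sum_abs)
  also have "\<dots> \<le> of_nat (card (UNIV :: 'b set)) * (K * K)"
  proof (rule sum_bounded_above)
    fix b
    show "\<bar>f b * g b\<bar> \<le> K * K"
      unfolding abs_mult using assms[of b] by (intro mult_mono) (auto intro: order_trans[OF abs_ge_zero])
  qed
  finally show ?thesis .
qed

section \<open>Moments of the stopped increment\<close>

context stopped_ito
begin

text \<open>The covariation over the cell of the components \<open>a\<close> and \<open>c\<close> of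
  the stopped integral.\<close>

definition QV where "QV a c w = (LINT s:{t\<^sub>0<..t\<^sub>1}|lborel. \<Sum>b\<in>UNIV. Gs s w $ a $ b * Gs s w $ c $ b)"

lemma QV_measurable: "QV a c \<in> borel_measurable M"
proof -
  have f: "fst \<in> restrict_space borel {0..t\<^sub>1} \<Otimes>\<^sub>M M \<rightarrow>\<^sub>M borel"
    by (rule measurable_compose[OF measurable_fst]) (rule measurable_restrict_space1, simp)
  have g: "(\<lambda>x. Gs (fst x) (snd x)) \<in> borel_measurable (restrict_space borel {0..t\<^sub>1} \<Otimes>\<^sub>M M)"
    using Gs_measurable by (simp add: case_prod_beta')
  have "(\<lambda>w. LINT s:{0..t\<^sub>1}|lborel. indicator {t\<^sub>0<..t\<^sub>1} s * (\<Sum>b\<in>UNIV. Gs s w $ a $ b * Gs s w $ c $ b)) \<in> borel_measurable M"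
    by (rule progressive_lebesgue_integral_measurable) (unfold case_prod_beta', use f g in measurable)
  moreover have "(LINT s:{0..t\<^sub>1}|lborel. indicator {t\<^sub>0<..t\<^sub>1} s * (\<Sum>b\<in>UNIV. Gs s w $ a $ b * Gs s w $ c $ b)) = QV a c w" for w
    unfolding QV_def set_lebesgue_integral_def
    by (intro Bochner_Integration.integral_cong) (use t01 in \<open>auto simp: indicator_def\<close>)
  ultimately show ?thesis by simp
qed

lemma Gs_section:
  assumes "w \<in> space M"
  shows "(\<lambda>s. indicator {t\<^sub>0<..t\<^sub>1} s *\<^sub>R Gs s w) \<in> borel_measurable borel"
proof -
  have "(\<lambda>s. Gs s w) \<in> borel_measurable (restrict_space borel {0..t\<^sub>1})"
    using measurable_compose[OF measurable_Pair2'[OF assms] Gs_measurable] by simp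
  then have [measurable]: "(\<lambda>s. indicator {0..t\<^sub>1} s *\<^sub>R Gs s w) \<in> borel_measurable borel"
    by (subst borel_measurable_restrict_space_iff[symmetric]) auto
  have m: "(\<lambda>s. indicator {t\<^sub>0<..t\<^sub>1} s *\<^sub>R (indicator {0..t\<^sub>1} s *\<^sub>R Gs s w)) \<in> borel_measurable borel" by measurable
  have eq: "indicator {t\<^sub>0<..t\<^sub>1} s *\<^sub>R (indicator {0..t\<^sub>1} s *\<^sub>R Gs s w) = indicator {t\<^sub>0<..t\<^sub>1} s *\<^sub>R Gs s w" for s
    using t01 by (simp add: indicator_def)
  show ?thesis using m unfolding eq .
qed

text \<open>For entries bounded by \<open>K\<close> a product of two entries changes by at most
  \<open>2 * K\<close> times the distance of the matrices, so convergence of the integrands in mean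
  suffices.\<close>

lemma QV_tendsto:
  fixes h :: "nat \<Rightarrow> real \<Rightarrow> real ^ 'm ^ 'd"
  assumes w: "w \<in> space M" and b: "\<And>s. t\<^sub>0 < s \<Longrightarrow> s \<le> t\<^sub>1 \<Longrightarrow> norm (Gs s w) \<le> K"
    and hm: "\<And>k. h k \<in> borel_measurable borel" and hK: "\<And>k s a b. \<bar>h k s $ a $ b\<bar> \<le> K"
    and lim: "(\<lambda>k. \<integral>\<^sup>+s\<in>{t\<^sub>0<..t\<^sub>1}. ennreal (norm (h k s - Gs s w)) \<partial>lborel) \<longlonglongrightarrow> 0"
  shows "(\<lambda>k. LINT s:{t\<^sub>0<..t\<^sub>1}|lborel. \<Sum>b\<in>UNIV. h k s $ a $ b * h k s $ c $ b) \<longlonglongrightarrow> QV a c w"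
proof -
  let ?m = "real CARD('m)"
  have gK: "\<bar>Gs s w $ a $ b\<bar> \<le> K" if "s \<in> {t\<^sub>0<..t\<^sub>1}" for s a b
    using order_trans[OF abs_entry_le_norm b[of s]] that by auto
  note gm = Gs_section[OF w]
  have gme: "(\<lambda>s. indicator {t\<^sub>0<..t\<^sub>1} s * Gs s w $ a $ b) \<in> borel_measurable borel" for a b
    using measurable_vec_nth[OF measurable_vec_nth[OF gm, of a], of b] by simp
  have i1: "set_integrable lborel {t\<^sub>0<..t\<^sub>1} (\<lambda>s. \<Sum>b\<in>UNIV. Gs s w $ a $ b * Gs s w $ c $ b)"
  proof (rule set_integrable_bounded[where C="?m * (K * K)"])
    have "(\<lambda>s. \<Sum>b\<in>UNIV. (indicator {t\<^sub>0<..t\<^sub>1} s * Gs s w $ a $ b) * (indicator {t\<^sub>0<..t\<^sub>1} s * Gs s w $ c $ b)) \<in> borel_measurable borel"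
      using gme by measurable
    moreover have "(\<Sum>b\<in>UNIV. (indicator {t\<^sub>0<..t\<^sub>1} s * Gs s w $ a $ b) * (indicator {t\<^sub>0<..t\<^sub>1} s * Gs s w $ c $ b)) =
      indicator {t\<^sub>0<..t\<^sub>1} s *\<^sub>R (\<Sum>b\<in>UNIV. Gs s w $ a $ b * Gs s w $ c $ b)" for s
      by (simp add: indicator_def)
    ultimately show "(\<lambda>s. indicator {t\<^sub>0<..t\<^sub>1} s *\<^sub>R (\<Sum>b\<in>UNIV. Gs s w $ a $ b * Gs s w $ c $ b)) \<in> borel_measurable borel" by (simp only:)
    show "\<bar>\<Sum>b\<in>UNIV. Gs s w $ a $ b * Gs s w $ c $ b\<bar> \<le> ?m * (K * K)" if "s \<in> {t\<^sub>0<..t\<^sub>1}" for s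
      by (rule abs_sum_product_le[OF gK[OF that] gK[OF that]])
  qed (use t01 in auto)
  have i2: "set_integrable lborel {t\<^sub>0<..t\<^sub>1} (\<lambda>s. \<Sum>b\<in>UNIV. h k s $ a $ b * h k s $ c $ b)" for k
  proof (rule set_integrable_bounded[where C="?m * (K * K)"])
    show "(\<lambda>s. indicator {t\<^sub>0<..t\<^sub>1} s *\<^sub>R (\<Sum>b\<in>UNIV. h k s $ a $ b * h k s $ c $ b)) \<in> borel_measurable borel"
      using hm[of k] by measurable
    show "\<bar>\<Sum>b\<in>UNIV. h k s $ a $ b * h k s $ c $ b\<bar> \<le> ?m * (K * K)" for s
      by (rule abs_sum_product_le[OF hK hK])
  qed (use t01 in auto)
  have i3: "set_integrable lborel {t\<^sub>0<..t\<^sub>1} (\<lambda>s. norm (h k s - Gs s w))" for k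
  proof (rule set_integrable_bounded[where C="real CARD('d) * (?m * K) + K"])
    have "(\<lambda>s. norm (indicator {t\<^sub>0<..t\<^sub>1} s *\<^sub>R h k s - indicator {t\<^sub>0<..t\<^sub>1} s *\<^sub>R Gs s w)) \<in> borel_measurable borel"
      using gm hm[of k] by measurable
    then show "(\<lambda>s. indicator {t\<^sub>0<..t\<^sub>1} s *\<^sub>R norm (h k s - Gs s w)) \<in> borel_measurable borel"
      by (simp flip: scaleR_right_diff_distrib)
    show "\<bar>norm (h k s - Gs s w)\<bar> \<le> real CARD('d) * (?m * K) + K" if "s \<in> {t\<^sub>0<..t\<^sub>1}" for s
      using norm_triangle_ineq4[of "h k s" "Gs s w"] norm_matrix_le_entries[of "h k s", OF hK] b[of s] that by auto
  qed (use t01 in auto)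
  have nn: "ennreal (LINT s:{t\<^sub>0<..t\<^sub>1}|lborel. norm (h k s - Gs s w)) = (\<integral>\<^sup>+s\<in>{t\<^sub>0<..t\<^sub>1}. ennreal (norm (h k s - Gs s w)) \<partial>lborel)" for k
    unfolding set_lebesgue_integral_def
    by (subst nn_integral_eq_integral[symmetric])
      (use i3[of k, unfolded set_integrable_def] in \<open>auto intro!: nn_integral_cong simp: indicator_def\<close>)
  have lim': "(\<lambda>k. LINT s:{t\<^sub>0<..t\<^sub>1}|lborel. norm (h k s - Gs s w)) \<longlonglongrightarrow> 0"
    using lim unfolding nn[symmetric]
    by (subst (asm) ennreal_tendsto_0_iff) (auto simp: set_lebesgue_integral_def intro!: Bochner_Integration.integral_nonneg)
  have pt: "\<bar>(\<Sum>b\<in>UNIV. h k s $ a $ b * h k s $ c $ b) - (\<Sum>b\<in>UNIV. Gs s w $ a $ b * Gs s w $ c $ b)\<bar> \<le> ?m * (2 * K) * norm (h k s - Gs s w)"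
    if s: "s \<in> {t\<^sub>0<..t\<^sub>1}" for k s
  proof -
    have "\<bar>h k s $ a $ b * h k s $ c $ b - Gs s w $ a $ b * Gs s w $ c $ b\<bar> \<le> 2 * K * norm (h k s - Gs s w)" for b
    proof -
      have e: "\<bar>h k s $ x $ b - Gs s w $ x $ b\<bar> \<le> norm (h k s - Gs s w)" for x
        using abs_entry_le_norm[of "h k s - Gs s w" x b] by simp
      have "h k s $ a $ b * h k s $ c $ b - Gs s w $ a $ b * Gs s w $ c $ b =
        h k s $ a $ b * (h k s $ c $ b - Gs s w $ c $ b) + (h k s $ a $ b - Gs s w $ a $ b) * Gs s w $ c $ b"
        by (simp add: algebra_simps)
      also have "\<bar>\<dots>\<bar> \<le> K * norm (h k s - Gs s w) + norm (h k s - Gs s w) * K"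
        by (rule order_trans[OF abs_triangle_ineq]) (unfold abs_mult, intro add_mono mult_mono e hK gK s K; simp)
      finally show ?thesis by (simp add: algebra_simps)
    qed
    then have "(\<Sum>b\<in>UNIV. \<bar>h k s $ a $ b * h k s $ c $ b - Gs s w $ a $ b * Gs s w $ c $ b\<bar>) \<le> ?m * (2 * K * norm (h k s - Gs s w))"
      using sum_bounded_above[of UNIV "\<lambda>b. \<bar>h k s $ a $ b * h k s $ c $ b - Gs s w $ a $ b * Gs s w $ c $ b\<bar>"] by simp
    then have "\<bar>\<Sum>b\<in>UNIV. h k s $ a $ b * h k s $ c $ b - Gs s w $ a $ b * Gs s w $ c $ b\<bar> \<le> ?m * (2 * K * norm (h k s - Gs s w))"
      by (rule order_trans[OF sum_abs])
    then show ?thesis by (simp add: sum_subtractf mult.assoc)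
  qed
  show ?thesis
  proof (rule LIM_zero_cancel, rule Lim_null_comparison)
    have "\<bar>(LINT s:{t\<^sub>0<..t\<^sub>1}|lborel. \<Sum>b\<in>UNIV. h k s $ a $ b * h k s $ c $ b) - QV a c w\<bar> \<le>
      ?m * (2 * K) * (LINT s:{t\<^sub>0<..t\<^sub>1}|lborel. norm (h k s - Gs s w))" for k
    proof -
      have "(LINT s:{t\<^sub>0<..t\<^sub>1}|lborel. \<Sum>b\<in>UNIV. h k s $ a $ b * h k s $ c $ b) - QV a c w =
        (LINT s:{t\<^sub>0<..t\<^sub>1}|lborel. (\<Sum>b\<in>UNIV. h k s $ a $ b * h k s $ c $ b) - (\<Sum>b\<in>UNIV. Gs s w $ a $ b * Gs s w $ c $ b))"
        unfolding QV_def by (rule set_integral_diff(2)[OF i2 i1, symmetric])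
      also have "\<bar>\<dots>\<bar> \<le> (LINT s:{t\<^sub>0<..t\<^sub>1}|lborel. ?m * (2 * K) * norm (h k s - Gs s w))"
        unfolding set_lebesgue_integral_def
      proof (rule integral_abs_bound_integral)
        show "integrable lborel (\<lambda>s. indicator {t\<^sub>0<..t\<^sub>1} s *\<^sub>R ((\<Sum>b\<in>UNIV. h k s $ a $ b * h k s $ c $ b) - (\<Sum>b\<in>UNIV. Gs s w $ a $ b * Gs s w $ c $ b)))"
          using set_integral_diff(1)[OF i2 i1] unfolding set_integrable_def .
        show "integrable lborel (\<lambda>s. indicator {t\<^sub>0<..t\<^sub>1} s *\<^sub>R (?m * (2 * K) * norm (h k s - Gs s w)))"
          using set_integrable_mult_right[OF i3, of "?m * (2 * K)"] unfolding set_integrable_def by blast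
      qed (use pt in \<open>auto simp: indicator_def\<close>)
      finally show ?thesis by simp
    qed
    then show "\<forall>\<^sub>F k in sequentially. norm ((LINT s:{t\<^sub>0<..t\<^sub>1}|lborel. \<Sum>b\<in>UNIV. h k s $ a $ b * h k s $ c $ b) - QV a c w) \<le>
      ?m * (2 * K) * (LINT s:{t\<^sub>0<..t\<^sub>1}|lborel. norm (h k s - Gs s w))" by simp
    show "(\<lambda>k. ?m * (2 * K) * (LINT s:{t\<^sub>0<..t\<^sub>1}|lborel. norm (h k s - Gs s w))) \<longlonglongrightarrow> 0"
      by (rule tendsto_mult_right_zero[OF lim'])
  qed
qed

text \<open>For the approximating grid sums the identities hold exactly; almost sure convergence and
  uniformly bounded fourth moments carry them to the limit. The weight \<open>\<xi>\<close> stands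
  for conditioning on \<open>F t\<^sub>0\<close>.\<close>

lemma \<Delta>J_moments:
  assumes \<xi>: "\<xi> \<in> borel_measurable (F t\<^sub>0)" "\<And>w. w \<in> space M \<Longrightarrow> \<bar>\<xi> w\<bar> \<le> A"
  shows "integrable M (\<lambda>w. (\<Delta>J w $ a) ^ 4)"
    and "expectation (\<lambda>w. (\<Delta>J w $ a) ^ 4) \<le> 3 * real CARD('m) ^ 4 * K ^ 4 * (t\<^sub>1 - t\<^sub>0)\<^sup>2"
    and "expectation (\<lambda>w. \<xi> w * \<Delta>J w $ a) = 0"
    and "expectation (\<lambda>w. \<xi> w * (\<Delta>J w $ a * \<Delta>J w $ c)) = expectation (\<lambda>w. \<xi> w * QV a c w)"
proof -
  obtain H q where q: "\<And>k. 0 < q k"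
    and Hm: "\<And>k j. i * q k \<le> j \<Longrightarrow> j < i' * q k \<Longrightarrow> H k j \<in> borel_measurable (F (real j * (1 / real (N * q k))))"
    and HK: "\<And>k j w a b. \<bar>H k j w $ a $ b\<bar> \<le> K"
    and Hl: "AE w in M. \<forall>c. (\<lambda>k. (\<Sum>j=i * q k..<i' * q k. H k j w *v
       (B (real (Suc j) * (1 / real (N * q k))) w - B (real j * (1 / real (N * q k))) w)) $ c) \<longlonglongrightarrow> \<Delta>J w $ c"
    and Hs: "AE w in M. (\<lambda>k. \<integral>\<^sup>+s\<in>{t\<^sub>0<..t\<^sub>1}. ennreal (norm (step_process (1 / real (N * q k)) (H k) s w - Gs s w)) \<partial>lborel) \<longlonglongrightarrow> 0"
    by (rule approximation) (rule that; assumption)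
  define d where "d k = 1 / real (N * q k)" for k
  have d0: "0 < d k" for k using N q by (simp add: d_def)
  have md: "real (i * q k) * d k = t\<^sub>0" "real (i' * q k) * d k = t\<^sub>1" for k
    using q[of k] N by (simp_all add: d_def t\<^sub>0_def t\<^sub>1_def)
  have m01: "i * q k \<le> i' * q k" for k using ii' by simp
  note Hm = Hm[folded d_def] and Hl = Hl[folded d_def] and Hs = Hs[folded d_def]
  define S where "S k c w = (\<Sum>j=i * q k..<i' * q k. \<Sum>b\<in>UNIV. H k j w $ c $ b * dB (d k) b j w)" for k c w
  have Hl: "AE w in M. \<forall>c. (\<lambda>k. S k c w) \<longlonglongrightarrow> \<Delta>J w $ c"
    using Hl unfolding S_def dB_def[OF d0] by (simp add: matrix_vector_mult_def)
  define C where "C = 3 * real CARD('m) ^ 4 * K ^ 4 * (t\<^sub>1 - t\<^sub>0)\<^sup>2"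
  have len: "d k * real (i' * q k - i * q k) = t\<^sub>1 - t\<^sub>0" for k
    using md[of k] m01[of k] by (simp add: of_nat_diff right_diff_distrib mult.commute del: of_nat_mult)
  have \<xi>k: "\<xi> \<in> borel_measurable (F (real (i * q k) * d k))" for k using \<xi>(1) unfolding md .
  have S: "S k c \<in> borel_measurable (F (real (i' * q k) * d k))" "integrable M (\<lambda>w. S k c w ^ 4)"
    "expectation (\<lambda>w. S k c w ^ 4) \<le> C"
    "expectation (\<lambda>w. \<xi> w * S k c w) = 0"
    "expectation (\<lambda>w. \<xi> w * (S k a w * S k c w)) =
      (\<Sum>j=i * q k..<i' * q k. \<Sum>b\<in>UNIV. d k * expectation (\<lambda>w. \<xi> w * (H k j w $ a $ b * H k j w $ c $ b)))" for k a c
    using martingale_transform_covariance(1-4)[OF d0[of k], where K=K and W="H k" and \<xi>=\<xi> and C=A and m\<^sub>0="i * q k" and m="i' * q k" and a=c, OF Hm HK m01 \<xi>k \<xi>(2)]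
      martingale_transform_covariance(5)[OF d0[of k], where K=K and W="H k" and \<xi>=\<xi> and C=A and m\<^sub>0="i * q k" and m="i' * q k" and a=a and c=c, OF Hm HK m01 \<xi>k \<xi>(2)]
    unfolding S_def C_def len by auto
  have SM: "S k c \<in> borel_measurable M" for k c using measurable_F_M[OF S(1)] md t01 by simp
  have \<xi>M: "\<xi> \<in> borel_measurable M" using measurable_F_M[OF \<xi>(1)] t01 by simp
  have JM: "(\<lambda>w. \<Delta>J w $ c) \<in> borel_measurable M" for c using \<Delta>J_measurable by measurable
  have lim: "AE w in M. (\<lambda>k. S k c w) \<longlonglongrightarrow> \<Delta>J w $ c" for c using Hl by eventually_elim auto
  have lim2: "AE w in M. (\<lambda>k. S k a w * S k c w) \<longlonglongrightarrow> \<Delta>J w $ a * \<Delta>J w $ c" for a c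
    using Hl by eventually_elim (auto intro: tendsto_mult)
  have S2: "integrable M (\<lambda>w. (S k c w)\<^sup>2)" for k c by (rule integrable_power_le[OF S(2) SM]) simp
  have ES2: "expectation (\<lambda>w. (S k c w)\<^sup>2) \<le> 1 + C" for k c
  proof -
    have "expectation (\<lambda>w. (S k c w)\<^sup>2) \<le> expectation (\<lambda>w. 1 + S k c w ^ 4)"
    proof (intro integral_mono S2 Bochner_Integration.integrable_add S(2))
      have "x\<^sup>2 \<le> 1 + x ^ 4" for x :: real
      proof -
        have "x ^ 4 = (x\<^sup>2)\<^sup>2" by (simp flip: power_mult)
        moreover have "0 \<le> (x\<^sup>2)\<^sup>2 + 1 - 2 * x\<^sup>2" using zero_le_power2[of "x\<^sup>2 - 1"] by (simp add: power2_diff)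
        ultimately show ?thesis using zero_le_power2[of x] by linarith
      qed
      then show "(S k c w)\<^sup>2 \<le> 1 + S k c w ^ 4" for w .
    qed simp
    also have "\<dots> = 1 + expectation (\<lambda>w. S k c w ^ 4)" using S(2) by (simp add: prob_space)
    finally show ?thesis using S(3)[of k c] by linarith
  qed
  \<comment> \<open>Fourth moments bound the second moment of a product of two components, which is
    what the convergence of its mean requires.\<close>
  have p4: "((S k a w) * (S k c w))\<^sup>2 \<le> S k a w ^ 4 + S k c w ^ 4" for k a c w
  proof -
    have "2 * (x\<^sup>2 * y\<^sup>2) \<le> (x\<^sup>2)\<^sup>2 + (y\<^sup>2)\<^sup>2" for x y :: real
      using sum_squares_bound[of "x\<^sup>2" "y\<^sup>2"] by simp
    then have "2 * ((S k a w)\<^sup>2 * (S k c w)\<^sup>2) \<le> S k a w ^ 4 + S k c w ^ 4" by (simp flip: power_mult)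
    moreover have "0 \<le> (S k a w)\<^sup>2 * (S k c w)\<^sup>2" by simp
    ultimately show ?thesis unfolding power_mult_distrib by linarith
  qed
  have SS2: "integrable M (\<lambda>w. ((S k a w) * (S k c w))\<^sup>2)" for k a c
  proof (rule Bochner_Integration.integrable_bound)
    show "integrable M (\<lambda>w. S k a w ^ 4 + S k c w ^ 4)" using S(2) by auto
    show "(\<lambda>w. ((S k a w) * (S k c w))\<^sup>2) \<in> borel_measurable M" using SM by auto
    show "AE w in M. norm (((S k a w) * (S k c w))\<^sup>2) \<le> norm (S k a w ^ 4 + S k c w ^ 4)"
      by (rule AE_I2) (use p4 in \<open>auto intro: order_trans[OF _ abs_ge_self]\<close>)
  qed
  have ESS2: "expectation (\<lambda>w. ((S k a w) * (S k c w))\<^sup>2) \<le> C + C" for k a c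
  proof -
    have "expectation (\<lambda>w. ((S k a w) * (S k c w))\<^sup>2) \<le> expectation (\<lambda>w. S k a w ^ 4 + S k c w ^ 4)"
      by (intro integral_mono SS2 Bochner_Integration.integrable_add S(2) p4)
    also have "\<dots> = expectation (\<lambda>w. S k a w ^ 4) + expectation (\<lambda>w. S k c w ^ 4)" using S(2) by simp
    finally show ?thesis using S(3)[of k a] S(3)[of k c] by linarith
  qed
  have "(\<lambda>k. expectation (\<lambda>w. \<xi> w * S k a w)) \<longlonglongrightarrow> expectation (\<lambda>w. \<xi> w * \<Delta>J w $ a)"
    by (rule expectation_tendsto_of_L2_bounded(3)[OF SM JM lim S2 ES2 \<xi>M \<xi>(2)])
  then show "expectation (\<lambda>w. \<xi> w * \<Delta>J w $ a) = 0"
    unfolding S(4) by (simp add: LIMSEQ_const_iff)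
  have S4: "integrable M (\<lambda>w. ((S k a w)\<^sup>2)\<^sup>2)" "expectation (\<lambda>w. ((S k a w)\<^sup>2)\<^sup>2) \<le> C" for k
    using S(2,3)[of k a] by (simp_all flip: power_mult)
  have lim4: "AE w in M. (\<lambda>k. (S k a w)\<^sup>2) \<longlonglongrightarrow> (\<Delta>J w $ a)\<^sup>2"
    using Hl by eventually_elim (auto intro: tendsto_power)
  have SM2: "(\<lambda>w. (S k a w)\<^sup>2) \<in> borel_measurable M" for k using SM by auto
  have JM2: "(\<lambda>w. (\<Delta>J w $ a)\<^sup>2) \<in> borel_measurable M" using JM by auto
  show "integrable M (\<lambda>w. (\<Delta>J w $ a) ^ 4)"
    using expectation_tendsto_of_L2_bounded(1)[OF SM2 JM2 lim4 S4 \<xi>M \<xi>(2)] by (simp flip: power_mult)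
  show "expectation (\<lambda>w. (\<Delta>J w $ a) ^ 4) \<le> 3 * real CARD('m) ^ 4 * K ^ 4 * (t\<^sub>1 - t\<^sub>0)\<^sup>2"
    using expectation_tendsto_of_L2_bounded(2)[OF SM2 JM2 lim4 S4 \<xi>M \<xi>(2)] unfolding C_def by (simp flip: power_mult)
  have SSM: "(\<lambda>w. S k a w * S k c w) \<in> borel_measurable M" for k using SM by auto
  have JJM: "(\<lambda>w. \<Delta>J w $ a * \<Delta>J w $ c) \<in> borel_measurable M" using JM by auto
  have l1: "(\<lambda>k. expectation (\<lambda>w. \<xi> w * (S k a w * S k c w))) \<longlonglongrightarrow> expectation (\<lambda>w. \<xi> w * (\<Delta>J w $ a * \<Delta>J w $ c))"
    by (rule expectation_tendsto_of_L2_bounded(3)[OF SSM JJM lim2 SS2 ESS2 \<xi>M \<xi>(2)])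
  \<comment> \<open>The discrete covariation: it is the integral of a step process over the cell and
    hence converges to \<open>QV\<close>.\<close>
  define Q where "Q k w = (\<Sum>j=i * q k..<i' * q k. d k * (\<Sum>b\<in>UNIV. H k j w $ a $ b * H k j w $ c $ b))" for k w
  have HM: "H k j \<in> borel_measurable M" if "j \<in> {i * q k..<i' * q k}" for k j
    using measurable_F_M[OF Hm[of k j]] that d0[of k] by simp
  have QM: "Q k \<in> borel_measurable M" for k
  proof -
    have "(\<lambda>w. d k * (\<Sum>b\<in>UNIV. H k j w $ a $ b * H k j w $ c $ b)) \<in> borel_measurable M" if "j \<in> {i * q k..<i' * q k}" for j
      using HM[OF that] by measurable
    then show ?thesis unfolding Q_def[abs_def] by (intro borel_measurable_sum) auto
  qed
  have Qb: "\<bar>Q k w\<bar> \<le> (t\<^sub>1 - t\<^sub>0) * (real CARD('m) * (K * K))" for k w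
  proof -
    have "\<bar>Q k w\<bar> \<le> (\<Sum>j=i * q k..<i' * q k. \<bar>d k * (\<Sum>b\<in>UNIV. H k j w $ a $ b * H k j w $ c $ b)\<bar>)"
      unfolding Q_def by (rule sum_abs)
    also have "\<dots> \<le> of_nat (card {i * q k..<i' * q k}) * (d k * (real CARD('m) * (K * K)))"
    proof (rule sum_bounded_above)
      fix j
      show "\<bar>d k * (\<Sum>b\<in>UNIV. H k j w $ a $ b * H k j w $ c $ b)\<bar> \<le> d k * (real CARD('m) * (K * K))"
        unfolding abs_mult abs_of_pos[OF d0] using d0[of k] by (intro mult_left_mono abs_sum_product_le HK) simp
    qed
    also have "\<dots> = (d k * real (i' * q k - i * q k)) * (real CARD('m) * (K * K))" by simp
    also have "\<dots> = (t\<^sub>1 - t\<^sub>0) * (real CARD('m) * (K * K))" unfolding len ..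
    finally show ?thesis .
  qed
  have Qe: "expectation (\<lambda>w. \<xi> w * (S k a w * S k c w)) = expectation (\<lambda>w. \<xi> w * Q k w)" for k
  proof -
    have ie: "integrable M (\<lambda>w. \<xi> w * (H k j w $ a $ b * H k j w $ c $ b))" if j: "j \<in> {i * q k..<i' * q k}" for j b
    proof (rule integrable_bounded)
      show "(\<lambda>w. \<xi> w * (H k j w $ a $ b * H k j w $ c $ b)) \<in> borel_measurable M" using HM[OF j] \<xi>M by measurable
      show "\<bar>\<xi> w * (H k j w $ a $ b * H k j w $ c $ b)\<bar> \<le> A * (K * K)" if "w \<in> space M" for w
        unfolding abs_mult using K by (intro mult_mono HK \<xi>(2)[OF that] order_trans[OF abs_ge_zero \<xi>(2)[OF that]]) auto
    qed
    have "(\<lambda>w. \<xi> w * Q k w) = (\<lambda>w. \<Sum>j=i * q k..<i' * q k. \<Sum>b\<in>UNIV. d k * (\<xi> w * (H k j w $ a $ b * H k j w $ c $ b)))"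
      unfolding Q_def by (simp add: sum_distrib_left mult_ac)
    then have "expectation (\<lambda>w. \<xi> w * Q k w) =
      (\<Sum>j=i * q k..<i' * q k. \<Sum>b\<in>UNIV. d k * expectation (\<lambda>w. \<xi> w * (H k j w $ a $ b * H k j w $ c $ b)))"
      using ie by (simp add: Bochner_Integration.integral_sum)
    then show ?thesis unfolding S(5) by simp
  qed
  have Ql: "AE w in M. (\<lambda>k. Q k w) \<longlonglongrightarrow> QV a c w"
    using Hs bound AE_space
  proof eventually_elim
    case (elim w)
    have "Q k w = (LINT s:{t\<^sub>0<..t\<^sub>1}|lborel. \<Sum>b\<in>UNIV. step_process (d k) (H k) s w $ a $ b * step_process (d k) (H k) s w $ c $ b)" for k
      using lebesgue_integral_step_process[OF d0[of k] m01[of k], of "\<lambda>j. \<Sum>b\<in>UNIV. H k j w $ a $ b * H k j w $ c $ b" w]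
      unfolding md by (simp add: Q_def step_process_def)
    then show ?case
    proof (simp only:, intro QV_tendsto[OF elim(3)])
      show "norm (Gs s w) \<le> K" if "t\<^sub>0 < s" "s \<le> t\<^sub>1" for s
        using elim(2) that K by (auto simp: Gs_def t\<^sub>0_def t\<^sub>1_def)
      show "(\<lambda>s. step_process (d k) (H k) s w) \<in> borel_measurable borel" for k
        unfolding step_process_def by measurable
      show "\<bar>step_process (d k) (H k) s w $ a $ b\<bar> \<le> K" for k s a b
        unfolding step_process_def by (rule HK)
    qed (rule elim(1))
  qed
  have "(\<lambda>k. expectation (\<lambda>w. \<xi> w * Q k w)) \<longlonglongrightarrow> expectation (\<lambda>w. \<xi> w * QV a c w)"
  proof (rule integral_dominated_convergence[where w="\<lambda>_. A * ((t\<^sub>1 - t\<^sub>0) * (real CARD('m) * (K * K)))"])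
    show "AE w in M. (\<lambda>k. \<xi> w * Q k w) \<longlonglongrightarrow> \<xi> w * QV a c w"
      using Ql by eventually_elim (rule tendsto_mult_left)
    show "AE w in M. norm (\<xi> w * Q k w) \<le> A * ((t\<^sub>1 - t\<^sub>0) * (real CARD('m) * (K * K)))" for k
    proof (rule AE_I2)
      fix w assume "w \<in> space M"
      then show "norm (\<xi> w * Q k w) \<le> A * ((t\<^sub>1 - t\<^sub>0) * (real CARD('m) * (K * K)))"
        unfolding real_norm_def abs_mult
        by (intro mult_mono Qb \<xi>(2)) (auto intro: order_trans[OF abs_ge_zero \<xi>(2)])
    qed
  qed (use \<xi>M QM QV_measurable in auto)
  with l1 show "expectation (\<lambda>w. \<xi> w * (\<Delta>J w $ a * \<Delta>J w $ c)) = expectation (\<lambda>w. \<xi> w * QV a c w)"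
    unfolding Qe by (rule LIMSEQ_unique)
qed

end

subsection \<open>Taylor expansion\<close>

text \<open>Moves the base point along the axis, turning the derivative at parameter 0 into one at
  parameter \<open>s\<close>.\<close>

lemma has_partial_shift:
  assumes "has_partial k u (z + s *\<^sub>R axis k 1)"
  shows "((\<lambda>s. u (z + s *\<^sub>R axis k 1)) has_field_derivative partial_deriv k u (z + s *\<^sub>R axis k 1)) (at s)"
proof -
  have "((\<lambda>r. u (z + s *\<^sub>R axis k 1 + r *\<^sub>R axis k 1)) has_field_derivative partial_deriv k u (z + s *\<^sub>R axis k 1)) (at 0)"
    using assms unfolding has_partial_def partial_deriv_def by (rule field_differentiable_derivI)
  then have "((\<lambda>r. u (z + (r + s) *\<^sub>R axis k 1)) has_field_derivative partial_deriv k u (z + s *\<^sub>R axis k 1)) (at (s - s))"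
    by (simp add: algebra_simps)
  then show ?thesis unfolding DERIV_shift[symmetric] by (simp add: DERIV_shift[of "\<lambda>s. u (z + s *\<^sub>R axis k 1)" _ 0 s, simplified])
qed

lemma norm_restrict_le: "norm ((\<Sum>k\<in>A. (h $ k) *\<^sub>R axis k 1) :: real ^ 'd) \<le> norm h" 
  for h :: "real ^ 'd"
proof (rule norm_le_componentwise_cart)
  fix i
  have "(\<Sum>k\<in>A. (h $ k) *\<^sub>R axis k 1 :: real ^ 'd) $ i = (\<Sum>k\<in>A. if i = k then h $ k else 0)"
    unfolding sum_component by (intro sum.cong) (auto simp: axis_def)
  also have "\<dots> = (if i \<in> A then h $ i else 0)" by (subst sum.delta') auto
  finally show "norm ((\<Sum>k\<in>A. (h $ k) *\<^sub>R axis k 1 :: real ^ 'd) $ i) \<le> norm (h $ i)" by simp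
qed

text \<open>\<open>C21\<close> speaks of partial derivatives only, while an expansion along a
  segment needs the total derivative. Coordinates are changed one at a time; for each, the mean
  value inequality is applied to \<open>u\<close> minus its linear part, whose derivative is small
  by continuity of the partials.\<close>

lemma continuous_partials_imp_has_derivative:
  fixes u :: "real ^ 'd \<Rightarrow> real"
  assumes p: "\<And>k x. has_partial k u x" and c: "continuous_on UNIV (\<lambda>x. \<chi> k. partial_deriv k u x)"
  shows "(u has_derivative (\<lambda>h. (\<chi> k. partial_deriv k u x) \<bullet> h)) (at x)"
proof -
  let ?g = "\<lambda>k. partial_deriv k u"
  let ?r = "\<lambda>A h. \<Sum>k\<in>A. (h $ k) *\<^sub>R axis k 1 :: real ^ 'd"
  have gc: "\<exists>\<delta>>0. \<forall>z k. norm (z - x) < \<delta> \<longrightarrow> \<bar>?g k z - ?g k x\<bar> \<le> e" if e: "e > 0" for e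
  proof -
    have "\<exists>\<delta>>0. \<forall>z\<in>UNIV. dist z x < \<delta> \<longrightarrow> dist (\<chi> k. ?g k z) (\<chi> k. ?g k x) < e"
      using c e unfolding continuous_on_iff by blast
    then obtain \<delta> where \<delta>: "\<delta> > 0" "\<forall>z\<in>UNIV. dist z x < \<delta> \<longrightarrow> dist (\<chi> k. ?g k z) (\<chi> k. ?g k x) < e" by blast
    have le: "\<bar>?g k z - ?g k x\<bar> \<le> dist (\<chi> k. ?g k z) (\<chi> k. ?g k x)" for k z
      using component_le_norm_cart[of "(\<chi> k. ?g k z) - (\<chi> k. ?g k x)" k] by (simp add: dist_norm)
    show ?thesis
    proof (intro exI[of _ \<delta>] conjI allI impI)
      fix z k assume "norm (z - x) < \<delta>"
      then have "dist (\<chi> k. ?g k z) (\<chi> k. ?g k x) < e" using \<delta>(2) by (simp add: dist_norm)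
      then show "\<bar>?g k z - ?g k x\<bar> \<le> e" using le[of k z] by linarith
    qed (rule \<delta>(1))
  qed
  have step: "\<bar>u (x + ?r A h) - u x - (\<Sum>k\<in>A. ?g k x * h $ k)\<bar> \<le> real (card A) * (e * norm h)"
    if "finite A" and \<delta>: "\<And>z k. norm (z - x) < \<delta> \<Longrightarrow> \<bar>?g k z - ?g k x\<bar> \<le> e" and h: "norm h < \<delta>" and e: "0 < e" for A h \<delta> e
    using \<open>finite A\<close>
  proof induction
    case (insert j A)
    let ?z = "x + ?r A h"
    define \<psi> where "\<psi> s = u (?z + s *\<^sub>R axis j 1) - ?g j x * s" for s
    have d: "(\<psi> has_field_derivative (?g j (?z + s *\<^sub>R axis j 1) - ?g j x)) (at s within closed_segment 0 (h $ j))" for s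
      unfolding \<psi>_def
      by (rule has_field_derivative_at_within) (rule derivative_eq_intros has_partial_shift p | simp)+
    have b: "norm (?g j (?z + s *\<^sub>R axis j 1) - ?g j x) \<le> e" if s: "s \<in> closed_segment 0 (h $ j)" for s
    proof -
      obtain r where r: "0 \<le> r" "r \<le> 1" "s = r * h $ j" using s by (auto simp: in_segment)
      \<comment> \<open>The intermediate point differs from \<open>x\<close> by a vector whose
        coordinates are those of \<open>h\<close>, shrunk or dropped, so it stays within
        \<open>\<delta>\<close> of \<open>x\<close>.\<close>
      define h' where "h' = (\<chi> k. if k = j then r * h $ k else h $ k)"
      have "?r A h + s *\<^sub>R axis j 1 = ?r (insert j A) h'"
      proof -
        have "?r A h = ?r A h'" using insert.hyps by (intro sum.cong) (auto simp: h'_def)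
        then show ?thesis using insert.hyps r by (simp add: h'_def)
      qed
      then have "norm (?r A h + s *\<^sub>R axis j 1) \<le> norm h'" using norm_restrict_le by metis
      also have "norm h' \<le> norm h"
        using r by (intro norm_le_componentwise_cart) (auto simp: h'_def abs_mult mult_left_le_one_le)
      finally have "norm (?z + s *\<^sub>R axis j 1 - x) < \<delta>" using h by (simp add: algebra_simps)
      then show ?thesis using \<delta> by simp
    qed
    have "norm (\<psi> (h $ j) - \<psi> 0) \<le> e * norm (h $ j - 0)"
      by (rule field_differentiable_bound[OF convex_closed_segment d b]) auto
    also have "\<dots> \<le> e * norm h" using component_le_norm_cart[of h j] e by (intro mult_left_mono) auto
    finally have "\<bar>u (?z + (h $ j) *\<^sub>R axis j 1) - u ?z - ?g j x * h $ j\<bar> \<le> e * norm h"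
      by (simp add: \<psi>_def algebra_simps)
    moreover have "x + ?r (insert j A) h = ?z + (h $ j) *\<^sub>R axis j 1" using insert.hyps by (simp add: algebra_simps)
    ultimately show ?case using insert by (simp add: algebra_simps)
  qed simp
  show ?thesis
    unfolding has_derivative_at_alt
  proof (intro conjI allI impI bounded_linear_inner_right)
    fix e :: real assume e: "0 < e"
    let ?n = "real CARD('d)"
    have e': "e / ?n > 0" using e by simp
    obtain \<delta> where \<delta>: "\<delta> > 0" "\<And>z k. norm (z - x) < \<delta> \<Longrightarrow> \<bar>?g k z - ?g k x\<bar> \<le> e / ?n" using gc[OF e'] by auto
    show "\<exists>d>0. \<forall>y. norm (y - x) < d \<longrightarrow> norm (u y - u x - (\<chi> k. ?g k x) \<bullet> (y - x)) \<le> e * norm (y - x)"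
    proof (intro exI[of _ \<delta>] conjI allI impI)
      fix y assume y: "norm (y - x) < \<delta>"
      have r: "?r UNIV (y - x) = y - x" using basis_expansion[of "y - x"] by (simp add: scalar_mult_eq_scaleR)
      show "norm (u y - u x - (\<chi> k. ?g k x) \<bullet> (y - x)) \<le> e * norm (y - x)"
        using step[OF finite[of UNIV] \<delta>(2) y e'] unfolding r by (simp add: inner_vec_def)
    qed (rule \<delta>)
  qed
qed

text \<open>Maclaurin's formula along the segment from \<open>y\<close> to
  \<open>y + \<Delta>\<close>; the total derivative is used for \<open>u\<close> and once more for
  each of its partial derivatives.\<close>

lemma C2_taylor:
  fixes u :: "real ^ 'd \<Rightarrow> real"
  assumes p: "\<And>k x. has_partial k u x" and p2: "\<And>k l x. has_partial l (partial_deriv k u) x"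
    and c: "continuous_on UNIV (\<lambda>x. \<chi> k. partial_deriv k u x)"
    and c2: "continuous_on UNIV (\<lambda>x. (\<chi> l j. partial_deriv l (partial_deriv j u) x) :: real ^ 'd ^ 'd)"
  shows "\<exists>r\<in>{0<..<1}. u (y + \<Delta>) = u y + (\<chi> k. partial_deriv k u y) \<bullet> \<Delta> +
     1 / 2 * (\<Delta> \<bullet> ((\<chi> l j. partial_deriv l (partial_deriv j u) (y + r *\<^sub>R \<Delta>)) *v \<Delta>))"
proof -
  let ?g = "\<lambda>x. \<chi> k. partial_deriv k u x"
  let ?H = "\<lambda>x. (\<chi> l j. partial_deriv l (partial_deriv j u) x) :: real ^ 'd ^ 'd"
  have cj: "continuous_on UNIV (\<lambda>x. \<chi> l. partial_deriv l (partial_deriv j u) x)" for j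
  proof -
    have "continuous_on UNIV (\<lambda>x. \<chi> l. ?H x $ l $ j)" by (intro continuous_intros c2)
    then show ?thesis by simp
  qed
  have d1: "((\<lambda>s. u (y + s *\<^sub>R \<Delta>)) has_field_derivative ?g (y + s *\<^sub>R \<Delta>) \<bullet> \<Delta>) (at s)" for s
  proof -
    have "((\<lambda>s. u (y + s *\<^sub>R \<Delta>)) has_derivative (\<lambda>h. ?g (y + s *\<^sub>R \<Delta>) \<bullet> (h *\<^sub>R \<Delta>))) (at s)"
      by (rule has_derivative_compose[OF _ continuous_partials_imp_has_derivative[OF p c]])
        (auto intro!: derivative_eq_intros)
    then show ?thesis by (simp add: has_field_derivative_def mult.commute[of "_ \<bullet> _"] mult_commute_abs)
  qed
  have d2: "((\<lambda>s. ?g (y + s *\<^sub>R \<Delta>) \<bullet> \<Delta>) has_field_derivative \<Delta> \<bullet> (?H (y + s *\<^sub>R \<Delta>) *v \<Delta>)) (at s)" for s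
  proof -
    have e: "((\<lambda>s. partial_deriv j u (y + s *\<^sub>R \<Delta>)) has_field_derivative (\<chi> l. partial_deriv l (partial_deriv j u) (y + s *\<^sub>R \<Delta>)) \<bullet> \<Delta>) (at s)" for j
    proof -
      have "((\<lambda>s. partial_deriv j u (y + s *\<^sub>R \<Delta>)) has_derivative (\<lambda>h. (\<chi> l. partial_deriv l (partial_deriv j u) (y + s *\<^sub>R \<Delta>)) \<bullet> (h *\<^sub>R \<Delta>))) (at s)"
        by (rule has_derivative_compose[OF _ continuous_partials_imp_has_derivative[OF p2 cj]])
          (auto intro!: derivative_eq_intros)
      then show ?thesis by (simp add: has_field_derivative_def mult.commute[of "_ \<bullet> _"] mult_commute_abs)
    qed
    have "((\<lambda>s. \<Sum>j\<in>UNIV. partial_deriv j u (y + s *\<^sub>R \<Delta>) * \<Delta> $ j) has_field_derivative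
      (\<Sum>j\<in>UNIV. ((\<chi> l. partial_deriv l (partial_deriv j u) (y + s *\<^sub>R \<Delta>)) \<bullet> \<Delta>) * \<Delta> $ j)) (at s)"
      by (intro DERIV_sum DERIV_cmult_right e)
    moreover have "(\<Sum>j\<in>UNIV. ((\<chi> l. partial_deriv l (partial_deriv j u) (y + s *\<^sub>R \<Delta>)) \<bullet> \<Delta>) * \<Delta> $ j) = \<Delta> \<bullet> (?H (y + s *\<^sub>R \<Delta>) *v \<Delta>)"
      by (simp add: inner_vec_def matrix_vector_mult_def sum_distrib_left sum_distrib_right mult_ac) (subst sum.swap, simp add: mult_ac)
    ultimately show ?thesis by (simp add: inner_vec_def)
  qed
  define df where "df m = (if m = 0 then (\<lambda>s. u (y + s *\<^sub>R \<Delta>)) else if m = 1 then (\<lambda>s. ?g (y + s *\<^sub>R \<Delta>) \<bullet> \<Delta>)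
     else (\<lambda>s. \<Delta> \<bullet> (?H (y + s *\<^sub>R \<Delta>) *v \<Delta>)))" for m :: nat
  have "\<exists>t. 0 < t \<and> t < 1 \<and> u (y + 1 *\<^sub>R \<Delta>) = (\<Sum>m<2. df m 0 / fact m * 1 ^ m) + df 2 t / fact 2 * 1 ^ 2"
    by (rule Maclaurin[of 1 2 df "\<lambda>s. u (y + s *\<^sub>R \<Delta>)"]) (use d1 d2 in \<open>auto simp: df_def less_2_cases_iff\<close>)
  then obtain t where "0 < t" "t < 1" "u (y + 1 *\<^sub>R \<Delta>) = (\<Sum>m<2. df m 0 / fact m * 1 ^ m) + df 2 t / fact 2 * 1 ^ 2" by blast
  then show ?thesis by (intro bexI[of _ t]) (auto simp: df_def numeral_2_eq_2)
qed

lemma finite_uniform_delta: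
  fixes P :: "'i \<Rightarrow> real \<Rightarrow> bool"
  assumes "finite S" "\<And>i. i \<in> S \<Longrightarrow> \<exists>\<delta>>0. P i \<delta>" "\<And>i \<delta> \<delta>'. P i \<delta> \<Longrightarrow> 0 < \<delta>' \<Longrightarrow> \<delta>' \<le> \<delta> \<Longrightarrow> P i \<delta>'"
  shows "\<exists>\<delta>>0. \<forall>i\<in>S. P i \<delta>"
  using assms(1,2)
proof induction
  case empty then show ?case by (auto intro: exI[of _ 1])
next
  case (insert i S)
  then obtain d where d: "d > 0" "\<forall>i\<in>S. P i d" by auto
  obtain d' where d': "d' > 0" "P i d'" using insert.prems by auto
  show ?case
  proof (intro exI[of _ "min d d'"] conjI ballI)
    fix j assume "j \<in> insert i S"
    then show "P j (min d d')" using assms(3)[of i d' "min d d'"] assms(3)[of j d "min d d'"] d d' by auto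
  qed (use d d' in auto)
qed

lemma norm_matrix_vector_le: "norm (A *v y) \<le> norm A * norm y" for A :: "real ^ 'm ^ 'd"
proof -
  have "norm ((A *v y) $ a) \<le> norm (A $ a) * norm y" for a
    using Cauchy_Schwarz_ineq2[of "A $ a" y] by (simp add: matrix_vector_mult_def inner_vec_def)
  then have "norm (A *v y) \<le> L2_set (\<lambda>a. norm (A $ a) * norm y) UNIV"
    unfolding norm_vec_def[of "A *v y"] by (intro L2_set_mono) auto
  also have "\<dots> = norm A * norm y" unfolding norm_vec_def[of A] by (simp add: L2_set_left_distrib)
  finally show ?thesis .
qed

lemma abs_bilinear_le: "\<bar>x \<bullet> (A *v y)\<bar> \<le> norm A * norm x * norm y" for A :: "real ^ 'm ^ 'd"
  using order_trans[OF Cauchy_Schwarz_ineq2[of x "A *v y"] mult_left_mono[OF norm_matrix_vector_le[of A y] norm_ge_zero[of x]]]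
  by (simp add: mult_ac)

lemma continuous_compact_bounds:
  fixes f :: "'a::euclidean_space \<Rightarrow> real \<Rightarrow> 'b::real_normed_vector"
  assumes c: "continuous_on (UNIV \<times> {0..}) (\<lambda>(x, t). f x t)" and a: "0 \<le> a"
  shows "\<exists>B>0. \<forall>x t. norm x \<le> R \<and> a \<le> t \<and> t \<le> T \<longrightarrow> norm (f x t) \<le> B"
    and "0 < \<epsilon> \<Longrightarrow> \<exists>\<theta>>0. \<forall>x t x' t'. norm x \<le> R \<and> a \<le> t \<and> t \<le> T \<and> norm x' \<le> R \<and> a \<le> t' \<and> t' \<le> T \<and>
      norm (x - x') < \<theta> \<and> \<bar>t - t'\<bar> < \<theta> \<longrightarrow> norm (f x t - f x' t') \<le> \<epsilon>"
proof -
  let ?D = "cball (0::'a) R \<times> {a..T}"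
  have D: "compact ?D" by (intro compact_Times) auto
  have c': "continuous_on ?D (\<lambda>(x, t). f x t)" by (rule continuous_on_subset[OF c]) (use a in auto)
  have "bounded ((\<lambda>(x, t). f x t) ` ?D)" by (intro compact_imp_bounded compact_continuous_image c' D)
  then obtain B where "B > 0" "\<forall>y\<in>(\<lambda>(x, t). f x t) ` ?D. norm y \<le> B" unfolding bounded_pos by blast
  then show "\<exists>B>0. \<forall>x t. norm x \<le> R \<and> a \<le> t \<and> t \<le> T \<longrightarrow> norm (f x t) \<le> B"
    by (intro exI[of _ B]) force
  assume e: "0 < \<epsilon>"
  have "uniformly_continuous_on ?D (\<lambda>(x, t). f x t)" by (rule compact_uniformly_continuous[OF c' D])
  then obtain \<delta> where \<delta>: "\<delta> > 0" "\<And>p p'. p \<in> ?D \<Longrightarrow> p' \<in> ?D \<Longrightarrow> dist p' p < \<delta> \<Longrightarrow> dist ((\<lambda>(x, t). f x t) p') ((\<lambda>(x, t). f x t) p) < \<epsilon>"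
    using e unfolding uniformly_continuous_on_def by meson
  show "\<exists>\<theta>>0. \<forall>x t x' t'. norm x \<le> R \<and> a \<le> t \<and> t \<le> T \<and> norm x' \<le> R \<and> a \<le> t' \<and> t' \<le> T \<and>
      norm (x - x') < \<theta> \<and> \<bar>t - t'\<bar> < \<theta> \<longrightarrow> norm (f x t - f x' t') \<le> \<epsilon>"
  proof (intro exI[of _ "\<delta> / 2"] conjI allI impI)
    fix x :: 'a and t :: real and x' :: 'a and t' :: real
    assume *: "norm x \<le> R \<and> a \<le> t \<and> t \<le> T \<and> norm x' \<le> R \<and> a \<le> t' \<and> t' \<le> T \<and> norm (x - x') < \<delta> / 2 \<and> \<bar>t - t'\<bar> < \<delta> / 2"
    have "dist (x, t) (x', t') \<le> dist x x' + dist t t'"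
      using sqrt_sum_squares_le_sum[of "dist x x'" "dist t t'"] by (simp add: dist_Pair_Pair)
    also have "\<dots> < \<delta>" using * by (simp add: dist_norm)
    finally have "dist (f x t) (f x' t') < \<epsilon>" using \<delta>(2)[of "(x', t')" "(x, t)"] * by (simp add: dist_commute)
    then show "norm (f x t - f x' t') \<le> \<epsilon>" by (simp add: dist_norm)
  qed (use \<delta> in auto)
qed

text \<open>This and the next two inequalities trade lower powers of an increment for its fourth
  power, whose mean is of second order in the time step.\<close>

lemma young_fourth: "0 < c \<Longrightarrow> 0 \<le> x \<Longrightarrow> x \<le> c + x ^ 4 / c ^ 3" for x c :: real
proof (cases "x \<le> c")
  case True
  assume "0 < c" "0 \<le> x" then show ?thesis using True by (simp add: add_increasing2)
next
  case False
  assume c: "0 < c" "0 \<le> x"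
  have "x * c ^ 3 \<le> x * x ^ 3" using False c by (intro mult_left_mono power_mono) auto
  then have "x \<le> x ^ 4 / c ^ 3" using c by (simp add: field_simps eval_nat_numeral)
  then show ?thesis using c by simp
qed

lemma young_fourth_square: "0 < c \<Longrightarrow> x ^ 2 \<le> c + x ^ 4 / c" for x c :: real
proof -
  assume c: "0 < c"
  have "0 \<le> (x\<^sup>2)\<^sup>2 - x\<^sup>2 * c + c\<^sup>2 / 4"
    using zero_le_power2[of "x\<^sup>2 - c / 2"] by (simp add: power2_diff power_divide)
  moreover have "(x\<^sup>2)\<^sup>2 = x ^ 4" by (simp flip: power_mult)
  ultimately have "x ^ 2 * c \<le> x ^ 4 + c ^ 2" using zero_le_power2[of c] by linarith
  then show ?thesis using c by (simp add: field_simps power2_eq_square)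
qed

lemma young_fourth_large:
  assumes "0 < (c::real)" "c \<le> x" "k \<le> 4"
  shows "x ^ k \<le> x ^ 4 / c ^ (4 - k)"
proof -
  have "x ^ k * c ^ (4 - k) \<le> x ^ k * x ^ (4 - k)" using assms by (intro mult_left_mono power_mono) auto
  also have "\<dots> = x ^ 4" using assms(3) by (simp flip: power_add)
  finally show ?thesis using assms(1) by (simp add: field_simps)
qed

lemma C21_bounds:
  fixes V :: "real ^ 'd \<Rightarrow> real \<Rightarrow> int \<Rightarrow> real"
  assumes V: "C21 S V" and S: "finite S" and a: "0 \<le> a"
  shows "\<exists>B>0. \<forall>i\<in>S. \<forall>x t. norm x \<le> R \<and> a \<le> t \<and> t \<le> T \<longrightarrow>
      \<bar>V x t i\<bar> \<le> B \<and> \<bar>Vt V x t i\<bar> \<le> B \<and> norm (Vx V x t i) \<le> B \<and> norm (Vxx V x t i) \<le> B"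
    and "0 < \<epsilon> \<Longrightarrow> \<exists>\<theta>>0. \<forall>i\<in>S. \<forall>x t x' t'. norm x \<le> R \<and> a \<le> t \<and> t \<le> T \<and> norm x' \<le> R \<and> a \<le> t' \<and> t' \<le> T \<and>
      norm (x - x') < \<theta> \<and> \<bar>t - t'\<bar> < \<theta> \<longrightarrow> \<bar>Vt V x t i - Vt V x' t' i\<bar> \<le> \<epsilon> \<and> norm (Vxx V x t i - Vxx V x' t' i) \<le> \<epsilon>"
proof -
  have c: "continuous_on (UNIV \<times> {0..}) (\<lambda>(x, t). V x t i)" "continuous_on (UNIV \<times> {0..}) (\<lambda>(x, t). Vt V x t i)"
    "continuous_on (UNIV \<times> {0..}) (\<lambda>(x, t). Vx V x t i)" "continuous_on (UNIV \<times> {0..}) (\<lambda>(x, t). Vxx V x t i)"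
    if "i \<in> S" for i
    using V that unfolding C21_def by auto
  \<comment> \<open>Bounds are written as \<open>1 / \<delta>\<close>, so that the lemma on a common
    small positive number also makes bounds uniform in \<open>i\<close>.\<close>
  have "\<exists>\<delta>>0. \<forall>i\<in>S. \<forall>x t. norm x \<le> R \<and> a \<le> t \<and> t \<le> T \<longrightarrow>
      \<bar>V x t i\<bar> \<le> 1 / \<delta> \<and> \<bar>Vt V x t i\<bar> \<le> 1 / \<delta> \<and> norm (Vx V x t i) \<le> 1 / \<delta> \<and> norm (Vxx V x t i) \<le> 1 / \<delta>"
  proof (rule finite_uniform_delta[OF S])
    fix i assume i: "i \<in> S"
    obtain B0 where B0: "B0 > 0" "\<forall>x t. norm x \<le> R \<and> a \<le> t \<and> t \<le> T \<longrightarrow> norm (V x t i) \<le> B0"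
      using continuous_compact_bounds(1)[OF c(1)[OF i] a] by blast
    obtain B1 where B1: "B1 > 0" "\<forall>x t. norm x \<le> R \<and> a \<le> t \<and> t \<le> T \<longrightarrow> norm (Vt V x t i) \<le> B1"
      using continuous_compact_bounds(1)[OF c(2)[OF i] a] by blast
    obtain B2 where B2: "B2 > 0" "\<forall>x t. norm x \<le> R \<and> a \<le> t \<and> t \<le> T \<longrightarrow> norm (Vx V x t i) \<le> B2"
      using continuous_compact_bounds(1)[OF c(3)[OF i] a] by blast
    obtain B3 where B3: "B3 > 0" "\<forall>x t. norm x \<le> R \<and> a \<le> t \<and> t \<le> T \<longrightarrow> norm (Vxx V x t i) \<le> B3"
      using continuous_compact_bounds(1)[OF c(4)[OF i] a] by blast
    let ?d = "1 / (B0 + B1 + B2 + B3)"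
    show "\<exists>\<delta>>0. \<forall>x t. norm x \<le> R \<and> a \<le> t \<and> t \<le> T \<longrightarrow>
      \<bar>V x t i\<bar> \<le> 1 / \<delta> \<and> \<bar>Vt V x t i\<bar> \<le> 1 / \<delta> \<and> norm (Vx V x t i) \<le> 1 / \<delta> \<and> norm (Vxx V x t i) \<le> 1 / \<delta>"
    proof (intro exI[of _ ?d] conjI allI impI)
      fix x :: "real ^ 'd" and t :: real assume *: "norm x \<le> R \<and> a \<le> t \<and> t \<le> T"
      have "\<bar>V x t i\<bar> \<le> B0" "\<bar>Vt V x t i\<bar> \<le> B1" "norm (Vx V x t i) \<le> B2" "norm (Vxx V x t i) \<le> B3"
        using * B0(2) B1(2) B2(2) B3(2) by auto
      then show "\<bar>V x t i\<bar> \<le> 1 / ?d" "\<bar>Vt V x t i\<bar> \<le> 1 / ?d" "norm (Vx V x t i) \<le> 1 / ?d" "norm (Vxx V x t i) \<le> 1 / ?d"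
        using B0(1) B1(1) B2(1) B3(1) by auto
    qed (use B0(1) B1(1) B2(1) B3(1) in auto)
  next
    fix i and \<delta> \<delta>' :: real
    assume *: "\<forall>x t. norm x \<le> R \<and> a \<le> t \<and> t \<le> T \<longrightarrow>
      \<bar>V x t i\<bar> \<le> 1 / \<delta> \<and> \<bar>Vt V x t i\<bar> \<le> 1 / \<delta> \<and> norm (Vx V x t i) \<le> 1 / \<delta> \<and> norm (Vxx V x t i) \<le> 1 / \<delta>"
      and "0 < \<delta>'" "\<delta>' \<le> \<delta>"
    then have "1 / \<delta> \<le> 1 / \<delta>'" by (intro divide_left_mono) auto
    then show "\<forall>x t. norm x \<le> R \<and> a \<le> t \<and> t \<le> T \<longrightarrow>
      \<bar>V x t i\<bar> \<le> 1 / \<delta>' \<and> \<bar>Vt V x t i\<bar> \<le> 1 / \<delta>' \<and> norm (Vx V x t i) \<le> 1 / \<delta>' \<and> norm (Vxx V x t i) \<le> 1 / \<delta>'"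
      using * by (meson order_trans)
  qed
  then obtain \<delta> where "\<delta> > 0" "\<forall>i\<in>S. \<forall>x t. norm x \<le> R \<and> a \<le> t \<and> t \<le> T \<longrightarrow>
      \<bar>V x t i\<bar> \<le> 1 / \<delta> \<and> \<bar>Vt V x t i\<bar> \<le> 1 / \<delta> \<and> norm (Vx V x t i) \<le> 1 / \<delta> \<and> norm (Vxx V x t i) \<le> 1 / \<delta>" by blast
  then show "\<exists>B>0. \<forall>i\<in>S. \<forall>x t. norm x \<le> R \<and> a \<le> t \<and> t \<le> T \<longrightarrow>
      \<bar>V x t i\<bar> \<le> B \<and> \<bar>Vt V x t i\<bar> \<le> B \<and> norm (Vx V x t i) \<le> B \<and> norm (Vxx V x t i) \<le> B"
    by (intro exI[of _ "1 / \<delta>"]) auto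
  assume e: "0 < \<epsilon>"
  show "\<exists>\<theta>>0. \<forall>i\<in>S. \<forall>x t x' t'. norm x \<le> R \<and> a \<le> t \<and> t \<le> T \<and> norm x' \<le> R \<and> a \<le> t' \<and> t' \<le> T \<and>
      norm (x - x') < \<theta> \<and> \<bar>t - t'\<bar> < \<theta> \<longrightarrow> \<bar>Vt V x t i - Vt V x' t' i\<bar> \<le> \<epsilon> \<and> norm (Vxx V x t i - Vxx V x' t' i) \<le> \<epsilon>"
  proof (rule finite_uniform_delta[OF S])
    fix i assume i: "i \<in> S"
    obtain d1 where d1: "d1 > 0" "\<forall>x t x' t'. norm x \<le> R \<and> a \<le> t \<and> t \<le> T \<and> norm x' \<le> R \<and> a \<le> t' \<and> t' \<le> T \<and>
      norm (x - x') < d1 \<and> \<bar>t - t'\<bar> < d1 \<longrightarrow> norm (Vt V x t i - Vt V x' t' i) \<le> \<epsilon>"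
      using continuous_compact_bounds(2)[OF c(2)[OF i] a e] by blast
    obtain d2 where d2: "d2 > 0" "\<forall>x t x' t'. norm x \<le> R \<and> a \<le> t \<and> t \<le> T \<and> norm x' \<le> R \<and> a \<le> t' \<and> t' \<le> T \<and>
      norm (x - x') < d2 \<and> \<bar>t - t'\<bar> < d2 \<longrightarrow> norm (Vxx V x t i - Vxx V x' t' i) \<le> \<epsilon>"
      using continuous_compact_bounds(2)[OF c(4)[OF i] a e] by blast
    show "\<exists>\<theta>>0. \<forall>x t x' t'. norm x \<le> R \<and> a \<le> t \<and> t \<le> T \<and> norm x' \<le> R \<and> a \<le> t' \<and> t' \<le> T \<and>
      norm (x - x') < \<theta> \<and> \<bar>t - t'\<bar> < \<theta> \<longrightarrow> \<bar>Vt V x t i - Vt V x' t' i\<bar> \<le> \<epsilon> \<and> norm (Vxx V x t i - Vxx V x' t' i) \<le> \<epsilon>"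
      by (intro exI[of _ "min d1 d2"]) (use d1 d2 in auto)
  qed auto
qed

text \<open>The time derivative is one-sided at 0, but its restriction to \<open>[t, t']\<close> is
  all that the mean value theorem asks for.\<close>

lemma C21_time_increment:
  fixes V :: "real ^ 'd \<Rightarrow> real \<Rightarrow> int \<Rightarrow> real"
  assumes V: "C21 S V" and i: "i \<in> S" and t: "0 \<le> t" "t \<le> t'"
  obtains s where "t \<le> s" "s \<le> t'" "V x t' i - V x t i = (t' - t) * Vt V x s i"
proof (cases "t < t'")
  case False
  then show thesis using that[of t] t by simp
next
  case True
  have "((\<lambda>s. V x s i) has_derivative (\<lambda>h. h * Vt V x s i)) (at s within {t..t'})" if "s \<in> {t..t'}" for s
  proof -
    have "(\<lambda>s. V x s i) differentiable (at s within {0..})" using V i that t unfolding C21_def by auto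
    then have "((\<lambda>s. V x s i) has_vector_derivative Vt V x s i) (at s within {0..})"
      unfolding Vt_def vector_derivative_works .
    then have "((\<lambda>s. V x s i) has_vector_derivative Vt V x s i) (at s within {t..t'})"
      by (rule has_vector_derivative_within_subset) (use t in auto)
    then show ?thesis by (simp add: has_vector_derivative_def)
  qed
  from mvt_simple[OF True this] obtain s where "s \<in> {t<..<t'}" "V x t' i - V x t i = (t' - t) * Vt V x s i" by auto
  then show thesis using that[of s] by auto
qed

lemma C21_space_increment:
  fixes V :: "real ^ 'd \<Rightarrow> real \<Rightarrow> int \<Rightarrow> real"
  assumes V: "C21 S V" and i: "i \<in> S" and t: "0 \<le> t"
  obtains r where "0 < r" "r < 1" "V (y + \<Delta>) t i - V y t i = Vx V y t i \<bullet> \<Delta> + 1 / 2 * (\<Delta> \<bullet> (Vxx V (y + r *\<^sub>R \<Delta>) t i *v \<Delta>))"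
proof -
  have c: "continuous_on UNIV (\<lambda>x. Vx V x t i)" "continuous_on UNIV (\<lambda>x. Vxx V x t i)"
  proof -
    have "continuous_on UNIV (\<lambda>x. (\<lambda>(x, t). Vx V x t i) (x, t))" "continuous_on UNIV (\<lambda>x. (\<lambda>(x, t). Vxx V x t i) (x, t))"
      by (rule continuous_on_compose2[where t="UNIV \<times> {0..}"]; use V i t in \<open>auto simp: C21_def intro!: continuous_intros\<close>)+
    then show "continuous_on UNIV (\<lambda>x. Vx V x t i)" "continuous_on UNIV (\<lambda>x. Vxx V x t i)" by simp_all
  qed
  have "\<exists>r\<in>{0<..<1}. V (y + \<Delta>) t i = V y t i + Vx V y t i \<bullet> \<Delta> + 1 / 2 * (\<Delta> \<bullet> (Vxx V (y + r *\<^sub>R \<Delta>) t i *v \<Delta>))"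
    unfolding Vx_def Vxx_def
    by (rule C2_taylor) (use V i t c in \<open>auto simp: C21_def Vx_def Vxx_def\<close>)
  then obtain r where "0 < r" "r < 1" "V (y + \<Delta>) t i = V y t i + Vx V y t i \<bullet> \<Delta> + 1 / 2 * (\<Delta> \<bullet> (Vxx V (y + r *\<^sub>R \<Delta>) t i *v \<Delta>))" by auto
  then show thesis using that[of r] by simp
qed

text \<open>\<open>\<beta>\<close> is the displacement by the drift, of order
  \<open>h = t' - t\<close>, and \<open>\<iota>\<close> the one by the stochastic integral, with
  norm \<open>x\<close>. If the state changes, a crude bound \<open>A * (h + x + x\<^sup>2)\<close>
  is reduced to \<open>\<eta>\<close> plus a multiple of \<open>x ^ 4\<close>. If it stays and
  \<open>x\<close> is large, the fourth power dominates everything. If it stays and \<open>x\<close>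
  is small, uniform continuity of the time and second-order derivatives leaves
  \<open>\<eta> * (h + x\<^sup>2)\<close> and terms of order \<open>h\<^sup>2\<close>. The term
  \<open>V y t i'\<close> keeps the new state, so the jump of \<open>V\<close> itself is no part of
  the error.\<close>

lemma C21_taylor:
  fixes V :: "real ^ 'd \<Rightarrow> real \<Rightarrow> int \<Rightarrow> real"
  assumes V: "C21 S V" and S: "finite S" and a: "0 \<le> a" and K: "0 \<le> K" and \<eta>: "0 < \<eta>"
  shows "\<exists>C>0. \<exists>\<delta>>0. \<forall>i\<in>S. \<forall>i'\<in>S. \<forall>t t' y \<beta> \<iota>. a \<le> t \<and> t \<le> t' \<and> t' \<le> T \<and> t' - t \<le> \<delta> \<and>
      norm y \<le> R \<and> norm (y + (\<beta> + \<iota>)) \<le> R \<and> norm \<beta> \<le> K * (t' - t) \<longrightarrow>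
    \<bar>V (y + (\<beta> + \<iota>)) t' i' - V y t i' - (t' - t) * Vt V y t i - Vx V y t i \<bullet> (\<beta> + \<iota>) - 1 / 2 * (\<iota> \<bullet> (Vxx V y t i *v \<iota>))\<bar>
    \<le> \<eta> * ((t' - t) + (norm \<iota>)\<^sup>2 + (if i = i' then 0 else 1)) + C * ((t' - t)\<^sup>2 + norm \<iota> ^ 4)"
proof -
  obtain B where B: "B > 0" "\<And>i x t. i \<in> S \<Longrightarrow> norm x \<le> R \<Longrightarrow> a \<le> t \<Longrightarrow> t \<le> T \<Longrightarrow>
      \<bar>Vt V x t i\<bar> \<le> B \<and> norm (Vx V x t i) \<le> B \<and> norm (Vxx V x t i) \<le> B"
    using C21_bounds(1)[OF V S a, of R T] by blast
  \<comment> \<open>Half of \<open>\<eta>\<close>, because the case of small \<open>\<iota>\<close>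
    ends with \<open>3 / 2 * (\<epsilon> * x\<^sup>2)\<close>.\<close>
  define \<epsilon> where "\<epsilon> = \<eta> / 2"
  have e: "0 < \<epsilon>" using \<eta> by (simp add: \<epsilon>_def)
  obtain \<theta> where \<theta>: "\<theta> > 0" "\<And>i x t x' t'. i \<in> S \<Longrightarrow> norm x \<le> R \<Longrightarrow> a \<le> t \<Longrightarrow> t \<le> T \<Longrightarrow> norm x' \<le> R \<Longrightarrow> a \<le> t' \<Longrightarrow> t' \<le> T \<Longrightarrow>
      norm (x - x') < \<theta> \<Longrightarrow> \<bar>t - t'\<bar> < \<theta> \<Longrightarrow> \<bar>Vt V x t i - Vt V x' t' i\<bar> \<le> \<epsilon> \<and> norm (Vxx V x t i - Vxx V x' t' i) \<le> \<epsilon>"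
    using C21_bounds(2)[OF V S a e, of R T] by blast
  \<comment> \<open>\<open>A\<close> is the constant of the crude bound. \<open>c\<close> gives each
    of its three terms a share \<open>\<eta> / 3\<close> when the state changes; \<open>c2\<close>
    is half the modulus of continuity, the other half being left to the drift. \<open>C1\<close>
    collects the terms of order \<open>h\<^sup>2\<close>.\<close>
  define A where "A = 2 * B + 2 * B * K + B * K\<^sup>2"
  define c where "c = \<eta> / (3 * A)"
  define c2 where "c2 = \<theta> / 2"
  define C1 where "C1 = \<epsilon> * K\<^sup>2 + B * K\<^sup>2 / 2 + (B * K)\<^sup>2 / (2 * \<epsilon>)"
  define C where "C = 1 + C1 + (A / c ^ 3 + A / c) + A * (1 / c2 ^ 4 + 1 / c2 ^ 3 + 1 / c2 ^ 2)"
  define \<delta> where "\<delta> = min (min 1 c2) (min (c2 / (K + 1)) c)"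
  have A: "A > 0" unfolding A_def using B(1) K by (intro add_pos_nonneg) auto
  have c: "c > 0" "A * c = \<eta> / 3" unfolding c_def using A \<eta> by (auto simp: field_simps)
  have c2: "c2 > 0" unfolding c2_def using \<theta> by simp
  have C1: "0 \<le> C1" unfolding C1_def using e B(1) by (intro add_nonneg_nonneg) auto
  have Cpos: "0 < C" unfolding C_def using C1 A c c2 by (intro add_pos_nonneg add_nonneg_nonneg mult_nonneg_nonneg divide_nonneg_nonneg) auto
  have \<delta>: "\<delta> > 0" "\<delta> \<le> 1" "\<delta> \<le> c2" "\<delta> \<le> c2 / (K + 1)" "\<delta> \<le> c" unfolding \<delta>_def using c c2 K by auto
  have \<delta>K: "K * h \<le> c2" if "0 \<le> h" "h \<le> \<delta>" for h
  proof -
    have "K * h \<le> (K + 1) * \<delta>" using that K by (intro mult_mono) auto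
    also have "\<dots> \<le> c2" using \<delta>(4) K by (simp add: field_simps)
    finally show ?thesis .
  qed
  show ?thesis
  proof (rule exI[of _ C], rule conjI[OF Cpos], rule exI[of _ \<delta>], rule conjI[OF \<delta>(1)], intro ballI allI impI)
    fix i i' :: int and t t' :: real and y \<beta> \<iota> :: "real ^ 'd"
    assume i: "i \<in> S" and i': "i' \<in> S" and *: "a \<le> t \<and> t \<le> t' \<and> t' \<le> T \<and> t' - t \<le> \<delta> \<and>
      norm y \<le> R \<and> norm (y + (\<beta> + \<iota>)) \<le> R \<and> norm \<beta> \<le> K * (t' - t)"
    define h where "h = t' - t"
    define \<Delta> where "\<Delta> = \<beta> + \<iota>"
    define x where "x = norm \<iota>"
    have h: "0 \<le> h" "h \<le> \<delta>" "norm \<beta> \<le> K * h" and t: "0 \<le> t" "a \<le> t" "t \<le> T" "a \<le> t'" "t' \<le> T"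
      and R: "norm y \<le> R" "norm (y + \<Delta>) \<le> R" using * a by (auto simp: h_def \<Delta>_def)
    have x0: "0 \<le> x" by (simp add: x_def)
    have h1: "h \<le> 1" "h\<^sup>2 \<le> h" using h \<delta>(2) by (auto simp: power2_eq_square intro: mult_left_le)
    have n\<Delta>: "norm \<Delta> \<le> x + K * h" using norm_triangle_ineq[of \<beta> \<iota>] h(3) by (simp add: \<Delta>_def x_def)
    have n\<Delta>2: "(norm \<Delta>)\<^sup>2 \<le> 2 * x\<^sup>2 + 2 * (K\<^sup>2 * h\<^sup>2)"
    proof -
      have "(norm \<Delta>)\<^sup>2 \<le> (x + K * h)\<^sup>2" using n\<Delta> by (intro power_mono) auto
      also have "\<dots> \<le> 2 * x\<^sup>2 + 2 * (K * h)\<^sup>2" using zero_le_power2[of "x - K * h"] by (simp add: power2_sum power2_diff)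
      finally show ?thesis by (simp add: power_mult_distrib)
    qed
    obtain s where s: "t \<le> s" "s \<le> t'" "V (y + \<Delta>) t' i' - V (y + \<Delta>) t i' = h * Vt V (y + \<Delta>) s i'"
      using C21_time_increment[OF V i' t(1), of t' "y + \<Delta>"] * unfolding h_def by blast
    obtain r where r: "0 < r" "r < 1" "V (y + \<Delta>) t i' - V y t i' = Vx V y t i' \<bullet> \<Delta> + 1 / 2 * (\<Delta> \<bullet> (Vxx V (y + r *\<^sub>R \<Delta>) t i' *v \<Delta>))"
      by (rule C21_space_increment[OF V i' t(1)])
    let ?H = "Vxx V y t i" and ?H' = "Vxx V (y + r *\<^sub>R \<Delta>) t i'"
    have Rr: "norm (y + r *\<^sub>R \<Delta>) \<le> R"
    proof -
      have "y + r *\<^sub>R \<Delta> = (1 - r) *\<^sub>R y + r *\<^sub>R (y + \<Delta>)" by (simp add: algebra_simps)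
      also have "norm \<dots> \<le> (1 - r) * R + r * R"
        using r R by (intro order_trans[OF norm_triangle_ineq] add_mono) (auto intro: mult_left_mono)
      finally show ?thesis by (simp add: algebra_simps)
    qed
    define E where "E = V (y + \<Delta>) t' i' - V y t i' - h * Vt V y t i - Vx V y t i \<bullet> \<Delta> - 1 / 2 * (\<iota> \<bullet> (?H *v \<iota>))"
    have E: "E = h * (Vt V (y + \<Delta>) s i' - Vt V y t i) + (Vx V y t i' - Vx V y t i) \<bullet> \<Delta> +
      (1 / 2 * (\<Delta> \<bullet> (?H' *v \<Delta>)) - 1 / 2 * (\<iota> \<bullet> (?H *v \<iota>)))"
      unfolding E_def using s(3) r(3) by (simp add: algebra_simps)
    have bH: "norm ?H \<le> B" "norm ?H' \<le> B" using B(2) i i' R Rr t by auto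
    have crude: "\<bar>E\<bar> \<le> A * (h + x + x\<^sup>2)"
    proof -
      have "\<bar>Vt V (y + \<Delta>) s i' - Vt V y t i\<bar> \<le> 2 * B"
      proof -
        have "\<bar>Vt V (y + \<Delta>) s i'\<bar> \<le> B" using B(2)[OF i' R(2), of s] s t by linarith
        moreover have "\<bar>Vt V y t i\<bar> \<le> B" using B(2)[OF i R(1), of t] t by linarith
        ultimately show ?thesis by linarith
      qed
      then have 1: "\<bar>h * (Vt V (y + \<Delta>) s i' - Vt V y t i)\<bar> \<le> h * (2 * B)"
        unfolding abs_mult using h by (simp add: mult_left_mono)
      have "norm (Vx V y t i' - Vx V y t i) \<le> 2 * B"
        using norm_triangle_ineq4[of "Vx V y t i'" "Vx V y t i"] B(2)[OF i' R(1) t(2,3)] B(2)[OF i R(1) t(2,3)] by linarith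
      then have 2: "\<bar>(Vx V y t i' - Vx V y t i) \<bullet> \<Delta>\<bar> \<le> 2 * B * (x + K * h)"
        using n\<Delta> B(1) by (intro order_trans[OF Cauchy_Schwarz_ineq2] mult_mono) auto
      have 3: "\<bar>\<Delta> \<bullet> (?H' *v \<Delta>)\<bar> \<le> B * (2 * x\<^sup>2 + 2 * (K\<^sup>2 * h\<^sup>2))"
      proof -
        have "\<bar>\<Delta> \<bullet> (?H' *v \<Delta>)\<bar> \<le> norm ?H' * (norm \<Delta>)\<^sup>2" using abs_bilinear_le[of \<Delta> ?H' \<Delta>] by (simp add: power2_eq_square mult.assoc)
        also have "\<dots> \<le> B * (2 * x\<^sup>2 + 2 * (K\<^sup>2 * h\<^sup>2))" using bH(2) n\<Delta>2 B(1) by (intro mult_mono) auto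
        finally show ?thesis .
      qed
      have 4: "\<bar>\<iota> \<bullet> (?H *v \<iota>)\<bar> \<le> B * x\<^sup>2"
      proof -
        have "\<bar>\<iota> \<bullet> (?H *v \<iota>)\<bar> \<le> norm ?H * x\<^sup>2" using abs_bilinear_le[of \<iota> ?H \<iota>] by (simp add: power2_eq_square mult.assoc x_def)
        also have "\<dots> \<le> B * x\<^sup>2" using bH(1) by (intro mult_right_mono) auto
        finally show ?thesis .
      qed
      have "\<bar>E\<bar> \<le> h * (2 * B) + 2 * B * (x + K * h) + (B * (x\<^sup>2 + K\<^sup>2 * h\<^sup>2) + B * x\<^sup>2 / 2)"
        unfolding E using 1 2 3 4 by (simp add: distrib_left)
      also have "\<dots> \<le> h * (2 * B) + 2 * B * (x + K * h) + (B * (x\<^sup>2 + K\<^sup>2 * h) + B * x\<^sup>2)"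
        using B(1) h1(2) h(1) K by (intro add_mono mult_left_mono) auto
      also have "\<dots> \<le> A * (h + x + x\<^sup>2)"
      proof -
        have "0 \<le> (2 * B * K + B * K\<^sup>2) * x + (2 * B * K + B * K\<^sup>2) * x\<^sup>2" using B(1) K x0 by simp
        then show ?thesis unfolding A_def by (simp add: algebra_simps)
      qed
      finally show ?thesis .
    qed
    have Cparts: "C1 * h\<^sup>2 \<le> C * h\<^sup>2" "(A / c ^ 3 + A / c) * x ^ 4 \<le> C * x ^ 4" "A * (1 / c2 ^ 4 + 1 / c2 ^ 3 + 1 / c2 ^ 2) * x ^ 4 \<le> C * x ^ 4"
      using C1 A c c2 unfolding C_def by (intro mult_right_mono; simp add: add_nonneg_nonneg)+
    have Ch: "0 \<le> C * h\<^sup>2" "0 \<le> C * x ^ 4" using Cpos x0 by auto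
    have "\<bar>E\<bar> \<le> \<eta> * (h + x\<^sup>2 + (if i = i' then 0 else 1)) + C * (h\<^sup>2 + x ^ 4)"
    proof (cases "i = i'")
      case False
      have "A * h \<le> \<eta> / 3" using h \<delta>(5) A c(2) mult_left_mono[of h c A] by linarith
      moreover have "A * x \<le> A * (c + x ^ 4 / c ^ 3)" using young_fourth[OF c(1) x0] A by (intro mult_left_mono) auto
      moreover have "A * x\<^sup>2 \<le> A * (c + x ^ 4 / c)" using young_fourth_square[OF c(1)] A by (intro mult_left_mono) auto
      ultimately have "A * (h + x + x\<^sup>2) \<le> \<eta> + (A / c ^ 3 + A / c) * x ^ 4" using c(2) by (simp add: algebra_simps)
      also have "\<dots> \<le> \<eta> + C * x ^ 4" using Cparts(2) by simp
      also have "\<dots> \<le> \<eta> * (h + x\<^sup>2 + 1) + C * (h\<^sup>2 + x ^ 4)"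
      proof -
        have "0 \<le> \<eta> * h + \<eta> * x\<^sup>2" using \<eta> h by simp
        then show ?thesis using Ch by (simp add: algebra_simps)
      qed
      finally show ?thesis using crude False by simp
    next
      case True
      show ?thesis
      proof (cases "x < c2")
        case False
        then have cx: "c2 \<le> x" by simp
        have "h + x + x\<^sup>2 \<le> x ^ 0 + x ^ 1 + x ^ 2" using h1 by simp
        also have "\<dots> \<le> x ^ 4 / c2 ^ (4 - 0) + x ^ 4 / c2 ^ (4 - 1) + x ^ 4 / c2 ^ (4 - 2)"
          by (intro add_mono young_fourth_large[OF c2 cx]) auto
        also have "\<dots> = (1 / c2 ^ 4 + 1 / c2 ^ 3 + 1 / c2 ^ 2) * x ^ 4" by (simp add: algebra_simps)
        finally have "A * (h + x + x\<^sup>2) \<le> A * ((1 / c2 ^ 4 + 1 / c2 ^ 3 + 1 / c2 ^ 2) * x ^ 4)" using A by (intro mult_left_mono) auto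
        also have "\<dots> \<le> C * x ^ 4" using Cparts(3) by (simp add: mult.assoc)
        also have "\<dots> \<le> \<eta> * (h + x\<^sup>2 + 0) + C * (h\<^sup>2 + x ^ 4)"
        proof -
          have "0 \<le> \<eta> * (h + x\<^sup>2 + 0)" using \<eta> h by simp
          then show ?thesis using Ch by (simp add: distrib_left)
        qed
        finally show ?thesis using crude True by simp
      next
        case near: True
        have d\<theta>: "norm \<Delta> < \<theta>" using n\<Delta> near \<delta>K[OF h(1,2)] unfolding c2_def by linarith
        have h\<theta>: "h < \<theta>" using h \<delta>(3) \<theta>(1) unfolding c2_def by linarith
        have e1: "\<bar>Vt V (y + \<Delta>) s i - Vt V y t i\<bar> \<le> \<epsilon>"
          using \<theta>(2)[OF i R(2) _ _ R(1) t(2,3), of s] s t d\<theta> h\<theta> unfolding h_def by auto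
        have rd: "norm (r *\<^sub>R \<Delta>) \<le> norm \<Delta>" using r by (simp add: mult_left_le_one_le)
        have e2: "norm (?H' - ?H) \<le> \<epsilon>"
          using \<theta>(2)[OF i Rr t(2,3) R(1) t(2,3)] rd d\<theta> \<theta>(1) True by simp
        have 1: "\<bar>h * (Vt V (y + \<Delta>) s i - Vt V y t i)\<bar> \<le> h * \<epsilon>"
          unfolding abs_mult using e1 h by (simp add: mult_left_mono)
        have 2: "\<bar>\<Delta> \<bullet> ((?H' - ?H) *v \<Delta>)\<bar> \<le> \<epsilon> * (2 * x\<^sup>2 + 2 * (K\<^sup>2 * h\<^sup>2))"
        proof -
          have "\<bar>\<Delta> \<bullet> ((?H' - ?H) *v \<Delta>)\<bar> \<le> norm (?H' - ?H) * (norm \<Delta>)\<^sup>2"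
            using abs_bilinear_le[of \<Delta> "?H' - ?H" \<Delta>] by (simp add: power2_eq_square mult.assoc)
          also have "\<dots> \<le> \<epsilon> * (2 * x\<^sup>2 + 2 * (K\<^sup>2 * h\<^sup>2))" using e2 n\<Delta>2 e by (intro mult_mono) auto
          finally show ?thesis .
        qed
        have bb: "\<bar>\<beta> \<bullet> (?H *v \<beta>)\<bar> \<le> B * (K\<^sup>2 * h\<^sup>2)"
        proof -
          have "\<bar>\<beta> \<bullet> (?H *v \<beta>)\<bar> \<le> norm ?H * (norm \<beta>)\<^sup>2" using abs_bilinear_le[of \<beta> ?H \<beta>] by (simp add: power2_eq_square mult.assoc)
          also have "\<dots> \<le> B * (K * h)\<^sup>2" using bH(1) h(3) B(1) by (intro mult_mono power_mono) auto
          finally show ?thesis by (simp add: power_mult_distrib)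
        qed
        have bi: "\<bar>\<beta> \<bullet> (?H *v \<iota>)\<bar> \<le> B * (K * h) * x" "\<bar>\<iota> \<bullet> (?H *v \<beta>)\<bar> \<le> B * (K * h) * x"
        proof -
          have le: "norm ?H * norm \<beta> * x \<le> B * (K * h) * x" using bH(1) h(3) B(1) x0 by (intro mult_mono mult_right_mono) auto
          show "\<bar>\<beta> \<bullet> (?H *v \<iota>)\<bar> \<le> B * (K * h) * x" using abs_bilinear_le[of \<beta> ?H \<iota>] le by (simp add: x_def)
          show "\<bar>\<iota> \<bullet> (?H *v \<beta>)\<bar> \<le> B * (K * h) * x" using abs_bilinear_le[of \<iota> ?H \<beta>] le by (simp add: x_def mult_ac)
        qed
        \<comment> \<open>The mixed term of the two displacements is of order \<open>h * x\<close>;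
          it is split so that \<open>x\<^sup>2\<close> gets a small factor and the rest is of order
          \<open>h\<^sup>2\<close>.\<close>
        have am: "B * (K * h) * x \<le> \<epsilon> * x\<^sup>2 / 2 + (B * K)\<^sup>2 / (2 * \<epsilon>) * h\<^sup>2"
        proof -
          have "0 \<le> (\<epsilon> * x - B * K * h)\<^sup>2 / (2 * \<epsilon>)" using e by simp
          also have "\<dots> = \<epsilon> * x\<^sup>2 / 2 + (B * K)\<^sup>2 / (2 * \<epsilon>) * h\<^sup>2 - B * (K * h) * x"
            using e by (simp add: power2_diff field_simps power2_eq_square)
          finally show ?thesis by simp
        qed
        have gen: "\<bar>p\<bar> \<le> P \<Longrightarrow> \<bar>q\<bar> \<le> Q \<Longrightarrow> \<bar>p + 1 / 2 * q\<bar> \<le> P + 1 / 2 * Q" for p q P Q :: real by linarith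
        have dec: "\<Delta> \<bullet> (?H' *v \<Delta>) - \<iota> \<bullet> (?H *v \<iota>) = \<Delta> \<bullet> ((?H' - ?H) *v \<Delta>) + (\<beta> \<bullet> (?H *v \<beta>) + \<beta> \<bullet> (?H *v \<iota>) + \<iota> \<bullet> (?H *v \<beta>))"
          unfolding \<Delta>_def by (simp add: matrix_vector_mult_diff_rdistrib matrix_vector_right_distrib inner_add_left inner_add_right inner_diff_right)
        have E': "E = h * (Vt V (y + \<Delta>) s i - Vt V y t i) + 1 / 2 * (\<Delta> \<bullet> (?H' *v \<Delta>) - \<iota> \<bullet> (?H *v \<iota>))"
          using E True by (simp add: right_diff_distrib)
        have "\<bar>\<Delta> \<bullet> (?H' *v \<Delta>) - \<iota> \<bullet> (?H *v \<iota>)\<bar> \<le> \<epsilon> * (2 * x\<^sup>2 + 2 * (K\<^sup>2 * h\<^sup>2)) + (B * (K\<^sup>2 * h\<^sup>2) + 2 * (B * (K * h) * x))"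
          unfolding dec using 2 bb bi by linarith
        then have "\<bar>E\<bar> \<le> h * \<epsilon> + 1 / 2 * (\<epsilon> * (2 * x\<^sup>2 + 2 * (K\<^sup>2 * h\<^sup>2)) + (B * (K\<^sup>2 * h\<^sup>2) + 2 * (B * (K * h) * x)))"
          unfolding E' by (rule gen[OF 1])
        also have "\<dots> = h * \<epsilon> + \<epsilon> * x\<^sup>2 + (\<epsilon> * K\<^sup>2 + B * K\<^sup>2 / 2) * h\<^sup>2 + B * (K * h) * x"
          by (simp add: algebra_simps)
        also have "\<dots> \<le> h * \<epsilon> + \<epsilon> * x\<^sup>2 + (\<epsilon> * K\<^sup>2 + B * K\<^sup>2 / 2) * h\<^sup>2 + (\<epsilon> * x\<^sup>2 / 2 + (B * K)\<^sup>2 / (2 * \<epsilon>) * h\<^sup>2)"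
          using am by simp
        also have "\<dots> = h * \<epsilon> + 3 / 2 * (\<epsilon> * x\<^sup>2) + C1 * h\<^sup>2" unfolding C1_def by (simp add: algebra_simps)
        also have "\<dots> \<le> \<eta> * (h + x\<^sup>2 + 0) + C * (h\<^sup>2 + x ^ 4)"
        proof -
          have "h * \<epsilon> \<le> \<eta> * h" "3 / 2 * (\<epsilon> * x\<^sup>2) \<le> \<eta> * x\<^sup>2" unfolding \<epsilon>_def using \<eta> h by (auto simp: field_simps)
          then show ?thesis using Cparts(1) Ch(2) by (simp add: distrib_left)
        qed
        finally show ?thesis using True by simp
      qed
    qed
    then show "\<bar>V (y + (\<beta> + \<iota>)) t' i' - V y t i' - (t' - t) * Vt V y t i - Vx V y t i \<bullet> (\<beta> + \<iota>) - 1 / 2 * (\<iota> \<bullet> (Vxx V y t i *v \<iota>))\<bar>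
      \<le> \<eta> * ((t' - t) + (norm \<iota>)\<^sup>2 + (if i = i' then 0 else 1)) + C * ((t' - t)\<^sup>2 + norm \<iota> ^ 4)"
      unfolding E_def \<Delta>_def h_def x_def .
  qed
qed

subsection \<open>One step of the Markov chain\<close>

context filtered_bm
begin

text \<open>The conditional probability given the present state is
  \<open>p \<delta> (r t) j\<close>, which is checked state by state; a state of probability zero,
  where \<open>p\<close> is arbitrary, contributes nothing to either side. The Markov property then
  replaces the present state by \<open>F t\<close>.\<close>

lemma markov_expectation:
  assumes mc: "markov_chain M F S \<Gamma> r" and S: "finite S"
    and p: "\<forall>t\<ge>0. \<forall>\<delta>\<ge>0. \<forall>i\<in>S. \<forall>j\<in>S. \<P>(w in M. r t w = i) > 0 \<longrightarrow>
       \<P>(w in M. r (t + \<delta>) w = j \<bar> r t w = i) = p \<delta> i j"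
    and t: "0 \<le> t" "0 \<le> \<delta>" and j: "j \<in> S"
    and \<xi>: "\<xi> \<in> borel_measurable (F t)" "\<And>w. w \<in> space M \<Longrightarrow> \<bar>\<xi> w\<bar> \<le> A"
  shows "expectation (\<lambda>w. \<xi> w * indicator {w\<in>space M. r (t + \<delta>) w = j} w) = expectation (\<lambda>w. \<xi> w * p \<delta> (r t w) j)"
proof -
  let ?G = "vimage_algebra (space M) (r t) (count_space S)"
  have rF: "r s \<in> measurable (F s) (count_space S)" if "0 \<le> s" for s using mc that unfolding markov_chain_def by auto
  have rM: "r s \<in> measurable M (count_space S)" if "0 \<le> s" for s using measurable_F_M[OF rF[OF that] that] .
  have rS: "r s w \<in> S" if "0 \<le> s" "w \<in> space M" for s w using measurable_space[OF rM[OF that(1)] that(2)] by simp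
  have evs: "{w\<in>space M. r s w = i} \<in> events" if "0 \<le> s" for s i
  proof -
    have "r s -` ({i} \<inter> S) \<inter> space M \<in> events" by (rule measurable_sets[OF rM[OF that]]) simp
    also have "r s -` ({i} \<inter> S) \<inter> space M = {w\<in>space M. r s w = i}" using rS[OF that] by auto
    finally show ?thesis .
  qed
  let ?I = "indicator {w\<in>space M. r (t + \<delta>) w = j} :: 'w \<Rightarrow> real"
  have td: "0 \<le> t + \<delta>" using t by simp
  have iI: "integrable M ?I" using evs[OF td] by (intro integrable_real_indicator) (auto simp: emeasure_eq_measure)
  have subF: "subalgebra M (F t)" using subalg[OF t(1)] .
  have setsG: "sets ?G = {r t -` Q \<inter> space M |Q. Q \<in> sets (count_space S)}"
    by (rule sets_vimage_algebra2) (use rS[OF t(1)] in auto)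
  have "sets ?G \<subseteq> events" unfolding setsG using measurable_sets[OF rM[OF t(1)]] by blast
  then have subG: "subalgebra M ?G" by (simp add: subalgebra_def)
  interpret f: finite_measure_subalgebra M "F t" by unfold_locales (rule subF)
  interpret g: finite_measure_subalgebra M ?G by unfold_locales (rule subG)
  have pG: "(\<lambda>w. p \<delta> (r t w) j) \<in> borel_measurable ?G"
    by (rule measurable_compose[OF measurable_vimage_algebra1[of _ _ "count_space S"]]) (use rS[OF t(1)] in auto)
  have pM: "(\<lambda>w. p \<delta> (r t w) j) \<in> borel_measurable M" by (rule measurable_from_subalg[OF subG pG])
  define C where "C = (\<Sum>i\<in>S. \<bar>p \<delta> i j\<bar>)"
  have C: "\<bar>p \<delta> i j\<bar> \<le> C" if "i \<in> S" for i
    unfolding C_def using that S by (intro member_le_sum) auto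
  have ip: "integrable M (\<lambda>w. p \<delta> (r t w) j)"
    by (rule integrable_bounded[OF pM, of C]) (use C rS[OF t(1)] in auto)
  have "AE w in M. real_cond_exp M ?G ?I w = p \<delta> (r t w) j"
  proof (rule g.real_cond_exp_charact[OF _ iI ip pG])
    fix Q assume "Q \<in> sets ?G"
    then obtain D where D: "D \<subseteq> S" "Q = r t -` D \<inter> space M"
      unfolding setsG by auto
    have fD: "finite D" using D(1) S finite_subset by blast
    have Qi: "indicator Q w = (\<Sum>i\<in>D. indicator {w\<in>space M. r t w = i} w :: real)" for w
      using fD D(2) by (auto simp: indicator_def sum.delta if_distrib cong: if_cong)
    have 1: "expectation (\<lambda>w. indicator {w\<in>space M. r t w = i} w * ?I w) = expectation (\<lambda>w. indicator {w\<in>space M. r t w = i} w * p \<delta> (r t w) j)"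
      if i: "i \<in> D" for i
    proof -
      have "(\<lambda>w. indicator {w\<in>space M. r t w = i} w * ?I w) = indicator {w\<in>space M. r (t + \<delta>) w = j \<and> r t w = i}"
        by (auto simp: indicator_def)
      moreover have "{w\<in>space M. r (t + \<delta>) w = j \<and> r t w = i} = {w\<in>space M. r (t + \<delta>) w = j} \<inter> {w\<in>space M. r t w = i}" by auto
      ultimately have l: "expectation (\<lambda>w. indicator {w\<in>space M. r t w = i} w * ?I w) = prob {w\<in>space M. r (t + \<delta>) w = j \<and> r t w = i}"
        using evs[OF td, of j] evs[OF t(1), of i] by simp
      have "(\<lambda>w. indicator {w\<in>space M. r t w = i} w * p \<delta> (r t w) j) = (\<lambda>w. p \<delta> i j * indicator {w\<in>space M. r t w = i} w)"
        by (auto simp: indicator_def)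
      then have r: "expectation (\<lambda>w. indicator {w\<in>space M. r t w = i} w * p \<delta> (r t w) j) = p \<delta> i j * prob {w\<in>space M. r t w = i}"
        using evs[OF t(1), of i] by simp
      show ?thesis
      proof (cases "prob {w\<in>space M. r t w = i} > 0")
        case True
        then have "prob {w\<in>space M. r (t + \<delta>) w = j \<and> r t w = i} / prob {w\<in>space M. r t w = i} = p \<delta> i j"
          using p t j i D(1) unfolding cond_prob_def by blast
        then show ?thesis unfolding l r using True by (simp add: field_simps)
      next
        case False
        then have z: "prob {w\<in>space M. r t w = i} = 0" by (simp add: zero_less_measure_iff)
        have "prob {w\<in>space M. r (t + \<delta>) w = j \<and> r t w = i} \<le> prob {w\<in>space M. r t w = i}"
          by (rule finite_measure_mono) (use evs[OF t(1), of i] in auto)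
        then show ?thesis unfolding l r z by (simp add: measure_le_0_iff)
      qed
    qed
    have i1: "integrable M (\<lambda>w. indicator {w\<in>space M. r t w = i} w * ?I w)" for i
      using integrable_mult_indicator[OF evs[OF t(1)] iI] by simp
    have i2: "integrable M (\<lambda>w. indicator {w\<in>space M. r t w = i} w * p \<delta> (r t w) j)" for i
      using integrable_mult_indicator[OF evs[OF t(1)] ip] by simp
    show "(LINT x:Q|M. ?I x) = (LINT x:Q|M. p \<delta> (r t x) j)"
      unfolding set_lebesgue_integral_def Qi real_scaleR_def sum_distrib_right
      using 1 i1 i2 by (simp add: Bochner_Integration.integral_sum)
  qed
  moreover have "AE w in M. real_cond_exp M (F t) ?I w = real_cond_exp M ?G ?I w"
    by (rule mc[unfolded markov_chain_def, THEN conjunct2, THEN conjunct2, THEN conjunct1, rule_format]) (use t j in auto)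
  ultimately have ae: "AE w in M. real_cond_exp M (F t) ?I w = p \<delta> (r t w) j" by eventually_elim simp
  have \<xi>M: "\<xi> \<in> borel_measurable M" using measurable_F_M[OF \<xi>(1) t(1)] .
  have "integrable M (\<lambda>w. \<xi> w * ?I w)"
    using integrable_mult_bounded[OF iI \<xi>M \<xi>(2)] by (simp add: mult.commute)
  then have "expectation (\<lambda>w. \<xi> w * ?I w) = expectation (\<lambda>w. \<xi> w * real_cond_exp M (F t) ?I w)"
    by (intro f.real_cond_exp_intg(2)[symmetric] \<xi>(1)) (use iI in auto)
  also have "\<dots> = expectation (\<lambda>w. \<xi> w * p \<delta> (r t w) j)"
  proof (rule integral_cong_AE)
    have "real_cond_exp M (F t) ?I \<in> borel_measurable M" by (rule borel_measurable_cond_exp2)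
    then show "(\<lambda>w. \<xi> w * real_cond_exp M (F t) ?I w) \<in> borel_measurable M" using \<xi>M by measurable
    show "(\<lambda>w. \<xi> w * p \<delta> (r t w) j) \<in> borel_measurable M" using \<xi>M pM by measurable
    show "AE w in M. \<xi> w * real_cond_exp M (F t) ?I w = \<xi> w * p \<delta> (r t w) j" using ae by eventually_elim simp
  qed
  finally show ?thesis .
qed

text \<open>The asymptotics of \<open>p\<close> are given for distinct states only, so the weight
  attached to the target \<open>j\<close> has to vanish where the chain already is in
  \<open>j\<close>. Finiteness of \<open>S\<close> and homogeneity make the error uniform in the
  states and in \<open>t\<close>.\<close>

lemma markov_step:
  assumes mc: "markov_chain M F S \<Gamma> r" and S: "finite S" and \<eta>: "0 < \<eta>"
  shows "\<exists>\<delta>\<^sub>0>0. \<forall>t \<delta> \<xi> A. 0 \<le> t \<and> 0 \<le> \<delta> \<and> \<delta> < \<delta>\<^sub>0 \<and> (\<forall>j\<in>S. \<xi> j \<in> borel_measurable (F t) \<and>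
      (\<forall>w\<in>space M. \<bar>\<xi> j w\<bar> \<le> A \<and> (r t w = j \<longrightarrow> \<xi> j w = 0))) \<longrightarrow>
    expectation (\<lambda>w. \<Sum>j\<in>S. \<xi> j w * indicator {w\<in>space M. r (t + \<delta>) w = j} w) \<le>
      \<delta> * expectation (\<lambda>w. \<Sum>j\<in>S. \<xi> j w * \<Gamma> (r t w) j) + \<eta> * A * \<delta>"
proof -
  have "\<exists>p. (\<forall>t\<ge>0. \<forall>\<delta>\<ge>0. \<forall>i\<in>S. \<forall>j\<in>S. \<P>(w in M. r t w = i) > 0 \<longrightarrow>
       \<P>(w in M. r (t + \<delta>) w = j \<bar> r t w = i) = p \<delta> i j) \<and>
     (\<forall>i\<in>S. \<forall>j\<in>S. i \<noteq> j \<longrightarrow> (\<lambda>\<delta>. p \<delta> i j - \<Gamma> i j * \<delta>) \<in> o[at_right 0](\<lambda>\<delta>. \<delta>))"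
    by (rule mc[unfolded markov_chain_def, THEN conjunct2, THEN conjunct2, THEN conjunct2])
  then obtain p where p: "\<forall>t\<ge>0. \<forall>\<delta>\<ge>0. \<forall>i\<in>S. \<forall>j\<in>S. \<P>(w in M. r t w = i) > 0 \<longrightarrow>
       \<P>(w in M. r (t + \<delta>) w = j \<bar> r t w = i) = p \<delta> i j"
    and po': "\<forall>i\<in>S. \<forall>j\<in>S. i \<noteq> j \<longrightarrow> (\<lambda>\<delta>. p \<delta> i j - \<Gamma> i j * \<delta>) \<in> o[at_right 0](\<lambda>\<delta>. \<delta>)"
    by (elim exE conjE)
  note po = po'[rule_format]
  \<comment> \<open>An equal share of \<open>\<eta>\<close> for every target state; the summand 1
    avoids division by zero.\<close>
  define c where "c = \<eta> / (real (card S) + 1)"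
  have c: "0 < c" "real (card S) * c \<le> \<eta>" unfolding c_def using \<eta> by (auto simp: field_simps)
  have "\<forall>\<^sub>F \<delta> in at_right 0. \<forall>i\<in>S. \<forall>j\<in>S. i \<noteq> j \<longrightarrow> \<bar>p \<delta> i j - \<Gamma> i j * \<delta>\<bar> \<le> c * \<bar>\<delta>\<bar>"
  proof (intro eventually_ball_finite S ballI)
    fix i j assume ij: "i \<in> S" "j \<in> S"
    show "\<forall>\<^sub>F \<delta> in at_right 0. i \<noteq> j \<longrightarrow> \<bar>p \<delta> i j - \<Gamma> i j * \<delta>\<bar> \<le> c * \<bar>\<delta>\<bar>"
      using landau_o.smallD[OF po[OF ij] c(1)] by (cases "i = j") auto
  qed
  then obtain \<delta>\<^sub>0 where d0: "\<delta>\<^sub>0 > 0" "\<And>\<delta> i j. 0 < \<delta> \<Longrightarrow> \<delta> < \<delta>\<^sub>0 \<Longrightarrow> i \<in> S \<Longrightarrow> j \<in> S \<Longrightarrow> i \<noteq> j \<Longrightarrow> \<bar>p \<delta> i j - \<Gamma> i j * \<delta>\<bar> \<le> c * \<bar>\<delta>\<bar>"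
    unfolding eventually_at_right_field by auto
  have rF: "r s \<in> measurable (F s) (count_space S)" if "0 \<le> s" for s using mc that unfolding markov_chain_def by auto
  have rM: "r s \<in> measurable M (count_space S)" if "0 \<le> s" for s using measurable_F_M[OF rF[OF that] that] .
  have rS: "r s w \<in> S" if "0 \<le> s" "w \<in> space M" for s w using measurable_space[OF rM[OF that(1)] that(2)] by simp
  show ?thesis
  proof (rule exI[of _ \<delta>\<^sub>0], rule conjI[OF d0(1)], intro allI impI)
    fix t \<delta> :: real and \<xi> :: "int \<Rightarrow> 'w \<Rightarrow> real" and A :: real
    assume *: "0 \<le> t \<and> 0 \<le> \<delta> \<and> \<delta> < \<delta>\<^sub>0 \<and> (\<forall>j\<in>S. \<xi> j \<in> borel_measurable (F t) \<and>
      (\<forall>w\<in>space M. \<bar>\<xi> j w\<bar> \<le> A \<and> (r t w = j \<longrightarrow> \<xi> j w = 0)))"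
    have t: "0 \<le> t" "0 \<le> \<delta>" "\<delta> < \<delta>\<^sub>0" and \<xi>m: "\<And>j. j \<in> S \<Longrightarrow> \<xi> j \<in> borel_measurable (F t)"
      and \<xi>b: "\<And>j w. j \<in> S \<Longrightarrow> w \<in> space M \<Longrightarrow> \<bar>\<xi> j w\<bar> \<le> A"
      and \<xi>0: "\<And>j w. j \<in> S \<Longrightarrow> w \<in> space M \<Longrightarrow> r t w = j \<Longrightarrow> \<xi> j w = 0" using * by auto
    have \<xi>M: "\<xi> j \<in> borel_measurable M" if "j \<in> S" for j using measurable_F_M[OF \<xi>m[OF that] t(1)] .
    let ?I = "\<lambda>j. indicator {w\<in>space M. r (t + \<delta>) w = j} :: 'w \<Rightarrow> real"
    have fr: "(\<lambda>w. q (r t w)) \<in> borel_measurable M" for q :: "int \<Rightarrow> real"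
      by (rule measurable_compose[OF rM[OF t(1)]]) simp
    have frb: "\<exists>C. \<forall>w\<in>space M. \<bar>q (r t w)\<bar> \<le> C" for q :: "int \<Rightarrow> real"
      using rS[OF t(1)] S member_le_sum[of _ S "\<lambda>i. \<bar>q i\<bar>"] by (intro exI[of _ "\<Sum>i\<in>S. \<bar>q i\<bar>"]) auto
    have i1: "integrable M (\<lambda>w. \<xi> j w * q (r t w))" if "j \<in> S" for q j
    proof -
      obtain C where C: "\<And>w. w \<in> space M \<Longrightarrow> \<bar>q (r t w)\<bar> \<le> C" using frb by blast
      show ?thesis
        by (rule integrable_mult_bounded[OF integrable_bounded[OF \<xi>M[OF that]] fr[of q] C]) (rule \<xi>b[OF that])
    qed
    have i1': "integrable M (\<lambda>w. \<xi> j w * \<Gamma> (r t w) j)" if "j \<in> S" for j using i1[OF that, of "\<lambda>i. \<Gamma> i j"] .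
    have rev: "{w\<in>space M. r (t + \<delta>) w = j} \<in> events" for j
    proof -
      have "r (t + \<delta>) -` ({j} \<inter> S) \<inter> space M \<in> events" by (rule measurable_sets[OF rM]) (use t in auto)
      also have "r (t + \<delta>) -` ({j} \<inter> S) \<inter> space M = {w\<in>space M. r (t + \<delta>) w = j}" using rS[of "t + \<delta>"] t by auto
      finally show ?thesis .
    qed
    have i2: "integrable M (\<lambda>w. \<xi> j w * ?I j w)" if "j \<in> S" for j
      by (rule integrable_mult_bounded[where C=1]) (use integrable_bounded[OF \<xi>M[OF that] \<xi>b[OF that]] rev in \<open>auto simp: indicator_def\<close>)
    have le: "expectation (\<lambda>w. \<xi> j w * ?I j w) \<le> \<delta> * expectation (\<lambda>w. \<xi> j w * \<Gamma> (r t w) j) + A * (c * \<delta>)" if j: "j \<in> S" for j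
    \<comment> \<open>The limit at 0 is one-sided and says nothing at 0 itself; there the chain has
      not moved and both sides vanish.\<close>
    proof (cases "\<delta> = 0")
      case True
      have "\<xi> j w * ?I j w = 0" if "w \<in> space M" for w using \<xi>0[OF j that] True by (auto simp: indicator_def)
      then have "expectation (\<lambda>w. \<xi> j w * ?I j w) = expectation (\<lambda>w. 0)" by (intro Bochner_Integration.integral_cong) auto
      then show ?thesis using True by simp
    next
      case False
      then have d: "0 < \<delta>" using t by simp
      have "expectation (\<lambda>w. \<xi> j w * ?I j w) = expectation (\<lambda>w. \<xi> j w * p \<delta> (r t w) j)"
        by (rule markov_expectation[OF mc S p t(1,2) j \<xi>m[OF j] \<xi>b[OF j]])
      also have "\<dots> \<le> expectation (\<lambda>w. \<xi> j w * (\<delta> * \<Gamma> (r t w) j) + A * (c * \<delta>))"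
      proof (rule integral_mono)
        show "integrable M (\<lambda>w. \<xi> j w * p \<delta> (r t w) j)" by (rule i1[OF j, of "\<lambda>i. p \<delta> i j"])
        show "integrable M (\<lambda>w. \<xi> j w * (\<delta> * \<Gamma> (r t w) j) + A * (c * \<delta>))"
          using i1[OF j, of "\<lambda>i. \<delta> * \<Gamma> i j"] by auto
        fix w assume w: "w \<in> space M"
        show "\<xi> j w * p \<delta> (r t w) j \<le> \<xi> j w * (\<delta> * \<Gamma> (r t w) j) + A * (c * \<delta>)"
        proof (cases "r t w = j")
          case True
          then show ?thesis using \<xi>0[OF j w] \<xi>b[OF j w] c d by simp
        next
          case False
          have "\<xi> j w * p \<delta> (r t w) j - \<xi> j w * (\<delta> * \<Gamma> (r t w) j) = \<xi> j w * (p \<delta> (r t w) j - \<Gamma> (r t w) j * \<delta>)"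
            by (simp add: algebra_simps)
          also have "\<dots> \<le> \<bar>\<xi> j w\<bar> * \<bar>p \<delta> (r t w) j - \<Gamma> (r t w) j * \<delta>\<bar>" by (simp flip: abs_mult)
          also have "\<dots> \<le> A * (c * \<delta>)"
            using d0(2)[OF d t(3) rS[OF t(1) w] j False] \<xi>b[OF j w] d by (intro mult_mono) auto
          finally show ?thesis by simp
        qed
      qed
      also have "\<dots> = \<delta> * expectation (\<lambda>w. \<xi> j w * \<Gamma> (r t w) j) + A * (c * \<delta>)"
        using i1[OF j, of "\<lambda>i. \<Gamma> i j"] i1[OF j, of "\<lambda>i. \<delta> * \<Gamma> i j"] by (simp add: mult.left_commute prob_space)
      finally show ?thesis .
    qed
    obtain w\<^sub>0 where w\<^sub>0: "w\<^sub>0 \<in> space M" using not_empty by blast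
    have A0: "0 \<le> A" by (rule order_trans[OF abs_ge_zero \<xi>b[OF rS[OF t(1) w\<^sub>0] w\<^sub>0]])
    have "expectation (\<lambda>w. \<Sum>j\<in>S. \<xi> j w * ?I j w) = (\<Sum>j\<in>S. expectation (\<lambda>w. \<xi> j w * ?I j w))"
      using i2 by (simp add: Bochner_Integration.integral_sum)
    also have "\<dots> \<le> (\<Sum>j\<in>S. \<delta> * expectation (\<lambda>w. \<xi> j w * \<Gamma> (r t w) j) + A * (c * \<delta>))"
      using le by (intro sum_mono)
    also have "\<dots> = \<delta> * expectation (\<lambda>w. \<Sum>j\<in>S. \<xi> j w * \<Gamma> (r t w) j) + real (card S) * (A * (c * \<delta>))"
      using i1' by (simp add: Bochner_Integration.integral_sum sum.distrib sum_distrib_left)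
    also have "real (card S) * (A * (c * \<delta>)) \<le> \<eta> * A * \<delta>"
    proof -
      have "(A * \<delta>) * (real (card S) * c) \<le> (A * \<delta>) * \<eta>" using c(2) t A0 by (intro mult_left_mono) auto
      then show ?thesis by (simp add: mult_ac)
    qed
    finally show "expectation (\<lambda>w. \<Sum>j\<in>S. \<xi> j w * ?I j w) \<le> \<delta> * expectation (\<lambda>w. \<Sum>j\<in>S. \<xi> j w * \<Gamma> (r t w) j) + \<eta> * A * \<delta>"
      by simp
  qed
qed

end

subsection \<open>The neutral equation\<close>

text \<open>The inequality for \<open>LV\<close> is required for almost all times only, because \<open>\<phi>\<close> and \<open>h\<close> stand for Borel versions of
  Lebesgue measurable functions.\<close>

locale nsdde_setting = filtered_bm M F B for M :: "'w measure" and F and B :: "real \<Rightarrow> 'w \<Rightarrow> real ^ 'm" +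
  fixes S :: "int set" and \<Gamma> :: "int \<Rightarrow> int \<Rightarrow> real" and r :: "real \<Rightarrow> 'w \<Rightarrow> int"
    and D :: "real ^ 'd \<Rightarrow> int \<Rightarrow> real ^ 'd"
    and f :: "real ^ 'd \<Rightarrow> real ^ 'd \<Rightarrow> real \<Rightarrow> int \<Rightarrow> real ^ 'd"
    and g :: "real ^ 'd \<Rightarrow> real ^ 'd \<Rightarrow> real \<Rightarrow> int \<Rightarrow> real ^ 'm ^ 'd"
    and X :: "real \<Rightarrow> 'w \<Rightarrow> real ^ 'd" and J :: "real \<Rightarrow> 'w \<Rightarrow> real ^ 'd"
    and V :: "real ^ 'd \<Rightarrow> real \<Rightarrow> int \<Rightarrow> real"
    and \<phi> h :: "real \<Rightarrow> real" and p \<tau> \<beta> c\<^sub>1 c\<^sub>2 C\<^sub>0 C\<^sub>\<xi> :: real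
  assumes S: "finite S" and gen: "generator_matrix S \<Gamma>" and mc: "markov_chain M F S \<Gamma> r"
    and \<tau>: "0 < \<tau>" and p: "1 \<le> p" and \<beta>: "0 < \<beta>" "\<beta> < 1" and C\<xi>: "0 \<le> C\<^sub>\<xi>"
    and D_meas: "\<And>i. i \<in> S \<Longrightarrow> (\<lambda>x. D x i) \<in> borel_measurable borel"
    and local_lipschitz: "\<And>R. R > 0 \<Longrightarrow> \<exists>L>0. \<forall>t\<ge>0. \<forall>i\<in>S. \<forall>x y x' y'.
      norm x \<le> R \<and> norm y \<le> R \<and> norm x' \<le> R \<and> norm y' \<le> R \<longrightarrow>
      max (norm (f x y t i - f x' y' t i)) (norm (g x y t i - g x' y' t i))
        \<le> L * (norm (x - x') + norm (y - y'))"
    and D_contraction: "\<And>x y i. i \<in> S \<Longrightarrow> norm (D x i - D y i) \<le> \<beta> * norm (x - y)"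
    and D_zero: "\<And>i. i \<in> S \<Longrightarrow> D 0 i = 0"
    and f_zero: "\<And>t i. t \<ge> 0 \<Longrightarrow> i \<in> S \<Longrightarrow> f 0 0 t i = 0"
    and g_zero: "\<And>t i. t \<ge> 0 \<Longrightarrow> i \<in> S \<Longrightarrow> g 0 0 t i = 0"
    and X_meas: "\<And>t. t \<ge> - \<tau> \<Longrightarrow> X t \<in> borel_measurable (F (max t 0))"
    and X_init: "AE w in M. \<forall>s\<in>{- \<tau>..0}. norm (X s w) \<le> C\<^sub>\<xi>"
    and f_integrable: "AE w in M. \<forall>t\<ge>0. set_integrable lborel {0..t} (\<lambda>s. f (X s w) (X (s - \<tau>) w) s (r s w))"
    and ito: "ito_integral M F B (\<lambda>s w. g (X s w) (X (s - \<tau>) w) s (r s w)) J"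
    and equation: "AE w in M. \<forall>t\<ge>0. X t w - D (X (t - \<tau>) w) (r t w) =
         X 0 w - D (X (- \<tau>) w) (r 0 w) + (LINT s:{0..t}|lborel. f (X s w) (X (s - \<tau>) w) s (r s w)) + J t w"
    and C21: "C21 S V"
    and \<phi>_nonneg: "\<And>t. t \<ge> 0 \<Longrightarrow> 0 \<le> \<phi> t" and \<phi>_int: "set_integrable lborel {0..} \<phi>"
    and h_nonneg: "\<And>t. t \<ge> 0 \<Longrightarrow> 0 \<le> h t" and h_int: "set_integrable lborel {0..} h"
    and c1: "0 < c\<^sub>1" and c2: "0 < c\<^sub>2" and C0: "0 < C\<^sub>0"
    and V_bounds: "\<And>x t i. t \<ge> 0 \<Longrightarrow> i \<in> S \<Longrightarrow> c\<^sub>1 * norm x powr p \<le> V x t i \<and> V x t i \<le> c\<^sub>2 * norm x powr p"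
    and LV_bound: "AE t in lborel. 0 \<le> t \<longrightarrow> (\<forall>x y. \<forall>i\<in>S. LV S \<Gamma> D f g V x y t i \<le> h t + (C\<^sub>0 + \<phi> t) * V (x - D y i) t i)"
begin

definition Z where "Z t w = X t w - D (X (t - \<tau>) w) (r t w)"
definition bb where "bb s w = f (X s w) (X (s - \<tau>) w) s (r s w)"
definition GG where "GG s w = g (X s w) (X (s - \<tau>) w) s (r s w)"

text \<open>One set of full measure on which the pathwise hypotheses hold for all times together, so
  that paths can be treated one by one.\<close>

definition \<Omega>\<^sub>0 where "\<Omega>\<^sub>0 = {w\<in>space M. (\<forall>s\<in>{- \<tau>..0}. norm (X s w) \<le> C\<^sub>\<xi>) \<and> (\<forall>t\<ge>0. set_integrable lborel {0..t} (\<lambda>s. bb s w)) \<and>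
   (\<forall>t\<ge>0. Z t w = Z 0 w + (LINT s:{0..t}|lborel. bb s w) + J t w)}"

lemma r_measurable_F: "0 \<le> t \<Longrightarrow> r t \<in> measurable (F t) (count_space S)"
  using mc unfolding markov_chain_def by auto

lemma r_measurable: "0 \<le> t \<Longrightarrow> r t \<in> measurable M (count_space S)"
  using measurable_F_M[OF r_measurable_F] by auto

lemma r_in_S: "0 \<le> t \<Longrightarrow> w \<in> space M \<Longrightarrow> r t w \<in> S"
  using measurable_space[OF r_measurable] by simp

lemma AE_\<Omega>0: "AE w in M. w \<in> \<Omega>\<^sub>0"
  using X_init f_integrable equation AE_space
proof eventually_elim
  case (elim w)
  have "Z t w = Z 0 w + (LINT s:{0..t}|lborel. bb s w) + J t w" if "0 \<le> t" for t
    using elim(3) that unfolding Z_def bb_def by simp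
  moreover have "\<forall>t\<ge>0. set_integrable lborel {0..t} (\<lambda>s. bb s w)" using elim(2) unfolding bb_def .
  ultimately show ?case unfolding \<Omega>\<^sub>0_def using elim(1,4) by blast
qed

lemma \<Omega>0_space: "\<Omega>\<^sub>0 \<subseteq> space M" unfolding \<Omega>\<^sub>0_def by blast

lemma \<Omega>0_init: "w \<in> \<Omega>\<^sub>0 \<Longrightarrow> - \<tau> \<le> s \<Longrightarrow> s \<le> 0 \<Longrightarrow> norm (X s w) \<le> C\<^sub>\<xi>"
  and \<Omega>0_integrable: "w \<in> \<Omega>\<^sub>0 \<Longrightarrow> 0 \<le> t \<Longrightarrow> set_integrable lborel {0..t} (\<lambda>s. bb s w)"
  and \<Omega>0_equation: "w \<in> \<Omega>\<^sub>0 \<Longrightarrow> 0 \<le> t \<Longrightarrow> Z t w = Z 0 w + (LINT s:{0..t}|lborel. bb s w) + J t w"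
  unfolding \<Omega>\<^sub>0_def mem_Collect_eq by (fastforce, blast, blast)

text \<open>The complement lies in a null set, and completeness of the filtration puts every such
  set into \<open>F 0\<close>.\<close>

lemma \<Omega>0_F: "0 \<le> t \<Longrightarrow> \<Omega>\<^sub>0 \<in> sets (F t)"
proof -
  assume t: "0 \<le> t"
  obtain N where N: "{w\<in>space M. w \<notin> \<Omega>\<^sub>0} \<subseteq> N" "N \<in> null_sets M"
    using AE_\<Omega>0 by (auto elim!: AE_E simp: null_sets_def)
  have "{w\<in>space M. w \<notin> \<Omega>\<^sub>0} \<in> sets (F 0)" using filtration N unfolding complete_filtration_def by blast
  then have "space (F 0) - {w\<in>space M. w \<notin> \<Omega>\<^sub>0} \<in> sets (F 0)" by (rule sets.compl_sets)
  moreover have "space (F 0) - {w\<in>space M. w \<notin> \<Omega>\<^sub>0} = \<Omega>\<^sub>0" using \<Omega>0_space by auto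
  ultimately show ?thesis using sets_F_mono[of 0 t] t by auto
qed

lemma \<Omega>0_events: "\<Omega>\<^sub>0 \<in> events" using sets_F_M[OF \<Omega>0_F[of 0]] by simp

lemma Z_measurable_F: "0 \<le> t \<Longrightarrow> Z t \<in> borel_measurable (F t)"
proof -
  assume t: "0 \<le> t"
  have X1: "X t \<in> borel_measurable (F t)" using X_meas[of t] t \<tau> by (simp add: max_def)
  have X2: "X (t - \<tau>) \<in> borel_measurable (F t)"
    by (rule measurable_F_mono[OF X_meas]) (use t \<tau> in auto)
  have "(\<lambda>w. D (X (t - \<tau>) w) (r t w)) \<in> borel_measurable (F t)"
  proof (rule measurable_compose_countable'[OF _ r_measurable_F[OF t]])
    show "(\<lambda>w. D (X (t - \<tau>) w) i) \<in> borel_measurable (F t)" if "i \<in> S" for i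
      using measurable_compose[OF X2 D_meas[OF that]] .
  qed (use S countable_finite in auto)
  then show ?thesis unfolding Z_def using X1 by measurable
qed

lemma Z_measurable: "0 \<le> t \<Longrightarrow> Z t \<in> borel_measurable M"
  using measurable_F_M[OF Z_measurable_F] by auto

lemma J_continuous: "w \<in> space M \<Longrightarrow> continuous_on {0..} (\<lambda>t. J t w)"
  and J_measurable: "0 \<le> t \<Longrightarrow> J t \<in> borel_measurable M"
  using ito measurable_F_M unfolding ito_integral_def by auto

lemma continuous_on_atLeastI:
  fixes u :: "real \<Rightarrow> 'b::metric_space"
  assumes "\<And>T. a \<le> T \<Longrightarrow> continuous_on {a..T} u"
  shows "continuous_on {a..} u"
  unfolding continuous_on_iff
proof (intro ballI allI impI)
  fix x e :: real assume x: "x \<in> {a..}" and e: "0 < e"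
  have "continuous_on {a..x + 1} u" using assms x by auto
  then obtain d where d: "d > 0" "\<forall>y\<in>{a..x + 1}. dist y x < d \<longrightarrow> dist (u y) (u x) < e"
    using x e unfolding continuous_on_iff by (metis atLeastAtMost_iff atLeast_iff le_add_same_cancel1 zero_le_one)
  show "\<exists>d>0. \<forall>y\<in>{a..}. dist y x < d \<longrightarrow> dist (u y) (u x) < e"
    by (intro exI[of _ "min d 1"]) (use d in \<open>auto simp: dist_real_def\<close>)
qed

text \<open>\<open>X\<close> may jump with the chain; \<open>Z\<close> does not, since the equation
  writes it as a Lebesgue integral plus the continuous process \<open>J\<close>.\<close>

lemma Z_continuous: "w \<in> \<Omega>\<^sub>0 \<Longrightarrow> continuous_on {0..} (\<lambda>t. Z t w)"
proof (rule continuous_on_atLeastI)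
  fix T :: real assume w: "w \<in> \<Omega>\<^sub>0" and T: "0 \<le> T"
  note i = \<Omega>0_integrable[OF w]
  have "continuous_on {0..T} (\<lambda>t. integral {0..t} (\<lambda>s. bb s w))"
    by (intro indefinite_integral_continuous_1 set_borel_integral_eq_integral(1) i T)
  moreover have "integral {0..t} (\<lambda>s. bb s w) = (LINT s:{0..t}|lborel. bb s w)" if "t \<in> {0..T}" for t
    using set_borel_integral_eq_integral(2)[OF i] that by simp
  ultimately have c: "continuous_on {0..T} (\<lambda>t. LINT s:{0..t}|lborel. bb s w)"
    by (rule continuous_on_eq)
  have "continuous_on {0..T} (\<lambda>t. Z 0 w + (LINT s:{0..t}|lborel. bb s w) + J t w)"
    by (intro continuous_intros c continuous_on_subset[OF J_continuous]) (use w \<Omega>0_space in auto)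
  moreover have "Z 0 w + (LINT s:{0..t}|lborel. bb s w) + J t w = Z t w" if "t \<in> {0..T}" for t
    using \<Omega>0_equation[OF w, of t, symmetric] that by simp
  ultimately show "continuous_on {0..T} (\<lambda>t. Z t w)" by (rule continuous_on_eq)
qed

lemma norm_D_le: "i \<in> S \<Longrightarrow> norm (D x i) \<le> \<beta> * norm x"
  using D_contraction[of i x 0] D_zero[of i] by simp

text \<open>Induction over delay intervals: \<open>X(s)\<close> is \<open>Z(s)\<close> plus a term
  at most \<open>\<beta>\<close> times the norm of \<open>X(s - \<tau>)\<close>, which is already
  bounded. The weight turns \<open>\<beta>\<close> into \<open>q\<close>. With
  \<open>\<mu> = 0\<close> this keeps \<open>X\<close> in a ball as long as \<open>Z\<close> is in
  one; with \<open>\<mu> > 0\<close> it carries the decay of \<open>Z\<close> over to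
  \<open>X\<close>.\<close>

lemma X_weighted_bound:
  assumes w: "w \<in> \<Omega>\<^sub>0" and Z: "\<And>s. 0 \<le> s \<Longrightarrow> s \<le> T \<Longrightarrow> norm (Z s w) \<le> R * exp (- (\<mu> * s))" and R: "0 \<le> R"
    and \<mu>: "0 \<le> \<mu>" "\<beta> * exp (\<mu> * \<tau>) < 1" and s: "- \<tau> \<le> s" "s \<le> T"
  shows "norm (X s w) \<le> (C\<^sub>\<xi> + R / (1 - \<beta> * exp (\<mu> * \<tau>))) * exp (- (\<mu> * s))"
proof -
  define q where "q = \<beta> * exp (\<mu> * \<tau>)"
  let ?R = "C\<^sub>\<xi> + R / (1 - q)"
  have q: "0 < q" "q < 1" using \<beta> \<mu> by (auto simp: q_def)
  have R0: "0 \<le> R / (1 - q)" using R q by simp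
  \<comment> \<open>\<open>R / (1 - q)\<close> is the fixed point of the map sending
    \<open>x\<close> to \<open>R + q * x\<close>; adding \<open>C\<^sub>\<xi>\<close> makes room for
    the initial segment.\<close>
  have fix_pt: "R + q * ?R \<le> ?R"
  proof -
    have "R + q * (R / (1 - q)) = R / (1 - q)" using q by (simp add: field_simps)
    moreover have "q * C\<^sub>\<xi> \<le> C\<^sub>\<xi>" using q C\<xi> by (simp add: mult_left_le_one_le)
    ultimately show ?thesis by (simp add: distrib_left)
  qed
  have "\<forall>s. - \<tau> \<le> s \<and> s \<le> T \<and> s \<le> real k * \<tau> \<longrightarrow> norm (X s w) \<le> ?R * exp (- (\<mu> * s))" for k
  proof (induction k)
    case 0
    show ?case
    proof (intro allI impI)
      fix s assume s: "- \<tau> \<le> s \<and> s \<le> T \<and> s \<le> real 0 * \<tau>"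
      then have "norm (X s w) \<le> C\<^sub>\<xi>" using \<Omega>0_init[OF w] by simp
      also have "\<dots> \<le> ?R * 1" using R0 by simp
      also have "\<dots> \<le> ?R * exp (- (\<mu> * s))"
        using R0 C\<xi> \<mu> s by (intro mult_left_mono) (auto simp: mult_nonneg_nonpos)
      finally show "norm (X s w) \<le> ?R * exp (- (\<mu> * s))" .
    qed
  next
    case (Suc k)
    show ?case
    proof (intro allI impI)
      fix s assume s: "- \<tau> \<le> s \<and> s \<le> T \<and> s \<le> real (Suc k) * \<tau>"
      show "norm (X s w) \<le> ?R * exp (- (\<mu> * s))"
      proof (cases "s \<le> real k * \<tau>")
        case True then show ?thesis using Suc s by blast
      next
        case False
        have "0 \<le> real k * \<tau>" using \<tau> by simp
        then have s0: "0 \<le> s" using False by linarith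
        have "s - \<tau> \<le> real k * \<tau>" "- \<tau> \<le> s - \<tau>" "s - \<tau> \<le> T" using s s0 \<tau> by (auto simp: distrib_right)
        then have "norm (X (s - \<tau>) w) \<le> ?R * exp (- (\<mu> * (s - \<tau>)))" using Suc by blast
        then have "\<beta> * norm (X (s - \<tau>) w) \<le> \<beta> * (?R * exp (- (\<mu> * (s - \<tau>))))" using \<beta>(1) by simp
        also have "\<dots> = q * ?R * exp (- (\<mu> * s))" by (simp add: q_def right_diff_distrib exp_diff exp_minus field_simps)
        finally have "\<beta> * norm (X (s - \<tau>) w) \<le> q * ?R * exp (- (\<mu> * s))" .
        moreover have "norm (D (X (s - \<tau>) w) (r s w)) \<le> \<beta> * norm (X (s - \<tau>) w)"
          using norm_D_le r_in_S[OF s0] w \<Omega>0_space by auto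
        moreover have "norm (X s w) \<le> norm (Z s w) + norm (D (X (s - \<tau>) w) (r s w))"
          unfolding Z_def using norm_triangle_sub[of "X s w" "D (X (s - \<tau>) w) (r s w)"] by (simp add: add.commute)
        moreover have "norm (Z s w) \<le> R * exp (- (\<mu> * s))" using Z s0 s by auto
        ultimately have "norm (X s w) \<le> (R + q * ?R) * exp (- (\<mu> * s))" unfolding distrib_right by linarith
        also have "\<dots> \<le> ?R * exp (- (\<mu> * s))" using fix_pt by (intro mult_right_mono) auto
        finally show ?thesis .
      qed
    qed
  qed
  moreover obtain k :: nat where "s < real k * \<tau>" using reals_Archimedean3[OF \<tau>] by blast
  ultimately show ?thesis using s unfolding q_def by (meson less_imp_le)
qed

corollary X_bound:
  assumes "w \<in> \<Omega>\<^sub>0" "\<And>s. 0 \<le> s \<Longrightarrow> s \<le> T \<Longrightarrow> norm (Z s w) \<le> R" "0 \<le> R" "- \<tau> \<le> s" "s \<le> T"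
  shows "norm (X s w) \<le> C\<^sub>\<xi> + R / (1 - \<beta>)"
  using X_weighted_bound[of w T R 0 s] assms \<beta> by simp

text \<open>The Lipschitz condition is applied between \<open>(x, y)\<close> and the origin, where
  both coefficients vanish.\<close>

lemma coefficient_bound:
  assumes "0 < R"
  obtains K where "0 < K" "\<And>x y t i. 0 \<le> t \<Longrightarrow> i \<in> S \<Longrightarrow> norm x \<le> R \<Longrightarrow> norm y \<le> R \<Longrightarrow> norm (f x y t i) \<le> K \<and> norm (g x y t i) \<le> K"
proof -
  obtain L where L: "L > 0" "\<forall>t\<ge>0. \<forall>i\<in>S. \<forall>x y x' y'.
      norm x \<le> R \<and> norm y \<le> R \<and> norm x' \<le> R \<and> norm y' \<le> R \<longrightarrow>
      max (norm (f x y t i - f x' y' t i)) (norm (g x y t i - g x' y' t i))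
        \<le> L * (norm (x - x') + norm (y - y'))"
    using local_lipschitz[OF assms] by blast
  have "norm (f x y t i) \<le> L * (2 * R) \<and> norm (g x y t i) \<le> L * (2 * R)" if "0 \<le> t" "i \<in> S" "norm x \<le> R" "norm y \<le> R" for x y t i
  proof -
    have "max (norm (f x y t i)) (norm (g x y t i)) \<le> L * (norm x + norm y)"
      using L(2)[rule_format, of t i x y 0 0] that assms f_zero g_zero by simp
    also have "\<dots> \<le> L * (2 * R)" using that L(1) by (intro mult_left_mono) auto
    finally show ?thesis by simp
  qed
  then show thesis using that[of "L * (2 * R)"] L(1) assms by simp
qed

end

subsection \<open>Stopping at a hitting time\<close>

text \<open>\<open>R\<close> confines \<open>Z\<close> on the whole past up to \<open>n\<close>,
  because the delay makes the coefficients depend on it; \<open>\<rho>\<close> is the level to be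
  hit in \<open>[n, n + 1]\<close>. Since \<open>\<rho> \<le> R\<close>, one ball contains
  \<open>Z\<close> up to the stopping time on the event \<open>H\<close>.\<close>

locale nsdde_hitting = nsdde_setting M F B S \<Gamma> r D f g X J V \<phi> h p \<tau> \<beta> c\<^sub>1 c\<^sub>2 C\<^sub>0 C\<^sub>\<xi>
  for M :: "'w measure" and F and B :: "real \<Rightarrow> 'w \<Rightarrow> real ^ 'm" and S \<Gamma> r
    and D :: "real ^ 'd \<Rightarrow> int \<Rightarrow> real ^ 'd" and f g X J V \<phi> h p \<tau> \<beta> c\<^sub>1 c\<^sub>2 C\<^sub>0 C\<^sub>\<xi> +
  fixes n :: nat and \<rho> R :: real
  assumes \<rho>: "0 < \<rho>" and \<rho>R: "\<rho> \<le> R"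
begin

definition a where "a = real n"
definition T where "T = real n + 1"
definition H where "H = {w\<in>\<Omega>\<^sub>0. \<forall>s\<in>{0..a}. norm (Z s w) \<le> R}"
definition A where "A t = {w\<in>H. \<forall>s\<in>{a..t}. norm (Z s w) < \<rho>}"
text \<open>The value \<open>T + 1\<close> encodes that the level is not reached by time \<open>T\<close>; off \<open>H\<close> the process is stopped at once.\<close>

definition \<sigma> where "\<sigma> w = (if w \<in> H then if w \<in> A T then T + 1 else Inf {s\<in>{a..T}. \<rho> \<le> norm (Z s w)} else a)"

lemma a0: "0 \<le> a" and aT: "a < T" "a \<le> T" by (auto simp: a_def T_def)

lemma R0: "0 < R" "0 \<le> R" using \<rho> \<rho>R by auto

lemma H_space: "H \<subseteq> space M" using \<Omega>0_space by (auto simp: H_def)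

lemma A_subset_H: "A t \<subseteq> H" by (auto simp: A_def)

lemma A_antimono: "s \<le> t \<Longrightarrow> A t \<subseteq> A s" by (auto simp: A_def)

lemma Zc_F:
  assumes "0 \<le> s" "s \<le> t"
  shows "(\<lambda>w. norm (indicator \<Omega>\<^sub>0 w *\<^sub>R Z s w)) \<in> borel_measurable (F t)"
proof -
  have "Z s \<in> borel_measurable (F t)" by (rule measurable_F_mono[OF Z_measurable_F[OF assms(1)] assms])
  moreover have "indicator \<Omega>\<^sub>0 \<in> borel_measurable (F t)" using \<Omega>0_F[of t] assms by simp
  ultimately show ?thesis by measurable
qed

lemma Zc_continuous: "w \<in> space M \<Longrightarrow> continuous_on {0..} (\<lambda>s. indicator \<Omega>\<^sub>0 w *\<^sub>R Z s w)"
  by (cases "w \<in> \<Omega>\<^sub>0") (auto simp: Z_continuous)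

lemma Zc_norm_continuous: "0 \<le> b \<Longrightarrow> w \<in> space M \<Longrightarrow> continuous_on {b..c} (\<lambda>s. norm (indicator \<Omega>\<^sub>0 w *\<^sub>R Z s w))"
  by (rule continuous_on_norm, rule continuous_on_subset[OF Zc_continuous]) auto

lemma H_F: "H \<in> sets (F a)"
proof -
  have "{w\<in>space (F a). \<forall>s\<in>{0..a}. norm (indicator \<Omega>\<^sub>0 w *\<^sub>R Z s w) \<le> R} \<in> sets (F a)"
    by (rule sets_all_le_interval) (use a0 in \<open>simp_all add: Zc_F Zc_norm_continuous del: norm_scaleR\<close>)
  then have "\<Omega>\<^sub>0 \<inter> {w\<in>space (F a). \<forall>s\<in>{0..a}. norm (indicator \<Omega>\<^sub>0 w *\<^sub>R Z s w) \<le> R} \<in> sets (F a)"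
    using \<Omega>0_F[OF a0] by (rule sets.Int[rotated])
  moreover have "\<Omega>\<^sub>0 \<inter> {w\<in>space (F a). \<forall>s\<in>{0..a}. norm (indicator \<Omega>\<^sub>0 w *\<^sub>R Z s w) \<le> R} = H"
    using \<Omega>0_space a0 unfolding H_def by auto
  ultimately show ?thesis by simp
qed

lemma A_F: assumes "a \<le> t" shows "A t \<in> sets (F t)"
proof -
  have t0: "0 \<le> t" using a0 assms by simp
  have "{w\<in>space (F t). \<forall>s\<in>{a..t}. norm (indicator \<Omega>\<^sub>0 w *\<^sub>R Z s w) < \<rho>} \<in> sets (F t)"
    by (rule sets_all_less_interval) (use a0 t0 in \<open>simp_all add: Zc_F Zc_norm_continuous del: norm_scaleR\<close>)
  then have "H \<inter> {w\<in>space (F t). \<forall>s\<in>{a..t}. norm (indicator \<Omega>\<^sub>0 w *\<^sub>R Z s w) < \<rho>} \<in> sets (F t)"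
    using H_F sets_F_mono[OF a0 assms] by (intro sets.Int) auto
  moreover have "H \<inter> {w\<in>space (F t). \<forall>s\<in>{a..t}. norm (indicator \<Omega>\<^sub>0 w *\<^sub>R Z s w) < \<rho>} = A t"
    using \<Omega>0_space t0 unfolding A_def H_def by auto
  ultimately show ?thesis by simp
qed

lemma H_events: "H \<in> events" and A_events: "a \<le> t \<Longrightarrow> A t \<in> events"
  using sets_F_M[OF H_F a0] sets_F_M[OF A_F] a0 by auto

lemma Z_continuous_H: "w \<in> H \<Longrightarrow> continuous_on {0..} (\<lambda>s. Z s w)"
  by (rule Z_continuous) (simp add: H_def)

text \<open>The times at which the norm is at least \<open>\<rho>\<close> form a closed set by
  continuity, so the infimum is attained.\<close>

lemma \<sigma>_hit:
  assumes w: "w \<in> H" "w \<notin> A T"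
  shows "a \<le> \<sigma> w" "\<sigma> w \<le> T" "\<rho> \<le> norm (Z (\<sigma> w) w)" "\<And>s. a \<le> s \<Longrightarrow> s < \<sigma> w \<Longrightarrow> norm (Z s w) < \<rho>"
proof -
  let ?S = "{s\<in>{a..T}. \<rho> \<le> norm (Z s w)}"
  have ne: "?S \<noteq> {}" using w unfolding A_def by (auto simp: not_less)
  have "continuous_on {a..T} (\<lambda>s. norm (Z s w))"
    using a0 by (intro continuous_on_norm continuous_on_subset[OF Z_continuous_H[OF w(1)]]) auto
  then have "closed {s\<in>{a..T}. (\<lambda>s. norm (Z s w)) s \<in> {\<rho>..}}"
    by (intro continuous_closed_preimage[unfolded vimage_def Int_def mem_Collect_eq, simplified]) auto
  then have cl: "closed ?S" by simp
  have bd: "bdd_below ?S" by (intro bdd_belowI[of _ a]) auto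
  have s: "\<sigma> w = Inf ?S" using w by (simp add: \<sigma>_def)
  have mem: "Inf ?S \<in> ?S" by (rule closed_contains_Inf[OF ne bd cl])
  then show "a \<le> \<sigma> w" "\<sigma> w \<le> T" "\<rho> \<le> norm (Z (\<sigma> w) w)" unfolding s by auto
  show "norm (Z s' w) < \<rho>" if "a \<le> s'" "s' < \<sigma> w" for s'
  proof (rule ccontr)
    assume "\<not> norm (Z s' w) < \<rho>"
    then have "s' \<in> ?S" using that \<open>\<sigma> w \<le> T\<close> by auto
    then have "Inf ?S \<le> s'" by (rule cInf_lower[OF _ bd])
    then show False using that s by simp
  qed
qed

lemma \<sigma>_outside: "w \<notin> H \<Longrightarrow> \<sigma> w = a" by (simp add: \<sigma>_def)

lemma \<sigma>_top: "w \<in> A T \<Longrightarrow> \<sigma> w = T + 1" using A_subset_H by (auto simp: \<sigma>_def)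

lemma \<sigma>_ge: "a \<le> \<sigma> w"
  using \<sigma>_hit(1)[of w] \<sigma>_outside[of w] \<sigma>_top[of w] aT by (cases "w \<in> H"; cases "w \<in> A T") auto

text \<open>As the hitting time is attained, stopping can be expressed by the events
  \<open>A t\<close>, which are decided by time \<open>t\<close>.\<close>

lemma \<sigma>_gt_iff:
  assumes "a \<le> t" "t \<le> T"
  shows "t < \<sigma> w \<longleftrightarrow> w \<in> A t"
proof (cases "w \<in> H")
  case False
  then show ?thesis using \<sigma>_outside assms A_subset_H by auto
next
  case H: True
  show ?thesis
  proof (cases "w \<in> A T")
    case True
    then show ?thesis using \<sigma>_top A_antimono[OF assms(2)] assms by auto
  next
    case False
    note hit = \<sigma>_hit[OF H False]
    show ?thesis
    proof
      assume "t < \<sigma> w" then show "w \<in> A t" using hit(4) H by (auto simp: A_def)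
    next
      assume At: "w \<in> A t"
      show "t < \<sigma> w"
      proof (rule ccontr)
        assume "\<not> t < \<sigma> w"
        then have "\<sigma> w \<in> {a..t}" using hit(1) by auto
        then show False using At hit(3) by (force simp: A_def)
      qed
    qed
  qed
qed

lemma \<sigma>_stop:
  assumes "a \<le> t" "t \<le> T"
  shows "{w\<in>space M. t < \<sigma> w} \<in> sets (F t)"
proof -
  have "{w\<in>space M. t < \<sigma> w} = A t" using \<sigma>_gt_iff[OF assms] A_subset_H H_space by blast
  then show ?thesis using A_F[OF assms(1)] by simp
qed

lemma \<sigma>_measurable: "\<sigma> \<in> borel_measurable M"
proof (subst borel_measurable_iff_greater, rule allI)
  fix c
  consider "c < a" | "a \<le> c" "c \<le> T" | "T < c" "c < T + 1" | "T + 1 \<le> c" by linarith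
  then show "{w\<in>space M. c < \<sigma> w} \<in> events"
  proof cases
    case 1
    then have "{w\<in>space M. c < \<sigma> w} = space M" using \<sigma>_ge order.strict_trans2 by blast
    then show ?thesis by simp
  next
    case 2
    then show ?thesis using sets_F_M[OF \<sigma>_stop] a0 by auto
  next
    \<comment> \<open>No value of \<open>\<sigma>\<close> lies strictly between \<open>T\<close> and
      \<open>T + 1\<close>.\<close>
    case 3
    have "c < \<sigma> w \<longleftrightarrow> w \<in> A T" for w
      using \<sigma>_gt_iff[of T w] \<sigma>_top[of w] 3 aT by (smt (verit))
    then have "{w\<in>space M. c < \<sigma> w} = A T" using A_subset_H H_space by blast
    then show ?thesis using A_events aT by simp
  next
    case 4
    have "\<sigma> w \<le> T + 1" for w
      using \<sigma>_gt_iff[of T w] \<sigma>_top[of w] aT by (smt (verit))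
    then have "{w\<in>space M. c < \<sigma> w} = {}" using 4 by (smt (verit) Collect_empty_eq)
    then show ?thesis by (simp only: sets.empty_sets)
  qed
qed

lemma \<sigma>_nonneg: "0 \<le> \<sigma> w" using \<sigma>_ge[of w] a0 by linarith

text \<open>At the hitting time itself the strict bound fails; the weak one is obtained as a limit
  from the left.\<close>

lemma Z_before:
  assumes w: "w \<in> H" and s: "0 \<le> s" "s \<le> \<sigma> w" "s \<le> T"
  shows "norm (Z s w) \<le> R"
proof (cases "s \<le> a")
  case True
  then show ?thesis using w s by (auto simp: H_def)
next
  case False
  have lt: "norm (Z u w) \<le> \<rho>" if "a \<le> u" "u < s" for u
  proof -
    have "u < \<sigma> w" using that s by simp
    then have "w \<in> A u" using \<sigma>_gt_iff[of u w] that s by auto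
    then show ?thesis using that by (force simp: A_def)
  qed
  have "norm (Z s w) \<le> \<rho>"
  proof (rule continuous_le_on_closure[where S="{a<..<s}" and f="\<lambda>u. norm (Z u w)"])
    show "continuous_on (closure {a<..<s}) (\<lambda>u. norm (Z u w))"
      using False a0 by (auto intro!: continuous_on_norm continuous_on_subset[OF Z_continuous_H[OF w]])
    show "s \<in> closure {a<..<s}" using False by simp
  qed (use lt in auto)
  then show ?thesis using \<rho>R by simp
qed

text \<open>The radius in which \<open>X\<close> stays up to the stopping time, by
  \<open>X_bound\<close>; the summand 1 makes it visibly positive.\<close>

definition R' where "R' = C\<^sub>\<xi> + R / (1 - \<beta>) + 1"

definition K where "K = (SOME K. 0 < K \<and> (\<forall>x y t i. 0 \<le> t \<longrightarrow> i \<in> S \<longrightarrow> norm x \<le> R' \<longrightarrow> norm y \<le> R' \<longrightarrow>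
   norm (f x y t i) \<le> K \<and> norm (g x y t i) \<le> K))"

lemma K: "0 < K" "0 \<le> t \<Longrightarrow> i \<in> S \<Longrightarrow> norm x \<le> R' \<Longrightarrow> norm y \<le> R' \<Longrightarrow> norm (f x y t i) \<le> K \<and> norm (g x y t i) \<le> K"
proof -
  have "0 \<le> R / (1 - \<beta>)" using R0 \<beta> by simp
  then have "0 < R'" using C\<xi> unfolding R'_def by linarith
  then obtain K' where "0 < K'" "\<And>x y t i. 0 \<le> t \<Longrightarrow> i \<in> S \<Longrightarrow> norm x \<le> R' \<Longrightarrow> norm y \<le> R' \<Longrightarrow> norm (f x y t i) \<le> K' \<and> norm (g x y t i) \<le> K'"
    by (rule coefficient_bound) (rule that; assumption)
  then have "\<exists>K. 0 < K \<and> (\<forall>x y t i. 0 \<le> t \<longrightarrow> i \<in> S \<longrightarrow> norm x \<le> R' \<longrightarrow> norm y \<le> R' \<longrightarrow> norm (f x y t i) \<le> K \<and> norm (g x y t i) \<le> K)"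
    by (intro exI[of _ K'] conjI allI impI) simp_all
  note * = someI_ex[OF this, folded K_def]
  show "0 < K" by (rule *[THEN conjunct1])
  show "0 \<le> t \<Longrightarrow> i \<in> S \<Longrightarrow> norm x \<le> R' \<Longrightarrow> norm y \<le> R' \<Longrightarrow> norm (f x y t i) \<le> K \<and> norm (g x y t i) \<le> K"
    by (rule *[THEN conjunct2, rule_format])
qed

lemma coefficients_before:
  assumes w: "w \<in> H" and s: "0 \<le> s" "s \<le> \<sigma> w" "s \<le> T"
  shows "norm (bb s w) \<le> K" "norm (GG s w) \<le> K"
proof -
  have w0: "w \<in> \<Omega>\<^sub>0" using w by (simp add: H_def)
  have X: "norm (X u w) \<le> R'" if "- \<tau> \<le> u" "u \<le> s" for u
  proof -
    have "norm (X u w) \<le> C\<^sub>\<xi> + R / (1 - \<beta>)"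
      by (rule X_bound[OF w0 _ R0(2) that]) (use Z_before[OF w] s in auto)
    then show ?thesis by (simp add: R'_def)
  qed
  have "r s w \<in> S" using r_in_S[OF s(1)] w H_space by auto
  then have "norm (bb s w) \<le> K \<and> norm (GG s w) \<le> K"
    unfolding bb_def GG_def by (intro K(2) X s) (use s \<tau> in auto)
  then show "norm (bb s w) \<le> K" "norm (GG s w) \<le> K" by auto
qed

lemma GG_ito: "ito_integral M F B GG J"
  using ito unfolding GG_def[abs_def] .

lemma AE_bound: "AE w in M. \<forall>s. a < s \<and> s \<le> T \<and> s \<le> \<sigma> w \<longrightarrow> norm (GG s w) \<le> K"
proof (rule AE_I2, intro allI impI)
  fix w s assume s: "a < s \<and> s \<le> T \<and> s \<le> \<sigma> w"
  then have "w \<in> H" using \<sigma>_outside[of w] by force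
  then show "norm (GG s w) \<le> K" using coefficients_before(2) s a0 by auto
qed

text \<open>Indices count cells of length \<open>1 / N\<close> from time 0, so the
  \<open>k\<close>-th cell after time \<open>n\<close> has index \<open>n * N + k\<close>.\<close>

lemma stopped_ito_cell:
  assumes N: "0 < N" and k: "k < N"
  shows "stopped_ito M F B GG J K \<sigma> N (n * N + k) (n * N + Suc k)"
    and "real (n * N + k) / real N = a + real k / real N"
    and "real (n * N + Suc k) / real N = a + real (Suc k) / real N"
    and "a \<le> a + real k / real N" "a + real k / real N \<le> a + real (Suc k) / real N" "a + real (Suc k) / real N \<le> T"
proof -
  show e: "real (n * N + k) / real N = a + real k / real N" "real (n * N + Suc k) / real N = a + real (Suc k) / real N"
    using N by (simp_all add: a_def field_simps)
  have "real (Suc k) \<le> real N" using k by simp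
  then have "real (Suc k) / real N \<le> 1" using N by simp
  then show l: "a \<le> a + real k / real N" "a + real k / real N \<le> a + real (Suc k) / real N" "a + real (Suc k) / real N \<le> T"
    by (auto simp: T_def a_def divide_right_mono)
  show "stopped_ito M F B GG J K \<sigma> N (n * N + k) (n * N + Suc k)"
  proof (intro stopped_ito.intro stopped_ito_axioms.intro)
    show "filtered_bm M F B" by (rule filtered_bm_axioms)
    show "AE w in M. \<forall>s. real (n * N + k) / real N < s \<and> s \<le> real (n * N + Suc k) / real N \<and> s \<le> \<sigma> w \<longrightarrow> norm (GG s w) \<le> K"
      unfolding e using AE_bound
    proof eventually_elim
      case (elim w)
      show ?case
      proof (intro allI impI)
        fix s assume s: "a + real k / real N < s \<and> s \<le> a + real (Suc k) / real N \<and> s \<le> \<sigma> w"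
        then have "a < s \<and> s \<le> T \<and> s \<le> \<sigma> w" using l by linarith
        then show "norm (GG s w) \<le> K" using elim by blast
      qed
    qed
    show "{w\<in>space M. u < \<sigma> w} \<in> sets (F u)" if "real (n * N + k) / real N \<le> u" "u \<le> real (n * N + Suc k) / real N" for u
      by (rule \<sigma>_stop) (use that[unfolded e] l in linarith)+
  qed (use GG_ito N K(1) \<sigma>_measurable \<sigma>_nonneg in auto)
qed

end

subsection \<open>The drift along a partition\<close>

text \<open>By right-continuity every \<open>s > 0\<close> starts an interval of constancy that
  reaches up to a rational \<open>q s\<close>. If two left jumps \<open>s < s'\<close> shared this
  rational, \<open>s'\<close> would lie inside the interval of \<open>s\<close> and be no jump. So
  \<open>q\<close> injects the left jumps into the rationals.\<close>

lemma countable_left_jumps: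
  fixes u :: "real \<Rightarrow> 'b::discrete_topology"
  assumes u: "\<And>t. 0 \<le> t \<Longrightarrow> continuous (at_right t) u"
  shows "countable {s. 0 < s \<and> \<not> (\<forall>\<^sub>F x in at_left s. u x = u s)}" (is "countable ?D")
proof -
  have "\<exists>q\<in>\<rat>. s < q \<and> (\<forall>x. s < x \<and> x < q \<longrightarrow> u x = u s)" if "0 < s" for s
  proof -
    have "\<forall>\<^sub>F x in at_right s. u x = u s"
      using u[of s] that by (simp add: continuous_within tendsto_discrete)
    then obtain e where e: "s < e" "\<And>x. s < x \<Longrightarrow> x < e \<Longrightarrow> u x = u s"
      by (auto simp: eventually_at_right_field)
    obtain q where "q \<in> \<rat>" "s < q" "q < e" using Rats_dense_in_real[OF e(1)] by blast
    then show ?thesis using e(2) by (intro bexI[of _ q]) auto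
  qed
  then have "\<exists>q. \<forall>s. 0 < s \<longrightarrow> q s \<in> \<rat> \<and> s < q s \<and> (\<forall>x. s < x \<and> x < q s \<longrightarrow> u x = u s)"
    by (intro choice) blast
  then obtain q where q: "\<And>s. 0 < s \<Longrightarrow> q s \<in> \<rat> \<and> s < q s \<and> (\<forall>x. s < x \<and> x < q s \<longrightarrow> u x = u s)" by blast
  have less: "q s \<noteq> q s'" if "s \<in> ?D" "s' \<in> ?D" "s < s'" for s s'
  proof
    assume eq: "q s = q s'"
    have s: "0 < s" "0 < s'" using that by auto
    have c: "u x = u s" if "s < x" "x \<le> s'" for x using q[of s] q[of s'] s eq that by auto
    have "\<forall>\<^sub>F x in at_left s'. u x = u s'"
      using eventually_at_left_real[OF that(3)] by eventually_elim (use c that(3) in auto)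
    then show False using that(2) by blast
  qed
  have "inj_on q ?D"
  proof (rule inj_onI)
    fix s s' assume D: "s \<in> ?D" "s' \<in> ?D" and q: "q s = q s'"
    have "\<not> s < s'" using less[OF D] q by blast
    moreover have "\<not> s' < s" using less[OF D(2,1)] q by auto
    ultimately show "s = s'" by simp
  qed
  moreover have "countable (q ` ?D)"
    by (rule countable_subset[OF _ countable_rat]) (use q in auto)
  ultimately show ?thesis by (rule countable_image_inj_on[rotated])
qed

text \<open>Brings the second-order term of \<open>LV\<close> into the form in which covariations of
  the stochastic integral enter.\<close>

lemma trace_sandwich:
  fixes g :: "real ^ 'm ^ 'd" and H :: "real ^ 'd ^ 'd"
  shows "trace (transpose g ** H ** g) = (\<Sum>a\<in>UNIV. \<Sum>c\<in>UNIV. H $ a $ c * (\<Sum>b\<in>UNIV. g $ a $ b * g $ c $ b))"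
proof -
  have "trace (transpose g ** H ** g) = (\<Sum>b\<in>UNIV. \<Sum>c\<in>UNIV. \<Sum>a\<in>UNIV. H $ a $ c * (g $ a $ b * g $ c $ b))"
    by (simp add: trace_def matrix_matrix_mult_def transpose_def sum_distrib_left sum_distrib_right mult_ac)
  also have "\<dots> = (\<Sum>b\<in>UNIV. \<Sum>a\<in>UNIV. \<Sum>c\<in>UNIV. H $ a $ c * (g $ a $ b * g $ c $ b))"
    by (intro sum.cong refl sum.swap)
  also have "\<dots> = (\<Sum>a\<in>UNIV. \<Sum>b\<in>UNIV. \<Sum>c\<in>UNIV. H $ a $ c * (g $ a $ b * g $ c $ b))" by (rule sum.swap)
  also have "\<dots> = (\<Sum>a\<in>UNIV. \<Sum>c\<in>UNIV. \<Sum>b\<in>UNIV. H $ a $ c * (g $ a $ b * g $ c $ b))"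
    by (intro sum.cong refl sum.swap)
  finally show ?thesis by (simp add: sum_distrib_left)
qed

context nsdde_hitting
begin

definition bS where "bS s w = (if s \<le> \<sigma> w then bb s w else 0)"
definition GS where "GS s w = (if s \<le> \<sigma> w then GG s w else 0)"
definition QS where "QS t t' i c w = (LINT s:{t<..t'}|lborel. \<Sum>b\<in>UNIV. GS s w $ i $ b * GS s w $ c $ b)"

text \<open>\<open>LV - (C\<^sub>0 + \<phi>) V\<close> with \<open>Z\<close>, \<open>r\<close> and
  the time argument of \<open>V\<close> frozen at \<open>t\<close>, while the two coefficients of
  the equation and \<open>\<phi>\<close> run with \<open>s\<close>: these need not be continuous in
  time.\<close>

definition drift where "drift t s w = indicator (A t) w * (Vt V (Z t w) t (r t w) + Vx V (Z t w) t (r t w) \<bullet> bS s w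
  + 1 / 2 * (\<Sum>a\<in>UNIV. \<Sum>c\<in>UNIV. Vxx V (Z t w) t (r t w) $ a $ c * (\<Sum>b\<in>UNIV. GS s w $ a $ b * GS s w $ c $ b))
  + (\<Sum>j\<in>S. \<Gamma> (r t w) j * V (Z t w) t j) - (C\<^sub>0 + \<phi> s) * V (Z t w) t (r t w))"

text \<open>The part of the expansion over a cell that is linear in the step, with the covariation
  \<open>QS\<close> in place of products of increments.\<close>

definition \<Lambda> where "\<Lambda> t t' w = indicator (A t) w * ((t' - t) * Vt V (Z t w) t (r t w)
  + Vx V (Z t w) t (r t w) \<bullet> (LINT s:{t<..t'}|lborel. bS s w)
  + 1 / 2 * (\<Sum>a\<in>UNIV. \<Sum>c\<in>UNIV. Vxx V (Z t w) t (r t w) $ a $ c * QS t t' a c w)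
  + (t' - t) * (\<Sum>j\<in>S. \<Gamma> (r t w) j * V (Z t w) t j))"

definition \<Phi> where "\<Phi> t t' = (LINT s:{t<..t'}|lborel. C\<^sub>0 + \<phi> s)"

lemma \<phi>_interval: "0 \<le> t \<Longrightarrow> set_integrable lborel {t<..t'} (\<lambda>s. C\<^sub>0 + \<phi> s)"
  and h_interval: "0 \<le> t \<Longrightarrow> set_integrable lborel {t<..t'} h"
proof -
  assume t: "0 \<le> t"
  have "set_integrable lborel {t<..t'} \<phi>" by (rule set_integrable_subset[OF \<phi>_int]) (use t in auto)
  moreover have "set_integrable lborel {t<..t'} (\<lambda>_. C\<^sub>0)"
    by (cases "t \<le> t'") (auto intro!: set_integrable_bounded[where C=C\<^sub>0] simp: C0 less_imp_le)
  ultimately show "set_integrable lborel {t<..t'} (\<lambda>s. C\<^sub>0 + \<phi> s)" by (rule set_integral_add(1)[rotated])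
  show "set_integrable lborel {t<..t'} h" by (rule set_integrable_subset[OF h_int]) (use t in auto)
qed

lemma bS_integrable:
  assumes "a \<le> t" "t \<le> t'" "t' \<le> T" "w \<in> H"
  shows "set_integrable lborel {t<..t'} (\<lambda>s. bS s w)"
    and "s \<in> {t<..t'} \<Longrightarrow> norm (bS s w) \<le> K"
proof -
  have "set_integrable lborel {0..t'} (\<lambda>s. bb s w)"
    using \<Omega>0_integrable assms a0 by (auto simp: H_def)
  then have "set_integrable lborel ({t<..t'} \<inter> {..\<sigma> w}) (\<lambda>s. bb s w)"
    by (rule set_integrable_subset) (use assms a0 in auto)
  then show "set_integrable lborel {t<..t'} (\<lambda>s. bS s w)"
    unfolding set_integrable_def
    by (rule back_subst[where P="integrable lborel"]) (auto simp: bS_def indicator_def)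
  show "norm (bS s w) \<le> K" if "s \<in> {t<..t'}"
    using coefficients_before(1)[OF assms(4), of s] that assms a0 K(1) by (auto simp: bS_def)
qed

lemma GS_bound:
  assumes "a \<le> s" "s \<le> T" "w \<in> H"
  shows "\<bar>GS s w $ a' $ b\<bar> \<le> K" "\<bar>\<Sum>b\<in>UNIV. GS s w $ a' $ b * GS s w $ c $ b\<bar> \<le> real CARD('m) * (K * K)"
proof -
  have *: "\<bar>GS s w $ a' $ b\<bar> \<le> K" for a' b
    using order_trans[OF abs_entry_le_norm coefficients_before(2)[OF assms(3), of s]] assms a0 K(1)
    by (auto simp: GS_def)
  then show "\<bar>GS s w $ a' $ b\<bar> \<le> K" .
  show "\<bar>\<Sum>b\<in>UNIV. GS s w $ a' $ b * GS s w $ c $ b\<bar> \<le> real CARD('m) * (K * K)"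
    by (rule abs_sum_product_le) (rule *)+
qed

lemma GS_integrable:
  assumes "a \<le> t" "t \<le> t'" "t' \<le> T" "w \<in> H"
  shows "set_integrable lborel {t<..t'} (\<lambda>s. \<Sum>b\<in>UNIV. GS s w $ a' $ b * GS s w $ c $ b)"
proof (rule set_integrable_bounded)
  have w: "w \<in> space M" using assms H_space by blast
  have p: "progressive F GG" using GG_ito unfolding ito_integral_def by blast
  have "(\<lambda>s. GG s w) \<in> borel_measurable (restrict_space borel {0..T})"
    by (rule progressive_section[OF p _ w]) (use a0 aT in auto)
  then have [measurable]: "(\<lambda>s. indicator {0..T} s *\<^sub>R GG s w) \<in> borel_measurable borel"
    by (subst (asm) borel_measurable_restrict_space_iff) auto
  have e: "indicator {t<..t'} s *\<^sub>R (\<Sum>b\<in>UNIV. GS s w $ a' $ b * GS s w $ c $ b) =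
    indicator ({t<..t'} \<inter> {..\<sigma> w}) s * (\<Sum>b\<in>UNIV. (indicator {0..T} s *\<^sub>R GG s w) $ a' $ b * (indicator {0..T} s *\<^sub>R GG s w) $ c $ b)" for s
    using assms a0 by (auto simp: GS_def indicator_def)
  show "(\<lambda>s. indicator {t<..t'} s *\<^sub>R (\<Sum>b\<in>UNIV. GS s w $ a' $ b * GS s w $ c $ b)) \<in> borel_measurable borel"
    unfolding e by (measurable; simp add: measurable_vec_nth)
  show "\<bar>\<Sum>b\<in>UNIV. GS s w $ a' $ b * GS s w $ c $ b\<bar> \<le> real CARD('m) * (K * K)" if "s \<in> {t<..t'}" for s
    by (rule GS_bound(2)) (use that assms in auto)
qed (use assms in auto)

lemma drift_integral:
  assumes "a \<le> t" "t \<le> t'" "t' \<le> T"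
  shows "set_integrable lborel {t<..t'} (\<lambda>s. drift t s w)"
    and "(LINT s:{t<..t'}|lborel. drift t s w) = \<Lambda> t t' w - indicator (A t) w * (\<Phi> t t' * V (Z t w) t (r t w))"
proof -
  let ?I = "\<lambda>f x. has_bochner_integral lborel (\<lambda>s. indicator {t<..t'} s *\<^sub>R (f s :: real)) x"
  have "?I (\<lambda>s. drift t s w) (\<Lambda> t t' w - indicator (A t) w * (\<Phi> t t' * V (Z t w) t (r t w)))"
  proof (cases "w \<in> A t")
    case False
    then show ?thesis by (simp add: drift_def \<Lambda>_def has_bochner_integral_zero)
  next
    case True
    then have H: "w \<in> H" using A_subset_H by blast
    let ?Q = "\<lambda>a c s. \<Sum>b\<in>UNIV. GS s w $ a $ b * GS s w $ c $ b"
    have b: "has_bochner_integral lborel (\<lambda>s. indicator {t<..t'} s *\<^sub>R bS s w) (LINT s:{t<..t'}|lborel. bS s w)"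
      using bS_integrable(1)[OF assms H] by (simp add: set_integrable_def set_lebesgue_integral_def has_bochner_integral_integrable)
    have q: "?I (?Q a c) (QS t t' a c w)" for a c
      using GS_integrable[OF assms H] by (simp add: QS_def set_integrable_def set_lebesgue_integral_def has_bochner_integral_integrable)
    have l: "?I (\<lambda>_. x) ((t' - t) * x)" for x :: real
      using has_bochner_integral_mult_left[OF has_bochner_integral_real_indicator[of "{t<..t'}" lborel], of x] assms
      by (simp add: has_bochner_integral_iff)
    have p: "?I (\<lambda>s. C\<^sub>0 + \<phi> s) (\<Phi> t t')"
      using \<phi>_interval[of t t'] assms a0 by (simp add: \<Phi>_def set_integrable_def set_lebesgue_integral_def has_bochner_integral_integrable)
    let ?x = "Z t w" let ?i = "r t w"
    have "has_bochner_integral lborel (\<lambda>s. (indicator {t<..t'} s *\<^sub>R Vt V ?x t ?i + Vx V ?x t ?i \<bullet> (indicator {t<..t'} s *\<^sub>R bS s w)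
       + 1 / 2 * (\<Sum>a\<in>UNIV. \<Sum>c\<in>UNIV. Vxx V ?x t ?i $ a $ c * (indicator {t<..t'} s *\<^sub>R ?Q a c s))
       + indicator {t<..t'} s *\<^sub>R (\<Sum>j\<in>S. \<Gamma> ?i j * V ?x t j)) - (indicator {t<..t'} s *\<^sub>R (C\<^sub>0 + \<phi> s)) * V ?x t ?i)
      (((t' - t) * Vt V ?x t ?i + Vx V ?x t ?i \<bullet> (LINT s:{t<..t'}|lborel. bS s w)
       + 1 / 2 * (\<Sum>a\<in>UNIV. \<Sum>c\<in>UNIV. Vxx V ?x t ?i $ a $ c * QS t t' a c w) + (t' - t) * (\<Sum>j\<in>S. \<Gamma> ?i j * V ?x t j))
       - \<Phi> t t' * V ?x t ?i)"
      by (intro has_bochner_integral_diff has_bochner_integral_add has_bochner_integral_mult_right has_bochner_integral_mult_left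
          has_bochner_integral_sum has_bochner_integral_inner_right b q l p)
    then show ?thesis
      by (rule has_bochner_integral_cong[THEN iffD1, rotated 3])
        (use True in \<open>auto simp: drift_def \<Lambda>_def indicator_def algebra_simps\<close>)
  qed
  then show "set_integrable lborel {t<..t'} (\<lambda>s. drift t s w)"
    "(LINT s:{t<..t'}|lborel. drift t s w) = \<Lambda> t t' w - indicator (A t) w * (\<Phi> t t' * V (Z t w) t (r t w))"
    by (auto simp: set_integrable_def set_lebesgue_integral_def has_bochner_integral_iff)
qed

end

context nsdde_setting
begin

lemma C21_continuous:
  assumes "i \<in> S"
  shows "continuous_on (UNIV \<times> {0..}) (\<lambda>(x, t). V x t i)" "continuous_on (UNIV \<times> {0..}) (\<lambda>(x, t). Vt V x t i)"
    "continuous_on (UNIV \<times> {0..}) (\<lambda>(x, t). Vx V x t i)" "continuous_on (UNIV \<times> {0..}) (\<lambda>(x, t). Vxx V x t i)"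
  using C21 assms unfolding C21_def by auto

text \<open>Continuity gives measurability for each fixed state, and the finitely many states are
  glued along the chain.\<close>

lemma state_measurable:
  fixes W :: "real ^ 'd \<Rightarrow> real \<Rightarrow> int \<Rightarrow> 'c::topological_space"
  assumes u: "u \<in> borel_measurable N" and q: "q \<in> measurable N (count_space S)"
    and W: "\<And>i. i \<in> S \<Longrightarrow> continuous_on (UNIV \<times> {0..}) (\<lambda>(x, t). W x t i)" and t: "0 \<le> t"
  shows "(\<lambda>w. W (u w) t (q w)) \<in> borel_measurable N"
proof (rule measurable_compose_countable'[OF _ q])
  show "(\<lambda>w. W (u w) t i) \<in> borel_measurable N" if i: "i \<in> S" for i
  proof (rule measurable_compose[OF u])
    have "continuous_on UNIV (\<lambda>x. (\<lambda>(x, t). W x t i) (x, t))"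
      by (rule continuous_on_compose2[OF W[OF i]]) (use t in \<open>auto intro!: continuous_intros\<close>)
    then show "(\<lambda>x. W x t i) \<in> borel_measurable borel" by (simp add: borel_measurable_continuous_onI)
  qed
qed (use S countable_finite in auto)

lemma tendsto_state:
  fixes W :: "real ^ 'd \<Rightarrow> real \<Rightarrow> int \<Rightarrow> 'c::topological_space"
  assumes W: "continuous_on (UNIV \<times> {0..}) (\<lambda>(x, t). W x t i)" and u: "continuous_on {0..} u" and s: "0 < s"
  shows "((\<lambda>t. W (u t) t i) \<longlongrightarrow> W (u s) s i) (at_left s)"
proof -
  have "continuous_on {0..} (\<lambda>t. (\<lambda>(x, t). W x t i) (u t, t))"
    by (rule continuous_on_compose2[OF W]) (use u in \<open>auto intro!: continuous_intros\<close>)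
  then have "((\<lambda>t. W (u t) t i) \<longlongrightarrow> W (u s) s i) (at s within {0..})"
    using s by (simp add: continuous_on_def)
  moreover have "at_left s \<le> at s within {0..}"
  proof (rule filter_leI)
    fix P assume "eventually P (at s within {0..})"
    then obtain S' where S': "open S'" "s \<in> S'" "\<forall>y\<in>S'. y \<noteq> s \<longrightarrow> y \<in> {0..} \<longrightarrow> P y"
      unfolding eventually_at_topological by blast
    show "eventually P (at_left s)" unfolding eventually_at_topological
      by (rule exI[of _ "S' \<inter> {0<..}"]) (use S' s in auto)
  qed
  ultimately show ?thesis by (rule tendsto_mono[rotated])
qed

text \<open>Almost every time is no left jump of the chain, so a state frozen shortly before it is
  the state at that time.\<close>

lemma AE_r_left: "w \<in> space M \<Longrightarrow> AE s in lborel. 0 < s \<longrightarrow> (\<forall>\<^sub>F t in at_left s. r t w = r s w)"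
proof -
  assume w: "w \<in> space M"
  have "countable {s. 0 < s \<and> \<not> (\<forall>\<^sub>F t in at_left s. r t w = r s w)}"
    by (rule countable_left_jumps) (use mc w in \<open>auto simp: markov_chain_def\<close>)
  then have "{s. 0 < s \<and> \<not> (\<forall>\<^sub>F t in at_left s. r t w = r s w)} \<in> null_sets lborel" by (rule countable_imp_null_set_lborel)
  then show ?thesis by (rule AE_I') auto
qed

end

context nsdde_hitting
begin

definition B\<^sub>V where "B\<^sub>V = (SOME B. 0 < B \<and> (\<forall>i\<in>S. \<forall>x t. norm x \<le> R \<and> a \<le> t \<and> t \<le> T \<longrightarrow>
      \<bar>V x t i\<bar> \<le> B \<and> \<bar>Vt V x t i\<bar> \<le> B \<and> norm (Vx V x t i) \<le> B \<and> norm (Vxx V x t i) \<le> B))"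

lemma B\<^sub>V: "0 < B\<^sub>V" and V_le: "i \<in> S \<Longrightarrow> norm x \<le> R \<Longrightarrow> a \<le> t \<Longrightarrow> t \<le> T \<Longrightarrow>
    \<bar>V x t i\<bar> \<le> B\<^sub>V \<and> \<bar>Vt V x t i\<bar> \<le> B\<^sub>V \<and> norm (Vx V x t i) \<le> B\<^sub>V \<and> norm (Vxx V x t i) \<le> B\<^sub>V"
  using someI_ex[OF C21_bounds(1)[OF C21 S a0, of R T, unfolded Bex_def], folded B\<^sub>V_def] by (blast, blast)

definition \<Gamma>\<^sub>S where "\<Gamma>\<^sub>S = (\<Sum>i\<in>S. \<Sum>j\<in>S. \<bar>\<Gamma> i j\<bar>)"

lemma \<Gamma>\<^sub>S: "0 \<le> \<Gamma>\<^sub>S" by (simp add: \<Gamma>\<^sub>S_def sum_nonneg)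

lemma sum_\<Gamma>_le:
  assumes "i \<in> S" "\<And>j. j \<in> S \<Longrightarrow> \<bar>u j\<bar> \<le> c" "0 \<le> c"
  shows "\<bar>\<Sum>j\<in>S. \<Gamma> i j * u j\<bar> \<le> \<Gamma>\<^sub>S * c"
proof -
  have "\<bar>\<Sum>j\<in>S. \<Gamma> i j * u j\<bar> \<le> (\<Sum>j\<in>S. \<bar>\<Gamma> i j\<bar> * c)"
    by (rule order_trans[OF sum_abs sum_mono]) (use assms in \<open>auto simp: abs_mult intro!: mult_left_mono\<close>)
  also have "\<dots> = (\<Sum>j\<in>S. \<bar>\<Gamma> i j\<bar>) * c" by (simp add: sum_distrib_right)
  also have "\<dots> \<le> \<Gamma>\<^sub>S * c" unfolding \<Gamma>\<^sub>S_def using assms S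
    by (intro mult_right_mono member_le_sum[of i S "\<lambda>i. \<Sum>j\<in>S. \<bar>\<Gamma> i j\<bar>"] sum_nonneg) auto
  finally show ?thesis .
qed

lemma A_D:
  assumes "w \<in> A t" "a \<le> t" "t \<le> T"
  shows "w \<in> H" "w \<in> space M" "t < \<sigma> w" "norm (Z t w) \<le> R" "r t w \<in> S"
proof -
  show H: "w \<in> H" and sp: "w \<in> space M" using assms A_subset_H H_space by blast+
  show t: "t < \<sigma> w" using \<sigma>_gt_iff assms by blast
  show "norm (Z t w) \<le> R" by (rule Z_before[OF H]) (use t a0 assms in auto)
  show "r t w \<in> S" using r_in_S sp a0 assms by auto
qed

definition C\<^sub>d where "C\<^sub>d = B\<^sub>V + B\<^sub>V * K + real CARD('d) * (real CARD('d) * (B\<^sub>V * (real CARD('m) * (K * K)))) + \<Gamma>\<^sub>S * B\<^sub>V + (C\<^sub>0 + 1) * B\<^sub>V"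

lemma C\<^sub>d: "0 \<le> C\<^sub>d" using B\<^sub>V K(1) \<Gamma>\<^sub>S C0 unfolding C\<^sub>d_def by (auto intro!: add_nonneg_nonneg mult_nonneg_nonneg)

lemma drift_bound:
  assumes t: "a \<le> t" "t < s" "s \<le> T"
  shows "\<bar>drift t s w\<bar> \<le> C\<^sub>d * (1 + \<phi> s)"
proof (cases "w \<in> A t")
  case False
  then show ?thesis using C\<^sub>d \<phi>_nonneg[of s] a0 t by (simp add: drift_def)
next
  case True
  have tT: "t \<le> T" using t by simp
  note D = A_D[OF True t(1) tT]
  note b = V_le[OF D(5,4) t(1) tT]
  let ?Q = "\<lambda>a c. \<Sum>b\<in>UNIV. GS s w $ a $ b * GS s w $ c $ b"
  let ?W = "Vxx V (Z t w) t (r t w)"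
  have p0: "0 \<le> \<phi> s" using \<phi>_nonneg[of s] a0 t by auto
  have 1: "\<bar>Vx V (Z t w) t (r t w) \<bullet> bS s w\<bar> \<le> B\<^sub>V * K"
    by (rule order_trans[OF Cauchy_Schwarz_ineq2]) (use b bS_integrable(2)[OF t(1) less_imp_le[OF t(2)] t(3) D(1), of s] t B\<^sub>V in \<open>auto intro!: mult_mono\<close>)
  have e: "\<bar>?W $ a' $ c * ?Q a' c\<bar> \<le> B\<^sub>V * (real CARD('m) * (K * K))" for a' c
    unfolding abs_mult by (rule mult_mono) (use b order_trans[OF abs_entry_le_norm[of ?W a' c]] GS_bound(2)[of s w] t D(1) B\<^sub>V in auto)
  have "\<bar>\<Sum>a\<in>UNIV. \<Sum>c\<in>UNIV. ?W $ a $ c * ?Q a c\<bar> \<le> (\<Sum>a\<in>(UNIV :: 'd set). \<Sum>c\<in>(UNIV :: 'd set). B\<^sub>V * (real CARD('m) * (K * K)))"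
    by (intro order_trans[OF sum_abs] sum_mono e)
  then have 2: "\<bar>\<Sum>a\<in>UNIV. \<Sum>c\<in>UNIV. ?W $ a $ c * ?Q a c\<bar> \<le> real CARD('d) * (real CARD('d) * (B\<^sub>V * (real CARD('m) * (K * K))))"
    by simp
  have 3: "\<bar>\<Sum>j\<in>S. \<Gamma> (r t w) j * V (Z t w) t j\<bar> \<le> \<Gamma>\<^sub>S * B\<^sub>V"
    by (rule sum_\<Gamma>_le[OF D(5)]) (use V_le D(4) t tT B\<^sub>V in auto)
  have 4: "\<bar>(C\<^sub>0 + \<phi> s) * V (Z t w) t (r t w)\<bar> \<le> C\<^sub>0 * B\<^sub>V + B\<^sub>V * \<phi> s"
  proof -
    have "\<bar>(C\<^sub>0 + \<phi> s) * V (Z t w) t (r t w)\<bar> \<le> (C\<^sub>0 + \<phi> s) * B\<^sub>V"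
      unfolding abs_mult using b p0 C0 by (intro mult_mono) auto
    then show ?thesis by (simp add: algebra_simps)
  qed
  have "\<bar>drift t s w\<bar> \<le> B\<^sub>V + B\<^sub>V * K + real CARD('d) * (real CARD('d) * (B\<^sub>V * (real CARD('m) * (K * K)))) + \<Gamma>\<^sub>S * B\<^sub>V + (C\<^sub>0 * B\<^sub>V + B\<^sub>V * \<phi> s)"
    using 1 2 3 4 b True unfolding drift_def by (simp add: abs_if split: if_splits)
  also have "\<dots> = (C\<^sub>d - B\<^sub>V) + B\<^sub>V * \<phi> s" unfolding C\<^sub>d_def by (simp add: algebra_simps)
  also have "\<dots> \<le> C\<^sub>d + C\<^sub>d * \<phi> s"
  proof -
    have "B\<^sub>V \<le> C\<^sub>d" unfolding C\<^sub>d_def using B\<^sub>V K(1) \<Gamma>\<^sub>S C0 by (auto intro!: add_nonneg_nonneg mult_nonneg_nonneg simp: add.assoc)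
    then have "B\<^sub>V * \<phi> s \<le> C\<^sub>d * \<phi> s" using p0 by (intro mult_right_mono)
    then show ?thesis using B\<^sub>V by linarith
  qed
  finally show ?thesis by (simp add: algebra_simps)
qed

lemma drift_limit:
  assumes s: "a < s" "s \<le> T" and w: "w \<in> space M" and s\<sigma>: "s \<noteq> \<sigma> w"
    and r: "\<forall>\<^sub>F t in at_left s. r t w = r s w"
    and LV: "\<And>x y i. i \<in> S \<Longrightarrow> LV S \<Gamma> D f g V x y s i \<le> h s + (C\<^sub>0 + \<phi> s) * V (x - D y i) s i"
  shows "((\<lambda>t. max (drift t s w - h s) 0) \<longlongrightarrow> 0) (at_left s)"
proof -
  have s0: "0 < s" using s a0 by simp
  have h0: "0 \<le> h s" using h_nonneg s0 by simp
  consider "s < \<sigma> w" | "\<sigma> w < s" using s\<sigma> by linarith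
  then show ?thesis
  proof cases
    case 1
    then have As: "w \<in> A s" using \<sigma>_gt_iff s by auto
    note D = A_D[OF As less_imp_le[OF s(1)] s(2)]
    note c = C21_continuous[OF D(5)]
    note Zc = Z_continuous_H[OF D(1)]
    let ?i = "r s w"
    let ?Q = "\<lambda>a c. \<Sum>b\<in>UNIV. GS s w $ a $ b * GS s w $ c $ b"
    define E where "E t = Vt V (Z t w) t ?i + Vx V (Z t w) t ?i \<bullet> bS s w
      + 1 / 2 * (\<Sum>a\<in>UNIV. \<Sum>c\<in>UNIV. Vxx V (Z t w) t ?i $ a $ c * ?Q a c)
      + (\<Sum>j\<in>S. \<Gamma> ?i j * V (Z t w) t j) - (C\<^sub>0 + \<phi> s) * V (Z t w) t ?i" for t
    have "(E \<longlongrightarrow> E s) (at_left s)" unfolding E_def[abs_def]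
      by (intro tendsto_intros tendsto_state[OF _ Zc s0] c C21_continuous(1))
    then have "((\<lambda>t. max (E t - h s) 0) \<longlongrightarrow> max (E s - h s) 0) (at_left s)" by (intro tendsto_intros)
    moreover have "max (E s - h s) 0 = 0"
    proof -
      have "bS s w = bb s w" "GS s w = GG s w" using 1 by (auto simp: bS_def GS_def)
      then have "E s = LV S \<Gamma> D f g V (X s w) (X (s - \<tau>) w) s ?i - (C\<^sub>0 + \<phi> s) * V (X s w - D (X (s - \<tau>) w) ?i) s ?i"
        unfolding E_def LV_def trace_sandwich by (simp add: Z_def bb_def GG_def)
      then show ?thesis using LV[OF D(5), of "X s w" "X (s - \<tau>) w"] by simp
    qed
    moreover have "\<forall>\<^sub>F t in at_left s. max (E t - h s) 0 = max (drift t s w - h s) 0"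
      using r eventually_at_left_real[OF s(1)]
    proof eventually_elim
      case (elim t)
      then have "w \<in> A t" using A_antimono[of t s] As by auto
      then show ?case using elim(1) by (simp add: drift_def E_def)
    qed
    ultimately show ?thesis by (auto elim: Lim_transform_eventually)
  next
    case 2
    then have lt: "max a (\<sigma> w) < s" using s by simp
    have "\<forall>\<^sub>F t in at_left s. 0 = max (drift t s w - h s) 0"
      using eventually_at_left_real[OF lt]
    proof eventually_elim
      case (elim t)
      then have "w \<notin> A t" using \<sigma>_gt_iff[of t w] s by auto
      then show ?case using h0 by (simp add: drift_def)
    qed
    then show ?thesis by (rule Lim_transform_eventually[OF tendsto_const])
  qed
qed

end

section \<open>Cells of the partition and the limit of the drift sums\<close>

context nsdde_hitting
begin

definition tk where "tk N k = a + real k / real N" for N k :: nat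
definition \<iota> where "\<iota> t t' w = J (min t' (\<sigma> w)) w - J (min t (\<sigma> w)) w"
text \<open>Set to zero off \<open>\<Omega>\<^sub>0\<close>, so that a random time is inserted into
  a process all of whose paths are continuous.\<close>

definition Y where "Y t w = indicator \<Omega>\<^sub>0 w *\<^sub>R Z (min t (\<sigma> w)) w"

lemma tk:
  assumes "0 < N" "k < N"
  shows "a \<le> tk N k" "tk N k < tk N (Suc k)" "tk N (Suc k) \<le> T" "tk N (Suc k) - tk N k = 1 / real N" "0 \<le> tk N k" "tk N k \<le> T"
proof -
  show "a \<le> tk N k" "tk N (Suc k) \<le> T" using stopped_ito_cell(4,6)[OF assms] unfolding tk_def by auto
  show d: "tk N (Suc k) - tk N k = 1 / real N" unfolding tk_def by (simp add: add_divide_distrib)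
  have "0 < 1 / real N" using assms by simp
  then show "tk N k < tk N (Suc k)" using d by linarith
  then show "0 \<le> tk N k" "tk N k \<le> T" using \<open>a \<le> tk N k\<close> \<open>tk N (Suc k) \<le> T\<close> a0 by linarith+
qed

lemma Y_measurable: "0 \<le> t \<Longrightarrow> Y t \<in> borel_measurable M"
  unfolding Y_def
  by (rule measurable_at_random_time[OF Zc_continuous])
    (use \<sigma>_measurable \<sigma>_nonneg \<Omega>0_events Z_measurable in \<open>auto intro!: borel_measurable_scaleR borel_measurable_indicator\<close>)

lemma Y_H: "w \<in> H \<Longrightarrow> Y t w = Z (min t (\<sigma> w)) w"
  by (simp add: Y_def H_def)

lemma Y_norm: "w \<in> H \<Longrightarrow> 0 \<le> t \<Longrightarrow> t \<le> T \<Longrightarrow> norm (Y t w) \<le> R"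
  unfolding Y_H by (rule Z_before) (use \<sigma>_nonneg in auto)

text \<open>The equation is used between \<open>t\<close> and the stopped end of the cell; cutting
  the drift integral at \<open>\<sigma>\<close> is the same as integrating
  \<open>bS\<close>.\<close>

lemma increment:
  assumes t: "a \<le> t" "t \<le> t'" "t' \<le> T" and w: "w \<in> A t"
  shows "Y t' w = Z t w + ((LINT s:{t<..t'}|lborel. bS s w) + \<iota> t t' w)"
    and "norm (LINT s:{t<..t'}|lborel. bS s w) \<le> K * (t' - t)"
proof -
  have tT: "t \<le> T" using t by simp
  note D = A_D[OF w t(1) tT]
  note b = bS_integrable[OF t D(1)]
  define m where "m = min t' (\<sigma> w)"
  have m: "t \<le> m" "0 \<le> t" "0 \<le> m" using t D(3) a0 by (auto simp: m_def)
  have w0: "w \<in> \<Omega>\<^sub>0" using D(1) by (simp add: H_def)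
  have i: "set_integrable lborel {0..m} (\<lambda>s. bb s w)" by (rule \<Omega>0_integrable[OF w0 m(3)])
  have e: "{0..m} = {0..t} \<union> {t<..m}" using m by auto
  have "(LINT s:{0..m}|lborel. bb s w) = (LINT s:{0..t}|lborel. bb s w) + (LINT s:{t<..m}|lborel. bb s w)"
    unfolding e by (rule set_integral_Un) (use m in \<open>auto intro!: set_integrable_subset[OF i]\<close>)
  moreover have "(LINT s:{t<..m}|lborel. bb s w) = (LINT s:{t<..t'}|lborel. bS s w)"
    unfolding set_lebesgue_integral_def by (intro Bochner_Integration.integral_cong) (auto simp: bS_def m_def indicator_def)
  ultimately have "Z m w = Z t w + ((LINT s:{t<..t'}|lborel. bS s w) + (J m w - J t w))"
    using \<Omega>0_equation[OF w0 m(3)] \<Omega>0_equation[OF w0 m(2)] by (simp add: algebra_simps)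
  moreover have "min t (\<sigma> w) = t" using D(3) by simp
  ultimately show "Y t' w = Z t w + ((LINT s:{t<..t'}|lborel. bS s w) + \<iota> t t' w)"
    by (simp add: Y_H[OF D(1)] \<iota>_def m_def)
  have ik: "set_integrable lborel {t<..t'} (\<lambda>_. K)"
    by (rule set_integrable_bounded[where C=K]) (use t K(1) in auto)
  have "norm (LINT s:{t<..t'}|lborel. bS s w) \<le> (\<integral>s. indicator {t<..t'} s *\<^sub>R K \<partial>lborel)"
    unfolding set_lebesgue_integral_def
    by (rule Bochner_Integration.integral_norm_bound_integral) (use b K(1) ik in \<open>auto simp: set_integrable_def split: split_indicator\<close>)
  then show "norm (LINT s:{t<..t'}|lborel. bS s w) \<le> K * (t' - t)" using t by (simp add: mult.commute)
qed

lemma cell_moments: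
  assumes N: "0 < N" "k < N"
  defines "t \<equiv> tk N k" and "t' \<equiv> tk N (Suc k)"
  shows "\<iota> t t' \<in> borel_measurable M" and "QS t t' i c \<in> borel_measurable M"
    and "integrable M (\<lambda>w. (\<iota> t t' w $ i) ^ 4)"
    and "expectation (\<lambda>w. (\<iota> t t' w $ i) ^ 4) \<le> 3 * real CARD('m) ^ 4 * K ^ 4 * (t' - t)\<^sup>2"
    and "\<xi> \<in> borel_measurable (F t) \<Longrightarrow> (\<And>w. w \<in> space M \<Longrightarrow> \<bar>\<xi> w\<bar> \<le> A') \<Longrightarrow> expectation (\<lambda>w. \<xi> w * \<iota> t t' w $ i) = 0"
    and "\<xi> \<in> borel_measurable (F t) \<Longrightarrow> (\<And>w. w \<in> space M \<Longrightarrow> \<bar>\<xi> w\<bar> \<le> A') \<Longrightarrow>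
      expectation (\<lambda>w. \<xi> w * (\<iota> t t' w $ i * \<iota> t t' w $ c)) = expectation (\<lambda>w. \<xi> w * QS t t' i c w)"
proof -
  interpret c: stopped_ito M F B GG J K \<sigma> N "n * N + k" "n * N + Suc k" by (rule stopped_ito_cell(1)[OF N])
  have t: "c.t\<^sub>0 = t" "c.t\<^sub>1 = t'"
    unfolding c.t\<^sub>0_def c.t\<^sub>1_def t_def t'_def tk_def by (rule stopped_ito_cell(2,3)[OF N])+
  have \<iota>: "c.\<Delta>J = \<iota> t t'" unfolding c.\<Delta>J_def[abs_def] \<iota>_def[abs_def] t ..
  have Q: "c.QV = QS t t'" unfolding c.QV_def[abs_def] QS_def[abs_def] c.Gs_def GS_def t ..
  show "\<iota> t t' \<in> borel_measurable M" "QS t t' i c \<in> borel_measurable M"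
    using c.\<Delta>J_measurable c.QV_measurable unfolding \<iota> Q by auto
  show "integrable M (\<lambda>w. (\<iota> t t' w $ i) ^ 4)"
    "expectation (\<lambda>w. (\<iota> t t' w $ i) ^ 4) \<le> 3 * real CARD('m) ^ 4 * K ^ 4 * (t' - t)\<^sup>2"
    using c.\<Delta>J_moments(1,2)[of "\<lambda>_. 0" 0 i] unfolding \<iota> t by auto
  show "\<xi> \<in> borel_measurable (F t) \<Longrightarrow> (\<And>w. w \<in> space M \<Longrightarrow> \<bar>\<xi> w\<bar> \<le> A') \<Longrightarrow> expectation (\<lambda>w. \<xi> w * \<iota> t t' w $ i) = 0"
    using c.\<Delta>J_moments(3)[of \<xi> A' i] unfolding \<iota> t .
  show "\<xi> \<in> borel_measurable (F t) \<Longrightarrow> (\<And>w. w \<in> space M \<Longrightarrow> \<bar>\<xi> w\<bar> \<le> A') \<Longrightarrow>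
      expectation (\<lambda>w. \<xi> w * (\<iota> t t' w $ i * \<iota> t t' w $ c)) = expectation (\<lambda>w. \<xi> w * QS t t' i c w)"
    using c.\<Delta>J_moments(4)[of \<xi> A' i c] unfolding \<iota> t Q .
qed

lemma cell_state_measurable:
  fixes W :: "real ^ 'd \<Rightarrow> real \<Rightarrow> int \<Rightarrow> 'c::{second_countable_topology, real_normed_vector}"
  assumes t: "a \<le> t" and W: "\<And>i. i \<in> S \<Longrightarrow> continuous_on (UNIV \<times> {0..}) (\<lambda>(x, t). W x t i)"
  shows "(\<lambda>w. indicator (A t) w *\<^sub>R W (Z t w) t (r t w)) \<in> borel_measurable (F t)"
    and "i \<in> S \<Longrightarrow> (\<lambda>w. indicator (A t) w *\<^sub>R W (Z t w) t i) \<in> borel_measurable (F t)"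
proof -
  have t0: "0 \<le> t" using t a0 by simp
  have A: "indicator (A t) \<in> borel_measurable (F t)" using A_F[OF t] by simp
  have "(\<lambda>w. W (Z t w) t (r t w)) \<in> borel_measurable (F t)"
    by (rule state_measurable[OF Z_measurable_F[OF t0] r_measurable_F[OF t0] W t0])
  then show "(\<lambda>w. indicator (A t) w *\<^sub>R W (Z t w) t (r t w)) \<in> borel_measurable (F t)"
    using A by (intro borel_measurable_scaleR)
  assume i: "i \<in> S"
  have "(\<lambda>w. W (Z t w) t i) \<in> borel_measurable (F t)"
    by (rule state_measurable[OF Z_measurable_F[OF t0] _ W t0, of "\<lambda>_. i"]) (use i in auto)
  then show "(\<lambda>w. indicator (A t) w *\<^sub>R W (Z t w) t i) \<in> borel_measurable (F t)"
    using A by (intro borel_measurable_scaleR)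
qed

lemma \<Lambda>_measurable:
  assumes N: "0 < N" "k < N"
  defines "t \<equiv> tk N k" and "t' \<equiv> tk N (Suc k)"
  shows "\<Lambda> t t' \<in> borel_measurable M"
proof -
  note tt = tk[OF N, folded t_def t'_def]
  note m = measurable_F_M[OF cell_state_measurable(1)[OF tt(1)] tt(5)]
  note c = C21_continuous
  have 1: "(\<lambda>w. indicator (A t) w *\<^sub>R Vt V (Z t w) t (r t w)) \<in> borel_measurable M"
    and 2: "(\<lambda>w. indicator (A t) w *\<^sub>R Vx V (Z t w) t (r t w)) \<in> borel_measurable M"
    and 3: "(\<lambda>w. indicator (A t) w *\<^sub>R Vxx V (Z t w) t (r t w)) \<in> borel_measurable M"
    by (rule m[of "Vt V", OF c(2)] m[of "Vx V", OF c(3)] m[of "Vxx V", OF c(4)]; assumption)+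
  have 4: "(\<lambda>w. indicator (A t) w *\<^sub>R (\<Sum>j\<in>S. \<Gamma> (r t w) j * V (Z t w) t j)) \<in> borel_measurable M"
    by (rule m[of "\<lambda>x t i. \<Sum>j\<in>S. \<Gamma> i j * V x t j"])
      (use c(1) in \<open>auto simp: case_prod_beta' intro!: continuous_intros\<close>)
  have 5: "Y t' \<in> borel_measurable M" "Z t \<in> borel_measurable M"
    using Y_measurable Z_measurable tt by auto
  \<comment> \<open>The integral of the stopped drift is expressed by \<open>Y\<close>,
    \<open>Z\<close> and \<open>\<iota>\<close>, whose measurability is known.\<close>
  have e: "\<Lambda> t t' w = (t' - t) * (indicator (A t) w *\<^sub>R Vt V (Z t w) t (r t w))
     + (indicator (A t) w *\<^sub>R Vx V (Z t w) t (r t w)) \<bullet> (Y t' w - Z t w - \<iota> t t' w)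
     + 1 / 2 * (\<Sum>a\<in>UNIV. \<Sum>c\<in>UNIV. (indicator (A t) w *\<^sub>R Vxx V (Z t w) t (r t w)) $ a $ c * QS t t' a c w)
     + (t' - t) * (indicator (A t) w *\<^sub>R (\<Sum>j\<in>S. \<Gamma> (r t w) j * V (Z t w) t j))" for w
    using increment(1)[OF tt(1) less_imp_le[OF tt(2)] tt(3), of w] by (cases "w \<in> A t") (simp_all add: \<Lambda>_def)
  have 6: "(\<lambda>w. (indicator (A t) w *\<^sub>R Vxx V (Z t w) t (r t w)) $ i $ c) \<in> borel_measurable M" for i c
    by (intro measurable_vec_nth 3)
  show ?thesis unfolding e[abs_def]
    using 1 2 4 5 6 cell_moments(1,2)[OF N, folded t_def t'_def]
    by (intro borel_measurable_add borel_measurable_times borel_measurable_sum borel_measurable_inner borel_measurable_diff borel_measurable_const)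
qed

lemma \<Lambda>_bound:
  assumes t: "a \<le> t" "t \<le> t'" "t' \<le> T"
  shows "\<bar>\<Lambda> t t' w\<bar> \<le> (LINT s:{t<..t'}|lborel. C\<^sub>d * (1 + \<phi> s)) + \<Phi> t t' * B\<^sub>V"
proof -
  have tT: "t \<le> T" using t by simp
  have t0: "0 \<le> t" using t a0 by simp
  have \<phi>i: "set_integrable lborel {t<..t'} \<phi>" by (rule set_integrable_subset[OF \<phi>_int]) (use t0 in auto)
  have ci: "set_integrable lborel {t<..t'} (\<lambda>_. 1 :: real)" by (rule set_integrable_bounded[where C=1]) (use t in auto)
  have "\<bar>LINT s:{t<..t'}|lborel. drift t s w\<bar> \<le> (LINT s:{t<..t'}|lborel. C\<^sub>d * (1 + \<phi> s))"
    unfolding set_lebesgue_integral_def real_norm_def[symmetric]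
  proof (rule Bochner_Integration.integral_norm_bound_integral)
    show "integrable lborel (\<lambda>s. indicat_real {t<..t'} s *\<^sub>R drift t s w)"
      using drift_integral(1)[OF t] by (simp add: set_integrable_def)
    show "integrable lborel (\<lambda>s. indicat_real {t<..t'} s *\<^sub>R (C\<^sub>d * (1 + \<phi> s)))"
      using set_integrable_mult_right[OF set_integral_add(1)[OF ci \<phi>i], of C\<^sub>d] by (simp add: set_integrable_def)
    show "norm (indicat_real {t<..t'} s *\<^sub>R drift t s w) \<le> indicat_real {t<..t'} s *\<^sub>R (C\<^sub>d * (1 + \<phi> s))" for s
      using drift_bound[of t s w] t by (auto simp: indicator_def)
  qed
  moreover have "\<bar>indicator (A t) w * (\<Phi> t t' * V (Z t w) t (r t w))\<bar> \<le> \<Phi> t t' * B\<^sub>V"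
  proof -
    have "0 \<le> \<Phi> t t'" unfolding \<Phi>_def set_lebesgue_integral_def
      by (intro integral_nonneg_AE AE_I2) (use C0 \<phi>_nonneg t0 in \<open>auto simp: indicator_def intro!: add_nonneg_nonneg\<close>)
    then show ?thesis using V_le[of "r t w" "Z t w" t] A_D[of w t] t tT B\<^sub>V
      by (cases "w \<in> A t") (auto simp: abs_mult intro!: mult_left_mono)
  qed
  ultimately show ?thesis using drift_integral(2)[OF t, of w] by linarith
qed

end

context nsdde_hitting
begin

definition \<Psi> where "\<Psi> N wt w = (\<Sum>k<N. wt k * (\<Lambda> (tk N k) (tk N (Suc k)) w
  - indicator (A (tk N k)) w * (\<Phi> (tk N k) (tk N (Suc k)) * V (Z (tk N k) w) (tk N k) (r (tk N k) w))))"

text \<open>Dominates \<open>wt * drift\<close> for every weight \<open>wt\<close> in \<open>[0, 1]\<close>, so that the discount factors need not converge, and tends to \<open>h\<close>.\<close>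

definition U where "U N w s = (\<Sum>k<N. indicator {tk N k<..tk N (Suc k)} s * (h s + max (drift (tk N k) s w - h s) 0))"

lemma U_point:
  assumes N: "0 < N" and s: "a < s" "s \<le> T"
  obtains k where "k < N" "tk N k < s" "s \<le> tk N (Suc k)" "\<And>w. U N w s = h s + max (drift (tk N k) s w - h s) 0"
proof -
  define d where "d = 1 / real N"
  define k where "k = nat (\<lceil>(s - a) / d\<rceil> - 1)"
  have d: "0 < d" "0 < s - a" using N s by (auto simp: d_def)
  note k = cell_index[OF d, folded k_def]
  have e: "tk N j = a + real j * d" for j by (simp add: tk_def d_def)
  have "real k * d < 1" using k(1) s by (simp add: T_def a_def)
  then have kN: "k < N" using N by (simp add: d_def)
  have iff: "s \<in> {tk N j<..tk N (Suc j)} \<longleftrightarrow> j = k" for j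
  proof
    assume "s \<in> {tk N j<..tk N (Suc j)}"
    then have "real j * d < s - a" "s - a \<le> real (Suc j) * d" unfolding e by auto
    then have "real j * d < real (Suc k) * d" "real k * d < real (Suc j) * d" using k by linarith+
    then show "j = k" using d(1) by simp
  qed (use k e in auto)
  have "U N w s = (\<Sum>j<N. if j = k then h s + max (drift (tk N k) s w - h s) 0 else 0)" for w
    unfolding U_def by (intro sum.cong refl) (use iff in \<open>simp add: indicator_def del: greaterThanAtMost_iff\<close>)
  then show thesis using that[OF kN] k e kN by auto
qed

lemma U_outside: "s \<notin> {a<..T} \<Longrightarrow> 0 < N \<Longrightarrow> U N w s = 0"
  unfolding U_def using tk(1,3)[of N] by (intro sum.neutral) (force simp: indicator_def)

lemma h_pos: "a < s \<Longrightarrow> 0 \<le> h s" and \<phi>_pos: "a < s \<Longrightarrow> 0 \<le> \<phi> s"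
  using h_nonneg \<phi>_nonneg a0 by auto

lemma U_le:
  assumes N: "0 < N"
  shows "\<bar>U N w s\<bar> \<le> indicator {a<..T} s * (h s + C\<^sub>d * (1 + \<phi> s))"
proof (cases "s \<in> {a<..T}")
  case True
  then obtain k where k: "k < N" "tk N k < s" "U N w s = h s + max (drift (tk N k) s w - h s) 0"
    using U_point[OF N] by (metis greaterThanAtMost_iff)
  have "\<bar>drift (tk N k) s w\<bar> \<le> C\<^sub>d * (1 + \<phi> s)"
    by (rule drift_bound) (use tk[OF N k(1)] k True in auto)
  moreover have "0 \<le> h s" using h_pos True by simp
  ultimately have "0 \<le> U N w s" "U N w s \<le> h s + C\<^sub>d * (1 + \<phi> s)" unfolding k(3) by linarith+
  then show ?thesis using True by simp
qed (simp add: U_outside N)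

text \<open>Three null sets of \<open>s\<close> are left out: the stopping time, the left jumps of
  the chain, and the times at which the bound on \<open>LV\<close> fails. For the other
  \<open>s\<close> in the interval, the left end of the cell of \<open>s\<close> approaches
  \<open>s\<close> strictly from the left and \<open>drift_limit\<close> applies.\<close>

lemma U_tendsto:
  assumes w: "w \<in> space M"
  shows "AE s in lborel. (\<lambda>N. U (Suc N) w s) \<longlonglongrightarrow> indicator {a<..T} s * h s"
proof -
  have "AE s in lborel. s \<noteq> \<sigma> w" by (rule AE_lborel_singleton)
  then show ?thesis using AE_r_left[OF w] LV_bound
  proof eventually_elim
    case (elim s)
    show ?case
    proof (cases "s \<in> {a<..T}")
      case False
      then show ?thesis by (simp add: U_outside)
    next
      case True
      then have s: "a < s" "s \<le> T" "0 < s" using a0 by auto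
      have lim: "((\<lambda>t. max (drift t s w - h s) 0) \<longlongrightarrow> 0) (at_left s)"
        by (rule drift_limit[OF s(1,2) w elim(1)]) (use elim s in auto)
      have "\<exists>k. tk (Suc N) k < s \<and> s \<le> tk (Suc N) (Suc k) \<and> U (Suc N) w s = h s + max (drift (tk (Suc N) k) s w - h s) 0" for N
        by (rule U_point[OF zero_less_Suc s(1,2), of N]) blast
      then have "\<exists>k. \<forall>N. tk (Suc N) (k N) < s \<and> s \<le> tk (Suc N) (Suc (k N)) \<and> U (Suc N) w s = h s + max (drift (tk (Suc N) (k N)) s w - h s) 0"
        by (intro choice allI)
      then obtain k where k: "\<And>N. tk (Suc N) (k N) < s" "\<And>N. s \<le> tk (Suc N) (Suc (k N))"
        "\<And>N. U (Suc N) w s = h s + max (drift (tk (Suc N) (k N)) s w - h s) 0" by blast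
      have "(\<lambda>N. tk (Suc N) (k N)) \<longlonglongrightarrow> s"
      proof (rule tendsto_sandwich[OF _ _ _ tendsto_const])
        show "(\<lambda>N. s - inverse (real (Suc N))) \<longlonglongrightarrow> s"
          using tendsto_diff[OF tendsto_const LIMSEQ_inverse_real_of_nat, of s] by simp
        have "s - inverse (real (Suc N)) \<le> tk (Suc N) (k N)" for N
          using k(2)[of N] unfolding tk_def by (simp add: add_divide_distrib inverse_eq_divide)
        then show "\<forall>\<^sub>F N in sequentially. s - inverse (real (Suc N)) \<le> tk (Suc N) (k N)" by simp
        show "\<forall>\<^sub>F N in sequentially. tk (Suc N) (k N) \<le> s" using k(1) by (simp add: less_imp_le)
      qed
      then have "filterlim (\<lambda>N. tk (Suc N) (k N)) (at_left s) sequentially"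
        unfolding filterlim_at using k(1) by (simp add: less_imp_neq)
      then have "(\<lambda>N. max (drift (tk (Suc N) (k N)) s w - h s) 0) \<longlonglongrightarrow> 0"
        by (rule filterlim_compose[OF lim])
      then have "(\<lambda>N. h s + max (drift (tk (Suc N) (k N)) s w - h s) 0) \<longlonglongrightarrow> h s + 0"
        by (intro tendsto_intros)
      then show ?thesis using True k(3) by simp
    qed
  qed
qed

lemma \<Psi>_le_U:
  assumes N: "0 < N" and wt: "\<And>k. 0 \<le> wt k \<and> wt k \<le> 1"
  shows "integrable lborel (U N w)" "\<Psi> N wt w \<le> (LINT s|lborel. U N w s)"
proof -
  have i: "integrable lborel (\<lambda>s. indicator {tk N k<..tk N (Suc k)} s * (h s + max (drift (tk N k) s w - h s) 0))" if k: "k < N" for k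
  proof -
    note t = tk[OF N k]
    have d: "integrable lborel (\<lambda>s. indicator {tk N k<..tk N (Suc k)} s * drift (tk N k) s w)"
      using drift_integral(1)[of "tk N k" "tk N (Suc k)" w] t by (simp add: set_integrable_def)
    have h: "integrable lborel (\<lambda>s. indicator {tk N k<..tk N (Suc k)} s * h s)"
      using h_interval[OF t(5), of "tk N (Suc k)"] by (simp add: set_integrable_def)
    have "integrable lborel (\<lambda>s. indicator {tk N k<..tk N (Suc k)} s * h s + max (indicator {tk N k<..tk N (Suc k)} s * drift (tk N k) s w - indicator {tk N k<..tk N (Suc k)} s * h s) 0)"
      using d h by (intro Bochner_Integration.integrable_add integrable_max Bochner_Integration.integrable_diff) auto
    then show ?thesis by (rule back_subst[where P="integrable lborel"]) (auto simp: indicator_def)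
  qed
  then show "integrable lborel (U N w)" unfolding U_def[abs_def] by (intro Bochner_Integration.integrable_sum) auto
  have "wt k * (\<Lambda> (tk N k) (tk N (Suc k)) w - indicator (A (tk N k)) w * (\<Phi> (tk N k) (tk N (Suc k)) * V (Z (tk N k) w) (tk N k) (r (tk N k) w)))
     \<le> (LINT s|lborel. indicator {tk N k<..tk N (Suc k)} s * (h s + max (drift (tk N k) s w - h s) 0))" if k: "k < N" for k
  proof -
    note t = tk[OF N k]
    have d: "integrable lborel (\<lambda>s. indicator {tk N k<..tk N (Suc k)} s * drift (tk N k) s w)"
      using drift_integral(1)[of "tk N k" "tk N (Suc k)" w] t by (simp add: set_integrable_def)
    have "wt k * (LINT s:{tk N k<..tk N (Suc k)}|lborel. drift (tk N k) s w)
        = (LINT s|lborel. wt k * (indicator {tk N k<..tk N (Suc k)} s * drift (tk N k) s w))"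
      by (simp add: set_lebesgue_integral_def)
    also have "\<dots> \<le> (LINT s|lborel. indicator {tk N k<..tk N (Suc k)} s * (h s + max (drift (tk N k) s w - h s) 0))"
    proof (rule integral_mono[OF integrable_mult_right[OF d] i[OF k]])
      fix s
      \<comment> \<open>A weight in \<open>[0, 1]\<close> shrinks a positive drift and leaves a
        negative one nonpositive; both cases are covered because \<open>y\<close> is
        nonnegative.\<close>
      have "wt k * x \<le> y + max (x - y) 0" if "0 \<le> y" for x y
      proof (cases "0 \<le> x")
        case True
        then have "wt k * x \<le> 1 * x" using wt by (intro mult_right_mono) auto
        then show ?thesis by linarith
      next
        case False
        then have "wt k * x \<le> 0" using wt by (simp add: mult_nonneg_nonpos)
        then show ?thesis using that by linarith
      qed
      then show "wt k * (indicator {tk N k<..tk N (Suc k)} s * drift (tk N k) s w)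
          \<le> indicator {tk N k<..tk N (Suc k)} s * (h s + max (drift (tk N k) s w - h s) 0)"
        using h_pos[of s] t by (auto simp: indicator_def)
    qed
    finally show ?thesis using drift_integral(2)[of "tk N k" "tk N (Suc k)" w] t by simp
  qed
  then have "\<Psi> N wt w \<le> (\<Sum>k<N. LINT s|lborel. indicator {tk N k<..tk N (Suc k)} s * (h s + max (drift (tk N k) s w - h s) 0))"
    unfolding \<Psi>_def by (intro sum_mono) auto
  also have "\<dots> = (LINT s|lborel. U N w s)"
    unfolding U_def by (rule Bochner_Integration.integral_sum[symmetric]) (use i in auto)
  finally show "\<Psi> N wt w \<le> (LINT s|lborel. U N w s)" .
qed

lemma \<Lambda>_integrable: "0 < N \<Longrightarrow> k < N \<Longrightarrow> integrable M (\<Lambda> (tk N k) (tk N (Suc k)))"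
  by (rule integrable_bounded[OF \<Lambda>_measurable \<Lambda>_bound]) (use tk[of N k] in auto)

lemma cell_V_integrable:
  assumes t: "a \<le> t" "t \<le> T"
  shows "integrable M (\<lambda>w. indicator (A t) w * V (Z t w) t (r t w))"
proof (rule integrable_bounded)
  have t0: "0 \<le> t" using t a0 by simp
  show "(\<lambda>w. indicator (A t) w * V (Z t w) t (r t w)) \<in> borel_measurable M"
    using measurable_F_M[OF cell_state_measurable(1)[of t V, OF t(1) C21_continuous(1)] t0] by simp
  show "\<bar>indicator (A t) w * V (Z t w) t (r t w)\<bar> \<le> B\<^sub>V" for w
    using V_le[of "r t w" "Z t w" t] A_D[of w t] t B\<^sub>V by (cases "w \<in> A t") auto
qed

lemma \<Psi>_integrable: "0 < N \<Longrightarrow> integrable M (\<Psi> N wt)"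
proof -
  assume N: "0 < N"
  have "integrable M (\<lambda>w. wt k * (\<Lambda> (tk N k) (tk N (Suc k)) w
     - \<Phi> (tk N k) (tk N (Suc k)) * (indicator (A (tk N k)) w * V (Z (tk N k) w) (tk N k) (r (tk N k) w))))" if k: "k < N" for k
    using \<Lambda>_integrable[OF N k] cell_V_integrable[of "tk N k"] tk[OF N k] by auto
  then show ?thesis unfolding \<Psi>_def[abs_def]
    by (intro Bochner_Integration.integrable_sum) (simp add: mult.left_commute)
qed

text \<open>Only the excess of \<open>\<Psi>\<close> over the integral of \<open>h\<close> has to
  vanish, which leaves the weights free to change with \<open>N\<close>. Dominated convergence is
  used first in time, for \<open>U\<close>, and then in the mean with a constant bound.\<close>

lemma expectation_\<Psi>_limit:
  assumes wt: "\<And>N k. 0 \<le> wt N k \<and> wt N k \<le> 1"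
  shows "(\<lambda>N. expectation (\<lambda>w. max (\<Psi> (Suc N) (wt N) w - (LINT s:{a<..T}|lborel. h s)) 0)) \<longlonglongrightarrow> 0"
proof -
  let ?h = "LINT s:{a<..T}|lborel. h s"
  let ?D = "\<lambda>s. indicator {a<..T} s * (h s + C\<^sub>d * (1 + \<phi> s))"
  have D: "integrable lborel ?D"
  proof -
    have p: "set_integrable lborel {a<..T} \<phi>" by (rule set_integrable_subset[OF \<phi>_int]) (use a0 in auto)
    have c: "set_integrable lborel {a<..T} (\<lambda>_. 1 :: real)" by (rule set_integrable_bounded[where C=1]) (use aT in auto)
    show ?thesis using set_integral_add(1)[OF h_interval[OF a0] set_integrable_mult_right[OF set_integral_add(1)[OF c p], of C\<^sub>d]]
      by (simp add: set_integrable_def)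
  qed
  have lim: "(\<lambda>N. LINT s|lborel. U (Suc N) w s) \<longlonglongrightarrow> ?h" if "w \<in> space M" for w
    unfolding set_lebesgue_integral_def real_scaleR_def
  proof (rule integral_dominated_convergence[OF _ _ D U_tendsto[OF that]])
    show "(\<lambda>s. indicator {a<..T} s * h s) \<in> borel_measurable lborel"
      using h_interval[OF a0, of T] by (simp add: set_integrable_def borel_measurable_integrable)
    show "U (Suc N) w \<in> borel_measurable lborel" for N
      by (rule borel_measurable_integrable[OF \<Psi>_le_U(1)[of _ "\<lambda>_. 0"]]) auto
    show "AE s in lborel. norm (U (Suc N) w s) \<le> ?D s" for N using U_le by simp
  qed
  have le: "\<Psi> (Suc N) (wt N) w \<le> (LINT s|lborel. U (Suc N) w s)" for N w
    by (rule \<Psi>_le_U(2)) (use wt in auto)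
  have UD: "(LINT s|lborel. U (Suc N) w s) \<le> integral\<^sup>L lborel ?D" for N w
    by (rule integral_mono[OF \<Psi>_le_U(1)[of _ "\<lambda>_. 0"] D]) (use U_le[of "Suc N" w] in \<open>auto intro: order_trans[OF abs_ge_self]\<close>)
  have "(\<lambda>N. expectation (\<lambda>w. max (\<Psi> (Suc N) (wt N) w - ?h) 0)) \<longlonglongrightarrow> expectation (\<lambda>_. 0)"
  proof (rule integral_dominated_convergence[where w="\<lambda>_. \<bar>integral\<^sup>L lborel ?D\<bar> + \<bar>?h\<bar>"])
    show "(\<lambda>w. max (\<Psi> (Suc N) (wt N) w - ?h) 0) \<in> borel_measurable M" for N
      using borel_measurable_integrable[OF \<Psi>_integrable, of "Suc N" "wt N"] by auto
    show "AE w in M. norm (max (\<Psi> (Suc N) (wt N) w - ?h) 0) \<le> \<bar>integral\<^sup>L lborel ?D\<bar> + \<bar>?h\<bar>" for N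
    proof (rule AE_I2)
      fix w
      show "norm (max (\<Psi> (Suc N) (wt N) w - ?h) 0) \<le> \<bar>integral\<^sup>L lborel ?D\<bar> + \<bar>?h\<bar>"
        using le[of N w] UD[of N w] by (auto simp: max_def abs_if)
    qed
    show "AE w in M. (\<lambda>N. max (\<Psi> (Suc N) (wt N) w - ?h) 0) \<longlonglongrightarrow> 0"
    proof (rule AE_I2)
      fix w assume w: "w \<in> space M"
      have "(\<lambda>N. max ((LINT s|lborel. U (Suc N) w s) - ?h) 0) \<longlonglongrightarrow> max (?h - ?h) 0"
        by (intro tendsto_intros lim w)
      then have l: "(\<lambda>N. max ((LINT s|lborel. U (Suc N) w s) - ?h) 0) \<longlonglongrightarrow> 0" by simp
      show "(\<lambda>N. max (\<Psi> (Suc N) (wt N) w - ?h) 0) \<longlonglongrightarrow> 0"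
      proof (rule tendsto_sandwich[OF _ _ tendsto_const l])
        show "\<forall>\<^sub>F N in sequentially. max (\<Psi> (Suc N) (wt N) w - ?h) 0 \<le> max ((LINT s|lborel. U (Suc N) w s) - ?h) 0"
          by (intro always_eventually allI max.mono diff_right_mono le order_refl)
      qed simp
    qed
  qed auto
  then show ?thesis by simp
qed

end

subsection \<open>The increments of V over a partition\<close>

lemma norm_power2_vec: "(norm x)\<^sup>2 = (\<Sum>a\<in>UNIV. (x $ a)\<^sup>2)" for x :: "real ^ 'd"
  unfolding power2_norm_eq_inner inner_vec_def by (simp add: power2_eq_square)

lemma norm_power4_vec_le: "norm x ^ 4 \<le> real CARD('d) * (\<Sum>a\<in>UNIV. (x $ a) ^ 4)" for x :: "real ^ 'd"
proof -
  have "norm x ^ 4 = ((norm x)\<^sup>2)\<^sup>2" by simp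
  also have "\<dots> \<le> (\<Sum>a\<in>UNIV. ((x $ a)\<^sup>2)\<^sup>2) * real CARD('d)"
    unfolding norm_power2_vec by (rule sum_squared_le_sum_of_squares)
  finally show ?thesis by (simp add: mult.commute)
qed

text \<open>Squares are bounded by fourth powers, so that one moment estimate controls all errors of
  the expansion; when \<open>\<delta>\<close> is the time step, the bound has a mean of order
  \<open>\<delta>\<close>.\<close>

lemma norm_power2_vec_le:
  fixes x :: "real ^ 'd"
  assumes "0 < \<delta>"
  shows "(norm x)\<^sup>2 \<le> (real CARD('d) * \<delta> + (\<Sum>a\<in>UNIV. (x $ a) ^ 4) / \<delta>) / 2"
proof -
  have "(x $ a)\<^sup>2 \<le> (\<delta> + (x $ a) ^ 4 / \<delta>) / 2" for a
  proof -
    have "0 \<le> (\<delta> - (x $ a)\<^sup>2)\<^sup>2 / \<delta>" using assms by simp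
    also have "\<dots> = \<delta> + (x $ a) ^ 4 / \<delta> - 2 * (x $ a)\<^sup>2"
      using assms by (simp add: field_simps power2_eq_square power4_eq_xxxx)
    finally show ?thesis by simp
  qed
  then have "(norm x)\<^sup>2 \<le> (\<Sum>a\<in>(UNIV :: 'd set). (\<delta> + (x $ a) ^ 4 / \<delta>) / 2)" unfolding norm_power2_vec by (rule sum_mono)
  then show ?thesis by (simp add: sum.distrib sum_divide_distrib add_divide_distrib)
qed

lemma quadratic_form_eq_sum: "x \<bullet> (A *v x) = (\<Sum>a\<in>UNIV. \<Sum>c\<in>UNIV. A $ a $ c * (x $ a * x $ c))" for x :: "real ^ 'd"
  by (simp add: inner_vec_def matrix_vector_mult_def sum_distrib_left mult_ac)

context nsdde_hitting
begin

lemma QS_bound: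
  assumes t: "a \<le> t" "t \<le> t'" "t' \<le> T" and w: "w \<in> H"
  shows "\<bar>QS t t' i c w\<bar> \<le> real CARD('m) * (K * K) * (t' - t)"
proof -
  let ?k = "real CARD('m) * (K * K)"
  have ik: "set_integrable lborel {t<..t'} (\<lambda>_. ?k)" by (rule set_integrable_bounded[where C="?k"]) (use t K(1) in auto)
  have "\<bar>QS t t' i c w\<bar> \<le> (\<integral>s. indicator {t<..t'} s *\<^sub>R ?k \<partial>lborel)"
    unfolding QS_def set_lebesgue_integral_def
    by (rule Bochner_Integration.integral_abs_bound_integral)
      (use ik GS_integrable[OF t w, of i c] GS_bound(2)[of _ w] t w in \<open>auto simp: set_integrable_def split: split_indicator\<close>)
  then show ?thesis using t by (simp add: mult.commute)
qed

text \<open>The increment of \<open>V\<close> is dominated pathwise by \<open>Q\<close>. In the mean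
  of \<open>Q\<close> the first-order term \<open>P3\<close> vanishes, the second-order term
  \<open>P4\<close> cancels against the covariation term \<open>P5\<close>, and the jump term
  \<open>P1\<close> is matched by the generator term \<open>P2\<close>. What remains is
  \<open>\<Lambda>\<close> and the errors.\<close>

lemma cell_inequality:
  fixes N k :: nat
  defines "t \<equiv> tk N k" and "t' \<equiv> tk N (Suc k)" and "\<delta> \<equiv> 1 / real N"
    and "q \<equiv> real CARD('d) * (3 * real CARD('m) ^ 4 * K ^ 4)"
  assumes N: "0 < N" "k < N" and \<eta>: "0 \<le> \<eta>" and C: "0 \<le> C"
    and taylor: "\<And>i i' y \<beta> \<iota>. i \<in> S \<Longrightarrow> i' \<in> S \<Longrightarrow> norm y \<le> R \<Longrightarrow> norm (y + (\<beta> + \<iota>)) \<le> R \<Longrightarrow> norm \<beta> \<le> K * (t' - t) \<Longrightarrow>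
      \<bar>V (y + (\<beta> + \<iota>)) t' i' - V y t i' - (t' - t) * Vt V y t i - Vx V y t i \<bullet> (\<beta> + \<iota>) - 1 / 2 * (\<iota> \<bullet> (Vxx V y t i *v \<iota>))\<bar>
      \<le> \<eta> * ((t' - t) + (norm \<iota>)\<^sup>2 + (if i = i' then 0 else 1)) + C * ((t' - t)\<^sup>2 + norm \<iota> ^ 4)"
    and markov: "\<And>\<xi> c e. e = \<eta> \<or> e = 1 \<Longrightarrow> (\<And>l. l \<in> S \<Longrightarrow> \<xi> l \<in> borel_measurable (F t)) \<Longrightarrow>
      (\<And>l w. l \<in> S \<Longrightarrow> w \<in> space M \<Longrightarrow> \<bar>\<xi> l w\<bar> \<le> c \<and> (r t w = l \<longrightarrow> \<xi> l w = 0)) \<Longrightarrow>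
      expectation (\<lambda>w. \<Sum>l\<in>S. \<xi> l w * indicator {w\<in>space M. r t' w = l} w) \<le>
        \<delta> * expectation (\<lambda>w. \<Sum>l\<in>S. \<xi> l w * \<Gamma> (r t w) l) + e * c * \<delta>"
  shows "integrable M (\<lambda>w. indicator (A t) w * V (Y t' w) t' (r t' w))"
    and "expectation (\<lambda>w. indicator (A t) w * V (Y t' w) t' (r t' w)) - expectation (\<lambda>w. indicator (A t) w * V (Z t w) t (r t w)) \<le>
      expectation (\<Lambda> t t') + \<eta> * (2 * B\<^sub>V + 2 + (real CARD('d) + q) / 2 + \<Gamma>\<^sub>S) * \<delta> + C * (1 + real CARD('d) * q) * \<delta>\<^sup>2"
proof -
  note tt = tk[OF N, folded t_def t'_def \<delta>_def]
  note mom = cell_moments[OF N, folded t_def t'_def]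
  have \<delta>: "0 < \<delta>" using N by (simp add: \<delta>_def)
  have le: "a \<le> t" "t \<le> t'" "t' \<le> T" using tt by auto
  have t'0: "0 \<le> t'" using tt by simp
  let ?I = "\<lambda>w. indicat_real (A t) w"
  define v where "v i w = ?I w * Vx V (Z t w) t (r t w) $ i" for i w
  define wt where "wt i c w = ?I w * Vxx V (Z t w) t (r t w) $ i $ c" for i c w
  \<comment> \<open>\<open>\<zeta> l\<close> is the change of \<open>V\<close> on moving to state
    \<open>l\<close>, and \<open>\<kappa> l\<close> counts such a move; both vanish when the chain
    already is in \<open>l\<close>, as the one-step law requires.\<close>
  define \<zeta> where "\<zeta> l w = ?I w * (V (Z t w) t l - V (Z t w) t (r t w))" for l w
  define \<kappa> where "\<kappa> l w = (if r t w = l then 0 else 1 :: real)" for l w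
  have bd: "\<bar>v i w\<bar> \<le> B\<^sub>V" "\<bar>wt i c w\<bar> \<le> B\<^sub>V" "l \<in> S \<Longrightarrow> \<bar>\<zeta> l w\<bar> \<le> 2 * B\<^sub>V" for i c l w
  proof (atomize (full), cases "w \<in> A t")
    case False
    then show "\<bar>v i w\<bar> \<le> B\<^sub>V \<and> \<bar>wt i c w\<bar> \<le> B\<^sub>V \<and> (l \<in> S \<longrightarrow> \<bar>\<zeta> l w\<bar> \<le> 2 * B\<^sub>V)"
      using B\<^sub>V by (simp add: v_def wt_def \<zeta>_def)
  next
    case True
    note D = A_D[OF True tt(1,6)]
    note b = V_le[OF _ D(4) tt(1,6)]
    have "\<bar>\<zeta> l w\<bar> \<le> 2 * B\<^sub>V" if "l \<in> S"
      using b[OF that] b[OF D(5)] True unfolding \<zeta>_def by (simp add: abs_le_iff)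
    moreover have "\<bar>v i w\<bar> \<le> B\<^sub>V"
      using b[OF D(5)] True unfolding v_def by (simp add: order_trans[OF component_le_norm_cart])
    moreover have "\<bar>wt i c w\<bar> \<le> B\<^sub>V"
      using b[OF D(5)] True unfolding wt_def by (simp add: order_trans[OF abs_entry_le_norm])
    ultimately show "\<bar>v i w\<bar> \<le> B\<^sub>V \<and> \<bar>wt i c w\<bar> \<le> B\<^sub>V \<and> (l \<in> S \<longrightarrow> \<bar>\<zeta> l w\<bar> \<le> 2 * B\<^sub>V)" by blast
  qed
  have mv: "v i \<in> borel_measurable (F t)" for i
    using measurable_vec_nth[OF cell_state_measurable(1)[of t "Vx V", OF tt(1) C21_continuous(3)], of i] by (simp add: v_def[abs_def])
  have mw: "wt i c \<in> borel_measurable (F t)" for i c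
    using measurable_vec_nth[OF measurable_vec_nth[OF cell_state_measurable(1)[of t "Vxx V", OF tt(1) C21_continuous(4)], of i], of c] by (simp add: wt_def[abs_def])
  have m\<zeta>: "\<zeta> l \<in> borel_measurable (F t)" if "l \<in> S" for l
    using borel_measurable_diff[OF cell_state_measurable(2)[of t V, OF tt(1) C21_continuous(1) that] cell_state_measurable(1)[of t V, OF tt(1) C21_continuous(1)]]
    by (simp add: \<zeta>_def[abs_def] right_diff_distrib)
  have r_comp: "(\<lambda>w. u (r t w)) \<in> borel_measurable (F t)" for u :: "int \<Rightarrow> real"
    by (rule measurable_compose[OF r_measurable_F[OF tt(5)]]) simp
  have m\<kappa>: "\<kappa> l \<in> borel_measurable (F t)" for l
    using r_comp[of "\<lambda>i. if i = l then 0 else 1"] by (simp add: \<kappa>_def[abs_def])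
  note FM = measurable_F_M[OF _ tt(5)]
  have rl: "{w\<in>space M. r t' w = l} \<in> events" if "l \<in> S" for l
    using measurable_sets[OF r_measurable[OF t'0], of "{l}"] that by (simp add: vimage_def Int_def conj_commute)
  define P1 where "P1 w = (\<Sum>l\<in>S. \<zeta> l w * indicator {w\<in>space M. r t' w = l} w)" for w
  define P2 where "P2 w = (\<Sum>l\<in>S. \<zeta> l w * \<Gamma> (r t w) l)" for w
  define P3 where "P3 w = (\<Sum>i\<in>UNIV. v i w * \<iota> t t' w $ i)" for w
  define P4 where "P4 w = (\<Sum>i\<in>UNIV. \<Sum>c\<in>UNIV. wt i c w * (\<iota> t t' w $ i * \<iota> t t' w $ c))" for w
  define P5 where "P5 w = (\<Sum>i\<in>UNIV. \<Sum>c\<in>UNIV. wt i c w * QS t t' i c w)" for w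
  define P7 where "P7 w = (\<Sum>l\<in>S. \<kappa> l w * indicator {w\<in>space M. r t' w = l} w)" for w
  define P8 where "P8 w = (\<Sum>i\<in>UNIV. (\<iota> t t' w $ i) ^ 4)" for w
  define Q where "Q w = \<Lambda> t t' w + (P1 w - \<delta> * P2 w) + P3 w + 1 / 2 * (P4 w - P5 w)
     + \<eta> * (\<delta> + (real CARD('d) * \<delta> + P8 w / \<delta>) / 2 + P7 w) + C * (\<delta>\<^sup>2 + real CARD('d) * P8 w)" for w
  have \<iota>m: "(\<lambda>w. \<iota> t t' w $ i) \<in> borel_measurable M" for i by (rule measurable_vec_nth[OF mom(1)])
  have \<iota>1: "integrable M (\<lambda>w. \<iota> t t' w $ i)" "integrable M (\<lambda>w. (\<iota> t t' w $ i)\<^sup>2)" for i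
    using integrable_power_le[OF mom(3)[of i] \<iota>m, of 1] integrable_power_le[OF mom(3)[of i] \<iota>m, of 2] by auto
  have \<iota>2: "integrable M (\<lambda>w. \<iota> t t' w $ i * \<iota> t t' w $ c)" for i c
  proof (rule Bochner_Integration.integrable_bound)
    show "integrable M (\<lambda>w. (\<iota> t t' w $ i)\<^sup>2 + (\<iota> t t' w $ c)\<^sup>2)" using \<iota>1 by auto
    show "AE w in M. norm (\<iota> t t' w $ i * \<iota> t t' w $ c) \<le> norm ((\<iota> t t' w $ i)\<^sup>2 + (\<iota> t t' w $ c)\<^sup>2)"
    proof (rule AE_I2)
      fix w
      have "\<bar>x * y\<bar> \<le> x\<^sup>2 + y\<^sup>2" for x y :: real
      proof -
        have "2 * (\<bar>x\<bar> * \<bar>y\<bar>) \<le> x\<^sup>2 + y\<^sup>2" using sum_squares_bound[of "\<bar>x\<bar>" "\<bar>y\<bar>"] by (simp add: mult.assoc)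
        moreover have "0 \<le> \<bar>x\<bar> * \<bar>y\<bar>" by simp
        ultimately show ?thesis unfolding abs_mult by linarith
      qed
      from this[of "\<iota> t t' w $ i" "\<iota> t t' w $ c"] show "norm (\<iota> t t' w $ i * \<iota> t t' w $ c) \<le> norm ((\<iota> t t' w $ i)\<^sup>2 + (\<iota> t t' w $ c)\<^sup>2)"
        by (simp only: real_norm_def abs_of_nonneg[OF add_nonneg_nonneg[OF zero_le_power2 zero_le_power2]])
    qed
  qed (use \<iota>m in auto)
  have i1: "integrable M P1" and i2: "integrable M P2" and i7: "integrable M P7"
  proof -
    have "integrable M (\<lambda>w. \<zeta> l w * indicator {w\<in>space M. r t' w = l} w)" if "l \<in> S" for l
      by (rule integrable_bounded[of _ "2 * B\<^sub>V"], intro borel_measurable_times borel_measurable_indicator FM m\<zeta> rl that)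
        (use bd(3)[OF that] B\<^sub>V in \<open>auto simp: indicator_def\<close>)
    then show "integrable M P1" unfolding P1_def[abs_def] by (intro Bochner_Integration.integrable_sum)
    have "integrable M (\<lambda>w. \<kappa> l w * indicator {w\<in>space M. r t' w = l} w)" if "l \<in> S" for l
      by (rule integrable_bounded[of _ 1], intro borel_measurable_times borel_measurable_indicator FM m\<kappa> rl that)
        (auto simp: indicator_def \<kappa>_def)
    then show "integrable M P7" unfolding P7_def[abs_def] by (intro Bochner_Integration.integrable_sum)
    show "integrable M P2"
    proof (rule integrable_bounded)
      show "P2 \<in> borel_measurable M" unfolding P2_def[abs_def]
        by (intro borel_measurable_sum borel_measurable_times FM m\<zeta> r_comp)
      show "\<bar>P2 w\<bar> \<le> \<Gamma>\<^sub>S * (2 * B\<^sub>V)" if "w \<in> space M" for w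
        using sum_\<Gamma>_le[OF r_in_S[OF tt(5) that], of "\<lambda>l. \<zeta> l w" "2 * B\<^sub>V"] bd(3) B\<^sub>V unfolding P2_def by (simp add: mult.commute)
    qed
  qed
  have v\<iota>: "integrable M (\<lambda>w. v i w * \<iota> t t' w $ i)" for i
    using integrable_mult_bounded[OF \<iota>1(1) FM[OF mv] bd(1)] by (simp add: mult.commute)
  then have i3: "integrable M P3" unfolding P3_def[abs_def] by (intro Bochner_Integration.integrable_sum)
  have wt\<iota>: "integrable M (\<lambda>w. wt i c w * (\<iota> t t' w $ i * \<iota> t t' w $ c))" for i c
    using integrable_mult_bounded[OF \<iota>2 FM[OF mw] bd(2)] by (simp add: mult.commute)
  then have i4: "integrable M P4" unfolding P4_def[abs_def] by (intro Bochner_Integration.integrable_sum)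
  have wQ: "integrable M (\<lambda>w. wt i c w * QS t t' i c w)" for i c
  proof (rule integrable_bounded)
    show "(\<lambda>w. wt i c w * QS t t' i c w) \<in> borel_measurable M" by (intro borel_measurable_times FM mw mom(2))
    show "\<bar>wt i c w * QS t t' i c w\<bar> \<le> B\<^sub>V * (real CARD('m) * (K * K) * (t' - t))" for w
    proof (cases "w \<in> A t")
      case True
      then have "w \<in> H" using A_subset_H by blast
      then show ?thesis unfolding abs_mult using bd(2) QS_bound[OF le] B\<^sub>V by (intro mult_mono) auto
    next
      case False
      then show ?thesis using B\<^sub>V tt \<delta> by (simp add: wt_def)
    qed
  qed
  then have i5: "integrable M P5" unfolding P5_def[abs_def] by (intro Bochner_Integration.integrable_sum)
  have i8: "integrable M P8" unfolding P8_def[abs_def] using mom(3) by (intro Bochner_Integration.integrable_sum)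
  have i\<Lambda>: "integrable M (\<Lambda> t t')" using \<Lambda>_integrable[OF N] by (simp add: t_def t'_def)
  note ints = i\<Lambda> i1 i2 i3 i4 i5 i7 i8
  have iQ: "integrable M Q" unfolding Q_def[abs_def] using ints by auto
  have E3: "expectation P3 = 0"
  proof -
    have "expectation P3 = (\<Sum>i\<in>UNIV. expectation (\<lambda>w. v i w * \<iota> t t' w $ i))"
      unfolding P3_def[abs_def] by (rule Bochner_Integration.integral_sum) (rule v\<iota>)
    also have "\<dots> = 0" using mom(5)[OF mv bd(1)] by simp
    finally show ?thesis .
  qed
  have E45: "expectation P4 = expectation P5"
  proof -
    have "expectation P4 = (\<Sum>i\<in>UNIV. \<Sum>c\<in>UNIV. expectation (\<lambda>w. wt i c w * (\<iota> t t' w $ i * \<iota> t t' w $ c)))"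
      unfolding P4_def[abs_def] by (subst Bochner_Integration.integral_sum; (intro sum.cong refl Bochner_Integration.integral_sum Bochner_Integration.integrable_sum wt\<iota>)?)
    also have "\<dots> = (\<Sum>i\<in>UNIV. \<Sum>c\<in>UNIV. expectation (\<lambda>w. wt i c w * QS t t' i c w))"
      using mom(6)[OF mw bd(2)] by simp
    also have "\<dots> = expectation P5"
      unfolding P5_def[abs_def] by (subst Bochner_Integration.integral_sum; (intro sum.cong refl Bochner_Integration.integral_sum[symmetric] Bochner_Integration.integrable_sum wQ)?)
    finally show ?thesis .
  qed
  have \<zeta>0: "r t w = l \<Longrightarrow> \<zeta> l w = 0" and \<kappa>0: "r t w = l \<Longrightarrow> \<kappa> l w = 0" "\<bar>\<kappa> l w\<bar> \<le> 1" for l w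
    by (simp_all add: \<zeta>_def \<kappa>_def)
  have E1: "expectation P1 \<le> \<delta> * expectation P2 + \<eta> * (2 * B\<^sub>V) * \<delta>"
    unfolding P1_def[abs_def] P2_def[abs_def]
    by (rule markov) (use m\<zeta> bd(3) \<zeta>0 in auto)
  have E7: "expectation P7 \<le> (\<Gamma>\<^sub>S + 1) * \<delta>"
  proof -
    have "expectation P7 \<le> \<delta> * expectation (\<lambda>w. \<Sum>l\<in>S. \<kappa> l w * \<Gamma> (r t w) l) + 1 * 1 * \<delta>"
      unfolding P7_def[abs_def] by (rule markov) (use m\<kappa> \<kappa>0 in auto)
    moreover have "expectation (\<lambda>w. \<Sum>l\<in>S. \<kappa> l w * \<Gamma> (r t w) l) \<le> \<Gamma>\<^sub>S"
    proof -
      have b: "\<bar>\<Sum>l\<in>S. \<kappa> l w * \<Gamma> (r t w) l\<bar> \<le> \<Gamma>\<^sub>S" if "w \<in> space M" for w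
        using sum_\<Gamma>_le[OF r_in_S[OF tt(5) that], of "\<lambda>l. \<kappa> l w" 1] by (simp add: \<kappa>_def mult.commute)
      have "(\<lambda>w. \<Sum>l\<in>S. \<kappa> l w * \<Gamma> (r t w) l) \<in> borel_measurable M"
        by (intro borel_measurable_sum borel_measurable_times FM m\<kappa> r_comp)
      then have "integrable M (\<lambda>w. \<Sum>l\<in>S. \<kappa> l w * \<Gamma> (r t w) l)" by (rule integrable_bounded) (rule b)
      then show ?thesis by (rule integral_le_const) (rule AE_I2, rule order_trans[OF abs_ge_self b])
    qed
    then have "\<delta> * expectation (\<lambda>w. \<Sum>l\<in>S. \<kappa> l w * \<Gamma> (r t w) l) \<le> \<delta> * \<Gamma>\<^sub>S"
      using \<delta> by (intro mult_left_mono) auto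
    ultimately show ?thesis by (simp add: algebra_simps)
  qed
  have E8: "expectation P8 \<le> q * \<delta>\<^sup>2"
  proof -
    have "expectation P8 = (\<Sum>i\<in>UNIV. expectation (\<lambda>w. (\<iota> t t' w $ i) ^ 4))"
      unfolding P8_def[abs_def] by (rule Bochner_Integration.integral_sum) (rule mom(3))
    also have "\<dots> \<le> (\<Sum>i\<in>(UNIV :: 'd set). 3 * real CARD('m) ^ 4 * K ^ 4 * (t' - t)\<^sup>2)" by (rule sum_mono) (rule mom(4))
    finally show ?thesis by (simp add: q_def tt(4) mult.assoc)
  qed
  have le_Q: "?I w * V (Y t' w) t' (r t' w) - ?I w * V (Z t w) t (r t w) \<le> Q w" if w: "w \<in> space M" for w
  proof -
    have P7: "P7 w = (if r t w = r t' w then 0 else 1)"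
    proof -
      have "P7 w = (\<Sum>l\<in>S. if l = r t' w then (if r t w = l then 0 else 1) else 0)"
        unfolding P7_def by (intro sum.cong refl) (use w in \<open>auto simp: \<kappa>_def\<close>)
      then show ?thesis using S r_in_S[OF t'0 w] by simp
    qed
    have P8: "0 \<le> P8 w" by (simp add: P8_def sum_nonneg)
    have err: "0 \<le> \<eta> * (\<delta> + (real CARD('d) * \<delta> + P8 w / \<delta>) / 2 + P7 w)" "0 \<le> C * (\<delta>\<^sup>2 + real CARD('d) * P8 w)"
      using \<eta> C \<delta> P8 by (auto simp: P7 intro!: mult_nonneg_nonneg add_nonneg_nonneg)
    show ?thesis
    proof (cases "w \<in> A t")
      case False
      then have "Q w = \<eta> * (\<delta> + (real CARD('d) * \<delta> + P8 w / \<delta>) / 2 + P7 w) + C * (\<delta>\<^sup>2 + real CARD('d) * P8 w)"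
        by (simp add: Q_def \<Lambda>_def P1_def P2_def P3_def P4_def P5_def \<zeta>_def v_def wt_def)
      then show ?thesis using False err by simp
    next
      case True
      note D = A_D[OF True tt(1,6)]
      let ?y = "Z t w" let ?i = "r t w" let ?b = "LINT s:{t<..t'}|lborel. bS s w" let ?\<iota> = "\<iota> t t' w"
      note inc = increment[OF le True]
      have "norm (Y t' w) \<le> R" by (rule Y_norm[OF D(1) t'0 tt(3)])
      then have "\<bar>V (Y t' w) t' (r t' w) - V ?y t (r t' w) - (t' - t) * Vt V ?y t ?i - Vx V ?y t ?i \<bullet> (?b + ?\<iota>) - 1 / 2 * (?\<iota> \<bullet> (Vxx V ?y t ?i *v ?\<iota>))\<bar>
        \<le> \<eta> * ((t' - t) + (norm ?\<iota>)\<^sup>2 + (if ?i = r t' w then 0 else 1)) + C * ((t' - t)\<^sup>2 + norm ?\<iota> ^ 4)"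
        unfolding inc(1) by (intro taylor D r_in_S[OF t'0 w] inc(2))
      moreover have "\<eta> * ((t' - t) + (norm ?\<iota>)\<^sup>2 + (if ?i = r t' w then 0 else 1)) \<le> \<eta> * (\<delta> + (real CARD('d) * \<delta> + P8 w / \<delta>) / 2 + P7 w)"
        unfolding tt(4) P7 P8_def by (intro mult_left_mono[OF _ \<eta>] add_mono norm_power2_vec_le \<delta> order_refl)
      moreover have "C * ((t' - t)\<^sup>2 + norm ?\<iota> ^ 4) \<le> C * (\<delta>\<^sup>2 + real CARD('d) * P8 w)"
        unfolding tt(4) P8_def by (intro mult_left_mono[OF _ C] add_mono norm_power4_vec_le order_refl)
      moreover have "P1 w = V ?y t (r t' w) - V ?y t ?i"
      proof -
        have "P1 w = (\<Sum>l\<in>S. if l = r t' w then V ?y t l - V ?y t ?i else 0)"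
          unfolding P1_def by (intro sum.cong refl) (use w True in \<open>auto simp: \<zeta>_def\<close>)
        then show ?thesis using S r_in_S[OF t'0 w] by simp
      qed
      moreover have "P3 w = Vx V ?y t ?i \<bullet> ?\<iota>" using True by (simp add: P3_def v_def inner_vec_def)
      moreover have "P4 w = ?\<iota> \<bullet> (Vxx V ?y t ?i *v ?\<iota>)" using True by (simp add: P4_def wt_def quadratic_form_eq_sum)
      moreover have "\<Lambda> t t' w = (t' - t) * Vt V ?y t ?i + Vx V ?y t ?i \<bullet> ?b + 1 / 2 * P5 w + \<delta> * P2 w"
      proof -
        \<comment> \<open>Rows of the generator sum to zero, so measuring \<open>V\<close> from its
          value at the present state does not change the generator term.\<close>
        have "(\<Sum>l\<in>S. \<Gamma> ?i l) = 0"
          using gen D(5) S unfolding generator_matrix_def by (simp add: sum.remove)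
        moreover have "P2 w = (\<Sum>l\<in>S. \<Gamma> ?i l * V ?y t l) - (\<Sum>l\<in>S. \<Gamma> ?i l) * V ?y t ?i"
          using True by (simp add: P2_def \<zeta>_def sum_distrib_right sum_subtractf[symmetric] algebra_simps)
        ultimately have "P2 w = (\<Sum>l\<in>S. \<Gamma> ?i l * V ?y t l)" by simp
        then show ?thesis using True by (simp add: \<Lambda>_def P5_def wt_def tt(4))
      qed
      moreover have "?I w * V (Y t' w) t' (r t' w) = V (Y t' w) t' (r t' w)" "?I w * V ?y t ?i = V ?y t ?i"
        using True by simp_all
      \<comment> \<open>The comparison is linear in its parts and is settled for abstract real
        numbers.\<close>
      moreover have "u1 - u2 \<le> L + (p1 - e) + p3 + 1 / 2 * (p4 - p5) + f1 + f2"
        if "\<bar>v1 - v2 - x - (y1 + y2) - 1 / 2 * z\<bar> \<le> e1 + e2" "e1 \<le> f1" "e2 \<le> f2" "p1 = v2 - v3" "p3 = y2" "p4 = z"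
          "L = x + y1 + 1 / 2 * p5 + e" "u1 = v1" "u2 = v3" for u1 u2 L p1 e p3 p4 p5 f1 f2 v1 v2 v3 x y1 y2 z e1 e2 :: real
        using that by (simp add: abs_le_iff field_simps)
      ultimately show ?thesis unfolding Q_def inner_add_right by blast
    qed
  qed
  show iY: "integrable M (\<lambda>w. ?I w * V (Y t' w) t' (r t' w))"
  proof (rule integrable_bounded)
    have "(\<lambda>w. V (Y t' w) t' (r t' w)) \<in> borel_measurable M"
      by (rule state_measurable[OF Y_measurable[OF t'0] r_measurable[OF t'0] C21_continuous(1) t'0])
    then show "(\<lambda>w. ?I w * V (Y t' w) t' (r t' w)) \<in> borel_measurable M" using A_events[OF tt(1)] by auto
    show "\<bar>?I w * V (Y t' w) t' (r t' w)\<bar> \<le> B\<^sub>V" if "w \<in> space M" for w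
      using V_le[of "r t' w" "Y t' w" t'] A_D(1)[of w t] Y_norm[of w t'] r_in_S[OF t'0 that] tt B\<^sub>V by (cases "w \<in> A t") auto
  qed
  have "expectation (\<lambda>w. ?I w * V (Y t' w) t' (r t' w)) - expectation (\<lambda>w. ?I w * V (Z t w) t (r t w)) =
      expectation (\<lambda>w. ?I w * V (Y t' w) t' (r t' w) - ?I w * V (Z t w) t (r t w))"
    by (rule Bochner_Integration.integral_diff[symmetric, OF iY cell_V_integrable[OF tt(1,6)]])
  also have "\<dots> \<le> expectation Q"
    by (rule integral_mono[OF Bochner_Integration.integrable_diff[OF iY cell_V_integrable[OF tt(1,6)]] iQ le_Q])
  also have "expectation Q = expectation (\<Lambda> t t') + (expectation P1 - \<delta> * expectation P2) + expectation P3 + 1 / 2 * (expectation P4 - expectation P5)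
     + \<eta> * (\<delta> + (real CARD('d) * \<delta> + expectation P8 / \<delta>) / 2 + expectation P7) + C * (\<delta>\<^sup>2 + real CARD('d) * expectation P8)"
    unfolding Q_def[abs_def] using ints by (simp add: prob_space)
  also have "\<dots> \<le> expectation (\<Lambda> t t') + \<eta> * (2 * B\<^sub>V) * \<delta> + 0 + 0
     + \<eta> * (\<delta> + (real CARD('d) * \<delta> + q * \<delta>) / 2 + (\<Gamma>\<^sub>S + 1) * \<delta>) + C * (\<delta>\<^sup>2 + real CARD('d) * (q * \<delta>\<^sup>2))"
  proof -
    have "expectation P8 / \<delta> \<le> q * \<delta>" using E8 \<delta> by (simp add: field_simps power2_eq_square)
    then have "\<eta> * (\<delta> + (real CARD('d) * \<delta> + expectation P8 / \<delta>) / 2 + expectation P7) \<le> \<eta> * (\<delta> + (real CARD('d) * \<delta> + q * \<delta>) / 2 + (\<Gamma>\<^sub>S + 1) * \<delta>)"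
      by (intro mult_left_mono[OF _ \<eta>] add_mono divide_right_mono order_refl E7) auto
    moreover have "C * (\<delta>\<^sup>2 + real CARD('d) * expectation P8) \<le> C * (\<delta>\<^sup>2 + real CARD('d) * (q * \<delta>\<^sup>2))"
      using E8 by (intro mult_left_mono[OF _ C] add_left_mono) auto
    moreover have "expectation P1 - \<delta> * expectation P2 \<le> \<eta> * (2 * B\<^sub>V) * \<delta>" using E1 by simp
    ultimately show ?thesis unfolding E3 E45 diff_self mult_zero_right by (intro add_mono order_refl)
  qed
  \<comment> \<open>In the constant, \<open>2 * B\<^sub>V\<close> comes from the bound on
    \<open>\<zeta>\<close>, the 2 from \<open>\<delta>\<close> itself and from the error in the jump
    probability, the fraction from the squared increments.\<close>
  also have "\<dots> = expectation (\<Lambda> t t') + \<eta> * (2 * B\<^sub>V + 2 + (real CARD('d) + q) / 2 + \<Gamma>\<^sub>S) * \<delta> + C * (1 + real CARD('d) * q) * \<delta>\<^sup>2"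
    by (simp add: algebra_simps add_divide_distrib)
  finally show "expectation (\<lambda>w. ?I w * V (Y t' w) t' (r t' w)) - expectation (\<lambda>w. ?I w * V (Z t w) t (r t w)) \<le>
      expectation (\<Lambda> t t') + \<eta> * (2 * B\<^sub>V + 2 + (real CARD('d) + q) / 2 + \<Gamma>\<^sub>S) * \<delta> + C * (1 + real CARD('d) * q) * \<delta>\<^sup>2" .
qed

end

lemma (in prob_space) expectation_add_indicator:
  fixes u :: "'a \<Rightarrow> real"
  assumes u: "integrable M u" and AB: "A \<in> events" "B \<in> events" "B \<subseteq> A"
  shows "integrable M (\<lambda>w. x * u w + c * indicator (A - B) w)"
    and "expectation (\<lambda>w. x * u w + c * indicator (A - B) w) = x * expectation u + c * (prob A - prob B)"
proof -
  have d: "A - B \<in> events" using AB by blast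
  then have i: "integrable M (\<lambda>w. c * indicator (A - B) w)"
    by (intro integrable_mult_right integrable_real_indicator) (auto simp: emeasure_eq_measure)
  show "integrable M (\<lambda>w. x * u w + c * indicator (A - B) w)" using u i by simp
  have "expectation (\<lambda>w. c * indicator (A - B) w) = c * prob (A - B)"
    using sets.Int_space_eq2[OF d] by simp
  then show "expectation (\<lambda>w. x * u w + c * indicator (A - B) w) = x * expectation u + c * (prob A - prob B)"
    using u i AB by (simp add: finite_measure_Diff)
qed

section \<open>The maximal inequality\<close>

context nsdde_hitting
begin

text \<open>\<open>\<eta>\<close> is divided by the constant of \<open>cell_inequality\<close>
  beforehand. \<open>C\<close> depends on \<open>\<eta>\<close>, but over \<open>N\<close> cells the
  errors add up to \<open>\<eta> + C / N\<close>, and \<open>N\<close> tends to infinity before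
  \<open>\<eta>\<close> tends to zero.\<close>

lemma cell_estimate:
  assumes \<eta>: "0 < \<eta>"
  shows "\<exists>C\<ge>0. \<exists>N\<^sub>0. \<forall>N k. N\<^sub>0 < N \<and> k < N \<longrightarrow>
    integrable M (\<lambda>w. indicator (A (tk N k)) w * V (Y (tk N (Suc k)) w) (tk N (Suc k)) (r (tk N (Suc k)) w)) \<and>
    expectation (\<lambda>w. indicator (A (tk N k)) w * V (Y (tk N (Suc k)) w) (tk N (Suc k)) (r (tk N (Suc k)) w))
      - expectation (\<lambda>w. indicator (A (tk N k)) w * V (Z (tk N k) w) (tk N k) (r (tk N k) w))
    \<le> expectation (\<Lambda> (tk N k) (tk N (Suc k))) + \<eta> / real N + C / (real N)\<^sup>2"
proof -
  define q where "q = real CARD('d) * (3 * real CARD('m) ^ 4 * K ^ 4)"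
  define c where "c = 2 * B\<^sub>V + 2 + (real CARD('d) + q) / 2 + \<Gamma>\<^sub>S"
  have q: "0 \<le> q" unfolding q_def using K(1) by simp
  have c: "0 < c" unfolding c_def using B\<^sub>V \<Gamma>\<^sub>S q by (intro add_pos_nonneg) auto
  define e where "e = \<eta> / c"
  have e: "0 < e" unfolding e_def using \<eta> c by simp
  obtain C d1 where C: "C > 0" and d1: "d1 > 0" and taylor: "\<forall>i\<in>S. \<forall>i'\<in>S. \<forall>t t' y \<beta> \<iota>. a \<le> t \<and> t \<le> t' \<and> t' \<le> T \<and> t' - t \<le> d1 \<and>
      norm y \<le> R \<and> norm (y + (\<beta> + \<iota>)) \<le> R \<and> norm \<beta> \<le> K * (t' - t) \<longrightarrow>
    \<bar>V (y + (\<beta> + \<iota>)) t' i' - V y t i' - (t' - t) * Vt V y t i - Vx V y t i \<bullet> (\<beta> + \<iota>) - 1 / 2 * (\<iota> \<bullet> (Vxx V y t i *v \<iota>))\<bar>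
    \<le> e * ((t' - t) + (norm \<iota>)\<^sup>2 + (if i = i' then 0 else 1)) + C * ((t' - t)\<^sup>2 + norm \<iota> ^ 4)"
    using C21_taylor[OF C21 S a0 less_imp_le[OF K(1)] e, of T R] by (elim exE conjE) (rule that)
  have mk: "\<exists>d>0. \<forall>t \<delta> \<xi> A. 0 \<le> t \<and> 0 \<le> \<delta> \<and> \<delta> < d \<and> (\<forall>j\<in>S. \<xi> j \<in> borel_measurable (F t) \<and>
      (\<forall>w\<in>space M. \<bar>\<xi> j w\<bar> \<le> A \<and> (r t w = j \<longrightarrow> \<xi> j w = 0))) \<longrightarrow>
    expectation (\<lambda>w. \<Sum>j\<in>S. \<xi> j w * indicator {w\<in>space M. r (t + \<delta>) w = j} w) \<le>
      \<delta> * expectation (\<lambda>w. \<Sum>j\<in>S. \<xi> j w * \<Gamma> (r t w) j) + u * A * \<delta>" if "0 < u" for u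
    using markov_step[OF mc S that] .
  obtain d2 where d2: "d2 > 0" and m2: "\<forall>t \<delta> \<xi> A. 0 \<le> t \<and> 0 \<le> \<delta> \<and> \<delta> < d2 \<and> (\<forall>j\<in>S. \<xi> j \<in> borel_measurable (F t) \<and>
      (\<forall>w\<in>space M. \<bar>\<xi> j w\<bar> \<le> A \<and> (r t w = j \<longrightarrow> \<xi> j w = 0))) \<longrightarrow>
    expectation (\<lambda>w. \<Sum>j\<in>S. \<xi> j w * indicator {w\<in>space M. r (t + \<delta>) w = j} w) \<le>
      \<delta> * expectation (\<lambda>w. \<Sum>j\<in>S. \<xi> j w * \<Gamma> (r t w) j) + e * A * \<delta>"
    using mk[OF e] by (elim exE conjE) (rule that)
  obtain d3 where d3: "d3 > 0" and m3: "\<forall>t \<delta> \<xi> A. 0 \<le> t \<and> 0 \<le> \<delta> \<and> \<delta> < d3 \<and> (\<forall>j\<in>S. \<xi> j \<in> borel_measurable (F t) \<and>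
      (\<forall>w\<in>space M. \<bar>\<xi> j w\<bar> \<le> A \<and> (r t w = j \<longrightarrow> \<xi> j w = 0))) \<longrightarrow>
    expectation (\<lambda>w. \<Sum>j\<in>S. \<xi> j w * indicator {w\<in>space M. r (t + \<delta>) w = j} w) \<le>
      \<delta> * expectation (\<lambda>w. \<Sum>j\<in>S. \<xi> j w * \<Gamma> (r t w) j) + 1 * A * \<delta>"
    using mk[OF zero_less_one] by (elim exE conjE) (rule that)
  obtain N\<^sub>0 where N\<^sub>0: "inverse (real (Suc N\<^sub>0)) < min d1 (min d2 d3)"
    using reals_Archimedean[of "min d1 (min d2 d3)"] d1 d2 d3 by auto
  show ?thesis
  proof (intro exI[of _ "C * (1 + real CARD('d) * q)"] conjI exI[of _ N\<^sub>0] allI impI)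
    show "0 \<le> C * (1 + real CARD('d) * q)" using C q by simp
    fix N k assume Nk: "N\<^sub>0 < N \<and> k < N"
    then have N: "0 < N" "k < N" by auto
    note tt = tk[OF N]
    have \<delta>: "1 / real N \<le> d1" "1 / real N < d2" "1 / real N < d3"
    proof -
      have "1 / real N \<le> inverse (real (Suc N\<^sub>0))"
        unfolding inverse_eq_divide using Nk by (intro divide_left_mono) auto
      then show "1 / real N \<le> d1" "1 / real N < d2" "1 / real N < d3" using N\<^sub>0 by auto
    qed
    have t': "tk N (Suc k) = tk N k + 1 / real N" using tt(4) by linarith
    have ty: "\<bar>V (y + (\<beta> + \<iota>)) (tk N (Suc k)) i' - V y (tk N k) i' - (tk N (Suc k) - tk N k) * Vt V y (tk N k) i - Vx V y (tk N k) i \<bullet> (\<beta> + \<iota>) - 1 / 2 * (\<iota> \<bullet> (Vxx V y (tk N k) i *v \<iota>))\<bar>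
      \<le> e * ((tk N (Suc k) - tk N k) + (norm \<iota>)\<^sup>2 + (if i = i' then 0 else 1)) + C * ((tk N (Suc k) - tk N k)\<^sup>2 + norm \<iota> ^ 4)"
      if "i \<in> S" "i' \<in> S" "norm y \<le> R" "norm (y + (\<beta> + \<iota>)) \<le> R" "norm \<beta> \<le> K * (tk N (Suc k) - tk N k)" for i i' y \<beta> \<iota>
      by (rule taylor[rule_format, OF that(1,2)]) (use tt \<delta> that(3,4,5) in \<open>auto simp del: of_nat_Suc\<close>)
    have mv: "expectation (\<lambda>w. \<Sum>l\<in>S. \<xi> l w * indicator {w\<in>space M. r (tk N (Suc k)) w = l} w) \<le>
        1 / real N * expectation (\<lambda>w. \<Sum>l\<in>S. \<xi> l w * \<Gamma> (r (tk N k) w) l) + e' * b * (1 / real N)"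
      if "e' = e \<or> e' = 1" "\<And>l. l \<in> S \<Longrightarrow> \<xi> l \<in> borel_measurable (F (tk N k))"
        "\<And>l w. l \<in> S \<Longrightarrow> w \<in> space M \<Longrightarrow> \<bar>\<xi> l w\<bar> \<le> b \<and> (r (tk N k) w = l \<longrightarrow> \<xi> l w = 0)" for \<xi> b e'
      using that(1)
    proof
      assume "e' = e" show ?thesis unfolding \<open>e' = e\<close> t' by (rule m2[rule_format]) (use tt(5) \<delta> that(2,3) in auto)
    next
      assume "e' = 1" show ?thesis unfolding \<open>e' = 1\<close> t' by (rule m3[rule_format]) (use tt(5) \<delta> that(2,3) in auto)
    qed
    note est = cell_inequality[OF N less_imp_le[OF e] less_imp_le[OF C] ty mv, folded q_def, folded c_def]
    show "integrable M (\<lambda>w. indicator (A (tk N k)) w * V (Y (tk N (Suc k)) w) (tk N (Suc k)) (r (tk N (Suc k)) w))"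
      by (rule est(1))
    have e1: "e * c * (1 / real N) = \<eta> / real N" using c by (simp add: e_def)
    have e2: "C * (1 + real CARD('d) * q) * (1 / real N)\<^sup>2 = C * (1 + real CARD('d) * q) / (real N)\<^sup>2"
      by (simp add: power_divide)
    show "expectation (\<lambda>w. indicator (A (tk N k)) w * V (Y (tk N (Suc k)) w) (tk N (Suc k)) (r (tk N (Suc k)) w))
      - expectation (\<lambda>w. indicator (A (tk N k)) w * V (Z (tk N k) w) (tk N k) (r (tk N k) w))
      \<le> expectation (\<Lambda> (tk N k) (tk N (Suc k))) + \<eta> / real N + C * (1 + real CARD('d) * q) / (real N)\<^sup>2"
      using est(2) unfolding e1 e2 .
  qed
qed

definition W where "W t = exp (- \<Phi> a t)"

lemma \<Phi>_nonneg: "0 \<le> t \<Longrightarrow> 0 \<le> \<Phi> t t'"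
  unfolding \<Phi>_def set_lebesgue_integral_def
  by (intro integral_nonneg_AE AE_I2) (use C0 \<phi>_nonneg in \<open>auto simp: indicator_def intro!: add_nonneg_nonneg\<close>)

lemma \<Phi>_add:
  assumes "a \<le> t" "t \<le> t'"
  shows "\<Phi> a t' = \<Phi> a t + \<Phi> t t'"
proof -
  have "{a<..t'} = {a<..t} \<union> {t<..t'}" using assms by auto
  then show ?thesis unfolding \<Phi>_def using assms a0 by (auto intro!: set_integral_Un \<phi>_interval)
qed

lemma W: "a \<le> t \<Longrightarrow> 0 < W t \<and> W t \<le> 1" "a \<le> t \<Longrightarrow> t \<le> t' \<Longrightarrow> W t' \<le> W t"
  using \<Phi>_nonneg[of a t] \<Phi>_add[of t t'] \<Phi>_nonneg[of t t'] a0 by (auto simp: W_def)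

lemma V_ge_hit: "0 \<le> t \<Longrightarrow> i \<in> S \<Longrightarrow> \<rho> \<le> norm x \<Longrightarrow> c\<^sub>1 * \<rho> powr p \<le> V x t i"
  using V_bounds[of t i x] powr_mono2[of p \<rho> "norm x"] p \<rho> c1 mult_left_mono[of "\<rho> powr p" "norm x powr p" c\<^sub>1] by linarith

lemma V_pos: "0 \<le> t \<Longrightarrow> i \<in> S \<Longrightarrow> 0 \<le> V x t i"
  using V_bounds[of t i x] c1 by (smt (verit) mult_nonneg_nonneg powr_ge_zero)

text \<open>On \<open>A t - A t'\<close> the stopped process sits at a point of norm at least \<open>\<rho>\<close>, where \<open>V\<close> pays for the probability that is
  lost.\<close>

lemma hitting_step:
  assumes N: "0 < N" "k < N"
  defines "t \<equiv> tk N k" and "t' \<equiv> tk N (Suc k)" and "c \<equiv> c\<^sub>1 * \<rho> powr p * W T"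
  assumes i: "integrable M (\<lambda>w. indicator (A t) w * V (Y t' w) t' (r t' w))"
    and est: "expectation (\<lambda>w. indicator (A t) w * V (Y t' w) t' (r t' w)) - expectation (\<lambda>w. indicator (A t) w * V (Z t w) t (r t w))
      \<le> expectation (\<Lambda> t t') + e" and e: "0 \<le> e"
  shows "W t' * expectation (\<lambda>w. indicator (A t') w * V (Z t' w) t' (r t' w)) + c * (prob H - prob (A t'))
    \<le> W t * expectation (\<lambda>w. indicator (A t) w * V (Z t w) t (r t w)) + c * (prob H - prob (A t))
      + W t' * (expectation (\<Lambda> t t') - \<Phi> t t' * expectation (\<lambda>w. indicator (A t) w * V (Z t w) t (r t w))) + e"
proof -
  note tt = tk[OF N, folded t_def t'_def]
  have t': "a \<le> t'" "0 \<le> t'" using tt by auto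
  let ?v = "expectation (\<lambda>w. indicator (A t) w * V (Z t w) t (r t w))"
  let ?y = "expectation (\<lambda>w. indicator (A t) w * V (Y t' w) t' (r t' w))"
  have At: "A t \<in> events" "A t' \<in> events" "A t' \<subseteq> A t" using A_events tt t' A_antimono[of t t'] by auto
  have "W t' * expectation (\<lambda>w. indicator (A t') w * V (Z t' w) t' (r t' w)) + c * (prob (A t) - prob (A t'))
     = expectation (\<lambda>w. W t' * (indicator (A t') w * V (Z t' w) t' (r t' w)) + c * indicator (A t - A t') w)"
    by (rule expectation_add_indicator(2)[symmetric, OF cell_V_integrable[OF t'(1) tt(3)] At])
  also have "\<dots> \<le> expectation (\<lambda>w. W t' * (indicator (A t) w * V (Y t' w) t' (r t' w)))"
  proof (rule integral_mono)
    show "integrable M (\<lambda>w. W t' * (indicator (A t') w * V (Z t' w) t' (r t' w)) + c * indicator (A t - A t') w)"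
      by (rule expectation_add_indicator(1)[OF cell_V_integrable[OF t'(1) tt(3)] At])
    show "integrable M (\<lambda>w. W t' * (indicator (A t) w * V (Y t' w) t' (r t' w)))" using i by simp
    fix w assume w: "w \<in> space M"
    have rS: "r t' w \<in> S" by (rule r_in_S[OF t'(2) w])
    consider "w \<in> A t'" | "w \<in> A t - A t'" | "w \<notin> A t" by blast
    then show "W t' * (indicator (A t') w * V (Z t' w) t' (r t' w)) + c * indicator (A t - A t') w
      \<le> W t' * (indicator (A t) w * V (Y t' w) t' (r t' w))"
    proof cases
      case 1
      then have "w \<in> A t" using At by blast
      moreover have "Y t' w = Z t' w" using A_D(1,3)[OF 1 t'(1) tt(3)] by (simp add: Y_H)
      ultimately show ?thesis using 1 by simp
    next
      case 2
      then have H: "w \<in> H" and "w \<notin> A T" using A_subset_H A_antimono[OF tt(3)] by auto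
      note hit = \<sigma>_hit[OF this]
      \<comment> \<open>The level is hit within this cell, so \<open>Y t'\<close> is the position at
        the hitting time.\<close>
      have "\<sigma> w \<le> t'" using \<sigma>_gt_iff[OF t'(1) tt(3), of w] 2 by auto
      then have "\<rho> \<le> norm (Y t' w)" using hit(3) by (simp add: Y_H[OF H] min_def)
      then have "c\<^sub>1 * \<rho> powr p \<le> V (Y t' w) t' (r t' w)" by (rule V_ge_hit[OF t'(2) rS])
      then have "W T * (c\<^sub>1 * \<rho> powr p) \<le> W t' * V (Y t' w) t' (r t' w)"
        using W(1)[OF t'(1)] W(1)[OF aT(2)] W(2)[OF t'(1) tt(3)] c1 by (intro mult_mono) auto
      then show ?thesis using 2 by (simp add: c_def mult_ac)
    next
      case 3
      then have "w \<notin> A t'" using At by blast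
      then show ?thesis using 3 by simp
    qed
  qed
  also have "\<dots> = W t' * ?y" by simp
  finally have 1: "W t' * expectation (\<lambda>w. indicator (A t') w * V (Z t' w) t' (r t' w)) + c * (prob (A t) - prob (A t')) \<le> W t' * ?y" .
  have v0: "0 \<le> ?v"
    by (rule integral_nonneg_AE, rule AE_I2) (use V_pos[OF tt(5)] r_in_S[OF tt(5)] in \<open>auto simp: indicator_def\<close>)
  have wt: "W t' * exp (\<Phi> t t') = W t"
    using \<Phi>_add[of t t'] tt by (simp add: W_def exp_add[symmetric])
  \<comment> \<open>The expansion involves the factor \<open>1 + \<Phi>\<close>, the discount over
    the cell is \<open>exp \<Phi>\<close>, and convexity of the exponential orders the two in the
    right way.\<close>
  have "W t' * ((1 + \<Phi> t t') * ?v) \<le> W t' * (exp (\<Phi> t t') * ?v)"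
    using W(1)[OF t'(1)] v0 exp_ge_add_one_self[of "\<Phi> t t'"] by (intro mult_left_mono mult_right_mono) auto
  then have 2: "W t' * (?v + \<Phi> t t' * ?v) \<le> W t * ?v"
    unfolding mult.assoc[symmetric] wt by (simp only: distrib_right distrib_left mult_1_left mult.assoc mult_1_right)
  have "W t' * (?y - ?v) \<le> W t' * (expectation (\<Lambda> t t') + e)"
    using est W(1)[OF t'(1)] by (intro mult_left_mono) auto
  also have "\<dots> \<le> W t' * expectation (\<Lambda> t t') + e"
    using W(1)[OF t'(1)] e by (simp add: distrib_left mult_left_le_one_le)
  finally show ?thesis using 1 2 by (simp add: algebra_simps)
qed

text \<open>Telescoping over the cells: apart from \<open>h\<close> and small errors
  \<open>P N k\<close> does not increase with \<open>k\<close>, it starts at most at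
  \<open>?E\<close> and ends above the left-hand side. The errors disappear as \<open>N\<close>
  tends to infinity, except for the arbitrary \<open>\<eta>\<close>.\<close>

theorem hitting_estimate:
  "c\<^sub>1 * \<rho> powr p * W T * prob (H - A T) \<le> expectation (\<lambda>w. indicator H w * V (Z a w) a (r a w)) + (LINT s:{a<..T}|lborel. h s)"
proof (rule field_le_epsilon)
  fix \<eta> :: real assume "0 < \<eta>"
  let ?c = "c\<^sub>1 * \<rho> powr p * W T"
  let ?E = "expectation (\<lambda>w. indicator H w * V (Z a w) a (r a w))"
  let ?h = "LINT s:{a<..T}|lborel. h s"
  obtain C N\<^sub>0 where C: "0 \<le> C" and est: "\<forall>N k. N\<^sub>0 < N \<and> k < N \<longrightarrow>
    integrable M (\<lambda>w. indicator (A (tk N k)) w * V (Y (tk N (Suc k)) w) (tk N (Suc k)) (r (tk N (Suc k)) w)) \<and>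
    expectation (\<lambda>w. indicator (A (tk N k)) w * V (Y (tk N (Suc k)) w) (tk N (Suc k)) (r (tk N (Suc k)) w))
      - expectation (\<lambda>w. indicator (A (tk N k)) w * V (Z (tk N k) w) (tk N k) (r (tk N k) w))
    \<le> expectation (\<Lambda> (tk N k) (tk N (Suc k))) + \<eta> / real N + C / (real N)\<^sup>2"
    using cell_estimate[OF \<open>0 < \<eta>\<close>] by (elim exE conjE) (rule that)
  \<comment> \<open>Discounted \<open>V\<close> on the paths not yet stopped, plus a reserve
    \<open>?c\<close> for each unit of probability that has been stopped.\<close>
  define P where "P N k = W (tk N k) * expectation (\<lambda>w. indicator (A (tk N k)) w * V (Z (tk N k) w) (tk N k) (r (tk N k) w))
    + ?c * (prob H - prob (A (tk N k)))" for N k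
  define wt where "wt N k = (if k < Suc N then W (tk (Suc N) (Suc k)) else 0)" for N k
  have wt: "0 \<le> wt N k \<and> wt N k \<le> 1" for N k
  proof -
    have "a \<le> tk (Suc N) (Suc k)" by (simp add: tk_def)
    from W(1)[OF this] show ?thesis by (simp add: wt_def less_imp_le)
  qed
  have HV: "integrable M (\<lambda>w. indicator H w * V (Z a w) a (r a w))"
  proof (rule integrable_bounded)
    have "(\<lambda>w. V (Z a w) a (r a w)) \<in> borel_measurable M"
      by (rule state_measurable[OF Z_measurable[OF a0] r_measurable[OF a0] C21_continuous(1) a0])
    then show "(\<lambda>w. indicator H w * V (Z a w) a (r a w)) \<in> borel_measurable M" using H_events by auto
    show "\<bar>indicator H w * V (Z a w) a (r a w)\<bar> \<le> B\<^sub>V" if "w \<in> space M" for w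
      using V_le[of "r a w" "Z a w" a] Z_before[of w a] \<sigma>_ge r_in_S[OF a0 that] aT a0 B\<^sub>V by (cases "w \<in> H") auto
  qed
  \<comment> \<open>Paths that are at or above the level already at time \<open>a\<close> are paid
    for by \<open>V\<close> at that time.\<close>
  have P0: "P N 0 \<le> ?E" for N
  proof -
    have t: "tk N 0 = a" by (simp add: tk_def)
    have Aa: "A a \<in> events" "A a \<subseteq> H" using A_events A_subset_H by auto
    have "P N 0 = expectation (\<lambda>w. indicator (A a) w * V (Z a w) a (r a w) + ?c * indicator (H - A a) w)"
      using expectation_add_indicator(2)[OF cell_V_integrable[of a] H_events Aa, of 1 ?c] aT
      by (simp add: P_def t W_def \<Phi>_def set_lebesgue_integral_def)
    also have "\<dots> \<le> ?E"
    proof (rule integral_mono[OF _ HV])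
      show "integrable M (\<lambda>w. indicator (A a) w * V (Z a w) a (r a w) + ?c * indicator (H - A a) w)"
        using expectation_add_indicator(1)[OF cell_V_integrable[of a] H_events Aa, of 1 ?c] aT by simp
      fix w assume w: "w \<in> space M"
      have "?c \<le> V (Z a w) a (r a w)" if "w \<in> H - A a"
      proof -
        have "\<rho> \<le> norm (Z a w)" using that by (force simp: A_def)
        then have "c\<^sub>1 * \<rho> powr p \<le> V (Z a w) a (r a w)" by (rule V_ge_hit[OF a0 r_in_S[OF a0 w]])
        moreover have "?c \<le> c\<^sub>1 * \<rho> powr p" using W(1)[OF aT(2)] c1 by (intro mult_right_le_one_le) auto
        ultimately show ?thesis by linarith
      qed
      then show "indicator (A a) w * V (Z a w) a (r a w) + ?c * indicator (H - A a) w \<le> indicator H w * V (Z a w) a (r a w)"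
        using Aa(2) by (auto simp: indicator_def)
    qed
    finally show ?thesis .
  qed
  have bound: "?c * prob (H - A T) \<le> ?E + ?h + expectation (\<lambda>w. max (\<Psi> (Suc N) (wt N) w - ?h) 0) + \<eta> + C * inverse (real (Suc N))" if "N\<^sub>0 \<le> N" for N
  proof -
    let ?N = "Suc N"
    let ?x = "\<lambda>k. expectation (\<Lambda> (tk ?N k) (tk ?N (Suc k))) - \<Phi> (tk ?N k) (tk ?N (Suc k)) * expectation (\<lambda>w. indicator (A (tk ?N k)) w * V (Z (tk ?N k) w) (tk ?N k) (r (tk ?N k) w))"
    let ?e = "\<eta> / real ?N + C / (real ?N)\<^sup>2"
    have e0: "0 \<le> ?e" using C \<open>0 < \<eta>\<close> by simp
    have step: "P ?N (Suc k) \<le> P ?N k + (wt N k * ?x k + ?e)" if "k < ?N" for k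
    proof -
      have "N\<^sub>0 < ?N \<and> k < ?N" using \<open>N\<^sub>0 \<le> N\<close> that by simp
      note est' = est[rule_format, OF this]
      show ?thesis
        using hitting_step[OF zero_less_Suc that est'[THEN conjunct1] est'[THEN conjunct2, unfolded add.assoc] e0] that
        unfolding P_def wt_def by (simp only: if_True add.assoc)
    qed
    have "k \<le> ?N \<Longrightarrow> P ?N k \<le> P ?N 0 + (\<Sum>j<k. wt N j * ?x j + ?e)" for k
    proof (induction k)
      case (Suc k)
      then show ?case using step[of k] by simp
    qed simp
    from this[of ?N] have "P ?N ?N \<le> P ?N 0 + (\<Sum>j<?N. wt N j * ?x j + ?e)" by simp
    also have "(\<Sum>j<?N. wt N j * ?x j + ?e) = (\<Sum>j<?N. wt N j * ?x j) + (\<eta> + C * inverse (real ?N))"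
    proof -
      have "real ?N * ?e = \<eta> + C * inverse (real ?N)"
        by (simp add: distrib_left power2_eq_square inverse_eq_divide del: of_nat_Suc)
      then show ?thesis by (simp add: sum.distrib del: of_nat_Suc sum.lessThan_Suc)
    qed
    also have "(\<Sum>j<?N. wt N j * ?x j) = expectation (\<Psi> ?N (wt N))"
    proof -
      have i: "integrable M (\<lambda>w. wt N k * (\<Lambda> (tk ?N k) (tk ?N (Suc k)) w
         - indicator (A (tk ?N k)) w * (\<Phi> (tk ?N k) (tk ?N (Suc k)) * V (Z (tk ?N k) w) (tk ?N k) (r (tk ?N k) w)))) \<and>
        expectation (\<lambda>w. wt N k * (\<Lambda> (tk ?N k) (tk ?N (Suc k)) w
         - indicator (A (tk ?N k)) w * (\<Phi> (tk ?N k) (tk ?N (Suc k)) * V (Z (tk ?N k) w) (tk ?N k) (r (tk ?N k) w)))) = wt N k * ?x k" if "k < ?N" for k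
        using \<Lambda>_integrable[OF zero_less_Suc that] cell_V_integrable[OF tk(1,6)[OF zero_less_Suc that]]
        by (simp add: mult.left_commute)
      have "expectation (\<Psi> ?N (wt N)) = (\<Sum>j<?N. wt N j * ?x j)" unfolding \<Psi>_def[abs_def]
        by (rule trans[OF Bochner_Integration.integral_sum sum.cong[OF refl]]) (simp_all only: lessThan_iff i)
      then show ?thesis by (rule sym)
    qed
    also have "expectation (\<Psi> ?N (wt N)) \<le> ?h + expectation (\<lambda>w. max (\<Psi> ?N (wt N) w - ?h) 0)"
    proof -
      note i = \<Psi>_integrable[of ?N "wt N", OF zero_less_Suc]
      have "expectation (\<Psi> ?N (wt N)) \<le> expectation (\<lambda>w. ?h + max (\<Psi> ?N (wt N) w - ?h) 0)"
        by (rule integral_mono) (use i in \<open>auto intro!: integrable_max\<close>)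
      also have "\<dots> = ?h + expectation (\<lambda>w. max (\<Psi> ?N (wt N) w - ?h) 0)"
        using i by (subst Bochner_Integration.integral_add) (auto intro!: integrable_max simp: prob_space)
      finally show ?thesis .
    qed
    finally have "P ?N ?N \<le> P ?N 0 + (?h + expectation (\<lambda>w. max (\<Psi> ?N (wt N) w - ?h) 0) + (\<eta> + C * inverse (real ?N)))"
      by simp
    moreover have "?c * prob (H - A T) \<le> P ?N ?N"
    proof -
      have t: "tk ?N ?N = T" by (simp add: tk_def T_def a_def del: of_nat_Suc)
      have "0 \<le> expectation (\<lambda>w. indicator (A T) w * V (Z T w) T (r T w))"
        by (rule integral_nonneg_AE, rule AE_I2) (use V_pos[of T] r_in_S[of T] aT a0 in \<open>auto simp: indicator_def\<close>)
      moreover have "prob (H - A T) = prob H - prob (A T)"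
        by (rule finite_measure_Diff) (use H_events A_events aT A_subset_H in auto)
      ultimately show ?thesis using W(1)[OF aT(2)] by (simp add: P_def t)
    qed
    ultimately show ?thesis using P0[of ?N] by linarith
  qed
  have "(\<lambda>N. ?E + ?h + expectation (\<lambda>w. max (\<Psi> (Suc N) (wt N) w - ?h) 0) + \<eta> + C * inverse (real (Suc N))) \<longlonglongrightarrow> ?E + ?h + 0 + \<eta> + C * 0"
    by (intro tendsto_intros expectation_\<Psi>_limit wt LIMSEQ_inverse_real_of_nat)
  then have "?c * prob (H - A T) \<le> ?E + ?h + 0 + \<eta> + C * 0"
    by (rule tendsto_lowerbound) (use bound in \<open>auto simp: eventually_sequentially\<close>)
  then show "?c * prob (H - A T) \<le> ?E + ?h + \<eta>" by simp
qed

end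

subsection \<open>Almost sure decay\<close>

context nsdde_hitting
begin

text \<open>As \<open>\<phi>\<close> is integrable over the half-line, the discount over
  \<open>[n, n + 1]\<close> is bounded below uniformly in \<open>n\<close>.\<close>

lemma tail_bounded:
  assumes i: "integrable M (\<lambda>w. norm (Z (real n) w) powr p)"
  defines "E \<equiv> {w\<in>\<Omega>\<^sub>0. (\<forall>s\<in>{0..real n}. norm (Z s w) \<le> R) \<and> (\<exists>s\<in>{real n..real n + 1}. \<rho> \<le> norm (Z s w))}"
  shows "E \<in> events"
    and "c\<^sub>1 * \<rho> powr p * exp (- C\<^sub>0 - (LINT s:{0..}|lborel. \<phi> s)) * prob E \<le>
      c\<^sub>2 * expectation (\<lambda>w. norm (Z (real n) w) powr p) + (LINT s:{real n<..real n + 1}|lborel. h s)"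
proof -
  have E: "E = H - A T" unfolding E_def H_def A_def a_def T_def by (auto simp: not_less)
  show "E \<in> events" unfolding E using H_events A_events[OF aT(2)] by auto
  have "\<Phi> a T \<le> C\<^sub>0 + (LINT s:{0..}|lborel. \<phi> s)"
  proof -
    have \<phi>i: "set_integrable lborel {a<..T} \<phi>" by (rule set_integrable_subset[OF \<phi>_int]) (use a0 in auto)
    have ci: "set_integrable lborel {a<..T} (\<lambda>_. C\<^sub>0)" by (rule set_integrable_bounded[where C=C\<^sub>0]) (use aT C0 in auto)
    have "\<Phi> a T = (LINT s:{a<..T}|lborel. C\<^sub>0) + (LINT s:{a<..T}|lborel. \<phi> s)"
      unfolding \<Phi>_def by (rule set_integral_add(2)[OF ci \<phi>i])
    moreover have "(LINT s:{a<..T}|lborel. C\<^sub>0) = C\<^sub>0" by (simp add: set_lebesgue_integral_def a_def T_def)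
    moreover have "(LINT s:{a<..T}|lborel. \<phi> s) \<le> (LINT s:{0..}|lborel. \<phi> s)"
      unfolding set_lebesgue_integral_def
      by (rule integral_mono) (use \<phi>i \<phi>_int \<phi>_nonneg a0 in \<open>auto simp: set_integrable_def indicator_def\<close>)
    ultimately show ?thesis by linarith
  qed
  then have wt: "exp (- C\<^sub>0 - (LINT s:{0..}|lborel. \<phi> s)) \<le> W T" by (simp add: W_def)
  have V: "expectation (\<lambda>w. indicator H w * V (Z a w) a (r a w)) \<le> expectation (\<lambda>w. c\<^sub>2 * norm (Z (real n) w) powr p)"
  proof (rule integral_mono')
    show "integrable M (\<lambda>w. c\<^sub>2 * norm (Z (real n) w) powr p)" using i by simp
    fix w assume w: "w \<in> space M"
    have "0 \<le> V (Z a w) a (r a w)" "V (Z a w) a (r a w) \<le> c\<^sub>2 * norm (Z (real n) w) powr p"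
      using V_bounds[OF a0 r_in_S[OF a0 w]] V_pos[OF a0 r_in_S[OF a0 w]] by (auto simp: a_def)
    then show "indicator H w * V (Z a w) a (r a w) \<le> c\<^sub>2 * norm (Z (real n) w) powr p"
      "0 \<le> c\<^sub>2 * norm (Z (real n) w) powr p" using c2 by (auto simp: indicator_def)
  qed
  have "c\<^sub>1 * \<rho> powr p * exp (- C\<^sub>0 - (LINT s:{0..}|lborel. \<phi> s)) * prob E \<le> c\<^sub>1 * \<rho> powr p * W T * prob (H - A T)"
    unfolding E using wt c1 by (intro mult_right_mono mult_left_mono) auto
  then show "c\<^sub>1 * \<rho> powr p * exp (- C\<^sub>0 - (LINT s:{0..}|lborel. \<phi> s)) * prob E \<le>
      c\<^sub>2 * expectation (\<lambda>w. norm (Z (real n) w) powr p) + (LINT s:{real n<..real n + 1}|lborel. h s)"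
    using hitting_estimate V by (simp add: a_def T_def)
qed

end

context nsdde_setting
begin

text \<open>The bound of \<open>tail_bounded\<close> does not involve \<open>R\<close>. With
  \<open>R = \<rho> + k\<close> the restricted events increase to \<open>E\<close>, since a
  continuous path is bounded on \<open>[0, n]\<close>.\<close>

lemma tail_estimate:
  fixes n :: nat
  assumes \<rho>: "0 < \<rho>" and i: "integrable M (\<lambda>w. norm (Z (real n) w) powr p)"
  defines "E \<equiv> {w\<in>\<Omega>\<^sub>0. \<exists>s\<in>{real n..real n + 1}. \<rho> \<le> norm (Z s w)}"
  shows "E \<in> events"
    and "c\<^sub>1 * \<rho> powr p * exp (- C\<^sub>0 - (LINT s:{0..}|lborel. \<phi> s)) * prob E \<le>
      c\<^sub>2 * expectation (\<lambda>w. norm (Z (real n) w) powr p) + (LINT s:{real n<..real n + 1}|lborel. h s)"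
proof -
  define E' where "E' k = {w\<in>\<Omega>\<^sub>0. (\<forall>s\<in>{0..real n}. norm (Z s w) \<le> \<rho> + real k) \<and> (\<exists>s\<in>{real n..real n + 1}. \<rho> \<le> norm (Z s w))}" for k :: nat
  have loc: "nsdde_hitting M F B S \<Gamma> r D f g X J V \<phi> h p \<tau> \<beta> c\<^sub>1 c\<^sub>2 C\<^sub>0 C\<^sub>\<xi> \<rho> (\<rho> + real k)" for k :: nat
    by (intro nsdde_hitting.intro nsdde_hitting_axioms.intro nsdde_setting_axioms) (use \<rho> in auto)
  note tail = nsdde_hitting.tail_bounded[OF loc i, folded E'_def]
  have U: "(\<Union>k. E' k) = E"
  proof (intro equalityI subsetI)
    fix w assume w: "w \<in> E"
    then have "continuous_on {0..real n} (\<lambda>s. Z s w)"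
      by (intro continuous_on_subset[OF Z_continuous]) (auto simp: E_def)
    then have "bounded ((\<lambda>s. Z s w) ` {0..real n})" by (intro compact_imp_bounded compact_continuous_image) auto
    then obtain b where b: "\<And>s. s \<in> {0..real n} \<Longrightarrow> norm (Z s w) \<le> b" unfolding bounded_iff by blast
    obtain k :: nat where "b \<le> real k" using real_arch_simple by blast
    then have "w \<in> E' k" using w b \<rho> by (fastforce simp: E_def E'_def)
    then show "w \<in> (\<Union>k. E' k)" by blast
  qed (auto simp: E_def E'_def)
  have "incseq E'" unfolding incseq_def le_fun_def E'_def by fastforce
  then have lim: "(\<lambda>k. prob (E' k)) \<longlonglongrightarrow> prob E"
    using finite_Lim_measure_incseq[of E'] tail(1) unfolding U by blast
  show "E \<in> events" unfolding U[symmetric] using tail(1) by blast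
  show "c\<^sub>1 * \<rho> powr p * exp (- C\<^sub>0 - (LINT s:{0..}|lborel. \<phi> s)) * prob E \<le>
      c\<^sub>2 * expectation (\<lambda>w. norm (Z (real n) w) powr p) + (LINT s:{real n<..real n + 1}|lborel. h s)"
    by (rule tendsto_upperbound[OF tendsto_mult_left[OF lim]]) (use tail(2) in auto)
qed

text \<open>At the level \<open>exp (- (\<mu> * n))\<close> the factor \<open>\<rho> powr p\<close>
  is \<open>exp (- (\<mu> * p * n))\<close>; dividing the decay
  \<open>exp (- (\<kappa> * n))\<close> by it leaves a geometric sequence with ratio
  \<open>q < 1\<close>, as \<open>\<mu> * p < \<kappa>\<close>.\<close>

lemma AE_exponential_bound:
  assumes mom: "\<And>n. n\<^sub>0 \<le> n \<Longrightarrow> integrable M (\<lambda>w. norm (Z (real n) w) powr p) \<and>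
      expectation (\<lambda>w. norm (Z (real n) w) powr p) \<le> C * exp (- (\<kappa> * real n))"
    and hi: "set_integrable lborel {0..} (\<lambda>t. exp (lam * t) * h t)" and \<kappa>: "\<kappa> \<le> lam"
    and lam: "0 < lam" and \<mu>: "0 < \<mu>" "\<mu> * p < \<kappa>" "\<beta> * exp (\<mu> * \<tau>) < 1"
  shows "AE w in M. \<exists>C>0. \<forall>t\<ge>0. norm (X t w) \<le> C * exp (- (\<mu> * t))"
proof -
  define E where "E n = {w\<in>\<Omega>\<^sub>0. \<exists>s\<in>{real n..real n + 1}. exp (- (\<mu> * real n)) \<le> norm (Z s w)}" for n :: nat
  define wt where "wt = c\<^sub>1 * exp (- C\<^sub>0 - (LINT s:{0..}|lborel. \<phi> s))"
  define I where "I = (LINT t:{0..}|lborel. exp (lam * t) * h t)"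
  define b where "b = (c\<^sub>2 * C + I) / wt"
  define q where "q = exp (- (\<kappa> - \<mu> * p))"
  have wt: "0 < wt" using c1 by (simp add: wt_def)
  have q: "0 \<le> q" "q < 1" using \<mu> by (auto simp: q_def)
  \<comment> \<open>On \<open>[n, n + 1]\<close> the weight \<open>exp (lam * t)\<close> is at least
    \<open>exp (lam * n)\<close>, so the integral of \<open>h\<close> decays at the rate
    \<open>lam\<close>, which is at least \<open>\<kappa>\<close>.\<close>
  have h_n: "(LINT s:{real n<..real n + 1}|lborel. h s) \<le> I * exp (- (\<kappa> * real n))" for n :: nat
  proof -
    have "(LINT s:{real n<..real n + 1}|lborel. h s) \<le> (LINT t|lborel. exp (- (lam * real n)) * (indicator {0..} t * (exp (lam * t) * h t)))"
      unfolding set_lebesgue_integral_def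
    proof (rule integral_mono)
      show "integrable lborel (\<lambda>s. indicat_real {real n<..real n + 1} s *\<^sub>R h s)"
        unfolding set_integrable_def[symmetric]
        by (rule set_integrable_subset[OF h_int]) (auto intro: order_trans[OF of_nat_0_le_iff less_imp_le])
      show "integrable lborel (\<lambda>t. exp (- (lam * real n)) * (indicat_real {0..} t * (exp (lam * t) * h t)))"
        using hi by (simp add: set_integrable_def)
      fix s
      have "1 * h s \<le> exp (lam * s - lam * real n) * h s" if "real n < s"
        using that lam h_nonneg[of s] by (intro mult_right_mono) (auto simp: mult_le_cancel_left)
      then show "indicat_real {real n<..real n + 1} s *\<^sub>R h s \<le> exp (- (lam * real n)) * (indicat_real {0..} s * (exp (lam * s) * h s))"
        using h_nonneg[of s] by (auto simp: indicator_def exp_diff exp_minus field_simps)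
    qed
    also have "\<dots> = exp (- (lam * real n)) * I" by (simp add: I_def set_lebesgue_integral_def)
    also have "\<dots> \<le> exp (- (\<kappa> * real n)) * I"
    proof (rule mult_right_mono)
      show "exp (- (lam * real n)) \<le> exp (- (\<kappa> * real n))" using \<kappa> by (simp add: mult_right_mono)
      show "0 \<le> I" unfolding I_def set_lebesgue_integral_def
        by (intro integral_nonneg_AE AE_I2) (use h_nonneg in \<open>auto simp: indicator_def\<close>)
    qed
    finally show ?thesis by (simp add: mult.commute)
  qed
  have tail: "E n \<in> events \<and> prob (E n) \<le> b * q ^ n" if n: "n\<^sub>0 \<le> n" for n
  proof -
    note m = mom[OF n]
    note t = tail_estimate[OF exp_gt_zero[of "- (\<mu> * real n)"] m[THEN conjunct1], folded E_def]
    have "wt * exp (- (\<mu> * p * real n)) * prob (E n) = c\<^sub>1 * exp (- (\<mu> * real n)) powr p * exp (- C\<^sub>0 - (LINT s:{0..}|lborel. \<phi> s)) * prob (E n)"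
      by (simp add: wt_def exp_powr_real mult_ac)
    also have "\<dots> \<le> c\<^sub>2 * expectation (\<lambda>w. norm (Z (real n) w) powr p) + (LINT s:{real n<..real n + 1}|lborel. h s)"
      by (rule t(2))
    also have "\<dots> \<le> c\<^sub>2 * (C * exp (- (\<kappa> * real n))) + I * exp (- (\<kappa> * real n))"
      using m[THEN conjunct2] c2 h_n by (intro add_mono mult_left_mono) auto
    also have "\<dots> = wt * (b * exp (- (\<kappa> * real n)))" using wt by (simp add: b_def distrib_right mult.assoc)
    finally have "exp (- (\<mu> * p * real n)) * prob (E n) \<le> b * exp (- (\<kappa> * real n))" using wt by (simp add: mult.assoc)
    then have "exp (\<mu> * p * real n) * (exp (- (\<mu> * p * real n)) * prob (E n)) \<le> exp (\<mu> * p * real n) * (b * exp (- (\<kappa> * real n)))"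
      by (intro mult_left_mono) auto
    then have "prob (E n) \<le> exp (\<mu> * p * real n) * (b * exp (- (\<kappa> * real n)))"
      by (simp add: mult.assoc[symmetric] exp_add[symmetric])
    also have "\<dots> = b * q ^ n"
      by (simp add: q_def exp_of_nat_mult[symmetric] exp_add[symmetric] algebra_simps)
    finally show ?thesis using t(1) by blast
  qed
  have "AE w in M. \<forall>\<^sub>F n in sequentially. w \<in> space M - E (n + n\<^sub>0)"
  proof (rule borel_cantelli_AE1)
    show "E (n + n\<^sub>0) \<in> events" for n using tail[of "n + n\<^sub>0"] by simp
    show "emeasure M (E (n + n\<^sub>0)) < \<infinity>" for n by (simp add: emeasure_eq_measure)
    have "summable (\<lambda>n. b * q ^ n\<^sub>0 * q ^ n)" using q by (intro summable_mult summable_geometric) simp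
    then show "summable (\<lambda>n. prob (E (n + n\<^sub>0)))"
      by (rule summable_comparison_test'[of _ 0]) (use tail[of "n + n\<^sub>0" for n] in \<open>simp add: power_add mult_ac\<close>)
  qed
  then show ?thesis using AE_\<Omega>0
  proof eventually_elim
    case (elim w)
    then obtain n1 where n1: "\<And>n. n1 \<le> n \<Longrightarrow> w \<notin> E (n + n\<^sub>0)" by (auto simp: eventually_sequentially)
    define t1 where "t1 = real (n1 + n\<^sub>0)"
    have "continuous_on {0..t1} (\<lambda>s. Z s w)" by (rule continuous_on_subset[OF Z_continuous[OF elim(2)]]) auto
    then have "bounded ((\<lambda>s. Z s w) ` {0..t1})" by (intro compact_imp_bounded compact_continuous_image) auto
    then obtain b' where b': "\<And>s. s \<in> {0..t1} \<Longrightarrow> norm (Z s w) \<le> b'" unfolding bounded_iff by blast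
    \<comment> \<open>The first summand covers the compact initial stretch, on which Borel-Cantelli
      says nothing; \<open>exp \<mu>\<close> accounts for the passage from \<open>n\<close> to
      \<open>s < n + 1\<close>.\<close>
    define R where "R = \<bar>b'\<bar> * exp (\<mu> * t1) + exp \<mu>"
    have R: "0 < R" by (simp add: R_def add_nonneg_pos)
    have Z: "norm (Z s w) \<le> R * exp (- (\<mu> * s))" if s: "0 \<le> s" for s
    proof (cases "s \<le> t1")
      case True
      have "norm (Z s w) \<le> \<bar>b'\<bar> * 1" using b'[of s] True s by simp
      also have "\<dots> \<le> \<bar>b'\<bar> * exp (\<mu> * t1 - \<mu> * s)" using True \<mu> by (intro mult_left_mono) auto
      also have "\<dots> = \<bar>b'\<bar> * exp (\<mu> * t1) * exp (- (\<mu> * s))" by (simp add: exp_diff exp_minus field_simps)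
      also have "\<dots> \<le> R * exp (- (\<mu> * s))" unfolding R_def by (intro mult_right_mono) auto
      finally show ?thesis .
    next
      case False
      define n where "n = nat \<lfloor>s\<rfloor>"
      have n: "real n \<le> s" "s < real n + 1" using s unfolding n_def by linarith+
      then have "n1 + n\<^sub>0 \<le> n" using False unfolding t1_def by linarith
      then have "w \<notin> E n" using n1[of "n - n\<^sub>0"] by simp
      then have "norm (Z s w) < exp (- (\<mu> * real n))" using elim(2) n unfolding E_def by force
      also have "\<dots> \<le> exp (\<mu> - \<mu> * s)" using n \<mu> by (simp add: algebra_simps) (metis distrib_left less_imp_le mult.right_neutral mult_left_mono)
      also have "\<dots> = exp \<mu> * exp (- (\<mu> * s))" by (simp add: exp_diff exp_minus field_simps)
      also have "\<dots> \<le> R * exp (- (\<mu> * s))" unfolding R_def by (intro mult_right_mono) auto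
      finally show ?thesis by simp
    qed
    have "0 < C\<^sub>\<xi> + R / (1 - \<beta> * exp (\<mu> * \<tau>))" using C\<xi> R \<mu> by (intro add_nonneg_pos) auto
    moreover have "norm (X t w) \<le> (C\<^sub>\<xi> + R / (1 - \<beta> * exp (\<mu> * \<tau>))) * exp (- (\<mu> * t))" if "0 \<le> t" for t
      by (rule X_weighted_bound[OF elim(2) Z less_imp_le[OF R] less_imp_le[OF \<mu>(1)] \<mu>(3)]) (use that \<tau> in auto)
    ultimately show ?case by blast
  qed
qed

end

text \<open>Passes from the completed measure to a Borel function that can be integrated over
  \<open>lborel\<close>; the maximum with 0 restores nonnegativity everywhere.\<close>

lemma set_integrable_lebesgue_borel_version:
  assumes "set_integrable lebesgue {0..} u" and u: "\<And>t. 0 \<le> t \<Longrightarrow> 0 \<le> u t"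
  shows "\<exists>v. (\<forall>t::real. 0 \<le> (v t :: real)) \<and> set_integrable lborel {0..} v \<and> (AE t in lborel. 0 \<le> t \<longrightarrow> v t = u t)"
proof -
  let ?u = "\<lambda>t. indicator {0..} t * u t"
  have ui: "integrable lebesgue ?u" using assms(1) by (simp add: set_integrable_def)
  obtain v where v: "v \<in> borel_measurable lborel" "AE t in lborel. ?u t = v t"
    using completion_ex_borel_measurable_real[OF borel_measurable_integrable[OF ui]] by (elim bexE) (rule that)
  have eq: "AE t in lborel. ?u t = max (v t) 0"
    using v(2)
  proof eventually_elim
    case (elim t)
    have "0 \<le> ?u t" using u[of t] by (cases "0 \<le> t") auto
    then show ?case unfolding elim by linarith
  qed
  have m: "(\<lambda>t. max (v t) 0) \<in> borel_measurable lborel" using v(1) by simp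
  have "AE t in lebesgue. ?u t = max (v t) 0" using eq by (rule AE_completion)
  then have "integrable lebesgue (\<lambda>t. max (v t) 0)"
    using ui m by (subst integrable_cong_AE[symmetric]) (auto intro: borel_measurable_integrable measurable_completion)
  then have "integrable lborel (\<lambda>t. max (v t) 0)" using integrable_completion[OF m] by simp
  then have "set_integrable lborel {0..} (\<lambda>t. max (v t) 0)"
    unfolding set_integrable_def by (intro integrable_mult_indicator) auto
  moreover have "AE t in lborel. 0 \<le> t \<longrightarrow> max (v t) 0 = u t" using eq by eventually_elim auto
  ultimately show ?thesis by (intro exI[of _ "\<lambda>t. max (v t) 0"]) auto
qed

text \<open>Where \<open>u\<close> vanishes the logarithm is minus infinity; elsewhere the quotient
  is at most \<open>ln C / t - \<mu>\<close>.\<close>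

lemma lyapunov_exponent_le:
  fixes u :: "real \<Rightarrow> real"
  assumes C: "0 < C" and u: "\<And>t. 0 \<le> t \<Longrightarrow> 0 \<le> u t" "\<And>t. 0 \<le> t \<Longrightarrow> u t \<le> C * exp (- (\<mu> * t))"
  shows "lyapunov_exponent (\<lambda>t. ennreal (u t)) \<le> ereal (- \<mu>)"
proof -
  have "ereal (1 / t) * ext_ln (ennreal (u t)) \<le> ereal (ln C / t - \<mu>)" if t: "0 < t" for t
  proof (cases "u t = 0")
    case True
    then show ?thesis using t by (simp add: ext_ln_def)
  next
    case False
    then have pos: "0 < u t" using u(1)[of t] t by simp
    have "ln (u t) \<le> ln (C * exp (- (\<mu> * t)))" using pos u(2)[of t] t by simp
    also have "\<dots> = ln C - \<mu> * t" using C by (simp add: ln_mult)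
    finally have "1 / t * ln (u t) \<le> 1 / t * (ln C - \<mu> * t)" using t by (intro mult_left_mono) auto
    also have "\<dots> = ln C / t - \<mu>" using t by (simp add: field_simps)
    finally show ?thesis using pos by (simp add: ext_ln_def ennreal_eq_0_iff)
  qed
  then have "lyapunov_exponent (\<lambda>t. ennreal (u t)) \<le> Limsup at_top (\<lambda>t. ereal (ln C / t - \<mu>))"
    unfolding lyapunov_exponent_def
    by (intro Limsup_mono eventually_mono[OF eventually_gt_at_top[of 0]]) auto
  also have "\<dots> = ereal (- \<mu>)"
  proof (rule lim_imp_Limsup)
    have "((\<lambda>t. ln C / t) \<longlongrightarrow> 0) at_top"
      by (rule tendsto_divide_0[OF tendsto_const]) (rule filterlim_at_top_imp_at_infinity[OF filterlim_ident])
    from tendsto_diff[OF this tendsto_const[of \<mu>]] show "((\<lambda>t. ereal (ln C / t - \<mu>)) \<longlongrightarrow> ereal (- \<mu>)) at_top" by simp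
  qed simp
  finally show ?thesis .
qed

text \<open>An infinite value has an infinite logarithm, so the bound on the exponent also forces
  eventual finiteness.\<close>

lemma lyapunov_exponent_imp_eventually_le:
  assumes "lyapunov_exponent u \<le> ereal (- lam)" and \<kappa>: "\<kappa> < lam"
  shows "\<exists>t\<^sub>0>0. \<forall>t\<ge>t\<^sub>0. u t \<le> ennreal (exp (- (\<kappa> * t)))"
proof -
  have "lyapunov_exponent u < ereal (- \<kappa>)" using assms by (meson ereal_less(2) le_less_trans less_ereal.simps(1) neg_less_iff_less)
  then have "\<forall>\<^sub>F t in at_top. ereal (1 / t) * ext_ln (u t) < ereal (- \<kappa>)"
    unfolding lyapunov_exponent_def by (rule Limsup_lessD)
  then obtain T where T: "\<And>t. T \<le> t \<Longrightarrow> ereal (1 / t) * ext_ln (u t) < ereal (- \<kappa>)"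
    by (auto simp: eventually_at_top_linorder)
  have "u t \<le> ennreal (exp (- (\<kappa> * t)))" if t: "max T 1 \<le> t" for t
  proof (cases "u t")
    case top
    have "ereal (1 / t) * \<infinity> = \<infinity>" using t by simp
    then show ?thesis using T[of t] t top by (simp add: ext_ln_def)
  next
    case (real x)
    show ?thesis
    proof (cases "x = 0")
      case False
      then have x: "0 < x" using real by simp
      have "1 / t * ln x < - \<kappa>" using T[of t] t real x by (simp add: ext_ln_def ennreal_eq_0_iff)
      then have "ln x < - (\<kappa> * t)" using t by (simp add: field_simps)
      then have "x \<le> exp (- (\<kappa> * t))" using x by (metis exp_ln exp_less_cancel_iff less_imp_le)
      then show ?thesis using real by (simp add: ennreal_leI)
    qed (use real in simp)
  qed
  then show ?thesis by (intro exI[of _ "max T 1"]) auto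
qed

lemma powr_add_le: "(x + y) powr p \<le> 2 powr p * (x powr p + y powr p)" if "0 \<le> x" "0 \<le> y" "0 \<le> p" for x y p :: real
proof -
  have "(x + y) powr p \<le> (2 * max x y) powr p" using that by (intro powr_mono2) auto
  also have "\<dots> = 2 powr p * max x y powr p" using that by (simp add: powr_mult)
  also have "\<dots> \<le> 2 powr p * (x powr p + y powr p)" by (intro mult_left_mono) (auto simp: max_def)
  finally show ?thesis .
qed

section \<open>From moments of the solution to its almost sure exponent\<close>

context nsdde_setting
begin

text \<open>As \<open>\<beta> < 1\<close>, the neutral term is at most the norm of the delayed
  value. The moments are given as extended integrals, and it is their finiteness that yields
  integrability.\<close>

lemma Z_moment:
  assumes t: "\<tau> \<le> t" and m: "(\<integral>\<^sup>+w. ennreal (norm (X t w) powr p) \<partial>M) \<le> ennreal x"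
      "(\<integral>\<^sup>+w. ennreal (norm (X (t - \<tau>) w) powr p) \<partial>M) \<le> ennreal y" and xy: "0 \<le> x" "0 \<le> y"
  shows "integrable M (\<lambda>w. norm (Z t w) powr p) \<and> expectation (\<lambda>w. norm (Z t w) powr p) \<le> 2 powr p * (x + y)"
proof -
  have t0: "0 \<le> t" using t \<tau> by simp
  have mX: "(\<lambda>w. norm (X s w) powr p) \<in> borel_measurable M" if "0 \<le> s" for s
    using measurable_F_M[OF X_meas[of s]] that \<tau> by simp
  have i: "integrable M (\<lambda>w. norm (X s w) powr p) \<and> expectation (\<lambda>w. norm (X s w) powr p) \<le> z"
    if "0 \<le> s" "(\<integral>\<^sup>+w. ennreal (norm (X s w) powr p) \<partial>M) \<le> ennreal z" "0 \<le> z" for s z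
  proof
    show "integrable M (\<lambda>w. norm (X s w) powr p)"
      by (rule integrableI_nonneg[OF mX[OF that(1)]]) (use le_less_trans[OF that(2) ennreal_less_top] in auto)
    have "expectation (\<lambda>w. norm (X s w) powr p) = enn2real (\<integral>\<^sup>+w. ennreal (norm (X s w) powr p) \<partial>M)"
      by (rule integral_eq_nn_integral[OF mX[OF that(1)]]) simp
    also have "\<dots> \<le> z" using that(2,3) by (simp add: enn2real_leI)
    finally show "expectation (\<lambda>w. norm (X s w) powr p) \<le> z" .
  qed
  note i1 = i[OF t0 m(1) xy(1)] and i2 = i[OF _ m(2) xy(2)]
  have le: "norm (Z t w) powr p \<le> 2 powr p * (norm (X t w) powr p + norm (X (t - \<tau>) w) powr p)" if w: "w \<in> space M" for w
  proof -
    have "norm (Z t w) \<le> norm (X t w) + norm (D (X (t - \<tau>) w) (r t w))" unfolding Z_def by (rule norm_triangle_ineq4)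
    also have "\<dots> \<le> norm (X t w) + norm (X (t - \<tau>) w)"
      using norm_D_le[OF r_in_S[OF t0 w], of "X (t - \<tau>) w"] \<beta> mult_left_le_one_le[of "norm (X (t - \<tau>) w)" \<beta>] by simp
    finally have "norm (Z t w) powr p \<le> (norm (X t w) + norm (X (t - \<tau>) w)) powr p" using p by (intro powr_mono2) auto
    also have "\<dots> \<le> 2 powr p * (norm (X t w) powr p + norm (X (t - \<tau>) w) powr p)" using p by (intro powr_add_le) auto
    finally show ?thesis .
  qed
  have iZ: "integrable M (\<lambda>w. 2 powr p * (norm (X t w) powr p + norm (X (t - \<tau>) w) powr p))"
    using i1 i2 t by auto
  have "integrable M (\<lambda>w. norm (Z t w) powr p)"
    by (rule Bochner_Integration.integrable_bound[OF iZ])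
      (use Z_measurable[OF t0] le in \<open>auto intro!: AE_I2 simp: abs_of_nonneg\<close>)
  moreover have "expectation (\<lambda>w. norm (Z t w) powr p) \<le> 2 powr p * (x + y)"
  proof -
    have "expectation (\<lambda>w. norm (Z t w) powr p) \<le> expectation (\<lambda>w. 2 powr p * (norm (X t w) powr p + norm (X (t - \<tau>) w) powr p))"
      by (rule integral_mono[OF calculation iZ le])
    also have "\<dots> = 2 powr p * (expectation (\<lambda>w. norm (X t w) powr p) + expectation (\<lambda>w. norm (X (t - \<tau>) w) powr p))"
      using i1 i2 t by simp
    also have "\<dots> \<le> 2 powr p * (x + y)" using i1 i2 t by (intro mult_left_mono add_mono) auto
    finally show ?thesis .
  qed
  ultimately show ?thesis by blast
qed

text \<open>Every rate \<open>\<mu>\<close> below \<open>lam / p\<close> is reached almost surely; a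
  sequence of rates increasing to \<open>lam / p\<close> costs only countably many null
  sets.\<close>

theorem AE_lyapunov_exponent_le:
  assumes stable: "lyapunov_exponent (\<lambda>t. \<integral>\<^sup>+w. ennreal (norm (X t w) powr p) \<partial>M) \<le> ereal (- lam)" and lam: "0 < lam"
    and hi: "set_integrable lborel {0..} (\<lambda>t. exp (lam * t) * h t)" and \<beta>lam: "\<beta> < exp (- lam * \<tau>)"
  shows "AE w in M. lyapunov_exponent (\<lambda>t. ennreal (norm (X t w))) \<le> ereal (- lam / p)"
proof -
  have AE: "AE w in M. lyapunov_exponent (\<lambda>t. ennreal (norm (X t w))) \<le> ereal (- \<mu>)" if \<mu>: "0 < \<mu>" "\<mu> * p < lam" for \<mu>
  proof -
    \<comment> \<open>The midpoint leaves room on both sides: above \<open>\<mu> * p\<close> for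
      summability, below \<open>lam\<close> for the decay of the moments.\<close>
    define \<kappa> where "\<kappa> = (\<mu> * p + lam) / 2"
    have \<kappa>: "\<mu> * p < \<kappa>" "\<kappa> < lam" using \<mu> by (auto simp: \<kappa>_def)
    \<comment> \<open>As \<open>p \<ge> 1\<close>, the rate \<open>\<mu>\<close> is below
      \<open>lam\<close>, so \<open>\<beta> < exp (- lam * \<tau>)\<close> gives the contraction
      with weight \<open>\<mu>\<close>.\<close>
    have "\<mu> * 1 \<le> \<mu> * p" using \<mu> p by (intro mult_left_mono) auto
    then have "\<mu> < lam" using \<mu>(2) by linarith
    have "\<beta> * exp (\<mu> * \<tau>) < exp (- lam * \<tau>) * exp (\<mu> * \<tau>)" using \<beta>lam by simp
    also have "\<dots> = exp (- ((lam - \<mu>) * \<tau>))" by (simp add: exp_add[symmetric] algebra_simps)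
    also have "\<dots> \<le> 1" using \<open>\<mu> < lam\<close> \<tau> by simp
    finally have \<beta>\<mu>: "\<beta> * exp (\<mu> * \<tau>) < 1" .
    obtain t\<^sub>0 where t0: "0 < t\<^sub>0" "\<And>t. t\<^sub>0 \<le> t \<Longrightarrow> (\<integral>\<^sup>+w. ennreal (norm (X t w) powr p) \<partial>M) \<le> ennreal (exp (- (\<kappa> * t)))"
      using lyapunov_exponent_imp_eventually_le[OF stable \<kappa>(2)] by blast
    \<comment> \<open>The delayed time \<open>n - \<tau>\<close> has to lie beyond
      \<open>t\<^sub>0\<close> as well.\<close>
    define n\<^sub>0 where "n\<^sub>0 = nat \<lceil>t\<^sub>0 + \<tau>\<rceil>"
    have "AE w in M. \<exists>C>0. \<forall>t\<ge>0. norm (X t w) \<le> C * exp (- (\<mu> * t))"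
    proof (rule AE_exponential_bound[OF _ hi less_imp_le[OF \<kappa>(2)] lam \<mu>(1) \<kappa>(1) \<beta>\<mu>])
      fix n assume "n\<^sub>0 \<le> n"
      then have n: "t\<^sub>0 + \<tau> \<le> real n" unfolding n\<^sub>0_def by linarith
      then have "integrable M (\<lambda>w. norm (Z (real n) w) powr p) \<and> expectation (\<lambda>w. norm (Z (real n) w) powr p)
        \<le> 2 powr p * (exp (- (\<kappa> * real n)) + exp (- (\<kappa> * (real n - \<tau>))))"
        using t0(1) \<tau> by (intro Z_moment t0(2)) auto
      moreover have "2 powr p * (exp (- (\<kappa> * real n)) + exp (- (\<kappa> * (real n - \<tau>)))) = 2 powr p * (1 + exp (\<kappa> * \<tau>)) * exp (- (\<kappa> * real n))"
        by (simp add: algebra_simps exp_add[symmetric])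
      ultimately show "integrable M (\<lambda>w. norm (Z (real n) w) powr p) \<and> expectation (\<lambda>w. norm (Z (real n) w) powr p)
        \<le> 2 powr p * (1 + exp (\<kappa> * \<tau>)) * exp (- (\<kappa> * real n))" by simp
    qed
    then show ?thesis
    proof eventually_elim
      case (elim w)
      then obtain C where "0 < C" "\<And>t. 0 \<le> t \<Longrightarrow> norm (X t w) \<le> C * exp (- (\<mu> * t))" by blast
      then show ?case by (intro lyapunov_exponent_le) auto
    qed
  qed
  \<comment> \<open>The shift by 2 keeps the first rate positive.\<close>
  define \<mu> where "\<mu> k = lam / p - lam / p * inverse (real (Suc (Suc k)))" for k
  have lp: "0 < lam / p" using lam p by simp
  have \<mu>: "0 < \<mu> k" "\<mu> k * p < lam" for k
  proof -
    have i: "0 < inverse (real (Suc (Suc k)))" "inverse (real (Suc (Suc k))) < 1" by (auto simp: field_simps)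
    have e: "\<mu> k = lam / p * (1 - inverse (real (Suc (Suc k))))" by (simp add: \<mu>_def right_diff_distrib)
    show "0 < \<mu> k" unfolding e using lp i by (intro mult_pos_pos) auto
    have "\<mu> k < lam / p" unfolding \<mu>_def using mult_pos_pos[OF lp i(1)] by linarith
    then show "\<mu> k * p < lam" using p by (simp add: field_simps)
  qed
  have "AE w in M. \<forall>k. lyapunov_exponent (\<lambda>t. ennreal (norm (X t w))) \<le> ereal (- \<mu> k)"
    unfolding AE_all_countable using AE \<mu> by blast
  then show ?thesis
  proof eventually_elim
    case (elim w)
    have "\<mu> \<longlonglongrightarrow> lam / p - lam / p * 0" unfolding \<mu>_def[abs_def]
      by (intro tendsto_intros LIMSEQ_Suc[OF LIMSEQ_inverse_real_of_nat])
    then have "(\<lambda>k. ereal (- \<mu> k)) \<longlonglongrightarrow> ereal (- lam / p)"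
      using tendsto_minus by fastforce
    then show ?case by (rule LIMSEQ_le_const) (use elim in auto)
  qed
qed

end

section \<open>Reduction to Borel data and to the locale\<close>

theorem theorem4p1:
  fixes M :: "'w measure" and F :: "real \<Rightarrow> 'w measure"
    and N :: nat and S :: "int set" and \<Gamma> :: "int \<Rightarrow> int \<Rightarrow> real"
    and \<Delta> :: "int \<Rightarrow> int \<Rightarrow> real set" and hbar :: "int \<Rightarrow> real \<Rightarrow> int"
    and \<nu> :: "'w \<Rightarrow> (real \<times> real) measure"
    and r :: "real \<Rightarrow> 'w \<Rightarrow> int" and i\<^sub>0 :: int
    and B :: "real \<Rightarrow> 'w \<Rightarrow> real ^ 'm"
    and D :: "real ^ 'd \<Rightarrow> int \<Rightarrow> real ^ 'd"
    and f :: "real ^ 'd \<Rightarrow> real ^ 'd \<Rightarrow> real \<Rightarrow> int \<Rightarrow> real ^ 'd"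
    and g :: "real ^ 'd \<Rightarrow> real ^ 'd \<Rightarrow> real \<Rightarrow> int \<Rightarrow> real ^ 'm ^ 'd"
    and \<xi> :: "real \<Rightarrow> 'w \<Rightarrow> real ^ 'd" and X :: "real \<Rightarrow> 'w \<Rightarrow> real ^ 'd"
    and V :: "real ^ 'd \<Rightarrow> real \<Rightarrow> int \<Rightarrow> real"
    and \<phi> h :: "real \<Rightarrow> real"
    and p \<tau> \<beta> lam c\<^sub>1 c\<^sub>2 C\<^sub>0 \<alpha> :: real
  assumes "prob_space M" and "complete_filtration M F"
    and "\<tau> > 0" and "p \<ge> 1" and "lam > 0"
    and S_def: "S = state_space N" and "i\<^sub>0 \<in> S"
    and "generator_matrix S \<Gamma>" and "markov_chain M F S \<Gamma> r"
    and "brownian_motion M F B"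
    and "independent_processes M borel B (count_space S) r"
    and "jump_intervals S \<Gamma> \<Delta>" and hbar_def: "hbar = jump_function S \<Delta>"
    and "chain_representation M hbar r \<nu>"
    and "initial_segment M F \<tau> \<xi>"
    and D_meas: "\<And>i. i \<in> S \<Longrightarrow> (\<lambda>x. D x i) \<in> borel_measurable borel"
    and f_meas: "\<And>i. i \<in> S \<Longrightarrow>
      (\<lambda>(x, y, t). f x y t i) \<in> borel_measurable (restrict_space borel (UNIV \<times> UNIV \<times> {0..}))"
    and g_meas: "\<And>i. i \<in> S \<Longrightarrow>
      (\<lambda>(x, y, t). g x y t i) \<in> borel_measurable (restrict_space borel (UNIV \<times> UNIV \<times> {0..}))"
    and local_lipschitz: "\<And>R. R > 0 \<Longrightarrow> \<exists>L>0. \<forall>t\<ge>0. \<forall>i\<in>S. \<forall>x y x' y'.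
      norm x \<le> R \<and> norm y \<le> R \<and> norm x' \<le> R \<and> norm y' \<le> R \<longrightarrow>
      max (norm (f x y t i - f x' y' t i)) (norm (g x y t i - g x' y' t i))
        \<le> L * (norm (x - x') + norm (y - y'))"
    and "0 < \<beta>" and "\<beta> < 1"
    and D_contraction: "\<And>x y i. i \<in> S \<Longrightarrow> norm (D x i - D y i) \<le> \<beta> * norm (x - y)"
    and D_zero: "\<And>i. i \<in> S \<Longrightarrow> D 0 i = 0"
    and f_zero: "\<And>t i. t \<ge> 0 \<Longrightarrow> i \<in> S \<Longrightarrow> f 0 0 t i = 0"
    and g_zero: "\<And>t i. t \<ge> 0 \<Longrightarrow> i \<in> S \<Longrightarrow> g 0 0 t i = 0"
    and "nsdde_solution M F D f g B r \<tau> \<xi> i\<^sub>0 X"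
    and moment_stable:
      "lyapunov_exponent (\<lambda>t. \<integral>\<^sup>+\<omega>. ennreal (norm (X t \<omega>) powr p) \<partial>M) \<le> ereal (- lam)"
    and "C21 S V" and V_nonneg: "\<And>x t i. t \<ge> 0 \<Longrightarrow> i \<in> S \<Longrightarrow> 0 \<le> V x t i"
    and \<phi>_nonneg: "\<And>t. t \<ge> 0 \<Longrightarrow> 0 \<le> \<phi> t" and \<phi>_L1: "set_integrable lebesgue {0..} \<phi>"
    and h_nonneg: "\<And>t. t \<ge> 0 \<Longrightarrow> 0 \<le> h t"
    and h_int: "set_integrable lebesgue {0..} (\<lambda>t. exp (lam * t) * h t)"
    and "c\<^sub>1 > 0" and "c\<^sub>2 > 0" and "C\<^sub>0 > 0" and "\<alpha> > 0"
    and V_bounds: "\<And>x t i. t \<ge> 0 \<Longrightarrow> i \<in> S \<Longrightarrow>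
      c\<^sub>1 * norm x powr p \<le> V x t i \<and> V x t i \<le> c\<^sub>2 * norm x powr p"
    and LV_bound: "\<And>x y t i. t \<ge> 0 \<Longrightarrow> i \<in> S \<Longrightarrow>
      LV S \<Gamma> D f g V x y t i \<le> h t + (C\<^sub>0 + \<phi> t) * V (x - D y i) t i"
    and diffusion_bound: "\<And>x y t i. t \<ge> 0 \<Longrightarrow> i \<in> S \<Longrightarrow>
      (norm (transpose (g x y t i) *v Vx V (x - D y i) t i))\<^sup>2
      + (LINT l|lborel. \<bar>V (x - D y i) t (i + hbar i l) - V (x - D y i) t i\<bar>\<^sup>2)
      \<le> \<alpha> * (V (x - D y i) t i)\<^sup>2"
    and "\<beta> < exp (- lam * \<tau>)"
  shows "AE \<omega> in M. lyapunov_exponent (\<lambda>t. ennreal (norm (X t \<omega>))) \<le> ereal (- lam / p)"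
proof -
  obtain C where C: "\<And>\<omega> s. \<omega> \<in> space M \<Longrightarrow> s \<in> {-\<tau>..0} \<Longrightarrow> norm (\<xi> s \<omega>) \<le> C"
    using \<open>initial_segment M F \<tau> \<xi>\<close> unfolding initial_segment_def by blast
  note sol = \<open>nsdde_solution M F D f g B r \<tau> \<xi> i\<^sub>0 X\<close>[unfolded nsdde_solution_def]
  obtain J where ito: "ito_integral M F B (\<lambda>s \<omega>. g (X s \<omega>) (X (s - \<tau>) \<omega>) s (r s \<omega>)) J"
    and equation: "AE \<omega> in M. \<forall>t\<ge>0. X t \<omega> - D (X (t - \<tau>) \<omega>) (r t \<omega>) =
      X 0 \<omega> - D (X (- \<tau>) \<omega>) (r 0 \<omega>) + (LINT s:{0..t}|lborel. f (X s \<omega>) (X (s - \<tau>) \<omega>) s (r s \<omega>)) + J t \<omega>"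
    using sol by (elim conjE exE) (rule that)
  obtain \<phi>' where \<phi>': "\<And>t. 0 \<le> \<phi>' t" "set_integrable lborel {0..} \<phi>'" "AE t in lborel. 0 \<le> t \<longrightarrow> \<phi>' t = \<phi> t"
    by (rule exE[OF set_integrable_lebesgue_borel_version[OF \<phi>_L1]]) (use \<phi>_nonneg that in blast)+
  have "0 \<le> exp (lam * t) * h t" if "0 \<le> t" for t using h_nonneg[OF that] by simp
  then obtain v where v: "\<And>t. 0 \<le> v t" "set_integrable lborel {0..} v" "AE t in lborel. 0 \<le> t \<longrightarrow> v t = exp (lam * t) * h t"
    by (rule exE[OF set_integrable_lebesgue_borel_version[OF h_int]]) (use that in blast)+
  \<comment> \<open>The Borel version is taken of the weighted function and the weight removed
    afterwards; the result is integrable because the weight is at least 1 on the half-line.\<close>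
  define h' where "h' t = exp (- (lam * t)) * v t" for t
  have h': "exp (lam * t) * h' t = v t" for t
    by (simp add: h'_def mult.assoc[symmetric] exp_add[symmetric])
  have h'_int: "set_integrable lborel {0..} h'"
    unfolding set_integrable_def
  proof (rule Bochner_Integration.integrable_bound)
    show "integrable lborel (\<lambda>t. indicator {0..} t *\<^sub>R v t)" using v(2) by (simp add: set_integrable_def)
    have "(\<lambda>t. exp (- (lam * t)) * (indicator {0..} t *\<^sub>R v t)) \<in> borel_measurable lborel"
      using v(2) unfolding set_integrable_def by (intro borel_measurable_times) auto
    then show "(\<lambda>t. indicat_real {0..} t *\<^sub>R h' t) \<in> borel_measurable lborel" by (simp add: h'_def mult_ac)
    have "h' t \<le> v t" if "0 \<le> t" for t
      unfolding h'_def using that v(1)[of t] \<open>lam > 0\<close> by (intro mult_left_le_one_le) auto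
    then show "AE t in lborel. norm (indicat_real {0..} t *\<^sub>R h' t) \<le> norm (indicat_real {0..} t *\<^sub>R v t)"
      using v(1) by (intro AE_I2) (auto simp: indicator_def h'_def)
  qed
  \<comment> \<open>The Borel versions agree with \<open>\<phi>\<close> and \<open>h\<close> almost
    everywhere, so the pointwise bound survives for almost all \<open>t\<close>.\<close>
  have LV: "AE t in lborel. 0 \<le> t \<longrightarrow> (\<forall>x y. \<forall>i\<in>S. LV S \<Gamma> D f g V x y t i \<le> h' t + (C\<^sub>0 + \<phi>' t) * V (x - D y i) t i)"
    using \<phi>'(3) v(3)
  proof eventually_elim
    case (elim t)
    show ?case
    proof (intro impI allI ballI)
      fix x y i assume t: "0 \<le> t" and i: "i \<in> S"
      have "h' t = h t" using elim(2) t unfolding h'_def by (simp add: mult.assoc[symmetric] exp_add[symmetric])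
      then show "LV S \<Gamma> D f g V x y t i \<le> h' t + (C\<^sub>0 + \<phi>' t) * V (x - D y i) t i"
        using elim(1) t LV_bound[OF t i] by simp
    qed
  qed
  interpret nsdde_setting M F B S \<Gamma> r D f g X J V \<phi>' h' p \<tau> \<beta> c\<^sub>1 c\<^sub>2 C\<^sub>0 "max C 0"
  proof (intro nsdde_setting.intro nsdde_setting_axioms.intro filtered_bm.intro filtered_bm_axioms.intro)
    show "AE \<omega> in M. \<forall>s\<in>{- \<tau>..0}. norm (X s \<omega>) \<le> max C 0"
    proof -
      have "AE \<omega> in M. \<forall>s\<in>{-\<tau>..0}. X s \<omega> = \<xi> s \<omega>" using sol by (elim conjE)
      then show ?thesis using AE_space
      proof eventually_elim
        case (elim \<omega>)
        then show ?case using C[of \<omega>] by (simp add: le_max_iff_disj)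
      qed
    qed
    show "X t \<in> borel_measurable (F (max t 0))" if "- \<tau> \<le> t" for t
      using sol[THEN conjunct1] that by blast
    show "AE \<omega> in M. \<forall>t\<ge>0. set_integrable lborel {0..t} (\<lambda>s. f (X s \<omega>) (X (s - \<tau>) \<omega>) s (r s \<omega>))"
      using sol by (elim conjE)
    show "finite S" by (simp add: S_def state_space_def)
    show "0 \<le> \<phi>' t" for t by (rule \<phi>'(1))
    show "0 \<le> h' t" for t using v(1) by (simp add: h'_def)
  qed (fact assms ito equation \<phi>' h'_int LV | rule max.cobounded2)+
  show ?thesis
    by (rule AE_lyapunov_exponent_le) (use assms v(2) in \<open>simp_all add: h'\<close>)
qed

end
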